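(* Let $(\Sigma_1,g_1)$ and $(\Sigma_2,g_2)$ be connected, complete, oriented Riemannian 2-manifolds and let $\epsilon\in\{1,-1\}$. Every projected rank one Lagrangian surface in $(\Sigma_1\times\Sigma_2,G^{\epsilon},J,\Omega^{\epsilon})$ can be locally parametrised by $\Phi:S\to\Sigma_1\times\Sigma_2$, $(s,t)\mapsto(\phi(s),\psi(t))$, where $\phi$ and $\psi$ are regular curves in $\Sigma_1$ and $\Sigma_2$ respectively, and the induced metric $\Phi^{*}G^{\epsilon}$ is flat. In addition, $\Phi$ is Hamiltonian $G^{\epsilon}$-minimal if and only if $\phi$ and $\psi$ are Cornu spirals of parameters $\lambda_{\phi}$ and $\lambda_{\psi}$ respectively such that $\lambda_{\phi}=-\epsilon\lambda_{\psi}$. Moreover, $\Phi$ is $G^{\epsilon}$-minimal Lagrangian if and only if both $\phi$ and $\psi$ are geodesics, and every projected rank one $G^{\epsilon}$-minimal Lagrangian surface in $\Sigma_1\times\Sigma_2$ is totally geodesic.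
   Context: For $k=1,2$, $j_k$ is the rotation by $+\pi/2$ in $T\Sigma_k$ and $\omega_k(\cdot,\cdot)=g_k(j_k\cdot,\cdot)$. Let $\pi_i:\Sigma_1\times\Sigma_2\to\Sigma_i$ be the projections. Define $G^{\epsilon}=\pi_1^{*}g_1+\epsilon\,\pi_2^{*}g_2$, $\Omega^{\epsilon}=\pi_1^{*}\omega_1+\epsilon\,\pi_2^{*}\omega_2$, and $J=j_1\oplus j_2$. An immersion $\Phi:S\to\Sigma_1\times\Sigma_2$ of a surface is Lagrangian if $\Phi^{*}\Omega^{\epsilon}=0$. Write $\Phi=(\phi,\psi)$ with $\phi=\pi_1\circ\Phi$, $\psi=\pi_2\circ\Phi$; the rank of a map at a point is the rank of its derivative there. $\Phi$ is of projected rank one at $p$ if $\mathrm{rank}(\phi)=1$ or $\mathrm{rank}(\psi)=1$ at $p$, and of projected rank one if this holds at every $p\in S$. When the induced metric $\Phi^*G^\epsilon$ is nondegenerate, $\Phi$ is $G^{\epsilon}$-minimal if its mean curvature vector $\vec H^{\epsilon}$ with respect to $G^{\epsilon}$ (half the trace of the second fundamental form) vanishes. A Lagrangian immersion is Hamiltonian $G^{\epsilon}$-minimal if it is a critical point of the volume functional under compactly supported Hamiltonian variations (variations with velocity $J\nabla u$, $u\in C_c^{\infty}(S)$, $\nabla$ the gradient of the induced metric); equivalently $\mathrm{div}(J\vec H^{\epsilon})=0$, the divergence being that of the induced metric. A regular curve $\gamma$ in an oriented Riemannian 2-manifold $(\Sigma,g)$ with rotation $j$ has signed curvature $\kappa_\gamma$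 defined by $D_{\gamma'}\gamma'=\kappa_\gamma\, j\gamma'$ in arclength parametrisation ($D$ the Levi-Civita connection). It is a Cornu spiral of parameter $\lambda$ if $\kappa_\gamma(s)=\lambda s+\mu$, where $s$ is arclength and $\lambda,\mu$ are real constants. *)

theory Defs
  imports "HOL-Analysis.Analysis"
begin

section \<open>Smooth functions and manifolds\<close>

primrec Ck_on :: "nat \<Rightarrow> 'e::euclidean_space set \<Rightarrow> ('e \<Rightarrow> 'f::euclidean_space) \<Rightarrow> bool" where
  "Ck_on 0 X f \<longleftrightarrow> continuous_on X f"
| "Ck_on (Suc k) X f \<longleftrightarrow>
     f differentiable_on X \<and> (\<forall>v. Ck_on k X (\<lambda>x. frechet_derivative f (at x) v))"

text \<open>Only used for open \<open>X\<close>.\<close>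

definition smooth_on :: "'e::euclidean_space set \<Rightarrow> ('e \<Rightarrow> 'f::euclidean_space) \<Rightarrow> bool" where
  "smooth_on X f \<longleftrightarrow> (\<forall>k. Ck_on k X f)"

text \<open>A chart is a pair of its domain and its coordinate map into the model space \<open>'e\<close>; only the
  values of the coordinate map on the domain matter. The atlas need not be maximal.\<close>

type_synonym ('a, 'e) chart = "'a set \<times> ('a \<Rightarrow> 'e)"

record ('a, 'e) manifold =
  mtop :: "'a topology"
  atlas :: "('a, 'e) chart set"

definition cinv :: "('a, 'e) chart \<Rightarrow> 'e \<Rightarrow> 'a" where
  "cinv c = inv_into (fst c) (snd c)"

definition local_rep :: "('a, 'e) chart \<Rightarrow> ('b, 'f) chart \<Rightarrow> ('a \<Rightarrow> 'b) \<Rightarrow> 'e \<Rightarrow> 'f" where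
  "local_rep c d f = (\<lambda>x. snd d (f (cinv c x)))"

definition charts_at :: "('a, 'e) manifold \<Rightarrow> 'a \<Rightarrow> ('a, 'e) chart set" where
  "charts_at M p = {c \<in> atlas M. p \<in> fst c}"

definition chart_at :: "('a, 'e) manifold \<Rightarrow> 'a \<Rightarrow> ('a, 'e) chart" where
  "chart_at M p = (SOME c. c \<in> charts_at M p)"

definition smooth_manifold :: "('a, 'e::euclidean_space) manifold \<Rightarrow> bool" where
  "smooth_manifold M \<longleftrightarrow>
     Hausdorff_space (mtop M) \<and> second_countable (mtop M) \<and>
     (\<forall>c\<in>atlas M. openin (mtop M) (fst c) \<and> open (snd c ` fst c) \<and>
        homeomorphic_map (subtopology (mtop M) (fst c)) (top_of_set (snd c ` fst c)) (snd c)) \<and>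
     (\<Union>c\<in>atlas M. fst c) = topspace (mtop M) \<and>
     (\<forall>c\<in>atlas M. \<forall>d\<in>atlas M. smooth_on (snd c ` (fst c \<inter> fst d)) (local_rep c d id))"

definition smooth_map ::
  "('a, 'e::euclidean_space) manifold \<Rightarrow> ('b, 'f::euclidean_space) manifold \<Rightarrow> ('a \<Rightarrow> 'b) \<Rightarrow> bool" where
  "smooth_map M N f \<longleftrightarrow> continuous_map (mtop M) (mtop N) f \<and>
     (\<forall>c\<in>atlas M. \<forall>d\<in>atlas N. smooth_on (snd c ` (fst c \<inter> f -` fst d)) (local_rep c d f))"

definition diffeomorphism ::
  "('a, 'e::euclidean_space) manifold \<Rightarrow> ('b, 'f::euclidean_space) manifold \<Rightarrow> ('a \<Rightarrow> 'b) \<Rightarrow> bool" where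
  "diffeomorphism M N f \<longleftrightarrow>
     bij_betw f (topspace (mtop M)) (topspace (mtop N)) \<and> smooth_map M N f \<and>
     smooth_map N M (inv_into (topspace (mtop M)) f)"

definition open_submanifold :: "('a, 'e) manifold \<Rightarrow> 'a set \<Rightarrow> ('a, 'e) manifold" where
  "open_submanifold M V =
     \<lparr>mtop = subtopology (mtop M) V, atlas = (\<lambda>c. (fst c \<inter> V, snd c)) ` atlas M\<rparr>"

definition euclidean_manifold :: "('e::euclidean_space, 'e) manifold" where
  "euclidean_manifold = \<lparr>mtop = euclidean, atlas = {(UNIV, id)}\<rparr>"

abbreviation open_region :: "'e::euclidean_space set \<Rightarrow> ('e, 'e) manifold" where
  "open_region V \<equiv> open_submanifold euclidean_manifold V"

definition product_manifold ::
  "('a, 'e) manifold \<Rightarrow> ('b, 'f) manifold \<Rightarrow> ('a \<times> 'b, 'e \<times> 'f) manifold" where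
  "product_manifold M N =
     \<lparr>mtop = prod_topology (mtop M) (mtop N),
      atlas = (\<lambda>(c, d). (fst c \<times> fst d, map_prod (snd c) (snd d))) ` (atlas M \<times> atlas N)\<rparr>"

text \<open>Tangent vectors at \<open>p\<close> are given by their components in a chart around \<open>p\<close>. The differential of
  \<open>f\<close> at \<open>p\<close> acts on components with respect to the charts \<open>c\<close> around \<open>p\<close> and \<open>d\<close> around \<open>f p\<close>; in
  particular \<open>tmap c d id p\<close> is the change of components from \<open>c\<close> to \<open>d\<close>.\<close>

definition tmap ::
  "('a, 'e::euclidean_space) chart \<Rightarrow> ('b, 'f::euclidean_space) chart \<Rightarrow> ('a \<Rightarrow> 'b) \<Rightarrow> 'a \<Rightarrow> 'e \<Rightarrow> 'f" where
  "tmap c d f p = frechet_derivative (local_rep c d f) (at (snd c p))"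

definition map_rank ::
  "('a, 'e::euclidean_space) manifold \<Rightarrow> ('b, 'f::euclidean_space) manifold \<Rightarrow> ('a \<Rightarrow> 'b) \<Rightarrow> 'a \<Rightarrow> nat" where
  "map_rank M N f p = dim (range (tmap (chart_at M p) (chart_at N (f p)) f p))"

definition immersion ::
  "('a, 'e::euclidean_space) manifold \<Rightarrow> ('b, 'f::euclidean_space) manifold \<Rightarrow> ('a \<Rightarrow> 'b) \<Rightarrow> bool" where
  "immersion M N f \<longleftrightarrow> smooth_map M N f \<and>
     (\<forall>p\<in>topspace (mtop M). \<forall>c\<in>charts_at M p. \<forall>d\<in>charts_at N (f p). inj (tmap c d f p))"


section \<open>Metrics, connection and curvature\<close>

text \<open>\<open>B c p v w\<close> is the value at \<open>p\<close> of a covariant 2-tensor field on the tangent vectors with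
  components \<open>v\<close> and \<open>w\<close> in the chart \<open>c\<close>.\<close>

type_synonym ('a, 'e) tensor2 = "('a, 'e) chart \<Rightarrow> 'a \<Rightarrow> 'e \<Rightarrow> 'e \<Rightarrow> real"

definition pullback ::
  "('b, 'f::euclidean_space) manifold \<Rightarrow> ('b, 'f) tensor2 \<Rightarrow> ('a \<Rightarrow> 'b) \<Rightarrow> ('a, 'e::euclidean_space) tensor2" where
  "pullback N B f c p v w =
     (let d = chart_at N (f p) in B d (f p) (tmap c d f p v) (tmap c d f p w))"

definition nondegenerate :: "('a, 'e::euclidean_space) manifold \<Rightarrow> ('a, 'e) tensor2 \<Rightarrow> bool" where
  "nondegenerate M g \<longleftrightarrow>
     (\<forall>p\<in>topspace (mtop M). \<forall>c\<in>charts_at M p. \<forall>v. (\<forall>w. g c p v w = 0) \<longrightarrow> v = 0)"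

definition pseudo_riemannian_metric :: "('a, 'e::euclidean_space) manifold \<Rightarrow> ('a, 'e) tensor2 \<Rightarrow> bool" where
  "pseudo_riemannian_metric M g \<longleftrightarrow>
     (\<forall>c\<in>atlas M. \<forall>v w. smooth_on (snd c ` fst c) (\<lambda>x. g c (cinv c x) v w)) \<and>
     (\<forall>p\<in>topspace (mtop M). \<forall>c\<in>charts_at M p.
        bilinear (g c p) \<and> (\<forall>v w. g c p v w = g c p w v) \<and>
        (\<forall>d\<in>charts_at M p. \<forall>v w. g c p v w = g d p (tmap c d id p v) (tmap c d id p w))) \<and>
     nondegenerate M g"

definition riemannian_metric :: "('a, 'e::euclidean_space) manifold \<Rightarrow> ('a, 'e) tensor2 \<Rightarrow> bool" where
  "riemannian_metric M g \<longleftrightarrow> pseudo_riemannian_metric M g \<and>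
     (\<forall>p\<in>topspace (mtop M). \<forall>c\<in>charts_at M p. \<forall>v. v \<noteq> 0 \<longrightarrow> g c p v v > 0)"

text \<open>The Christoffel map \<open>\<Gamma>(v, w)\<close> of the Levi-Civita connection in the chart \<open>c\<close>, obtained from the
  Koszul formula for coordinate vector fields:
  \<open>2 g(\<Gamma>(v, w), u) = \<partial>\<^sub>v g(w, u) + \<partial>\<^sub>w g(v, u) - \<partial>\<^sub>u g(v, w)\<close>.\<close>

definition metric_deriv ::
  "('a, 'e::euclidean_space) tensor2 \<Rightarrow> ('a, 'e) chart \<Rightarrow> 'a \<Rightarrow> 'e \<Rightarrow> 'e \<Rightarrow> 'e \<Rightarrow> real" where
  "metric_deriv g c p u v w = frechet_derivative (\<lambda>x. g c (cinv c x) v w) (at (snd c p)) u"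

definition christoffel ::
  "('a, 'e::euclidean_space) tensor2 \<Rightarrow> ('a, 'e) chart \<Rightarrow> 'a \<Rightarrow> 'e \<Rightarrow> 'e \<Rightarrow> 'e" where
  "christoffel g c p v w = (THE z. \<forall>u. 2 * g c p z u =
     metric_deriv g c p v w u + metric_deriv g c p w v u - metric_deriv g c p u v w)"

text \<open>\<open>R(u, v) w\<close> for the coordinate-constant fields with components \<open>u\<close>, \<open>v\<close>, \<open>w\<close>.\<close>

definition riemann_curvature ::
  "('a, 'e::euclidean_space) tensor2 \<Rightarrow> ('a, 'e) chart \<Rightarrow> 'a \<Rightarrow> 'e \<Rightarrow> 'e \<Rightarrow> 'e \<Rightarrow> 'e" where
  "riemann_curvature g c p u v w =
     frechet_derivative (\<lambda>x. christoffel g c (cinv c x) v w) (at (snd c p)) u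
     - frechet_derivative (\<lambda>x. christoffel g c (cinv c x) u w) (at (snd c p)) v
     + christoffel g c p u (christoffel g c p v w) - christoffel g c p v (christoffel g c p u w)"

definition flat_metric :: "('a, 'e::euclidean_space) manifold \<Rightarrow> ('a, 'e) tensor2 \<Rightarrow> bool" where
  "flat_metric M g \<longleftrightarrow> pseudo_riemannian_metric M g \<and>
     (\<forall>p\<in>topspace (mtop M). \<forall>c\<in>charts_at M p. \<forall>u v w. riemann_curvature g c p u v w = 0)"

definition sharp :: "('a, 'e::euclidean_space) tensor2 \<Rightarrow> ('a, 'e) chart \<Rightarrow> 'a \<Rightarrow> ('e \<Rightarrow> real) \<Rightarrow> 'e" where
  "sharp g c p \<alpha> = (THE v. \<forall>w. g c p v w = \<alpha> w)"

definition gradient ::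
  "('a, 'e::euclidean_space) tensor2 \<Rightarrow> ('a \<Rightarrow> real) \<Rightarrow> ('a, 'e) chart \<Rightarrow> 'a \<Rightarrow> 'e" where
  "gradient g u c p = sharp g c p (frechet_derivative (\<lambda>x. u (cinv c x)) (at (snd c p)))"


section \<open>Immersions into pseudo-Riemannian manifolds\<close>

text \<open>The ambient covariant derivative of \<open>df(W)\<close> in direction \<open>df(v)\<close>, for the coordinate-constant
  field \<open>W\<close> with components \<open>w\<close>.\<close>

definition ambient_hessian ::
  "('b, 'f::euclidean_space) tensor2 \<Rightarrow> ('a \<Rightarrow> 'b) \<Rightarrow> ('a, 'e::euclidean_space) chart \<Rightarrow> ('b, 'f) chart \<Rightarrow>
   'a \<Rightarrow> 'e \<Rightarrow> 'e \<Rightarrow> 'f" where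
  "ambient_hessian G f c d p v w =
     frechet_derivative (\<lambda>x. frechet_derivative (local_rep c d f) (at x) w) (at (snd c p)) v
     + christoffel G d (f p) (tmap c d f p v) (tmap c d f p w)"

definition second_fundamental_form ::
  "('b, 'f::euclidean_space) tensor2 \<Rightarrow> ('a \<Rightarrow> 'b) \<Rightarrow> ('a, 'e::euclidean_space) chart \<Rightarrow> ('b, 'f) chart \<Rightarrow>
   'a \<Rightarrow> 'e \<Rightarrow> 'e \<Rightarrow> 'f" where
  "second_fundamental_form G f c d p v w =
     (THE n. (\<forall>u. G d (f p) n (tmap c d f p u) = 0) \<and>
             (\<exists>u. ambient_hessian G f c d p v w = tmap c d f p u + n))"

text \<open>For an orthonormal coordinate basis \<open>b\<close> the components of \<open>sharp h c p (\<lambda>w. w \<bullet> b)\<close> form the row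
  of the inverse metric belonging to \<open>b\<close>, so the sum is the trace with respect to the induced metric
  \<open>h\<close>. The factor is the one for surfaces.\<close>

definition mean_curvature ::
  "('b, 'f::euclidean_space) manifold \<Rightarrow> ('b, 'f) tensor2 \<Rightarrow> ('a \<Rightarrow> 'b) \<Rightarrow>
   ('a, real \<times> real) chart \<Rightarrow> ('b, 'f) chart \<Rightarrow> 'a \<Rightarrow> 'f" where
  "mean_curvature N G f c d p = (1/2) *\<^sub>R
     (\<Sum>b\<in>Basis. second_fundamental_form G f c d p b (sharp (pullback N G f) c p (\<lambda>w. w \<bullet> b)))"

definition minimal_immersion ::
  "('a, real \<times> real) manifold \<Rightarrow> ('b, 'f::euclidean_space) manifold \<Rightarrow> ('b, 'f) tensor2 \<Rightarrow> ('a \<Rightarrow> 'b) \<Rightarrow> bool" where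
  "minimal_immersion S N G f \<longleftrightarrow> immersion S N f \<and> nondegenerate S (pullback N G f) \<and>
     (\<forall>p\<in>topspace (mtop S). \<forall>c\<in>charts_at S p. \<forall>d\<in>charts_at N (f p). mean_curvature N G f c d p = 0)"

definition totally_geodesic ::
  "('a, 'e::euclidean_space) manifold \<Rightarrow> ('b, 'f::euclidean_space) manifold \<Rightarrow> ('b, 'f) tensor2 \<Rightarrow> ('a \<Rightarrow> 'b) \<Rightarrow> bool" where
  "totally_geodesic S N G f \<longleftrightarrow> immersion S N f \<and> nondegenerate S (pullback N G f) \<and>
     (\<forall>p\<in>topspace (mtop S). \<forall>c\<in>charts_at S p. \<forall>d\<in>charts_at N (f p). \<forall>v w.
        second_fundamental_form G f c d p v w = 0)"

definition lagrangian_immersion ::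
  "('a, real \<times> real) manifold \<Rightarrow> ('b, 'f::euclidean_space) manifold \<Rightarrow> ('b, 'f) tensor2 \<Rightarrow> ('a \<Rightarrow> 'b) \<Rightarrow> bool" where
  "lagrangian_immersion S N \<Omega> f \<longleftrightarrow> immersion S N f \<and>
     (\<forall>p\<in>topspace (mtop S). \<forall>c\<in>charts_at S p. \<forall>v w. pullback N \<Omega> f c p v w = 0)"

text \<open>The Borel measure with density \<open>sqrt \<bar>det h\<bar>\<close> in every chart. It is unique since countably many
  chart domains cover a surface.\<close>

definition area_density :: "('a, real \<times> real) tensor2 \<Rightarrow> ('a, real \<times> real) chart \<Rightarrow> 'a \<Rightarrow> real" where
  "area_density h c p =
     sqrt \<bar>h c p (1, 0) (1, 0) * h c p (0, 1) (0, 1) - h c p (1, 0) (0, 1) * h c p (0, 1) (1, 0)\<bar>"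

definition volume_measure :: "('a, real \<times> real) manifold \<Rightarrow> ('a, real \<times> real) tensor2 \<Rightarrow> 'a measure" where
  "volume_measure S h = (THE \<mu>. space \<mu> = topspace (mtop S) \<and>
     sets \<mu> = sigma_sets (topspace (mtop S)) {U. openin (mtop S) U} \<and>
     (\<forall>c\<in>atlas S. \<forall>A\<in>sets \<mu>. A \<subseteq> fst c \<longrightarrow>
        emeasure \<mu> A = (\<integral>\<^sup>+ x\<in>snd c ` A. ennreal (area_density h c (cinv c x)) \<partial>lborel)))"

text \<open>\<open>variation S N f \<delta> K F\<close>: \<open>F\<close> is a smooth variation of \<open>f\<close> with parameter in
  \<open>{-\<delta><..<\<delta>}\<close> which is constant outside the compact set \<open>K\<close>.\<close>

definition variation ::
  "('a, real \<times> real) manifold \<Rightarrow> ('b, 'f::euclidean_space) manifold \<Rightarrow> ('a \<Rightarrow> 'b) \<Rightarrow>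
   real \<Rightarrow> 'a set \<Rightarrow> (real \<times> 'a \<Rightarrow> 'b) \<Rightarrow> bool" where
  "variation S N f \<delta> K F \<longleftrightarrow> 0 < \<delta> \<and> compactin (mtop S) K \<and>
     smooth_map (product_manifold (open_region {-\<delta><..<\<delta>}) S) N F \<and>
     (\<forall>p\<in>topspace (mtop S). F (0, p) = f p) \<and>
     (\<forall>\<tau>\<in>{-\<delta><..<\<delta>}. \<forall>p\<in>topspace (mtop S) - K. F (\<tau>, p) = f p)"

text \<open>\<open>J d q\<close> is the almost complex structure at \<open>q\<close> on components in the chart \<open>d\<close>. The volume of
  \<open>K\<close> suffices, as nothing moves outside \<open>K\<close> and the total volume may be infinite.\<close>

definition hamiltonian_minimal ::
  "('a, real \<times> real) manifold \<Rightarrow> ('b, 'f::euclidean_space) manifold \<Rightarrow> ('b, 'f) tensor2 \<Rightarrow>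
   (('b, 'f) chart \<Rightarrow> 'b \<Rightarrow> 'f \<Rightarrow> 'f) \<Rightarrow> ('b, 'f) tensor2 \<Rightarrow> ('a \<Rightarrow> 'b) \<Rightarrow> bool" where
  "hamiltonian_minimal S N G J \<Omega> f \<longleftrightarrow>
     lagrangian_immersion S N \<Omega> f \<and> nondegenerate S (pullback N G f) \<and>
     (\<forall>u \<delta> K F.
        smooth_map S euclidean_manifold u \<and>
        (\<exists>L. compactin (mtop S) L \<and> (\<forall>p\<in>topspace (mtop S) - L. u p = 0)) \<and>
        variation S N f \<delta> K F \<and>
        (\<forall>p\<in>topspace (mtop S). \<forall>c\<in>charts_at S p. \<forall>d\<in>charts_at N (f p).
           vector_derivative (\<lambda>\<tau>. snd d (F (\<tau>, p))) (at 0)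
           = J d (f p) (tmap c d f p (gradient (pullback N G f) u c p))) \<longrightarrow>
        ((\<lambda>\<tau>. measure (volume_measure S (pullback N G (\<lambda>p. F (\<tau>, p)))) K)
           has_real_derivative 0) (at 0))"


section \<open>Oriented surfaces and their products\<close>

definition signed_area :: "real \<times> real \<Rightarrow> real \<times> real \<Rightarrow> real" where
  "signed_area v w = fst v * snd w - snd v * fst w"

text \<open>The orientation is given by the atlas, whose charts are the positively oriented ones.\<close>

definition oriented_riemannian_surface ::
  "('a, real \<times> real) manifold \<Rightarrow> ('a, real \<times> real) tensor2 \<Rightarrow> bool" where
  "oriented_riemannian_surface M g \<longleftrightarrow> smooth_manifold M \<and> riemannian_metric M g \<and>
     (\<forall>p\<in>topspace (mtop M). \<forall>c\<in>charts_at M p. \<forall>d\<in>charts_at M p.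
        signed_area (tmap c d id p (1, 0)) (tmap c d id p (0, 1)) > 0)"

definition rotation ::
  "('a, real \<times> real) tensor2 \<Rightarrow> ('a, real \<times> real) chart \<Rightarrow> 'a \<Rightarrow> real \<times> real \<Rightarrow> real \<times> real" where
  "rotation g c p v = (THE w. g c p v w = 0 \<and> g c p w w = g c p v v \<and> signed_area v w \<ge> 0)"

definition kaehler_form :: "('a, real \<times> real) tensor2 \<Rightarrow> ('a, real \<times> real) tensor2" where
  "kaehler_form g c p v w = g c p (rotation g c p v) w"

definition product_tensor ::
  "real \<Rightarrow> ('a, 'e::euclidean_space) manifold \<Rightarrow> ('a, 'e) tensor2 \<Rightarrow>
   ('b, 'f::euclidean_space) manifold \<Rightarrow> ('b, 'f) tensor2 \<Rightarrow> ('a \<times> 'b, 'e \<times> 'f) tensor2" where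
  "product_tensor \<epsilon> M1 B1 M2 B2 c p v w =
     pullback M1 B1 fst c p v w + \<epsilon> * pullback M2 B2 snd c p v w"

definition product_rotation ::
  "('a, real \<times> real) manifold \<Rightarrow> ('a, real \<times> real) tensor2 \<Rightarrow>
   ('b, real \<times> real) manifold \<Rightarrow> ('b, real \<times> real) tensor2 \<Rightarrow>
   ('a \<times> 'b, (real \<times> real) \<times> (real \<times> real)) chart \<Rightarrow> 'a \<times> 'b \<Rightarrow>
   (real \<times> real) \<times> (real \<times> real) \<Rightarrow> (real \<times> real) \<times> (real \<times> real)" where
  "product_rotation M1 g1 M2 g2 c p v =
     (let c1 = chart_at M1 (fst p); c2 = chart_at M2 (snd p) in
      THE w. tmap c c1 fst p w = rotation g1 c1 (fst p) (tmap c c1 fst p v) \<and>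
             tmap c c2 snd p w = rotation g2 c2 (snd p) (tmap c c2 snd p v))"

definition projected_rank_one ::
  "('s, real \<times> real) manifold \<Rightarrow> ('a, real \<times> real) manifold \<Rightarrow> ('b, real \<times> real) manifold \<Rightarrow>
   ('s \<Rightarrow> 'a \<times> 'b) \<Rightarrow> bool" where
  "projected_rank_one S M1 M2 \<Phi> \<longleftrightarrow>
     (\<forall>p\<in>topspace (mtop S). map_rank S M1 (fst \<circ> \<Phi>) p = 1 \<or> map_rank S M2 (snd \<circ> \<Phi>) p = 1)"


section \<open>Curves\<close>

definition open_interval :: "real set \<Rightarrow> bool" where
  "open_interval I \<longleftrightarrow> I \<noteq> {} \<and> open I \<and> is_interval I"

definition velocity :: "('a, 'e::euclidean_space) chart \<Rightarrow> (real \<Rightarrow> 'a) \<Rightarrow> real \<Rightarrow> 'e" where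
  "velocity c \<gamma> s = vector_derivative (\<lambda>r. snd c (\<gamma> r)) (at s)"

text \<open>\<open>D\<^bsub>\<gamma>'\<^esub> \<gamma>'\<close> in the chart \<open>c\<close>.\<close>

definition acceleration ::
  "('a, 'e::euclidean_space) tensor2 \<Rightarrow> ('a, 'e) chart \<Rightarrow> (real \<Rightarrow> 'a) \<Rightarrow> real \<Rightarrow> 'e" where
  "acceleration g c \<gamma> s = vector_derivative (velocity c \<gamma>) (at s)
     + christoffel g c (\<gamma> s) (velocity c \<gamma> s) (velocity c \<gamma> s)"

definition regular_curve :: "('a, 'e::euclidean_space) manifold \<Rightarrow> real set \<Rightarrow> (real \<Rightarrow> 'a) \<Rightarrow> bool" where
  "regular_curve M I \<gamma> \<longleftrightarrow> open_interval I \<and> smooth_map (open_region I) M \<gamma> \<and>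
     (\<forall>s\<in>I. \<forall>c\<in>charts_at M (\<gamma> s). velocity c \<gamma> s \<noteq> 0)"

definition affine_geodesic ::
  "('a, 'e::euclidean_space) manifold \<Rightarrow> ('a, 'e) tensor2 \<Rightarrow> real set \<Rightarrow> (real \<Rightarrow> 'a) \<Rightarrow> bool" where
  "affine_geodesic M g I \<gamma> \<longleftrightarrow> open_interval I \<and> smooth_map (open_region I) M \<gamma> \<and>
     (\<forall>s\<in>I. \<forall>c\<in>charts_at M (\<gamma> s). acceleration g c \<gamma> s = 0)"

definition geodesically_complete ::
  "('a, 'e::euclidean_space) manifold \<Rightarrow> ('a, 'e) tensor2 \<Rightarrow> bool" where
  "geodesically_complete M g \<longleftrightarrow>
     (\<forall>I \<gamma>. affine_geodesic M g I \<gamma> \<longrightarrow>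
        (\<exists>\<gamma>'. affine_geodesic M g UNIV \<gamma>' \<and> (\<forall>s\<in>I. \<gamma>' s = \<gamma> s)))"

text \<open>\<open>\<gamma> \<circ> \<sigma>\<close> is an orientation-preserving reparametrisation of \<open>\<gamma>\<close> by arclength.\<close>

definition arclength_reparametrisation ::
  "('a, 'e::euclidean_space) manifold \<Rightarrow> ('a, 'e) tensor2 \<Rightarrow> real set \<Rightarrow> (real \<Rightarrow> 'a) \<Rightarrow>
   real set \<Rightarrow> (real \<Rightarrow> real) \<Rightarrow> bool" where
  "arclength_reparametrisation M g I \<gamma> I' \<sigma> \<longleftrightarrow>
     open_interval I' \<and> bij_betw \<sigma> I' I \<and> smooth_on I' \<sigma> \<and> (\<forall>s\<in>I'. deriv \<sigma> s > 0) \<and>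
     (\<forall>s\<in>I'. \<forall>c\<in>charts_at M (\<gamma> (\<sigma> s)).
        g c (\<gamma> (\<sigma> s)) (velocity c (\<gamma> \<circ> \<sigma>) s) (velocity c (\<gamma> \<circ> \<sigma>) s) = 1)"

definition geodesic_curve ::
  "('a, 'e::euclidean_space) manifold \<Rightarrow> ('a, 'e) tensor2 \<Rightarrow> real set \<Rightarrow> (real \<Rightarrow> 'a) \<Rightarrow> bool" where
  "geodesic_curve M g I \<gamma> \<longleftrightarrow> regular_curve M I \<gamma> \<and>
     (\<exists>I' \<sigma>. arclength_reparametrisation M g I \<gamma> I' \<sigma> \<and> affine_geodesic M g I' (\<gamma> \<circ> \<sigma>))"

text \<open>Meaningful for curves parametrised by arclength.\<close>

definition signed_curvature ::
  "('a, real \<times> real) manifold \<Rightarrow> ('a, real \<times> real) tensor2 \<Rightarrow> (real \<Rightarrow> 'a) \<Rightarrow> real \<Rightarrow> real" where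
  "signed_curvature M g \<gamma> s =
     (let c = chart_at M (\<gamma> s) in
      THE k. acceleration g c \<gamma> s = k *\<^sub>R rotation g c (\<gamma> s) (velocity c \<gamma> s))"

definition cornu_spiral ::
  "('a, real \<times> real) manifold \<Rightarrow> ('a, real \<times> real) tensor2 \<Rightarrow> real set \<Rightarrow> (real \<Rightarrow> 'a) \<Rightarrow> real \<Rightarrow> bool" where
  "cornu_spiral M g I \<gamma> l \<longleftrightarrow> regular_curve M I \<gamma> \<and>
     (\<exists>I' \<sigma> m. arclength_reparametrisation M g I \<gamma> I' \<sigma> \<and>
        (\<forall>s\<in>I'. signed_curvature M g (\<gamma> \<circ> \<sigma>) s = l * s + m))"

end

theory Submission
  imports Defs
begin

text \<open>For a surface of projected rank one one of the two projections has rank one at each point, and the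
  Lagrangian condition \<open>\<phi>\<^sup>*\<omega>\<^sub>1 + \<epsilon> \<psi>\<^sup>*\<omega>\<^sub>2 = 0\<close> forces the other to have rank one as well. Two
  coordinate functions, one on each factor, then have independent differentials along the surface, and in the local
  coordinates \<open>(s, t)\<close> which they define the surface is a product of two curves. The induced metric is
  \<open>a(s)\<^sup>2 ds\<^sup>2 + \<epsilon> b(t)\<^sup>2 dt\<^sup>2\<close> with the speeds \<open>a\<close> and \<open>b\<close>, hence flat, and the second fundamental form
  is diagonal with entries \<open>a\<^sup>2 \<kappa>\<^sub>1 j\<phi>'/a\<close> and \<open>b\<^sup>2 \<kappa>\<^sub>2 j\<psi>'/b\<close>. So minimality means
  \<open>\<kappa>\<^sub>1 = \<kappa>\<^sub>2 = 0\<close>, and a minimal surface is totally geodesic.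

  The Hamiltonian variation given by \<open>u\<close> moves \<open>\<phi>\<close> with velocity \<open>u\<^sub>s j\<phi>'/a\<^sup>2\<close> and \<open>\<psi>\<close> with velocity
  \<open>\<epsilon> u\<^sub>t j\<psi>'/b\<^sup>2\<close>. After an integration by parts, the first variation of the area is the integral of
  \<open>u (\<kappa>\<^sub>1' b + \<epsilon> \<kappa>\<^sub>2' a)\<close>. Testing with bump functions, critical points are the products with
  \<open>\<kappa>\<^sub>1'/a = - \<epsilon> \<kappa>\<^sub>2'/b\<close>. The two sides depend on different variables, so both are constant, and
  they are the derivatives of the curvatures with respect to arclength.\<close>

section \<open>Smooth functions on open sets\<close>

text \<open>Tangent vectors are components in charts, and pullbacks and product tensors are
  evaluated in the arbitrary chart \<open>chart_at\<close>, so every quantity must be shown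
  independent of the chart before it can be computed. The delicate case is the acceleration of a
  curve. It is settled by \<open>first_variation\<close>, which expresses the pairing of the
  acceleration with a variation field by derivatives of pulled-back metric coefficients. The same
  identity yields the first variation of the area.

  Curves carry arbitrary regular parameters. Speed \<open>sp\<close> and curvature \<open>kv\<close>
  are functions of the given parameter, and arclength enters only through
  \<open>geodesic_curve_iff\<close> and \<open>cornu_spiral_iff\<close>.

  Hamiltonian minimality prescribes only the initial velocity of a variation. For sufficiency the
  area must be differentiated along an unknown variation; for necessity a variation with given
  initial velocity must be built. There the test function may have small support, so that straight
  lines in one chart of each factor suffice.\<close>

abbreviation frd :: "('e::real_normed_vector \<Rightarrow> 'f::real_normed_vector) \<Rightarrow> 'e \<Rightarrow> 'e \<Rightarrow> 'f"
  where "frd f x \<equiv> frechet_derivative f (at x)"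

lemma frd_eq: "(f has_derivative f') (at x) \<Longrightarrow> frd f x = f'"
  using frechet_derivative_at by metis

text \<open>\<open>frechet_derivative\<close> is a choice from the set of derivatives at
  \<open>x\<close>. Functions that agree near \<open>x\<close> have the same set, so the equality
  also holds where no derivative exists.\<close>

lemma frd_cong:
  assumes "open X" "x \<in> X" "\<And>y. y \<in> X \<Longrightarrow> f y = g y"
  shows "frd f x = frd g x"
proof -
  have "(f has_derivative D) (at x) \<longleftrightarrow> (g has_derivative D) (at x)" for D
    using has_derivative_transform_within_open[OF _ assms(1,2), of f D UNIV g]
      has_derivative_transform_within_open[OF _ assms(1,2), of g D UNIV f] assms(3) by auto
  then show ?thesis unfolding frechet_derivative_def by simp
qed

lemma Ck_on_cong:
  assumes "open X" "\<And>y. y \<in> X \<Longrightarrow> f y = g y"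
  shows "Ck_on k X f \<longleftrightarrow> Ck_on k X g"
  using assms(2)
proof (induction k arbitrary: f g)
  case 0
  then show ?case by (simp cong: continuous_on_cong)
next
  case (Suc k)
  have "(f has_derivative D) (at x) \<longleftrightarrow> (g has_derivative D) (at x)" if "x \<in> X" for D x
    using has_derivative_transform_within_open[OF _ assms(1) that, of f D UNIV g]
      has_derivative_transform_within_open[OF _ assms(1) that, of g D UNIV f] Suc.prems by auto
  then have "f differentiable_on X \<longleftrightarrow> g differentiable_on X"
    unfolding differentiable_on_eq_differentiable_at[OF assms(1)] differentiable_def by simp
  moreover have "Ck_on k X (\<lambda>x. frd f x v) \<longleftrightarrow> Ck_on k X (\<lambda>x. frd g x v)" for v
  proof (rule Suc.IH)
    show "frd f y v = frd g y v" if "y \<in> X" for y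
      using frd_cong[OF assms(1) that Suc.prems] by simp
  qed
  ultimately show ?case by simp
qed

lemma Ck_on_subset: "Ck_on k X f \<Longrightarrow> Y \<subseteq> X \<Longrightarrow> Ck_on k Y f"
  by (induction k arbitrary: f) (auto intro: continuous_on_subset differentiable_on_subset)

lemma Ck_on_SucD: "Ck_on (Suc k) X f \<Longrightarrow> Ck_on k X f"
  by (induction k arbitrary: f) (auto intro: differentiable_imp_continuous_on)

text \<open>\<open>frd\<close> is taken at the point and not within \<open>X\<close>, so the
  neighbourhoods supplied for \<open>f\<close> serve for its derivatives as well.\<close>

lemma Ck_on_local:
  assumes "\<And>x. x \<in> X \<Longrightarrow> \<exists>U. open U \<and> x \<in> U \<and> Ck_on k U f"
  shows "Ck_on k X f"
  using assms
proof (induction k arbitrary: f)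
  case 0
  then show ?case
    by (simp, metis continuous_at_imp_continuous_on continuous_on_eq_continuous_at)
next
  case (Suc k)
  have "f differentiable_on X"
    unfolding differentiable_on_def
    by (metis Suc.prems Ck_on.simps(2) differentiable_at_withinI differentiable_on_eq_differentiable_at)
  moreover have "Ck_on k X (\<lambda>x. frd f x v)" for v
    by (rule Suc.IH) (use Suc.prems in force)
  ultimately show ?case by simp
qed

lemma smooth_on_cong:
  "open X \<Longrightarrow> (\<And>y. y \<in> X \<Longrightarrow> f y = g y) \<Longrightarrow> smooth_on X f \<longleftrightarrow> smooth_on X g"
  unfolding smooth_on_def using Ck_on_cong by blast

lemma smooth_on_subset: "smooth_on X f \<Longrightarrow> Y \<subseteq> X \<Longrightarrow> smooth_on Y f"
  unfolding smooth_on_def using Ck_on_subset by blast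

lemma smooth_on_local:
  assumes "\<And>x. x \<in> X \<Longrightarrow> \<exists>U. open U \<and> x \<in> U \<and> smooth_on U f"
  shows "smooth_on X f"
  unfolding smooth_on_def by (metis Ck_on_local assms smooth_on_def)

lemma smooth_on_continuous: "smooth_on X f \<Longrightarrow> continuous_on X f"
  unfolding smooth_on_def by (metis Ck_on.simps(1))

lemma smooth_on_has_derivative:
  assumes "smooth_on X f" "open X" "x \<in> X"
  shows "(f has_derivative frd f x) (at x)"
proof -
  have "Ck_on (Suc 0) X f" using assms(1) unfolding smooth_on_def by blast
  then show ?thesis
    using assms frechet_derivative_works differentiable_on_eq_differentiable_at by (metis Ck_on.simps(2))
qed

lemma smooth_on_linear_frd: "smooth_on X f \<Longrightarrow> open X \<Longrightarrow> x \<in> X \<Longrightarrow> linear (frd f x)"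
  using smooth_on_has_derivative has_derivative_linear by blast

lemma smooth_on_frd: "smooth_on X f \<Longrightarrow> smooth_on X (\<lambda>x. frd f x v)"
  unfolding smooth_on_def by (metis Ck_on.simps(2))

text \<open>Trades the chosen \<open>frd\<close> for an explicit derivative: the inductions below
  only differentiate a formula and apply the induction hypothesis to the result.\<close>

lemma Ck_on_SucI:
  assumes "open X" "\<And>x. x \<in> X \<Longrightarrow> (f has_derivative f' x) (at x)" "\<And>v. Ck_on k X (\<lambda>x. f' x v)"
  shows "Ck_on (Suc k) X f"
proof -
  have "f differentiable_on X"
    unfolding differentiable_on_eq_differentiable_at[OF assms(1)] using assms(2) differentiableI by blast
  moreover have "Ck_on k X (\<lambda>x. frd f x v)" for v
    using Ck_on_cong[OF assms(1), of "\<lambda>x. frd f x v" "\<lambda>x. f' x v" k] assms(3) frd_eq[OF assms(2)] by simp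
  ultimately show ?thesis by simp
qed

lemma Ck_on_SucE:
  assumes "Ck_on (Suc k) X f" "open X"
  shows "\<And>x. x \<in> X \<Longrightarrow> (f has_derivative frd f x) (at x)" "\<And>v. Ck_on k X (\<lambda>x. frd f x v)"
  using assms by (auto simp: differentiable_on_eq_differentiable_at frechet_derivative_works)

lemma smooth_onI:
  assumes "open X" "\<And>x. x \<in> X \<Longrightarrow> (f has_derivative f' x) (at x)" "\<And>v. smooth_on X (\<lambda>x. f' x v)"
  shows "smooth_on X f"
  unfolding smooth_on_def
proof
  fix k show "Ck_on k X f"
  proof (rule Ck_on_SucD, rule Ck_on_SucI)
    show "Ck_on k X (\<lambda>x. f' x v)" for v using assms(3) unfolding smooth_on_def by blast
  qed (use assms in auto)
qed

lemma Ck_on_const: "Ck_on k X (\<lambda>x. c)"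
proof (induction k arbitrary: c)
  case (Suc k)
  then show ?case by simp
qed simp

lemma Ck_on_bounded_linear:
  assumes "bounded_linear h" "open X" "Ck_on k X f"
  shows "Ck_on k X (\<lambda>x. h (f x))"
  using assms(3)
proof (induction k arbitrary: f)
  case 0
  then show ?case by (simp add: bounded_linear.continuous_on[OF assms(1)])
next
  case (Suc k)
  note F = Ck_on_SucE[OF Suc.prems assms(2)]
  show ?case
    by (rule Ck_on_SucI[OF assms(2) bounded_linear.has_derivative[OF assms(1) F(1)]])
      (use F Suc.IH in auto)
qed

lemma Ck_on_add:
  assumes "open X" "Ck_on k X f" "Ck_on k X g"
  shows "Ck_on k X (\<lambda>x. f x + g x)"
  using assms(2,3)
proof (induction k arbitrary: f g)
  case 0
  then show ?case by (simp add: continuous_on_add)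
next
  case (Suc k)
  note F = Ck_on_SucE[OF Suc.prems(1) assms(1)] note G = Ck_on_SucE[OF Suc.prems(2) assms(1)]
  show ?case
    by (rule Ck_on_SucI[OF assms(1) has_derivative_add[OF F(1) G(1)]]) (use F G Suc.IH in auto)
qed

lemma Ck_on_bilinear:
  assumes "bounded_bilinear h" "open X" "Ck_on k X f" "Ck_on k X g"
  shows "Ck_on k X (\<lambda>x. h (f x) (g x))"
  using assms(3,4)
proof (induction k arbitrary: f g)
  case 0
  then show ?case by (simp add: bounded_bilinear.continuous_on[OF assms(1)])
next
  case (Suc k)
  note F = Ck_on_SucE[OF Suc.prems(1) assms(2)] note G = Ck_on_SucE[OF Suc.prems(2) assms(2)]
  note fg = Ck_on_SucD[OF Suc.prems(1)] Ck_on_SucD[OF Suc.prems(2)]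
  show ?case
    by (rule Ck_on_SucI[OF assms(2) bounded_bilinear.FDERIV[OF assms(1) F(1) G(1)]])
      (auto intro!: Ck_on_add[OF assms(2)] Suc.IH F G fg)
qed

lemma Ck_on_sum:
  assumes "open X" "\<And>i. i \<in> I \<Longrightarrow> Ck_on k X (f i)"
  shows "Ck_on k X (\<lambda>x. \<Sum>i\<in>I. f i x)"
  using assms(2)
  by (induction I rule: infinite_finite_induct) (auto simp: Ck_on_const intro!: Ck_on_add assms(1))

lemma linear_basis_expansion:
  fixes A :: "'e::euclidean_space \<Rightarrow> 'f::real_vector"
  assumes "linear A"
  shows "A v = (\<Sum>b\<in>Basis. (v \<bullet> b) *\<^sub>R A b)"
proof -
  have "A v = A (\<Sum>b\<in>Basis. (v \<bullet> b) *\<^sub>R b)" by (simp add: euclidean_representation)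
  also have "\<dots> = (\<Sum>b\<in>Basis. (v \<bullet> b) *\<^sub>R A b)"
    by (simp only: linear_sum[OF assms] linear_scale[OF assms])
  finally show ?thesis .
qed

lemma Ck_on_compose:
  fixes f :: "'e::euclidean_space \<Rightarrow> 'f::euclidean_space" and g :: "'f \<Rightarrow> 'g::euclidean_space"
  assumes "open X" "open Y" "Ck_on k X f" "Ck_on k Y g" "f ` X \<subseteq> Y"
  shows "Ck_on k X (\<lambda>x. g (f x))"
  using assms(3,4)
proof (induction k arbitrary: g)
  case 0
  then show ?case using assms(5) by (simp add: continuous_on_compose2)
next
  case (Suc k)
  note F = Ck_on_SucE[OF Suc.prems(1) assms(1)] note G = Ck_on_SucE[OF Suc.prems(2) assms(2)]
  \<comment> \<open>In \<open>frd g (f x) (frd f x v)\<close> both the base point and the direction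
    depend on \<open>x\<close>. Expanding the direction in the basis separates them, and the
    induction hypothesis, which is general in \<open>g\<close>, applies to each fixed direction
    \<open>b\<close>.\<close>
  have eq: "frd g (f x) (frd f x v) = (\<Sum>b\<in>Basis. (frd f x v \<bullet> b) *\<^sub>R frd g (f x) b)"
    if "x \<in> X" for x v
    by (rule linear_basis_expansion[OF has_derivative_linear[OF G(1)]]) (use assms(5) that in auto)
  have "Ck_on k X (\<lambda>x. frd g (f x) (frd f x v))" for v
    by (rule iffD2[OF Ck_on_cong[OF assms(1) eq]], assumption)
      (intro Ck_on_sum Ck_on_bilinear[OF bounded_bilinear_scaleR]
        Ck_on_bounded_linear[OF bounded_linear_inner_left] assms(1) F G Suc.IH Ck_on_SucD[OF Suc.prems(1)])
  moreover have "((\<lambda>x. g (f x)) has_derivative (\<lambda>v. frd g (f x) (frd f x v))) (at x)" if "x \<in> X" for x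
    using has_derivative_compose[OF F(1)[OF that] G(1)] assms(5) that by auto
  ultimately show ?case by (intro Ck_on_SucI[OF assms(1)])
qed

section \<open>Closure properties of smooth functions\<close>

named_theorems smooth_intros

lemma smooth_on_const [smooth_intros]: "smooth_on X (\<lambda>x. c)"
  unfolding smooth_on_def using Ck_on_const by blast

lemma smooth_on_bounded_linear:
  "bounded_linear h \<Longrightarrow> open X \<Longrightarrow> smooth_on X f \<Longrightarrow> smooth_on X (\<lambda>x. h (f x))"
  unfolding smooth_on_def by (rule allI, rule Ck_on_bounded_linear) simp_all

lemma smooth_on_bilinear:
  "bounded_bilinear h \<Longrightarrow> open X \<Longrightarrow> smooth_on X f \<Longrightarrow> smooth_on X g \<Longrightarrow> smooth_on X (\<lambda>x. h (f x) (g x))"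
  unfolding smooth_on_def by (rule allI, rule Ck_on_bilinear) simp_all

lemma smooth_on_add [smooth_intros]:
  "open X \<Longrightarrow> smooth_on X f \<Longrightarrow> smooth_on X g \<Longrightarrow> smooth_on X (\<lambda>x. f x + g x)"
  unfolding smooth_on_def by (rule allI, rule Ck_on_add) simp_all

lemma smooth_on_sum [smooth_intros]:
  "open X \<Longrightarrow> (\<And>i. i \<in> I \<Longrightarrow> smooth_on X (f i)) \<Longrightarrow> smooth_on X (\<lambda>x. \<Sum>i\<in>I. f i x)"
  unfolding smooth_on_def by (rule allI, rule Ck_on_sum) simp_all

lemma smooth_on_compose:
  "smooth_on Y g \<Longrightarrow> open X \<Longrightarrow> open Y \<Longrightarrow> smooth_on X f \<Longrightarrow> f ` X \<subseteq> Y \<Longrightarrow> smooth_on X (\<lambda>x. g (f x))"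
  unfolding smooth_on_def by (rule allI, rule Ck_on_compose) auto

lemma smooth_on_id [smooth_intros]: "open X \<Longrightarrow> smooth_on X (\<lambda>x. x)"
  by (rule smooth_onI[OF _ has_derivative_ident]) (auto intro: smooth_intros)

lemmas smooth_on_scaleR [smooth_intros] = smooth_on_bilinear[OF bounded_bilinear_scaleR]
lemma smooth_on_mult [smooth_intros]:
  fixes f g :: "'e::euclidean_space \<Rightarrow> real"
  shows "open X \<Longrightarrow> smooth_on X f \<Longrightarrow> smooth_on X g \<Longrightarrow> smooth_on X (\<lambda>x. f x * g x)"
  by (rule smooth_on_bilinear[OF bounded_bilinear_mult])

lemmas smooth_on_inner [smooth_intros] = smooth_on_bilinear[OF bounded_bilinear_inner]
lemmas smooth_on_fst [smooth_intros] = smooth_on_bounded_linear[OF bounded_linear_fst]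
lemmas smooth_on_snd [smooth_intros] = smooth_on_bounded_linear[OF bounded_linear_snd]
lemmas smooth_on_minus [smooth_intros] =
  smooth_on_bounded_linear[OF bounded_linear_minus[OF bounded_linear_ident]]

lemma smooth_on_diff [smooth_intros]:
  "open X \<Longrightarrow> smooth_on X f \<Longrightarrow> smooth_on X g \<Longrightarrow> smooth_on X (\<lambda>x. f x - g x)"
  using smooth_on_add[of X f "\<lambda>x. - g x"] smooth_on_minus[of X g] by simp

lemma smooth_on_Pair [smooth_intros]:
  assumes "open X" "smooth_on X f" "smooth_on X g"
  shows "smooth_on X (\<lambda>x. (f x, g x))"
proof -
  have "smooth_on X (\<lambda>x. (f x, 0) + (0, g x))"
    by (intro smooth_on_add smooth_on_bounded_linear[OF bounded_linear_Pair[OF bounded_linear_ident bounded_linear_zero]]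
        smooth_on_bounded_linear[OF bounded_linear_Pair[OF bounded_linear_zero bounded_linear_ident]] assms)
  then show ?thesis by simp
qed

lemma smooth_on_power [smooth_intros]:
  fixes f :: "'e::euclidean_space \<Rightarrow> real"
  shows "open X \<Longrightarrow> smooth_on X f \<Longrightarrow> smooth_on X (\<lambda>x. f x ^ n)"
  by (induction n) (auto intro!: smooth_intros)

lemma Ck_on_inverse: "Ck_on k {x::real. x \<noteq> 0} inverse"
proof (induction k)
  case 0
  then show ?case by (auto intro!: continuous_intros)
next
  case (Suc k)
  have o: "open {x::real. x \<noteq> 0}" by (rule open_Collect_neq) auto
  show ?case
    by (rule Ck_on_SucI[OF o has_derivative_inverse'])
      (auto intro!: Ck_on_bilinear[OF bounded_bilinear_mult] o Suc Ck_on_const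
        Ck_on_bounded_linear[OF bounded_linear_minus[OF bounded_linear_ident]])
qed

lemma smooth_on_inverse [smooth_intros]:
  assumes "open X" "smooth_on X f" "\<And>x. x \<in> X \<Longrightarrow> f x \<noteq> (0::real)"
  shows "smooth_on X (\<lambda>x. inverse (f x))"
proof (rule smooth_on_compose[OF _ assms(1) _ assms(2)])
  show "smooth_on {x::real. x \<noteq> 0} inverse" unfolding smooth_on_def using Ck_on_inverse by blast
  show "open {x::real. x \<noteq> 0}" by (rule open_Collect_neq) auto
qed (use assms(3) in auto)

lemma smooth_on_divide [smooth_intros]:
  assumes "open X" "smooth_on X f" "smooth_on X g" "\<And>x. x \<in> X \<Longrightarrow> g x \<noteq> (0::real)"
  shows "smooth_on X (\<lambda>x. f x / g x)"
  unfolding divide_inverse using assms by (intro smooth_intros)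

lemma Ck_on_sqrt: "Ck_on k {x::real. x > 0} sqrt"
proof (induction k)
  case 0
  then show ?case by (auto intro!: continuous_intros)
next
  case (Suc k)
  have o: "open {x::real. x > 0}" by (rule open_Collect_less) auto
  have inv: "Ck_on k {x::real. x > 0} inverse" by (rule Ck_on_subset[OF Ck_on_inverse]) auto
  \<comment> \<open>The derivative \<open>1 / (2 * sqrt x)\<close> is written with
    \<open>sqrt x * inverse x\<close>, so that it is a product of \<open>sqrt\<close>, covered by
    the induction hypothesis, and \<open>inverse\<close>.\<close>
  have d: "(sqrt has_derivative (\<lambda>v. v * (1/2) * (sqrt x * inverse x))) (at x)" if "x \<in> {x. x > 0}" for x
  proof -
    have c: "(\<lambda>v. v * (1/2) * (sqrt x * inverse x)) = (*) (sqrt x * inverse x / 2)" by (simp add: fun_eq_iff)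
    have "sqrt x * sqrt x = x" using that by simp
    then have e: "inverse (sqrt x) = sqrt x * inverse x" using that by (simp add: field_simps)
    show ?thesis
      unfolding c using DERIV_real_sqrt[of x] that by (simp add: has_field_derivative_def e)
  qed
  show ?case
    by (rule Ck_on_SucI[OF o d], assumption)
      (intro Ck_on_bilinear[OF bounded_bilinear_mult] o Suc Ck_on_const inv)
qed

lemma smooth_on_sqrt [smooth_intros]:
  assumes "open X" "smooth_on X f" "\<And>x. x \<in> X \<Longrightarrow> f x > (0::real)"
  shows "smooth_on X (\<lambda>x. sqrt (f x))"
proof (rule smooth_on_compose[OF _ assms(1) _ assms(2)])
  show "smooth_on {x::real. x > 0} sqrt" unfolding smooth_on_def using Ck_on_sqrt by blast
  show "open {x::real. x > 0}" by (rule open_Collect_less) auto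
qed (use assms(3) in auto)

lemma frd_compose:
  assumes "smooth_on X f" "open X" "smooth_on Y g" "open Y" "x \<in> X" "f x \<in> Y"
  shows "frd (\<lambda>x. g (f x)) x v = frd g (f x) (frd f x v)"
  by (subst frd_eq[OF has_derivative_compose[OF smooth_on_has_derivative[OF assms(1,2,5)]
          smooth_on_has_derivative[OF assms(3,4,6)]]]) simp

text \<open>Regularity for an equation \<open>g' = h(g)\<close> with smooth \<open>h\<close>: if
  \<open>g\<close> is k times differentiable, then so is \<open>h(g)\<close>, and \<open>g\<close>
  gains one order. It serves for local inverses and for the arclength parameter, whose derivatives
  are given by such equations.\<close>

lemma smooth_on_bootstrap:
  fixes g :: "'e::euclidean_space \<Rightarrow> 'f::euclidean_space"
  assumes "open V" "open U" "g ` V \<subseteq> U"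
    and "\<And>y. y \<in> V \<Longrightarrow> (g has_derivative h (g y)) (at y)"
    and "\<And>v. smooth_on U (\<lambda>x. h x v)"
  shows "smooth_on V g"
  unfolding smooth_on_def
proof
  fix k show "Ck_on k V g"
  proof (induction k)
    case 0
    have "g differentiable_on V"
      unfolding differentiable_on_eq_differentiable_at[OF assms(1)] using assms(4) differentiableI by blast
    then show ?case by (simp add: differentiable_imp_continuous_on)
  next
    case (Suc k)
    show ?case
      by (rule Ck_on_SucI[OF assms(1,4)])
        (use Ck_on_compose[OF assms(1,2) Suc _ assms(3)] assms(5) in \<open>auto simp: smooth_on_def\<close>)
  qed
qed

lemma smooth_on_vector_derivative:
  assumes "smooth_on X f" "open X"
  shows "smooth_on X (\<lambda>s. vector_derivative f (at s))"
    and "s \<in> X \<Longrightarrow> (f has_vector_derivative vector_derivative f (at s)) (at s)"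
    and "s \<in> X \<Longrightarrow> vector_derivative f (at s) = frd f s 1"
    and "s \<in> X \<Longrightarrow> frd f s v = v *\<^sub>R vector_derivative f (at s)"
proof -
  have v: "(f has_vector_derivative vector_derivative f (at s)) (at s)" if "s \<in> X" for s
    using smooth_on_has_derivative[OF assms that] differentiableI vector_derivative_works by blast
  show "s \<in> X \<Longrightarrow> (f has_vector_derivative vector_derivative f (at s)) (at s)" by (rule v)
  have e: "frd f s v = v *\<^sub>R vector_derivative f (at s)" if "s \<in> X" for s v
    using frd_eq v[OF that] unfolding has_vector_derivative_def by metis
  then show "s \<in> X \<Longrightarrow> frd f s v = v *\<^sub>R vector_derivative f (at s)" .
  show "s \<in> X \<Longrightarrow> vector_derivative f (at s) = frd f s 1" using e by simp
  show "smooth_on X (\<lambda>s. vector_derivative f (at s))"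
    using smooth_on_cong[OF assms(2), of "\<lambda>s. vector_derivative f (at s)" "\<lambda>s. frd f s 1"] e
      smooth_on_frd[OF assms(1)] by simp
qed

text \<open>Both mixed derivatives are limits of the same second difference quotient.\<close>

lemma second_difference_mean_value:
  fixes f :: "'e::euclidean_space \<Rightarrow> real"
  assumes f: "smooth_on X f" "open X" and h: "h > 0"
    and sq: "\<And>s t. 0 \<le> s \<Longrightarrow> s \<le> h \<Longrightarrow> 0 \<le> t \<Longrightarrow> t \<le> h \<Longrightarrow> x + s *\<^sub>R v + t *\<^sub>R w \<in> X"
  obtains s t where "0 \<le> s" "s \<le> h" "0 \<le> t" "t \<le> h"
    "f (x + h *\<^sub>R v + h *\<^sub>R w) - f (x + h *\<^sub>R v) - f (x + h *\<^sub>R w) + f x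
      = h\<^sup>2 * frd (\<lambda>y. frd f y v) (x + s *\<^sub>R v + t *\<^sub>R w) w"
proof -
  have d1: "((\<lambda>s. f (x + s *\<^sub>R v + t *\<^sub>R w)) has_real_derivative frd f (x + s *\<^sub>R v + t *\<^sub>R w) v) (at s)"
    if "0 \<le> s" "s \<le> h" "0 \<le> t" "t \<le> h" for s t
  proof -
    have "((\<lambda>s. x + s *\<^sub>R v + t *\<^sub>R w) has_derivative (\<lambda>r. r *\<^sub>R v)) (at s)"
      by (auto intro!: derivative_eq_intros)
    from has_derivative_compose[OF this smooth_on_has_derivative[OF f sq[OF that]]]
    show ?thesis
      using smooth_on_linear_frd[OF f sq[OF that]]
      by (simp add: has_field_derivative_def linear_scale mult.commute[of _ "frd f _ v"])
  qed
  have d2: "((\<lambda>t. frd f (x + s *\<^sub>R v + t *\<^sub>R w) v) has_real_derivative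
      frd (\<lambda>y. frd f y v) (x + s *\<^sub>R v + t *\<^sub>R w) w) (at t)"
    if "0 \<le> s" "s \<le> h" "0 \<le> t" "t \<le> h" for s t
  proof -
    note F = smooth_on_frd[OF f(1), of v]
    have "((\<lambda>t. x + s *\<^sub>R v + t *\<^sub>R w) has_derivative (\<lambda>r. r *\<^sub>R w)) (at t)"
      by (auto intro!: derivative_eq_intros)
    from has_derivative_compose[OF this smooth_on_has_derivative[OF F f(2) sq[OF that]]]
    show ?thesis
      using smooth_on_linear_frd[OF F f(2) sq[OF that]]
      by (simp add: has_field_derivative_def linear_scale mult.commute[of _ "frd _ _ w"])
  qed
  have "\<exists>s. 0 < s \<and> s < h \<and> (f (x + h *\<^sub>R v + h *\<^sub>R w) - f (x + h *\<^sub>R v)) - (f (x + 0 *\<^sub>R v + h *\<^sub>R w) - f (x + 0 *\<^sub>R v))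
      = (h - 0) * (frd f (x + s *\<^sub>R v + h *\<^sub>R w) v - frd f (x + s *\<^sub>R v + 0 *\<^sub>R w) v)"
    by (rule MVT2[OF h, where f = "\<lambda>s. f (x + s *\<^sub>R v + h *\<^sub>R w) - f (x + s *\<^sub>R v)"])
      (use d1[of _ h] d1[of _ 0] h in \<open>auto intro!: DERIV_diff\<close>)
  then obtain s where s: "0 < s" "s < h" "(f (x + h *\<^sub>R v + h *\<^sub>R w) - f (x + h *\<^sub>R v)) - (f (x + h *\<^sub>R w) - f x)
      = h * (frd f (x + s *\<^sub>R v + h *\<^sub>R w) v - frd f (x + s *\<^sub>R v + 0 *\<^sub>R w) v)" by auto
  have "\<exists>t. 0 < t \<and> t < h \<and> frd f (x + s *\<^sub>R v + h *\<^sub>R w) v - frd f (x + s *\<^sub>R v + 0 *\<^sub>R w) v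
      = (h - 0) * frd (\<lambda>y. frd f y v) (x + s *\<^sub>R v + t *\<^sub>R w) w"
    by (rule MVT2[OF h]) (use d2 s in auto)
  then obtain t where "0 < t" "t < h" "frd f (x + s *\<^sub>R v + h *\<^sub>R w) v - frd f (x + s *\<^sub>R v + 0 *\<^sub>R w) v
      = h * frd (\<lambda>y. frd f y v) (x + s *\<^sub>R v + t *\<^sub>R w) w" by auto
  then show thesis using that[of s t] s by (simp add: power2_eq_square)
qed

text \<open>The second difference over a small parallelogram is symmetric in \<open>v\<close> and
  \<open>w\<close>, and it equals \<open>h\<^sup>2\<close> times either mixed derivative at some
  point nearby. If the mixed derivatives differed at \<open>x\<close> by \<open>2 * e\<close>,
  continuity would keep each within \<open>e\<close> of its value at \<open>x\<close>, a
  contradiction.\<close>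

lemma frd_symmetric_real:
  fixes f :: "'e::euclidean_space \<Rightarrow> real"
  assumes f: "smooth_on X f" "open X" "x \<in> X"
  shows "frd (\<lambda>y. frd f y v) x w = frd (\<lambda>y. frd f y w) x v"
proof (rule ccontr)
  let ?A = "\<lambda>y. frd (\<lambda>y. frd f y v) y w" and ?B = "\<lambda>y. frd (\<lambda>y. frd f y w) y v"
  assume ne: "?A x \<noteq> ?B x"
  define e where "e = \<bar>?A x - ?B x\<bar> / 2"
  have e: "e > 0" using ne by (simp add: e_def)
  have "continuous_on X ?A" "continuous_on X ?B"
    by (intro smooth_on_continuous smooth_on_frd f)+
  then have c: "isCont ?A x" "isCont ?B x" using f(2,3) by (simp_all add: continuous_on_eq_continuous_at)
  obtain da where da: "da > 0" "\<And>y. dist y x < da \<Longrightarrow> dist (?A y) (?A x) < e"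
    using c(1)[unfolded continuous_at_eps_delta, rule_format, OF e] by auto
  obtain db where db: "db > 0" "\<And>y. dist y x < db \<Longrightarrow> dist (?B y) (?B x) < e"
    using c(2)[unfolded continuous_at_eps_delta, rule_format, OF e] by auto
  obtain dx where dx: "dx > 0" "ball x dx \<subseteq> X" using f(2,3) by (meson open_contains_ball)
  define d where "d = min da (min db dx)"
  \<comment> \<open>This keeps the parallelogram spanned by \<open>h v\<close> and
    \<open>h w\<close> within distance \<open>d\<close> of \<open>x\<close>; the summand 1 covers
    the case that both vectors vanish.\<close>
  define h where "h = d / (2 * (norm v + norm w + 1))"
  have n: "norm v + norm w + 1 > 0" by (simp add: add_nonneg_pos)
  have d: "d > 0" using da db dx by (simp add: d_def)
  have h: "h > 0" using d n by (simp add: h_def)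
  have near: "dist (x + s *\<^sub>R v + t *\<^sub>R w) x < d" if "0 \<le> s" "s \<le> h" "0 \<le> t" "t \<le> h" for s t
  proof -
    have "dist (x + s *\<^sub>R v + t *\<^sub>R w) x = norm (s *\<^sub>R v + t *\<^sub>R w)" by (simp add: dist_norm algebra_simps)
    also have "\<dots> \<le> s * norm v + t * norm w" using norm_triangle_ineq[of "s *\<^sub>R v" "t *\<^sub>R w"] that by simp
    also have "\<dots> \<le> h * norm v + h * norm w" using that by (intro add_mono mult_right_mono) auto
    also have "\<dots> \<le> h * (norm v + norm w + 1)" using h by (simp add: algebra_simps)
    also have "\<dots> = d / 2" using n by (simp add: h_def field_simps)
    finally show ?thesis using d by simp
  qed
  have inX: "x + s *\<^sub>R v + t *\<^sub>R w \<in> X" if "0 \<le> s" "s \<le> h" "0 \<le> t" "t \<le> h" for s t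
    using near[OF that] dx(2) by (auto simp: d_def dist_commute)
  obtain s t where st: "0 \<le> s" "s \<le> h" "0 \<le> t" "t \<le> h"
    "f (x + h *\<^sub>R v + h *\<^sub>R w) - f (x + h *\<^sub>R v) - f (x + h *\<^sub>R w) + f x = h\<^sup>2 * ?A (x + s *\<^sub>R v + t *\<^sub>R w)"
    by (rule second_difference_mean_value[OF f(1,2) h inX])
  have "x + s *\<^sub>R w + t *\<^sub>R v \<in> X" if "0 \<le> s" "s \<le> h" "0 \<le> t" "t \<le> h" for s t
    using inX[OF that(3,4,1,2)] by (simp add: add.commute add.left_commute)
  note inX' = this
  obtain s' t' where st': "0 \<le> s'" "s' \<le> h" "0 \<le> t'" "t' \<le> h"
    "f (x + h *\<^sub>R w + h *\<^sub>R v) - f (x + h *\<^sub>R w) - f (x + h *\<^sub>R v) + f x = h\<^sup>2 * ?B (x + s' *\<^sub>R w + t' *\<^sub>R v)"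
    by (rule second_difference_mean_value[OF f(1,2) h inX'])
  have "?A (x + s *\<^sub>R v + t *\<^sub>R w) = ?B (x + t' *\<^sub>R v + s' *\<^sub>R w)"
    using st(5) st'(5) h by (simp add: algebra_simps)
  moreover have "dist (?A (x + s *\<^sub>R v + t *\<^sub>R w)) (?A x) < e"
    using near[OF st(1-4)] da by (simp add: d_def)
  moreover have "dist (?B (x + t' *\<^sub>R v + s' *\<^sub>R w)) (?B x) < e"
    using near[OF st'(3,4,1,2)] db by (simp add: d_def)
  ultimately have "\<bar>?A x - ?B x\<bar> < 2 * e" by (simp add: dist_real_def)
  then show False by (simp add: e_def)
qed

lemma frd_symmetric:
  fixes f :: "'e::euclidean_space \<Rightarrow> 'f::euclidean_space"
  assumes f: "smooth_on X f" "open X" "x \<in> X"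
  shows "frd (\<lambda>y. frd f y v) x w = frd (\<lambda>y. frd f y w) x v"
proof (rule euclidean_eqI)
  fix b :: 'f assume "b \<in> Basis"
  have s: "smooth_on X (\<lambda>x. f x \<bullet> b)" by (intro smooth_intros f)
  have e: "frd (\<lambda>x. f x \<bullet> b) y u = frd f y u \<bullet> b" if "y \<in> X" for y u
    using frd_eq[OF has_derivative_inner_left[OF smooth_on_has_derivative[OF f(1,2) that], of b]] by simp
  have e2: "frd (\<lambda>y. frd (\<lambda>x. f x \<bullet> b) y u) x z = frd (\<lambda>y. frd f y u) x z \<bullet> b" for u z
  proof -
    have "frd (\<lambda>y. frd (\<lambda>x. f x \<bullet> b) y u) x = frd (\<lambda>y. frd f y u \<bullet> b) x"
      by (rule frd_cong[OF f(2,3)]) (rule e)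
    moreover have "frd (\<lambda>y. frd f y u \<bullet> b) x = (\<lambda>z. frd (\<lambda>y. frd f y u) x z \<bullet> b)"
      by (rule frd_eq[OF has_derivative_inner_left[OF smooth_on_has_derivative[OF smooth_on_frd[OF f(1)] f(2,3)]]])
    ultimately show ?thesis by simp
  qed
  show "frd (\<lambda>y. frd f y v) x w \<bullet> b = frd (\<lambda>y. frd f y w) x v \<bullet> b"
    using frd_symmetric_real[OF s f(2,3), of v w] by (simp add: e2)
qed

section \<open>Linear algebra of the plane and smooth local inverses\<close>

lemma linear_plane: "linear A \<Longrightarrow> A v = fst v *\<^sub>R A (1, 0) + snd v *\<^sub>R A (0, 1)"
  for A :: "real \<times> real \<Rightarrow> 'f::real_vector"
proof -
  assume A: "linear A"
  have "v = fst v *\<^sub>R (1, 0) + snd v *\<^sub>R (0, 1)" by (cases v) simp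
  then have "A v = A (fst v *\<^sub>R (1, 0) + snd v *\<^sub>R (0, 1))" by simp
  then show ?thesis by (simp only: linear_add[OF A] linear_scale[OF A])
qed

text \<open>The factor is the determinant of \<open>A\<close>; \<open>signed_area\<close> of the
  images of the standard basis stands for the determinant from here on.\<close>

lemma linear_plane_signed_area:
  fixes A :: "real \<times> real \<Rightarrow> real \<times> real"
  assumes "linear A"
  shows "signed_area (A v) (A w) = signed_area (A (1, 0)) (A (0, 1)) * signed_area v w"
  by (subst (1 2) linear_plane[OF assms]) (simp add: signed_area_def algebra_simps)

text \<open>\<open>B\<close> is Cramer's rule, which exhibits the inverse as a rational expression
  in the entries of \<open>A\<close>.\<close>

lemma linear_plane_inverse:
  fixes A :: "real \<times> real \<Rightarrow> real \<times> real"
  assumes "linear A" and nz: "signed_area (A (1, 0)) (A (0, 1)) \<noteq> 0"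
  defines "B \<equiv> \<lambda>v. (signed_area v (A (0, 1)) / signed_area (A (1, 0)) (A (0, 1)),
                     signed_area (A (1, 0)) v / signed_area (A (1, 0)) (A (0, 1)))"
  shows "A (B v) = v" and "B (A v) = v"
proof -
  note A = linear_plane[OF assms(1)]
  show "B (A v) = v"
    unfolding B_def by (subst (1 5) A) (use nz in \<open>auto simp: signed_area_def algebra_simps divide_simps prod_eq_iff\<close>)
  show "A (B v) = v"
    unfolding B_def
    by (subst A) (use nz in \<open>simp add: signed_area_def prod_eq_iff divide_simps, simp add: algebra_simps\<close>)
qed

text \<open>The inverse function theorem gives a differentiable inverse \<open>g\<close> whose
  derivative at \<open>y\<close> is Cramer's inverse of the derivative of \<open>f\<close> at
  \<open>g y\<close>. This inverse depends smoothly on the base point, so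
  \<open>smooth_on_bootstrap\<close> makes \<open>g\<close> smooth.\<close>

lemma smooth_local_inverse:
  fixes f :: "real \<times> real \<Rightarrow> real \<times> real"
  assumes f: "smooth_on X f" "open X" "x \<in> X"
    and nz: "signed_area (frd f x (1, 0)) (frd f x (0, 1)) \<noteq> 0"
  obtains U V g where "open U" "U \<subseteq> X" "x \<in> U" "open V" "f x \<in> V" "homeomorphism U V f g" "smooth_on V g"
proof -
  let ?det = "\<lambda>y. signed_area (frd f y (1, 0)) (frd f y (0, 1))"
  \<comment> \<open>The bootstrap evaluates Cramer's inverse at every point \<open>g y\<close>, so
    the determinant has to be nonzero on a whole neighbourhood and not only at
    \<open>x\<close>.\<close>
  define X' where "X' = {y\<in>X. ?det y \<noteq> 0}"
  have cont: "continuous_on X ?det" unfolding signed_area_def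
    by (intro continuous_intros smooth_on_continuous smooth_on_frd f)
  have X': "open X'" "x \<in> X'" "X' \<subseteq> X"
    using continuous_open_preimage[OF cont f(2), of "- {0}"] f(3) nz
    by (auto simp: X'_def vimage_def Int_def)
  note f' = smooth_on_subset[OF f(1) X'(3)]
  define D where "D y = Blinfun (frd f y)" for y
  have bl: "bounded_linear (frd f y)" if "y \<in> X'" for y
    using smooth_on_has_derivative[OF f' X'(1) that] has_derivative_bounded_linear by blast
  have D: "blinfun_apply (D y) = frd f y" if "y \<in> X'" for y
    unfolding D_def by (rule bounded_linear_Blinfun_apply[OF bl[OF that]])
  have lin: "linear (frd f y)" if "y \<in> X'" for y using bl[OF that] by (rule bounded_linear.linear)
  define B where "B y v = (signed_area v (frd f y (0, 1)) / ?det y, signed_area (frd f y (1, 0)) v / ?det y)" for y v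
  have B: "frd f y (B y v) = v" "B y (frd f y v) = v" if "y \<in> X'" for y v
    using linear_plane_inverse[OF lin[OF that]] that unfolding B_def X'_def by auto
  have linB: "bounded_linear (B y)" for y
    unfolding linear_conv_bounded_linear[symmetric]
    by (rule linearI) (auto simp: B_def signed_area_def algebra_simps add_divide_distrib diff_divide_distrib)
  obtain U V g g' where UV: "open U" "U \<subseteq> X'" "x \<in> U" "open V" "f x \<in> V" "homeomorphism U V f g"
    "\<And>y. y \<in> V \<Longrightarrow> (g has_derivative (g' y)) (at y)"
    "\<And>y. y \<in> V \<Longrightarrow> g' y = inv (blinfun_apply (D (g y)))"
  proof (rule inverse_function_theorem[OF X'(1), of f D x "Blinfun (B x)"])
    show "(f has_derivative blinfun_apply (D y)) (at y)" if "y \<in> X'" for y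
      using smooth_on_has_derivative[OF f' X'(1) that] by (simp add: D that)
    show "continuous_on X' D"
    proof (rule continuous_on_blinfun_componentwise)
      fix i :: "real \<times> real"
      have "continuous_on X' (\<lambda>y. frd f y i)" by (intro smooth_on_continuous smooth_on_frd f')
      then show "continuous_on X' (\<lambda>y. blinfun_apply (D y) i)"
        by (rule continuous_on_eq) (simp add: D)
    qed
    show "Blinfun (B x) o\<^sub>L D x = id_blinfun"
      by (rule blinfun_eqI) (simp add: bounded_linear_Blinfun_apply[OF linB] D X' B)
  qed (use X' in auto)
  have gU: "g ` V \<subseteq> X'" using UV(2,6) by (auto simp: homeomorphism_def)
  have "smooth_on V g"
  proof (rule smooth_on_bootstrap[OF UV(4) X'(1) gU, where h = B])
    fix y assume y: "y \<in> V"
    have gy: "g y \<in> X'" using gU y by auto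
    have "inv (frd f (g y)) = B (g y)"
      by (rule inv_unique_comp) (use B[OF gy] in \<open>auto simp: fun_eq_iff\<close>)
    then show "(g has_derivative B (g y)) (at y)" using UV(7,8)[OF y] D[OF gy] by simp
  next
    show "smooth_on X' (\<lambda>y. B y v)" for v
      unfolding B_def signed_area_def
      by (intro smooth_intros smooth_on_frd X'(1) f') (auto simp: X'_def signed_area_def)
  qed
  then show thesis using that[OF UV(1) _ UV(3-6)] UV(2) X'(3) by auto
qed

text \<open>The derivatives of \<open>exp (- 1/x)\<close> are combinations of the functions \<open>x\<^sup>-\<^sup>n exp (- 1/x)\<close>, all of
  which are continued by zero to the nonpositive numbers.\<close>

definition flat_exp :: "nat \<Rightarrow> real \<Rightarrow> real" where
  "flat_exp n x = (if x > 0 then inverse x ^ n * exp (- inverse x) else 0)"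

text \<open>Substituting \<open>y = inverse x\<close> turns the limit from the right into that of
  \<open>y ^ n / exp y\<close> at infinity.\<close>

lemma flat_exp_tendsto: "(flat_exp n \<longlongrightarrow> 0) (at 0)"
proof -
  have "((\<lambda>y::real. y ^ n / exp y) \<longlongrightarrow> 0) at_top" by (rule tendsto_power_div_exp_0)
  then have "((\<lambda>x::real. inverse x ^ n / exp (inverse x)) \<longlongrightarrow> 0) (at_right 0)"
    by (rule filterlim_compose[OF _ filterlim_inverse_at_top_right])
  then have r: "(flat_exp n \<longlongrightarrow> 0) (at_right 0)"
    by (rule Lim_transform_eventually)
      (auto simp: eventually_at_filter flat_exp_def exp_minus divide_inverse)
  have "(flat_exp n \<longlongrightarrow> 0) (at_left 0)"
    by (rule Lim_transform_eventually[OF tendsto_const]) (auto simp: eventually_at_filter flat_exp_def)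
  with r show ?thesis using filterlim_at_split by blast
qed

lemma flat_exp_has_derivative:
  "(flat_exp n has_real_derivative flat_exp (n + 2) x - real n * flat_exp (n + 1) x) (at x)"
proof (cases x "0::real" rule: linorder_cases)
  case less
  have "((\<lambda>x. 0::real) has_real_derivative 0) (at x)" by simp
  then have "(flat_exp n has_real_derivative 0) (at x)"
    by (rule has_field_derivative_transform_within_open[of _ _ _ "{..<0}"]) (use less in \<open>auto simp: flat_exp_def\<close>)
  then show ?thesis using less by (simp add: flat_exp_def)
next
  case equal
  \<comment> \<open>At 0 the difference quotient of \<open>flat_exp n\<close> is
    \<open>flat_exp (n + 1)\<close> itself, which tends to 0.\<close>
  have "((\<lambda>h. (flat_exp n (0 + h) - flat_exp n 0) / h) \<longlongrightarrow> 0) (at 0)"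
    by (rule Lim_transform_eventually[OF flat_exp_tendsto[of "n + 1"]])
      (auto simp: flat_exp_def eventually_at_filter divide_inverse)
  then show ?thesis using equal by (simp add: DERIV_def flat_exp_def)
next
  case greater
  have "((\<lambda>x. inverse x ^ n * exp (- inverse x)) has_real_derivative
      flat_exp (n + 2) x - real n * flat_exp (n + 1) x) (at x)"
  proof -
    have di: "(inverse has_real_derivative - (inverse x * inverse x)) (at x)"
      using DERIV_inverse[of x UNIV] greater by (simp add: power2_eq_square)
    have "((\<lambda>x. inverse x ^ n) has_real_derivative - real n * inverse x ^ (n + 1)) (at x)"
      using DERIV_power[OF di, of n] by (cases n) (auto simp: algebra_simps)
    moreover have "((\<lambda>x. exp (- inverse x)) has_real_derivative exp (- inverse x) * (inverse x * inverse x)) (at x)"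
      using DERIV_fun_exp[OF DERIV_minus[OF di]] by simp
    ultimately have "((\<lambda>x. inverse x ^ n * exp (- inverse x)) has_real_derivative
        - real n * inverse x ^ (n + 1) * exp (- inverse x) + exp (- inverse x) * (inverse x * inverse x) * inverse x ^ n) (at x)"
      by (rule DERIV_mult)
    then show ?thesis using greater by (simp add: flat_exp_def algebra_simps)
  qed
  then show ?thesis
    by (rule has_field_derivative_transform_within_open[of _ _ _ "{0<..}"]) (use greater in \<open>auto simp: flat_exp_def\<close>)
qed

lemma smooth_flat_exp: "smooth_on UNIV (flat_exp n)"
  unfolding smooth_on_def
proof
  fix k show "Ck_on k UNIV (flat_exp n)"
  proof (induction k arbitrary: n)
    case 0
    show ?case using flat_exp_has_derivative DERIV_isCont
      by (metis Ck_on.simps(1) continuous_at_imp_continuous_on)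
  next
    case (Suc k)
    have "(flat_exp n has_derivative (\<lambda>v. (flat_exp (n + 2) x + - real n * flat_exp (n + 1) x) * v)) (at x)" for x
      using flat_exp_has_derivative[of n x] by (simp add: has_field_derivative_def)
    then show ?case
      by (rule Ck_on_SucI[OF open_UNIV])
        (intro Ck_on_bilinear[OF bounded_bilinear_mult] Ck_on_add Ck_on_const Suc open_UNIV)
  qed
qed

text \<open>The argument of \<open>flat_exp 0\<close> is positive exactly for points closer to
  \<open>c\<close> than \<open>r\<close>. Products of two such functions are the test functions of
  the first variation.\<close>

definition bump :: "real \<Rightarrow> real \<Rightarrow> real \<Rightarrow> real" where
  "bump c r s = flat_exp 0 (r\<^sup>2 - (s - c)\<^sup>2)"

lemma smooth_bump: "smooth_on UNIV (bump c r)"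
  unfolding bump_def
  by (rule smooth_on_compose[OF smooth_flat_exp]) (auto intro!: smooth_intros)

lemma bump_nonneg: "bump c r s \<ge> 0"
  by (simp add: bump_def flat_exp_def)

lemma bump_pos_iff: "r > 0 \<Longrightarrow> bump c r s > 0 \<longleftrightarrow> \<bar>s - c\<bar> < r"
  using abs_le_square_iff[of r "s - c"] by (auto simp: bump_def flat_exp_def)

lemma bump_eq_0: "r > 0 \<Longrightarrow> \<bar>s - c\<bar> \<ge> r \<Longrightarrow> bump c r s = 0"
  using bump_pos_iff[of r c s] bump_nonneg[of c r s] by linarith

section \<open>Charts and smooth maps\<close>

text \<open>The part of \<open>smooth_manifold\<close> on which the chart calculus rests. The
  homeomorphism property is put as a correspondence of open subsets, a form that restricts directly
  to open submanifolds.\<close>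

definition smooth_atlas :: "('a, 'e::euclidean_space) manifold \<Rightarrow> bool" where
  "smooth_atlas M \<longleftrightarrow>
     (\<forall>c\<in>atlas M. openin (mtop M) (fst c) \<and> inj_on (snd c) (fst c) \<and>
        (\<forall>U. U \<subseteq> fst c \<longrightarrow> (openin (mtop M) U \<longleftrightarrow> open (snd c ` U)))) \<and>
     (\<Union>c\<in>atlas M. fst c) = topspace (mtop M) \<and>
     (\<forall>c\<in>atlas M. \<forall>d\<in>atlas M. smooth_on (snd c ` (fst c \<inter> fst d)) (local_rep c d id))"

lemma smooth_manifold_smooth_atlas:
  assumes "smooth_manifold M"
  shows "smooth_atlas M"
proof -
  have key: "inj_on (snd c) (fst c) \<and> (\<forall>U. U \<subseteq> fst c \<longrightarrow> (openin (mtop M) U \<longleftrightarrow> open (snd c ` U)))"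
    if op: "openin (mtop M) (fst c)" "open (snd c ` fst c)"
      and hom: "homeomorphic_map (subtopology (mtop M) (fst c)) (top_of_set (snd c ` fst c)) (snd c)" for c
  proof -
    have ts: "topspace (subtopology (mtop M) (fst c)) = fst c"
      using openin_subset[OF op(1)] by (auto simp: topspace_subtopology)
    have "openin (mtop M) U \<longleftrightarrow> open (snd c ` U)" if U: "U \<subseteq> fst c" for U
    proof -
      have "openin (top_of_set (snd c ` fst c)) (snd c ` U) \<longleftrightarrow> openin (subtopology (mtop M) (fst c)) U"
        by (rule homeomorphic_map_openness[OF hom]) (use U ts in blast)
      moreover have "openin (subtopology (mtop M) (fst c)) U \<longleftrightarrow> openin (mtop M) U"
        using openin_open_subtopology[OF op(1), of U] U by blast
      moreover have "openin (top_of_set (snd c ` fst c)) (snd c ` U) \<longleftrightarrow> open (snd c ` U)"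
        using openin_open_eq[OF op(2), of "snd c ` U"] image_mono[OF U, of "snd c"] by blast
      ultimately show ?thesis by blast
    qed
    then show ?thesis using homeomorphic_imp_injective_map[OF hom] unfolding ts by blast
  qed
  have "\<forall>c\<in>atlas M. openin (mtop M) (fst c) \<and> inj_on (snd c) (fst c) \<and>
      (\<forall>U. U \<subseteq> fst c \<longrightarrow> (openin (mtop M) U \<longleftrightarrow> open (snd c ` U)))"
  proof
    fix c assume c: "c \<in> atlas M"
    note m = assms[unfolded smooth_manifold_def, THEN conjunct2, THEN conjunct2, THEN conjunct1, THEN bspec, OF c]
    show "openin (mtop M) (fst c) \<and> inj_on (snd c) (fst c) \<and>
        (\<forall>U. U \<subseteq> fst c \<longrightarrow> (openin (mtop M) U \<longleftrightarrow> open (snd c ` U)))"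
      by (rule conjI[OF conjunct1[OF m] key[OF conjunct1[OF m] conjunct1[OF conjunct2[OF m]] conjunct2[OF conjunct2[OF m]]]])
  qed
  then show ?thesis using assms unfolding smooth_manifold_def smooth_atlas_def by simp
qed

lemma charts_atD: "c \<in> charts_at M p \<Longrightarrow> c \<in> atlas M" "c \<in> charts_at M p \<Longrightarrow> p \<in> fst c"
  by (auto simp: charts_at_def)

lemma charts_atI: "c \<in> atlas M \<Longrightarrow> p \<in> fst c \<Longrightarrow> c \<in> charts_at M p"
  by (auto simp: charts_at_def)

lemma charts_at_ex:
  assumes "smooth_atlas M" "p \<in> topspace (mtop M)"
  obtains c where "c \<in> charts_at M p"
proof -
  have "p \<in> (\<Union>c\<in>atlas M. fst c)" using assms unfolding smooth_atlas_def by simp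
  then show thesis using that unfolding charts_at_def by blast
qed

lemma chart_at_charts_at: "smooth_atlas M \<Longrightarrow> p \<in> topspace (mtop M) \<Longrightarrow> chart_at M p \<in> charts_at M p"
  unfolding chart_at_def by (rule someI_ex) (metis charts_at_ex)

lemma charts_at_topspace: "smooth_atlas M \<Longrightarrow> c \<in> charts_at M p \<Longrightarrow> p \<in> topspace (mtop M)"
  unfolding smooth_atlas_def charts_at_def by blast

lemma chart_domain_topspace: "smooth_atlas M \<Longrightarrow> c \<in> atlas M \<Longrightarrow> fst c \<subseteq> topspace (mtop M)"
  unfolding smooth_atlas_def by blast

lemma chart_domain_open: "smooth_atlas M \<Longrightarrow> c \<in> atlas M \<Longrightarrow> openin (mtop M) (fst c)"
  unfolding smooth_atlas_def by blast

lemma chart_image_open: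
  assumes "smooth_atlas M" "c \<in> atlas M" "openin (mtop M) U"
  shows "open (snd c ` (fst c \<inter> U))"
  using assms openin_Int[OF chart_domain_open[OF assms(1,2)] assms(3)]
  unfolding smooth_atlas_def by (metis Int_lower1)

lemma chart_range_open: "smooth_atlas M \<Longrightarrow> c \<in> atlas M \<Longrightarrow> open (snd c ` fst c)"
  using chart_image_open[of M c "fst c"] chart_domain_open by fastforce

lemma cinv_chart: "smooth_atlas M \<Longrightarrow> c \<in> atlas M \<Longrightarrow> p \<in> fst c \<Longrightarrow> cinv c (snd c p) = p"
  unfolding smooth_atlas_def cinv_def by (simp add: inv_into_f_f)

lemma chart_cinv: "x \<in> snd c ` fst c \<Longrightarrow> snd c (cinv c x) = x"
  and cinv_domain: "x \<in> snd c ` fst c \<Longrightarrow> cinv c x \<in> fst c"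
  unfolding cinv_def by (simp_all add: f_inv_into_f inv_into_into)

lemma chart_preimage_open:
  assumes "smooth_atlas M" "c \<in> atlas M" "open W"
  shows "openin (mtop M) {p\<in>fst c. snd c p \<in> W}"
proof -
  have "snd c ` {p\<in>fst c. snd c p \<in> W} = snd c ` fst c \<inter> W" by auto
  then have "open (snd c ` {p\<in>fst c. snd c p \<in> W})"
    using chart_range_open[OF assms(1,2)] assms(3) by auto
  then show ?thesis using assms(1,2) unfolding smooth_atlas_def by (metis (no_types, lifting) mem_Collect_eq subsetI)
qed

lemma transition_smooth:
  assumes "smooth_atlas M" "c \<in> atlas M" "d \<in> atlas M"
  shows "open (snd c ` (fst c \<inter> fst d))" "smooth_on (snd c ` (fst c \<inter> fst d)) (local_rep c d id)"
  using assms chart_image_open[OF assms(1,2) chart_domain_open[OF assms(1,3)]]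
  unfolding smooth_atlas_def by auto

lemma smooth_map_local_rep:
  assumes "smooth_atlas M" "smooth_atlas N" "smooth_map M N f" "c \<in> atlas M" "d \<in> atlas N"
  shows "open (snd c ` (fst c \<inter> f -` fst d))" "smooth_on (snd c ` (fst c \<inter> f -` fst d)) (local_rep c d f)"
proof -
  have "openin (mtop M) {p \<in> topspace (mtop M). f p \<in> fst d}"
    using assms(3) chart_domain_open[OF assms(2,5)] unfolding smooth_map_def
    by (intro openin_continuous_map_preimage) auto
  moreover have "fst c \<inter> f -` fst d = fst c \<inter> {p \<in> topspace (mtop M). f p \<in> fst d}"
    using chart_domain_topspace[OF assms(1,4)] by auto
  ultimately show "open (snd c ` (fst c \<inter> f -` fst d))" using chart_image_open[OF assms(1,4)] by auto
  show "smooth_on (snd c ` (fst c \<inter> f -` fst d)) (local_rep c d f)"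
    using assms unfolding smooth_map_def by blast
qed

lemma smooth_map_topspace: "smooth_map M N f \<Longrightarrow> p \<in> topspace (mtop M) \<Longrightarrow> f p \<in> topspace (mtop N)"
  unfolding smooth_map_def continuous_map_def by auto

lemma local_rep_compose:
  assumes "smooth_atlas N" "d \<in> atlas N" "f (cinv c x) \<in> fst d"
  shows "local_rep c e (g \<circ> f) x = local_rep d e g (local_rep c d f x)"
  using cinv_chart[OF assms] by (simp add: local_rep_def)

lemma local_rep_chart:
  "smooth_atlas M \<Longrightarrow> c \<in> atlas M \<Longrightarrow> p \<in> fst c \<Longrightarrow> local_rep c d f (snd c p) = snd d (f p)"
  by (simp add: local_rep_def cinv_chart)

text \<open>One good pair of charts around each point suffices: in any other pair the local
  representative is the good one composed with transition maps on both sides. Continuity is read off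
  in the good charts too.\<close>

lemma smooth_mapI:
  assumes M: "smooth_atlas M" and N: "smooth_atlas N"
    and loc: "\<And>p. p \<in> topspace (mtop M) \<Longrightarrow> \<exists>c\<in>charts_at M p. \<exists>d\<in>charts_at N (f p). \<exists>W. open W \<and>
      snd c p \<in> W \<and> W \<subseteq> snd c ` (fst c \<inter> f -` fst d) \<and> smooth_on W (local_rep c d f)"
  shows "smooth_map M N f"
  unfolding smooth_map_def
proof (intro conjI ballI)
  show "continuous_map (mtop M) (mtop N) f"
    unfolding continuous_map_def
  proof (intro conjI allI impI)
    show "f \<in> topspace (mtop M) \<rightarrow> topspace (mtop N)"
      using loc charts_at_topspace[OF N] by blast
    fix U assume U: "openin (mtop N) U"
    show "openin (mtop M) {p \<in> topspace (mtop M). f p \<in> U}"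
    proof (subst openin_subopen, intro ballI)
      fix p assume p: "p \<in> {p \<in> topspace (mtop M). f p \<in> U}"
      then obtain c d W where c: "c \<in> charts_at M p" and d: "d \<in> charts_at N (f p)" and W: "open W" "snd c p \<in> W"
        "W \<subseteq> snd c ` (fst c \<inter> f -` fst d)" "smooth_on W (local_rep c d f)" using loc by blast
      note c' = charts_atD[OF c] note d' = charts_atD[OF d]
      let ?V = "snd d ` (fst d \<inter> U)"
      have oV: "open ?V" by (rule chart_image_open[OF N d'(1) U])
      have "open (W \<inter> local_rep c d f -` ?V)"
        using continuous_open_preimage[OF smooth_on_continuous[OF W(4)] W(1) oV] by simp
      then have o: "openin (mtop M) {q\<in>fst c. snd c q \<in> W \<inter> local_rep c d f -` ?V}"
        by (rule chart_preimage_open[OF M c'(1)])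
      have sub: "f q \<in> U" if q: "q \<in> fst c" "snd c q \<in> W" "local_rep c d f (snd c q) \<in> ?V" for q
      proof -
        obtain q' where "q' \<in> fst c" "f q' \<in> fst d" "snd c q = snd c q'" using W(3) q(2) by auto
        then have "f q \<in> fst d" using cinv_chart[OF M c'(1)] q(1) by metis
        moreover obtain y where "y \<in> fst d" "y \<in> U" "snd d (f q) = snd d y"
          using q(3) local_rep_chart[OF M c'(1) q(1), of d f] by auto
        ultimately show ?thesis using cinv_chart[OF N d'(1)] by metis
      qed
      have "p \<in> {q\<in>fst c. snd c q \<in> W \<inter> local_rep c d f -` ?V}"
        using p W(2) c'(2) d'(2) local_rep_chart[OF M c', of d f] by auto
      then show "\<exists>T. openin (mtop M) T \<and> p \<in> T \<and> T \<subseteq> {p \<in> topspace (mtop M). f p \<in> U}"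
        using o sub openin_subset[OF o] by (intro exI[of _ "{q\<in>fst c. snd c q \<in> W \<inter> local_rep c d f -` ?V}"]) auto
    qed
  qed
  fix c d assume c: "c \<in> atlas M" and d: "d \<in> atlas N"
  show "smooth_on (snd c ` (fst c \<inter> f -` fst d)) (local_rep c d f)"
  proof (rule smooth_on_local)
    fix x assume "x \<in> snd c ` (fst c \<inter> f -` fst d)"
    then obtain p where p: "p \<in> fst c" "f p \<in> fst d" and x: "x = snd c p" by auto
    have "p \<in> topspace (mtop M)" using p chart_domain_topspace[OF M c] by auto
    then obtain c' d' W where c': "c' \<in> charts_at M p" and d': "d' \<in> charts_at N (f p)" and W: "open W" "snd c' p \<in> W"
      "W \<subseteq> snd c' ` (fst c' \<inter> f -` fst d')" "smooth_on W (local_rep c' d' f)" using loc by blast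
    note c'' = charts_atD[OF c'] note d'' = charts_atD[OF d']
    note tc = transition_smooth[OF M c c''(1)]
    note td = transition_smooth[OF N d''(1) d]
    let ?tc = "local_rep c c' id" and ?td = "local_rep d' d id"
    \<comment> \<open>\<open>W'\<close> and \<open>O'\<close> cut the domain down to the points
      where the whole composite of transition, representative and transition is defined.\<close>
    define W' where "W' = W \<inter> local_rep c' d' f -` (snd d' ` (fst d' \<inter> fst d))"
    have W': "open W'" unfolding W'_def
      by (rule continuous_open_preimage[OF smooth_on_continuous[OF W(4)] W(1) td(1)])
    define O' where "O' = snd c ` (fst c \<inter> fst c') \<inter> ?tc -` W'"
    have O': "open O'" unfolding O'_def
      by (rule continuous_open_preimage[OF smooth_on_continuous[OF tc(2)] tc(1) W'])
    have "x \<in> O'"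
      unfolding O'_def W'_def x using p c'' d'' W(2)
      by (auto simp: local_rep_chart[OF M c p(1)] local_rep_chart[OF M c''])
    moreover have "smooth_on O' (\<lambda>y. ?td (local_rep c' d' f (?tc y)))"
    proof (rule smooth_on_compose[OF td(2) O' td(1)])
      show "smooth_on O' (\<lambda>y. local_rep c' d' f (?tc y))"
        by (rule smooth_on_compose[OF W(4) O' W(1)]) (auto simp: O'_def W'_def intro: smooth_on_subset[OF tc(2)])
    qed (auto simp: O'_def W'_def)
    then have "smooth_on O' (local_rep c d f)"
    proof (rule iffD1[OF smooth_on_cong[OF O'], rotated])
      fix y assume y: "y \<in> O'"
      obtain q where q: "q \<in> fst c" "q \<in> fst c'" "y = snd c q" using y by (auto simp: O'_def)
      have tq: "?tc y = snd c' q" using local_rep_chart[OF M c q(1), of c' id] q(3) by simp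
      have "snd c' q \<in> W" using y tq by (auto simp: O'_def W'_def)
      then obtain q' where q': "q' \<in> fst c'" "f q' \<in> fst d'" "snd c' q = snd c' q'" using W(3) by auto
      have "f q \<in> fst d'" using q' q(2) cinv_chart[OF M c''(1)] by metis
      then show "?td (local_rep c' d' f (?tc y)) = local_rep c d f y"
        using tq q local_rep_chart[OF M c''(1) q(2), of d' f] local_rep_chart[OF N d''(1), of "f q" d id]
          local_rep_chart[OF M c q(1), of d f]
        by simp
    qed
    ultimately show "\<exists>U. open U \<and> x \<in> U \<and> smooth_on U (local_rep c d f)" using O' by blast
  qed
qed

lemma smooth_map_id: "smooth_atlas M \<Longrightarrow> smooth_map M M id"
  unfolding smooth_map_def using transition_smooth(2)[of M] by (simp add: continuous_map_id)

lemma smooth_map_compose: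
  assumes M: "smooth_atlas M" and N: "smooth_atlas N" and P: "smooth_atlas P"
    and f: "smooth_map M N f" and g: "smooth_map N P g"
  shows "smooth_map M P (g \<circ> f)"
proof (rule smooth_mapI[OF M P])
  fix p assume p: "p \<in> topspace (mtop M)"
  obtain c where c: "c \<in> charts_at M p" using charts_at_ex[OF M p] .
  obtain d where d: "d \<in> charts_at N (f p)" using charts_at_ex[OF N smooth_map_topspace[OF f p]] .
  obtain e where e: "e \<in> charts_at P (g (f p))"
    using charts_at_ex[OF P smooth_map_topspace[OF g smooth_map_topspace[OF f p]]] .
  note cD = charts_atD[OF c] note dD = charts_atD[OF d] note eD = charts_atD[OF e]
  note F = smooth_map_local_rep[OF M N f cD(1) dD(1)] note G = smooth_map_local_rep[OF N P g dD(1) eD(1)]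
  define W where "W = snd c ` (fst c \<inter> f -` fst d) \<inter> local_rep c d f -` (snd d ` (fst d \<inter> g -` fst e))"
  have W: "open W" unfolding W_def by (rule continuous_open_preimage[OF smooth_on_continuous[OF F(2)] F(1) G(1)])
  have xW: "snd c p \<in> W" unfolding W_def using cD dD eD by (auto simp: local_rep_chart[OF M cD])
  have s: "W \<subseteq> snd c ` (fst c \<inter> (g \<circ> f) -` fst e)"
  proof
    fix y assume y: "y \<in> W"
    obtain q where q: "q \<in> fst c" "f q \<in> fst d" "y = snd c q" using y by (auto simp: W_def)
    obtain r where r: "r \<in> fst d" "g r \<in> fst e" "snd d (f q) = snd d r"
      using y local_rep_chart[OF M cD(1) q(1), of d f] by (auto simp: W_def q(3))
    have "f q = r" using r q cinv_chart[OF N dD(1)] by metis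
    then show "y \<in> snd c ` (fst c \<inter> (g \<circ> f) -` fst e)" using q r by auto
  qed
  have "smooth_on W (\<lambda>x. local_rep d e g (local_rep c d f x))"
    by (rule smooth_on_compose[OF G(2) W G(1)]) (auto simp: W_def intro: smooth_on_subset[OF F(2)])
  then have "smooth_on W (local_rep c e (g \<circ> f))"
  proof (rule iffD1[OF smooth_on_cong[OF W], rotated])
    fix y assume "y \<in> W"
    then obtain q where q: "q \<in> fst c" "f q \<in> fst d" "y = snd c q" by (auto simp: W_def)
    then show "local_rep d e g (local_rep c d f y) = local_rep c e (g \<circ> f) y"
      using local_rep_compose[OF N dD(1), of f c y e g] cinv_chart[OF M cD(1) q(1)] by simp
  qed
  then show "\<exists>c\<in>charts_at M p. \<exists>d\<in>charts_at P ((g \<circ> f) p). \<exists>W. open W \<and> snd c p \<in> W \<and>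
      W \<subseteq> snd c ` (fst c \<inter> (g \<circ> f) -` fst d) \<and> smooth_on W (local_rep c d (g \<circ> f))"
    using c e W xW s by (intro bexI[of _ c] bexI[of _ e] exI[of _ W]) auto
qed

section \<open>Differentials and changes of charts\<close>

lemma tmap_has_derivative:
  assumes M: "smooth_atlas M" and N: "smooth_atlas N" and f: "smooth_map M N f"
    and c: "c \<in> charts_at M p" and d: "d \<in> charts_at N (f p)"
  shows "(local_rep c d f has_derivative tmap c d f p) (at (snd c p))"
  unfolding tmap_def
  by (rule smooth_on_has_derivative[OF smooth_map_local_rep(2,1)[OF M N f]])
    (use charts_atD[OF c] charts_atD[OF d] in auto)

lemma tmap_linear:
  assumes "smooth_atlas M" "smooth_atlas N" "smooth_map M N f" "c \<in> charts_at M p" "d \<in> charts_at N (f p)"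
  shows "linear (tmap c d f p)"
  using tmap_has_derivative[OF assms] has_derivative_linear by blast

lemma tmap_cong:
  assumes M: "smooth_atlas M" and c: "c \<in> charts_at M p"
    and U: "openin (mtop M) U" "p \<in> U" and eq: "\<And>q. q \<in> U \<Longrightarrow> f q = g q"
  shows "tmap c d f p = tmap c d g p"
  unfolding tmap_def
proof (rule frd_cong[OF chart_image_open[OF M charts_atD(1)[OF c] U(1)]])
  fix y assume "y \<in> snd c ` (fst c \<inter> U)"
  then show "local_rep c d f y = local_rep c d g y"
    using cinv_chart[OF M charts_atD(1)[OF c]] eq by (auto simp: local_rep_def)
qed (use U charts_atD(2)[OF c] in auto)

text \<open>The chain rule. Taking one or both of the maps to be the identity yields all the rules
  below for changing the chart in the source or in the target.\<close>

lemma tmap_compose: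
  assumes M: "smooth_atlas M" and N: "smooth_atlas N" and P: "smooth_atlas P"
    and f: "smooth_map M N f" and g: "smooth_map N P g"
    and c: "c \<in> charts_at M p" and d: "d \<in> charts_at N (f p)" and e: "e \<in> charts_at P (g (f p))"
  shows "tmap c e (g \<circ> f) p v = tmap d e g (f p) (tmap c d f p v)"
proof -
  note cD = charts_atD[OF c] note dD = charts_atD[OF d] note eD = charts_atD[OF e]
  have x: "snd c p \<in> snd c ` (fst c \<inter> f -` fst d)" using cD dD by auto
  have "((\<lambda>x. local_rep d e g (local_rep c d f x)) has_derivative (\<lambda>v. tmap d e g (f p) (tmap c d f p v))) (at (snd c p))"
    by (rule has_derivative_compose[OF tmap_has_derivative[OF M N f c d]])
      (use tmap_has_derivative[OF N P g d e] in \<open>simp add: local_rep_chart[OF M cD]\<close>)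
  then have "(local_rep c e (g \<circ> f) has_derivative (\<lambda>v. tmap d e g (f p) (tmap c d f p v))) (at (snd c p))"
  proof (rule has_derivative_transform_within_open[OF _ smooth_map_local_rep(1)[OF M N f cD(1) dD(1)] x])
    fix y assume "y \<in> snd c ` (fst c \<inter> f -` fst d)"
    then show "local_rep d e g (local_rep c d f y) = local_rep c e (g \<circ> f) y"
      using local_rep_compose[OF N dD(1), of f c _ e g] cinv_chart[OF M cD(1)] by auto
  qed
  then show ?thesis unfolding tmap_def[of c e] by (simp add: frd_eq)
qed

lemma tmap_id:
  assumes M: "smooth_atlas M" and c: "c \<in> charts_at M p"
  shows "tmap c c id p v = v"
proof -
  note cD = charts_atD[OF c]
  have "frd (local_rep c c id) (snd c p) = frd (\<lambda>x. x) (snd c p)"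
    by (rule frd_cong[OF chart_range_open[OF M cD(1)]]) (use cD in \<open>auto simp: local_rep_chart[OF M cD(1)]\<close>)
  then show ?thesis by (simp add: tmap_def)
qed

lemma tmap_transition:
  assumes M: "smooth_atlas M" and "c \<in> charts_at M p" "d \<in> charts_at M p" "e \<in> charts_at M p"
  shows "tmap d e id p (tmap c d id p v) = tmap c e id p v"
  using tmap_compose[OF M M M smooth_map_id[OF M] smooth_map_id[OF M], of c p d e v] assms by simp

lemma tmap_transition_inverse:
  assumes "smooth_atlas M" "c \<in> charts_at M p" "d \<in> charts_at M p"
  shows "tmap d c id p (tmap c d id p v) = v"
  using tmap_transition[OF assms(1-3,2)] tmap_id[OF assms(1,2)] by simp

lemma tmap_change_target:
  assumes M: "smooth_atlas M" and N: "smooth_atlas N" and f: "smooth_map M N f"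
    and c: "c \<in> charts_at M p" and d: "d \<in> charts_at N (f p)" "e \<in> charts_at N (f p)"
  shows "tmap c e f p v = tmap d e id (f p) (tmap c d f p v)"
  using tmap_compose[OF M N N f smooth_map_id[OF N] c d(1), of e v] d by simp

lemma tmap_change_source:
  assumes M: "smooth_atlas M" and N: "smooth_atlas N" and f: "smooth_map M N f"
    and c: "c \<in> charts_at M p" "c' \<in> charts_at M p" and d: "d \<in> charts_at N (f p)"
  shows "tmap c d f p v = tmap c' d f p (tmap c c' id p v)"
  using tmap_compose[OF M M N smooth_map_id[OF M] f c(1), of c' d v] c d by simp

section \<open>Open submanifolds and open regions of Euclidean space\<close>

lemma mtop_open_submanifold: "mtop (open_submanifold M V) = subtopology (mtop M) V"
  and atlas_open_submanifold: "atlas (open_submanifold M V) = (\<lambda>c. (fst c \<inter> V, snd c)) ` atlas M"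
  by (auto simp: open_submanifold_def)

text \<open>\<open>cinv\<close> depends on the domain through \<open>inv_into\<close>; injectivity
  on the larger domain makes both choices agree.\<close>

lemma cinv_restrict:
  assumes "smooth_atlas M" "c \<in> atlas M" "x \<in> snd c ` (fst c \<inter> V)"
  shows "cinv (fst c \<inter> V, snd c) x = cinv c x"
proof -
  obtain p where p: "p \<in> fst c \<inter> V" "x = snd c p" using assms(3) by auto
  have "inj_on (snd c) (fst c \<inter> V)" using assms unfolding smooth_atlas_def by (meson inf_le1 inj_on_subset)
  then have "cinv (fst c \<inter> V, snd c) x = p" using p by (simp add: cinv_def)
  then show ?thesis using cinv_chart[OF assms(1,2)] p by auto
qed

lemma smooth_atlas_open_submanifold:
  assumes M: "smooth_atlas M" and V: "openin (mtop M) V"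
  shows "smooth_atlas (open_submanifold M V)"
  unfolding smooth_atlas_def atlas_open_submanifold mtop_open_submanifold
proof (intro conjI ballI)
  fix c assume "c \<in> (\<lambda>c. (fst c \<inter> V, snd c)) ` atlas M"
  then obtain c0 where c0: "c0 \<in> atlas M" "c = (fst c0 \<inter> V, snd c0)" by auto
  show "openin (subtopology (mtop M) V) (fst c)"
    using c0 chart_domain_open[OF M c0(1)] V by (simp add: openin_open_subtopology openin_Int)
  show "inj_on (snd c) (fst c)"
    using M c0 unfolding smooth_atlas_def by (metis fst_conv inf_le1 inj_on_subset snd_conv)
  show "\<forall>U\<subseteq>fst c. openin (subtopology (mtop M) V) U = open (snd c ` U)"
    using M c0 V unfolding smooth_atlas_def by (auto simp: openin_open_subtopology)
  fix d assume "d \<in> (\<lambda>c. (fst c \<inter> V, snd c)) ` atlas M"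
  then obtain d0 where d0: "d0 \<in> atlas M" "d = (fst d0 \<inter> V, snd d0)" by auto
  have eq: "fst c \<inter> fst d = fst c0 \<inter> (fst d0 \<inter> V)" using c0 d0 by auto
  have o: "open (snd c0 ` (fst c0 \<inter> (fst d0 \<inter> V)))"
    by (rule chart_image_open[OF M c0(1) openin_Int[OF chart_domain_open[OF M d0(1)] V]])
  have "smooth_on (snd c0 ` (fst c0 \<inter> (fst d0 \<inter> V))) (local_rep c0 d0 id)"
    by (rule smooth_on_subset[OF transition_smooth(2)[OF M c0(1) d0(1)]]) auto
  moreover have "local_rep c0 d0 id y = local_rep c d id y" if "y \<in> snd c0 ` (fst c0 \<inter> (fst d0 \<inter> V))" for y
    using that cinv_restrict[OF M c0(1), of y V] c0 d0 by (auto simp: local_rep_def)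
  ultimately show "smooth_on (snd c ` (fst c \<inter> fst d)) (local_rep c d id)"
    unfolding eq using smooth_on_cong[OF o, of "local_rep c0 d0 id" "local_rep c d id"] c0 by simp
next
  show "\<Union> (fst ` (\<lambda>c. (fst c \<inter> V, snd c)) ` atlas M) = topspace (subtopology (mtop M) V)"
    using M unfolding smooth_atlas_def by (auto simp: topspace_subtopology)
qed

lemma open_region_simps [simp]:
  "mtop (open_region W) = top_of_set W" "atlas (open_region W) = {(W, id)}"
  "topspace (mtop (open_region W)) = W"
  by (auto simp: open_submanifold_def euclidean_manifold_def)

lemma charts_at_open_region: "x \<in> W \<Longrightarrow> charts_at (open_region W) x = {(W, id)}"
  by (auto simp: charts_at_def)

lemma cinv_id: "x \<in> W \<Longrightarrow> cinv (W, id) x = x"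
  by (simp add: cinv_def)

lemma smooth_atlas_open_region: "open W \<Longrightarrow> smooth_atlas (open_region W)"
proof -
  assume W: "open W"
  have "smooth_on W (local_rep (W, id) (W, id) id)"
    by (rule iffD1[OF smooth_on_cong[OF W] smooth_on_id[OF W]]) (simp add: local_rep_def cinv_id)
  then show ?thesis using W by (auto simp: smooth_atlas_def openin_open_eq)
qed

lemma euclidean_manifold_open_region: "euclidean_manifold = open_region UNIV"
  by (simp add: open_submanifold_def euclidean_manifold_def)

lemma tmap_open_region:
  assumes "open W" "x \<in> W"
  shows "tmap (W, id) d f x = frd (\<lambda>y. snd d (f y)) x"
  unfolding tmap_def using assms
  by (simp, intro frd_cong[OF assms]) (simp add: local_rep_def cinv_id)

lemma smooth_map_open_region:
  assumes W: "open W" and N: "smooth_atlas N" and f: "smooth_map (open_region W) N f" and d: "d \<in> atlas N"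
  shows "open (W \<inter> f -` fst d)" "smooth_on (W \<inter> f -` fst d) (\<lambda>x. snd d (f x))"
proof -
  note A = smooth_map_local_rep[OF smooth_atlas_open_region[OF W] N f, of "(W, id)" d]
  show o: "open (W \<inter> f -` fst d)" using A(1) d by simp
  show "smooth_on (W \<inter> f -` fst d) (\<lambda>x. snd d (f x))"
    by (rule iffD1[OF smooth_on_cong[OF o]]) (use A(2) d in \<open>auto simp: local_rep_def cinv_id\<close>)
qed

lemma smooth_map_open_regionI:
  assumes W: "open W" and N: "smooth_atlas N"
    and loc: "\<And>x. x \<in> W \<Longrightarrow> \<exists>d\<in>atlas N. \<exists>U. open U \<and> x \<in> U \<and> U \<subseteq> W \<inter> f -` fst d \<and> smooth_on U (\<lambda>x. snd d (f x))"
  shows "smooth_map (open_region W) N f"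
proof (rule smooth_mapI[OF smooth_atlas_open_region[OF W] N])
  fix x assume "x \<in> topspace (mtop (open_region W))"
  then have x: "x \<in> W" by simp
  obtain d U where d: "d \<in> atlas N" and U: "open U" "x \<in> U" "U \<subseteq> W \<inter> f -` fst d" "smooth_on U (\<lambda>x. snd d (f x))"
    using loc[OF x] by blast
  have "smooth_on U (local_rep (W, id) d f)"
    by (rule iffD1[OF smooth_on_cong[OF U(1)] U(4)]) (use U(3) in \<open>auto simp: local_rep_def cinv_id\<close>)
  then show "\<exists>c\<in>charts_at (open_region W) x. \<exists>d\<in>charts_at N (f x). \<exists>V. open V \<and> snd c x \<in> V \<and>
      V \<subseteq> snd c ` (fst c \<inter> f -` fst d) \<and> smooth_on V (local_rep c d f)"
    unfolding charts_at_open_region[OF x] using U d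
    by (intro bexI[of _ "(W, id)"] bexI[of _ d] exI[of _ U]) (auto simp: charts_at_def)
qed

lemma smooth_map_open_regions:
  assumes W: "open W" and V: "open V"
  shows "smooth_map (open_region W) (open_region V) f \<longleftrightarrow> smooth_on W f \<and> f ` W \<subseteq> V"
proof
  assume f: "smooth_map (open_region W) (open_region V) f"
  have fV: "f ` W \<subseteq> V" using smooth_map_topspace[OF f] by auto
  then have "W \<inter> f -` V = W" by auto
  then show "smooth_on W f \<and> f ` W \<subseteq> V"
    using smooth_map_open_region(2)[OF W smooth_atlas_open_region[OF V] f, of "(V, id)"] fV by simp
next
  assume f: "smooth_on W f \<and> f ` W \<subseteq> V"
  show "smooth_map (open_region W) (open_region V) f"
  proof (rule smooth_map_open_regionI[OF W smooth_atlas_open_region[OF V]])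
    fix x assume "x \<in> W"
    then show "\<exists>d\<in>atlas (open_region V). \<exists>U. open U \<and> x \<in> U \<and> U \<subseteq> W \<inter> f -` fst d \<and> smooth_on U (\<lambda>x. snd d (f x))"
      using W f by (intro bexI[of _ "(V, id)"] exI[of _ W]) auto
  qed
qed

text \<open>A variation lives on the product of a time interval with the surface. For a surface that
  is an open region this product becomes an open region again, where plain calculus applies.\<close>

lemma product_open_region:
  "product_manifold (open_region A) (open_region B) = open_region (A \<times> B)"
proof -
  have "prod_topology (top_of_set A) (top_of_set B) = top_of_set (A \<times> B)"
    using subtopology_Times[of euclidean euclidean A B] by (simp add: euclidean_product_topology)
  then show ?thesis
    by (simp add: product_manifold_def open_submanifold_def euclidean_manifold_def map_prod.id)
qed

section \<open>Products of manifolds\<close>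

lemma product_manifold_simps [simp]:
  "mtop (product_manifold M N) = prod_topology (mtop M) (mtop N)"
  "atlas (product_manifold M N) = (\<lambda>(c, d). (fst c \<times> fst d, map_prod (snd c) (snd d))) ` (atlas M \<times> atlas N)"
  by (auto simp: product_manifold_def)

abbreviation prod_chart :: "('a, 'e) chart \<Rightarrow> ('b, 'f) chart \<Rightarrow> ('a \<times> 'b, 'e \<times> 'f) chart" where
  "prod_chart c d \<equiv> (fst c \<times> fst d, map_prod (snd c) (snd d))"

lemma charts_at_product:
  "d \<in> charts_at (product_manifold M N) q \<longleftrightarrow>
    (\<exists>d1 d2. d1 \<in> charts_at M (fst q) \<and> d2 \<in> charts_at N (snd q) \<and> d = prod_chart d1 d2)"
  unfolding charts_at_def product_manifold_simps by (cases q) (fastforce simp: mem_Times_iff)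

lemma local_rep_prod_chart: "local_rep c (prod_chart d1 d2) f x = (local_rep c d1 (fst \<circ> f) x, local_rep c d2 (snd \<circ> f) x)"
  by (simp add: local_rep_def map_prod_def split_beta)

lemma smooth_map_product:
  assumes S: "smooth_atlas S" and M: "smooth_atlas M" and N: "smooth_atlas N"
  shows "smooth_map S (product_manifold M N) f \<longleftrightarrow> smooth_map S M (fst \<circ> f) \<and> smooth_map S N (snd \<circ> f)"
proof
  assume f: "smooth_map S (product_manifold M N) f"
  have cont: "continuous_map (mtop S) (prod_topology (mtop M) (mtop N)) f"
    using f unfolding smooth_map_def by simp
  have o: "open (snd c ` (fst c \<inter> f -` (fst d1 \<times> fst d2)))" (is ?O)
    and s: "smooth_on (snd c ` (fst c \<inter> f -` (fst d1 \<times> fst d2))) (local_rep c (prod_chart d1 d2) f)" (is ?S)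
    if "c \<in> atlas S" "d1 \<in> atlas M" "d2 \<in> atlas N" for c d1 d2
  proof -
    have "openin (prod_topology (mtop M) (mtop N)) (fst d1 \<times> fst d2)"
      using that chart_domain_open[OF M] chart_domain_open[OF N] by (simp add: openin_prod_Times_iff)
    then have "openin (mtop S) {p \<in> topspace (mtop S). f p \<in> fst d1 \<times> fst d2}"
      by (rule openin_continuous_map_preimage[OF cont])
    moreover have "fst c \<inter> f -` (fst d1 \<times> fst d2) = fst c \<inter> {p \<in> topspace (mtop S). f p \<in> fst d1 \<times> fst d2}"
      using chart_domain_topspace[OF S that(1)] by auto
    ultimately show ?O using chart_image_open[OF S that(1)] by simp
    have "prod_chart d1 d2 \<in> atlas (product_manifold M N)" using that by (auto simp: image_iff)
    then show ?S using f that(1) unfolding smooth_map_def by fastforce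
  qed
  have top: "f p \<in> topspace (mtop M) \<times> topspace (mtop N)" if "p \<in> topspace (mtop S)" for p
    using cont that unfolding continuous_map_def by auto
  show "smooth_map S M (fst \<circ> f) \<and> smooth_map S N (snd \<circ> f)"
    unfolding smooth_map_def
  proof (intro conjI ballI)
    show "continuous_map (mtop S) (mtop M) (fst \<circ> f)" "continuous_map (mtop S) (mtop N) (snd \<circ> f)"
      using continuous_map_compose[OF cont continuous_map_fst] continuous_map_compose[OF cont continuous_map_snd] by auto
    fix c assume c: "c \<in> atlas S"
    { fix d1 assume d1: "d1 \<in> atlas M"
      show "smooth_on (snd c ` (fst c \<inter> (fst \<circ> f) -` fst d1)) (local_rep c d1 (fst \<circ> f))"
      proof (rule smooth_on_local)
        fix x assume "x \<in> snd c ` (fst c \<inter> (fst \<circ> f) -` fst d1)"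
        then obtain p where p: "p \<in> fst c" "fst (f p) \<in> fst d1" "x = snd c p" by auto
        \<comment> \<open>Charts of the product come in pairs. To test the first component in
          \<open>d1\<close>, some chart \<open>d2\<close> around the second component is needed, and
          the neighbourhood has to be shrunk to both.\<close>
        have "snd (f p) \<in> topspace (mtop N)" using top chart_domain_topspace[OF S c] p(1) by fastforce
        then obtain d2 where d2: "d2 \<in> charts_at N (snd (f p))" using charts_at_ex[OF N] by blast
        note d2' = charts_atD[OF d2]
        have "smooth_on (snd c ` (fst c \<inter> f -` (fst d1 \<times> fst d2))) (\<lambda>x. fst (local_rep c (prod_chart d1 d2) f x))"
          by (intro smooth_intros o s c d1 d2')
        then show "\<exists>U. open U \<and> x \<in> U \<and> smooth_on U (local_rep c d1 (fst \<circ> f))"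
          using o[OF c d1 d2'(1)] p d2'(2) unfolding local_rep_prod_chart fst_conv
          by (intro exI conjI) (auto simp: mem_Times_iff)
      qed }
    { fix d2 assume d2: "d2 \<in> atlas N"
      show "smooth_on (snd c ` (fst c \<inter> (snd \<circ> f) -` fst d2)) (local_rep c d2 (snd \<circ> f))"
      proof (rule smooth_on_local)
        fix x assume "x \<in> snd c ` (fst c \<inter> (snd \<circ> f) -` fst d2)"
        then obtain p where p: "p \<in> fst c" "snd (f p) \<in> fst d2" "x = snd c p" by auto
        have "fst (f p) \<in> topspace (mtop M)" using top chart_domain_topspace[OF S c] p(1) by fastforce
        then obtain d1 where d1: "d1 \<in> charts_at M (fst (f p))" using charts_at_ex[OF M] by blast
        note d1' = charts_atD[OF d1]
        have "smooth_on (snd c ` (fst c \<inter> f -` (fst d1 \<times> fst d2))) (\<lambda>x. snd (local_rep c (prod_chart d1 d2) f x))"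
          by (intro smooth_intros o s c d2 d1')
        then show "\<exists>U. open U \<and> x \<in> U \<and> smooth_on U (local_rep c d2 (snd \<circ> f))"
          using o[OF c d1'(1) d2] p d1'(2) unfolding local_rep_prod_chart snd_conv
          by (intro exI conjI) (auto simp: mem_Times_iff)
      qed }
  qed
next
  assume f: "smooth_map S M (fst \<circ> f) \<and> smooth_map S N (snd \<circ> f)"
  show "smooth_map S (product_manifold M N) f"
    unfolding smooth_map_def
  proof (intro conjI ballI)
    show "continuous_map (mtop S) (mtop (product_manifold M N)) f"
      using f unfolding smooth_map_def by (simp add: continuous_map_pairwise)
    fix c d assume c: "c \<in> atlas S" and "d \<in> atlas (product_manifold M N)"
    then obtain d1 d2 where d: "d1 \<in> atlas M" "d2 \<in> atlas N" "d = prod_chart d1 d2" by auto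
    note F1 = smooth_map_local_rep[OF S M conjunct1[OF f] c d(1)]
    note F2 = smooth_map_local_rep[OF S N conjunct2[OF f] c d(2)]
    have sub: "snd c ` (fst c \<inter> f -` fst d) =
      snd c ` (fst c \<inter> (fst \<circ> f) -` fst d1) \<inter> snd c ` (fst c \<inter> (snd \<circ> f) -` fst d2)" (is "_ = ?A \<inter> ?B")
    proof -
      have inj: "inj_on (snd c) (fst c)" using S c unfolding smooth_atlas_def by blast
      have "?A \<inter> ?B = snd c ` ((fst c \<inter> (fst \<circ> f) -` fst d1) \<inter> (fst c \<inter> (snd \<circ> f) -` fst d2))"
        by (rule inj_on_image_Int[OF inj, symmetric]) auto
      moreover have "(fst c \<inter> (fst \<circ> f) -` fst d1) \<inter> (fst c \<inter> (snd \<circ> f) -` fst d2) = fst c \<inter> f -` fst d"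
        by (auto simp: d(3) mem_Times_iff)
      ultimately show ?thesis by simp
    qed
    have "smooth_on (?A \<inter> ?B) (\<lambda>x. (local_rep c d1 (fst \<circ> f) x, local_rep c d2 (snd \<circ> f) x))"
      by (intro smooth_intros open_Int F1(1) F2(1) smooth_on_subset[OF F1(2)] smooth_on_subset[OF F2(2)]) auto
    then show "smooth_on (snd c ` (fst c \<inter> f -` fst d)) (local_rep c d f)"
      unfolding sub unfolding d(3) local_rep_prod_chart[abs_def] .
  qed
qed

lemma tmap_prod_chart:
  assumes S: "smooth_atlas S" and M: "smooth_atlas M" and N: "smooth_atlas N"
    and f: "smooth_map S (product_manifold M N) f"
    and c: "c \<in> charts_at S p" and d: "d1 \<in> charts_at M (fst (f p))" "d2 \<in> charts_at N (snd (f p))"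
  shows "tmap c (prod_chart d1 d2) f p v = (tmap c d1 (fst \<circ> f) p v, tmap c d2 (snd \<circ> f) p v)"
proof -
  have f12: "smooth_map S M (fst \<circ> f)" "smooth_map S N (snd \<circ> f)" using f smooth_map_product[OF S M N] by auto
  have "((\<lambda>x. (local_rep c d1 (fst \<circ> f) x, local_rep c d2 (snd \<circ> f) x)) has_derivative
      (\<lambda>v. (tmap c d1 (fst \<circ> f) p v, tmap c d2 (snd \<circ> f) p v))) (at (snd c p))"
    using tmap_has_derivative[OF S M f12(1) c, of d1] tmap_has_derivative[OF S N f12(2) c, of d2] d
    by (intro has_derivative_Pair) auto
  then show ?thesis unfolding tmap_def[of c "prod_chart d1 d2"] local_rep_prod_chart[abs_def]
    by (simp add: frd_eq)
qed

lemma cinv_prod_chart: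
  assumes "smooth_atlas M" "smooth_atlas N" "d1 \<in> atlas M" "d2 \<in> atlas N"
    and "x \<in> snd d1 ` fst d1" "y \<in> snd d2 ` fst d2"
  shows "cinv (prod_chart d1 d2) (x, y) = (cinv d1 x, cinv d2 y)"
proof -
  have "inj_on (map_prod (snd d1) (snd d2)) (fst d1 \<times> fst d2)"
    using assms(1-4) unfolding smooth_atlas_def by (intro map_prod_inj_on) auto
  then have "inv_into (fst d1 \<times> fst d2) (map_prod (snd d1) (snd d2)) (map_prod (snd d1) (snd d2) (cinv d1 x, cinv d2 y))
      = (cinv d1 x, cinv d2 y)"
    by (rule inv_into_f_f) (use cinv_domain[OF assms(5)] cinv_domain[OF assms(6)] in auto)
  then show ?thesis by (simp add: cinv_def[of "prod_chart d1 d2"] chart_cinv assms)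
qed

lemma tmap_prod_chart_fst:
  assumes M: "smooth_atlas M" and N: "smooth_atlas N"
    and d: "d1 \<in> charts_at M (fst q)" "d2 \<in> charts_at N (snd q)" and e: "e \<in> charts_at M (fst q)"
  shows "tmap (prod_chart d1 d2) e fst q v = tmap d1 e id (fst q) (fst v)"
proof -
  note dD = charts_atD[OF d(1)] charts_atD[OF d(2)]
  have A: "open (snd d1 ` fst d1 \<times> snd d2 ` fst d2)"
    using chart_range_open[OF M dD(1)] chart_range_open[OF N dD(3)] by (rule open_Times)
  have "(local_rep d1 e id has_derivative tmap d1 e id (fst q)) (at (snd d1 (fst q)))"
    using tmap_has_derivative[OF M M smooth_map_id[OF M] d(1), of e] e by simp
  then have "((\<lambda>x. local_rep d1 e id (fst x)) has_derivative (\<lambda>v. tmap d1 e id (fst q) (fst v)))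
      (at (snd d1 (fst q), snd d2 (snd q)))"
    using has_derivative_compose[OF has_derivative_fst[OF has_derivative_ident],
        of "local_rep d1 e id" "tmap d1 e id (fst q)" "(snd d1 (fst q), snd d2 (snd q))" UNIV]
    unfolding fst_conv by blast
  then have "(local_rep (prod_chart d1 d2) e fst has_derivative (\<lambda>v. tmap d1 e id (fst q) (fst v)))
      (at (snd d1 (fst q), snd d2 (snd q)))"
    by (rule has_derivative_transform_within_open[OF _ A])
      (use dD in \<open>auto simp: local_rep_def cinv_prod_chart[OF M N dD(1,3)] cinv_chart[OF M dD(1)]\<close>)
  then show ?thesis by (cases q) (simp add: tmap_def[of "prod_chart d1 d2"] frd_eq)
qed

lemma tmap_prod_chart_snd:
  assumes M: "smooth_atlas M" and N: "smooth_atlas N"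
    and d: "d1 \<in> charts_at M (fst q)" "d2 \<in> charts_at N (snd q)" and e: "e \<in> charts_at N (snd q)"
  shows "tmap (prod_chart d1 d2) e snd q v = tmap d2 e id (snd q) (snd v)"
proof -
  note dD = charts_atD[OF d(1)] charts_atD[OF d(2)]
  have A: "open (snd d1 ` fst d1 \<times> snd d2 ` fst d2)"
    using chart_range_open[OF M dD(1)] chart_range_open[OF N dD(3)] by (rule open_Times)
  have "(local_rep d2 e id has_derivative tmap d2 e id (snd q)) (at (snd d2 (snd q)))"
    using tmap_has_derivative[OF N N smooth_map_id[OF N] d(2), of e] e by simp
  then have "((\<lambda>x. local_rep d2 e id (snd x)) has_derivative (\<lambda>v. tmap d2 e id (snd q) (snd v)))
      (at (snd d1 (fst q), snd d2 (snd q)))"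
    using has_derivative_compose[OF has_derivative_snd[OF has_derivative_ident],
        of "local_rep d2 e id" "tmap d2 e id (snd q)" "(snd d1 (fst q), snd d2 (snd q))" UNIV]
    unfolding snd_conv by blast
  then have "(local_rep (prod_chart d1 d2) e snd has_derivative (\<lambda>v. tmap d2 e id (snd q) (snd v)))
      (at (snd d1 (fst q), snd d2 (snd q)))"
    by (rule has_derivative_transform_within_open[OF _ A])
      (use dD in \<open>auto simp: local_rep_def cinv_prod_chart[OF M N dD(1,3)] cinv_chart[OF N dD(3)]\<close>)
  then show ?thesis by (cases q) (simp add: tmap_def[of "prod_chart d1 d2"] frd_eq)
qed

section \<open>Smooth fields of bilinear forms\<close>

lemma bilinear_expansion:
  fixes B :: "'e::euclidean_space \<Rightarrow> 'e \<Rightarrow> real"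
  assumes "bilinear B"
  shows "B v w = (\<Sum>i\<in>Basis. \<Sum>j\<in>Basis. (v \<bullet> i) * (w \<bullet> j) * B i j)"
proof -
  have l: "linear (\<lambda>v. B v w)" "linear (B v)" for v w using assms unfolding bilinear_def by auto
  have "B v w = (\<Sum>i\<in>Basis. (v \<bullet> i) * B i w)"
    using linear_basis_expansion[OF l(1), of v] by simp
  also have "\<dots> = (\<Sum>i\<in>Basis. (v \<bullet> i) * (\<Sum>j\<in>Basis. (w \<bullet> j) * B i j))"
  proof -
    have "B i w = (\<Sum>j\<in>Basis. (w \<bullet> j) * B i j)" for i
      using linear_basis_expansion[OF l(2)[of i], of w] by simp
    then show ?thesis by simp
  qed
  finally show ?thesis by (simp add: sum_distrib_left mult.assoc)
qed

text \<open>The picture of a covariant 2-tensor in a single chart. It takes the analysis of metrics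
  and connections from the manifold to an open set of a vector space.\<close>

locale smooth_bilinear_field =
  fixes U :: "'e::euclidean_space set" and G :: "'e \<Rightarrow> 'e \<Rightarrow> 'e \<Rightarrow> real"
  assumes open_U: "open U"
    and smooth_G: "smooth_on U (\<lambda>x. G x v w)"
    and bilinear_G: "x \<in> U \<Longrightarrow> bilinear (G x)"
begin

definition dG :: "'e \<Rightarrow> 'e \<Rightarrow> 'e \<Rightarrow> 'e \<Rightarrow> real" where
  "dG x u v w = frd (\<lambda>x. G x v w) x u"

lemmas G_simps = bilinear_ladd[OF bilinear_G] bilinear_radd[OF bilinear_G] bilinear_lmul[OF bilinear_G]
  bilinear_rmul[OF bilinear_G] bilinear_lzero[OF bilinear_G] bilinear_rzero[OF bilinear_G]
  bilinear_lsub[OF bilinear_G] bilinear_rsub[OF bilinear_G]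

lemma G_has_derivative: "x \<in> U \<Longrightarrow> ((\<lambda>x. G x v w) has_derivative (\<lambda>u. dG x u v w)) (at x)"
  using smooth_on_has_derivative[OF smooth_G open_U, of x v w] by (simp add: dG_def)

text \<open>Smoothness is known for fixed arguments only. The expansion in a basis reduces varying
  arguments to the coefficients \<open>G x i j\<close>.\<close>

lemma smooth_field:
  assumes "open Z" "smooth_on Z a" "smooth_on Z X" "smooth_on Z Y" "a ` Z \<subseteq> U"
  shows "smooth_on Z (\<lambda>z. G (a z) (X z) (Y z))"
proof (rule iffD2[OF smooth_on_cong[OF assms(1)]])
  show "G (a z) (X z) (Y z) = (\<Sum>i\<in>Basis. \<Sum>j\<in>Basis. (X z \<bullet> i) * (Y z \<bullet> j) * G (a z) i j)" if "z \<in> Z" for z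
    by (rule bilinear_expansion[OF bilinear_G]) (use assms(5) that in auto)
  show "smooth_on Z (\<lambda>z. \<Sum>i\<in>Basis. \<Sum>j\<in>Basis. (X z \<bullet> i) * (Y z \<bullet> j) * G (a z) i j)"
    by (intro smooth_intros assms(1-4) smooth_on_compose[OF smooth_G assms(1) open_U assms(2) assms(5)])
qed

lemma dG_bilinear: "x \<in> U \<Longrightarrow> bilinear (dG x u)"
proof -
  assume x: "x \<in> U"
  have d: "frd (\<lambda>x. G x v w) x = D" if "((\<lambda>x. G x v w) has_derivative D) (at x)" for v w D
    by (rule frd_eq[OF that])
  have a: "frd f x = frd h x" if "\<And>y. y \<in> U \<Longrightarrow> f y = h y" for f h :: "'e \<Rightarrow> real"
    by (rule frd_cong[OF open_U x that])
  note H = G_has_derivative[OF x]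
  have "dG x u (v + v') w = dG x u v w + dG x u v' w" for v v' w
    unfolding dG_def[of x u "v + v'"] by (subst a[of _ "\<lambda>y. G y v w + G y v' w"])
      (simp_all add: G_simps frd_eq[OF has_derivative_add[OF H H]])
  moreover have "dG x u v (w + w') = dG x u v w + dG x u v w'" for v w w'
    unfolding dG_def[of x u _ "w + w'"] by (subst a[of _ "\<lambda>y. G y v w + G y v w'"])
      (simp_all add: G_simps frd_eq[OF has_derivative_add[OF H H]])
  moreover have "dG x u (r *\<^sub>R v) w = r * dG x u v w" for r v w
    unfolding dG_def[of x u "r *\<^sub>R v"] by (subst a[of _ "\<lambda>y. r * G y v w"])
      (simp_all add: G_simps frd_eq[OF has_derivative_mult_right[OF H]])
  moreover have "dG x u v (r *\<^sub>R w) = r * dG x u v w" for r v w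
    unfolding dG_def[of x u _ "r *\<^sub>R w"] by (subst a[of _ "\<lambda>y. r * G y v w"])
      (simp_all add: G_simps frd_eq[OF has_derivative_mult_right[OF H]])
  ultimately show ?thesis by (auto simp: bilinear_def intro!: linearI)
qed

lemma dG_linear: "x \<in> U \<Longrightarrow> linear (\<lambda>u. dG x u v w)"
  using has_derivative_linear[OF G_has_derivative] .

lemma dG_field: "smooth_bilinear_field U (\<lambda>x. dG x u)"
  by unfold_locales (auto intro: open_U dG_bilinear smooth_on_frd smooth_G simp: dG_def)

lemma smooth_dG:
  assumes "open Z" "smooth_on Z a" "smooth_on Z u" "smooth_on Z X" "smooth_on Z Y" "a ` Z \<subseteq> U"
  shows "smooth_on Z (\<lambda>z. dG (a z) (u z) (X z) (Y z))"
proof (rule iffD2[OF smooth_on_cong[OF assms(1)]])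
  show "dG (a z) (u z) (X z) (Y z) = (\<Sum>k\<in>Basis. (u z \<bullet> k) * dG (a z) k (X z) (Y z))" if "z \<in> Z" for z
    using linear_basis_expansion[OF dG_linear, of "a z" "u z" "X z" "Y z"] assms(6) that by auto
  show "smooth_on Z (\<lambda>z. \<Sum>k\<in>Basis. (u z \<bullet> k) * dG (a z) k (X z) (Y z))"
    by (intro smooth_intros assms(1-5) smooth_bilinear_field.smooth_field[OF dG_field assms(1,2,4,5,6)])
qed

lemma field_has_derivative:
  assumes Z: "open Z" "z \<in> Z" "a ` Z \<subseteq> U"
    and d: "(a has_derivative a') (at z)" "(X has_derivative X') (at z)" "(Y has_derivative Y') (at z)"
  shows "((\<lambda>z. G (a z) (X z) (Y z)) has_derivative
    (\<lambda>e. dG (a z) (a' e) (X z) (Y z) + G (a z) (X' e) (Y z) + G (a z) (X z) (Y' e))) (at z)"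
proof -
  have z: "a z \<in> U" using Z by auto
  have Gd: "((\<lambda>z. G (a z) i j) has_derivative (\<lambda>e. dG (a z) (a' e) i j)) (at z)" for i j
    by (rule has_derivative_compose[OF d(1) G_has_derivative[OF z]])
  note e = bilinear_expansion[OF bilinear_G[OF z]] bilinear_expansion[OF dG_bilinear[OF z]]
  have "((\<lambda>z. \<Sum>i\<in>Basis. \<Sum>j\<in>Basis. (X z \<bullet> i) * (Y z \<bullet> j) * G (a z) i j) has_derivative
    (\<lambda>e. \<Sum>i\<in>Basis. \<Sum>j\<in>Basis. (X z \<bullet> i) * (Y z \<bullet> j) * dG (a z) (a' e) i j
       + ((X z \<bullet> i) * (Y' e \<bullet> j) + (X' e \<bullet> i) * (Y z \<bullet> j)) * G (a z) i j)) (at z)"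
    by (intro has_derivative_sum has_derivative_mult has_derivative_inner_left d Gd)
  also have "(\<lambda>e. \<Sum>i\<in>Basis. \<Sum>j\<in>Basis. (X z \<bullet> i) * (Y z \<bullet> j) * dG (a z) (a' e) i j
       + ((X z \<bullet> i) * (Y' e \<bullet> j) + (X' e \<bullet> i) * (Y z \<bullet> j)) * G (a z) i j)
    = (\<lambda>e. dG (a z) (a' e) (X z) (Y z) + G (a z) (X' e) (Y z) + G (a z) (X z) (Y' e))"
    by (rule ext, subst e(2), subst (1 2) e(1)) (simp add: sum.distrib algebra_simps)
  finally show ?thesis
    by (rule has_derivative_transform_within_open[OF _ Z(1,2)])
      (use Z(3) in \<open>auto intro!: bilinear_expansion[OF bilinear_G, symmetric]\<close>)
qed

end

section \<open>The Levi-Civita connection in coordinates\<close>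

locale smooth_metric_field = smooth_bilinear_field +
  assumes sym_G: "x \<in> U \<Longrightarrow> G x v w = G x w v"
    and nondegenerate_G: "x \<in> U \<Longrightarrow> (\<And>w. G x v w = 0) \<Longrightarrow> v = 0"

text \<open>\<open>L\<close> is the map from vectors to covectors given by \<open>B\<close>, with
  covectors written as vectors by means of the basis. Nondegeneracy makes it injective, and equality
  of dimensions makes it surjective.\<close>

lemma nondegenerate_bilinear_represents:
  fixes B :: "'e::euclidean_space \<Rightarrow> 'e \<Rightarrow> real"
  assumes B: "bilinear B" and nd: "\<And>v. (\<And>w. B v w = 0) \<Longrightarrow> v = 0" and l: "linear l"
  shows "\<exists>!v. \<forall>w. B v w = l w"
proof -
  define L where "L v = (\<Sum>b\<in>Basis. B v b *\<^sub>R b)" for v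
  have lin: "linear L"
    unfolding L_def by (rule linearI)
      (simp_all add: bilinear_ladd[OF B] bilinear_lmul[OF B] scaleR_left_distrib sum.distrib scaleR_sum_right)
  have Lb: "L v \<bullet> b = B v b" if "b \<in> Basis" for v b
    unfolding L_def using that by simp
  have Bw: "B v w = (\<Sum>b\<in>Basis. (w \<bullet> b) * B v b)" for v w
    using linear_basis_expansion[of "B v" w] B unfolding bilinear_def by simp
  have "inj L"
  proof (rule iffD2[OF linear_injective_0[OF lin]], intro allI impI)
    fix v assume "L v = 0"
    then have "B v b = 0" if "b \<in> Basis" for b using Lb[OF that, of v] by simp
    then have "B v w = 0" for w using Bw[of v w] by simp
    then show "v = 0" by (rule nd)
  qed
  then have "surj L" using linear_injective_imp_surjective[OF lin] by blast
  then obtain v where v: "L v = (\<Sum>b\<in>Basis. l b *\<^sub>R b)" by (metis surjD)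
  have "B v b = l b" if "b \<in> Basis" for b using Lb[OF that, of v] that by (simp add: v)
  then have ex: "B v w = l w" for w
    using Bw[of v w] linear_basis_expansion[OF l, of w] by simp
  show ?thesis
  proof (rule ex1I[of _ v])
    show "\<forall>w. B v w = l w" using ex by simp
    fix v' assume "\<forall>w. B v' w = l w"
    then have "B (v' - v) w = 0" for w using ex by (simp add: bilinear_lsub[OF B])
    then show "v' = v" using nd[of "v' - v"] by simp
  qed
qed

context smooth_metric_field
begin

definition Chr :: "'a \<Rightarrow> 'a \<Rightarrow> 'a \<Rightarrow> 'a" where
  "Chr x v w = (THE z. \<forall>u. 2 * G x z u = dG x v w u + dG x w v u - dG x u v w)"

lemma represents: "x \<in> U \<Longrightarrow> linear l \<Longrightarrow> \<exists>!v. \<forall>w. G x v w = l w"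
  by (rule nondegenerate_bilinear_represents[OF bilinear_G nondegenerate_G])

lemma eqI: "x \<in> U \<Longrightarrow> (\<And>u. G x v u = G x w u) \<Longrightarrow> v = w"
  using nondegenerate_G[of x "v - w"] by (simp add: G_simps)

text \<open>Half of the right-hand side is a linear form in \<open>u\<close>, hence represented by
  exactly one vector.\<close>

lemma Chr_ex1:
  assumes x: "x \<in> U"
  shows "\<exists>!z. \<forall>u. 2 * G x z u = dG x v w u + dG x w v u - dG x u v w"
proof -
  have "linear (\<lambda>u. (dG x v w u + dG x w v u - dG x u v w) / 2)"
    using dG_linear[OF x, of v w] bilinear_radd[OF dG_bilinear[OF x]] bilinear_rmul[OF dG_bilinear[OF x]]
      linear_add[OF dG_linear[OF x]] linear_scale[OF dG_linear[OF x]]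
    by (intro linearI) (simp_all add: algebra_simps add_divide_distrib diff_divide_distrib)
  from represents[OF x this] show ?thesis by (simp add: field_simps)
qed

lemma koszul: "x \<in> U \<Longrightarrow> 2 * G x (Chr x v w) u = dG x v w u + dG x w v u - dG x u v w"
  unfolding Chr_def by (rule theI'[OF Chr_ex1, THEN spec])

lemma Chr_unique:
  assumes x: "x \<in> U" and z: "\<And>u. 2 * G x z u = dG x v w u + dG x w v u - dG x u v w"
  shows "Chr x v w = z"
proof (rule eqI[OF x])
  fix u show "G x (Chr x v w) u = G x z u" using koszul[OF x, of v w u] z[of u] by linarith
qed

lemma Chr_scale:
  assumes x: "x \<in> U"
  shows "Chr x (r *\<^sub>R v) (r' *\<^sub>R w) = (r * r') *\<^sub>R Chr x v w"
proof (rule Chr_unique[OF x])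
  fix u
  have "2 * G x ((r * r') *\<^sub>R Chr x v w) u = (r * r') * (2 * G x (Chr x v w) u)" by (simp add: G_simps x)
  also have "\<dots> = (r * r') * (dG x v w u + dG x w v u - dG x u v w)" by (simp only: koszul[OF x])
  also have "\<dots> = dG x (r *\<^sub>R v) (r' *\<^sub>R w) u + dG x (r' *\<^sub>R w) (r *\<^sub>R v) u - dG x u (r *\<^sub>R v) (r' *\<^sub>R w)"
    by (simp add: x bilinear_lmul[OF dG_bilinear[OF x]] bilinear_rmul[OF dG_bilinear[OF x]]
        linear_scale[OF dG_linear[OF x]] algebra_simps)
  finally show "2 * G x ((r * r') *\<^sub>R Chr x v w) u =
    dG x (r *\<^sub>R v) (r' *\<^sub>R w) u + dG x (r' *\<^sub>R w) (r *\<^sub>R v) u - dG x u (r *\<^sub>R v) (r' *\<^sub>R w)" .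
qed

text \<open>The coordinate form of \<open>\<partial>\<^sub>1 <f\<^sub>2, f\<^sub>2> = 2
  \<partial>\<^sub>2 <f\<^sub>1, f\<^sub>2> - 2 <f\<^sub>1, D\<^sub>2 f\<^sub>2>\<close>, where the
  indices are derivatives in the directions \<open>e1\<close> and \<open>e2\<close>. It combines the
  symmetry of second derivatives with the Koszul formula. Only the last term involves the
  connection, so the identity can be solved for it.\<close>

lemma first_variation:
  fixes f :: "'z::euclidean_space \<Rightarrow> 'a"
  assumes f: "smooth_on Z f" "open Z" "f ` Z \<subseteq> U" "z \<in> Z"
  shows "frd (\<lambda>z. G (f z) (frd f z e2) (frd f z e2)) z e1 =
    2 * frd (\<lambda>z. G (f z) (frd f z e1) (frd f z e2)) z e2
    - 2 * G (f z) (frd f z e1) (frd (\<lambda>z. frd f z e2) z e2 + Chr (f z) (frd f z e2) (frd f z e2))"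
proof -
  let ?f1 = "\<lambda>z. frd f z e1" and ?f2 = "\<lambda>z. frd f z e2"
  have z: "f z \<in> U" using f by auto
  note d = smooth_on_has_derivative[OF f(1,2,4)]
  note d1 = smooth_on_has_derivative[OF smooth_on_frd[OF f(1), of e1] f(2,4)]
  note d2 = smooth_on_has_derivative[OF smooth_on_frd[OF f(1), of e2] f(2,4)]
  have "frd (\<lambda>z. G (f z) (?f2 z) (?f2 z)) z e1 = dG (f z) (?f1 z) (?f2 z) (?f2 z) + 2 * G (f z) (frd ?f2 z e1) (?f2 z)"
    by (simp add: frd_eq[OF field_has_derivative[OF f(2,4,3) d d2 d2]] sym_G[OF z, of "?f2 z" "frd ?f2 z e1"])
  moreover have "frd (\<lambda>z. G (f z) (?f1 z) (?f2 z)) z e2 =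
      dG (f z) (?f2 z) (?f1 z) (?f2 z) + G (f z) (frd ?f2 z e1) (?f2 z) + G (f z) (?f1 z) (frd ?f2 z e2)"
    by (simp add: frd_eq[OF field_has_derivative[OF f(2,4,3) d d1 d2]] frd_symmetric[OF f(1,2,4), of e1 e2])
  moreover have "2 * G (f z) (?f1 z) (Chr (f z) (?f2 z) (?f2 z)) =
      2 * dG (f z) (?f2 z) (?f1 z) (?f2 z) - dG (f z) (?f1 z) (?f2 z) (?f2 z)"
  proof -
    have "dG (f z) (?f2 z) (?f2 z) (?f1 z) = dG (f z) (?f2 z) (?f1 z) (?f2 z)"
      unfolding dG_def by (rule fun_cong[OF frd_cong[OF open_U z]], rule sym_G)
    then show ?thesis
      using koszul[OF z, of "?f2 z" "?f2 z" "?f1 z"] sym_G[OF z, of "?f1 z"] by simp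
  qed
  ultimately show ?thesis by (simp add: G_simps z algebra_simps)
qed

end

section \<open>Curves on surfaces\<close>

lemma smooth_map_curve:
  assumes "smooth_atlas M" "open I" "smooth_map (open_region I) M \<gamma>" "c \<in> atlas M"
  defines "J \<equiv> I \<inter> \<gamma> -` fst c"
  shows "open J" "smooth_on J (\<lambda>s. snd c (\<gamma> s))" "smooth_on J (velocity c \<gamma>)"
    "s \<in> J \<Longrightarrow> ((\<lambda>s. snd c (\<gamma> s)) has_vector_derivative velocity c \<gamma> s) (at s)"
    "s \<in> J \<Longrightarrow> velocity c \<gamma> s = tmap (I, id) c \<gamma> s 1"
    "s \<in> J \<Longrightarrow> tmap (I, id) c \<gamma> s r = r *\<^sub>R velocity c \<gamma> s"
    "(\<lambda>s. snd c (\<gamma> s)) ` J \<subseteq> snd c ` fst c"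
proof -
  note A = smooth_map_open_region[OF assms(2,1,3,4), folded J_def]
  show "open J" "smooth_on J (\<lambda>s. snd c (\<gamma> s))" by (fact A)+
  show "smooth_on J (velocity c \<gamma>)"
    using smooth_on_vector_derivative(1)[OF A(2,1)] unfolding velocity_def[abs_def] .
  show "s \<in> J \<Longrightarrow> ((\<lambda>s. snd c (\<gamma> s)) has_vector_derivative velocity c \<gamma> s) (at s)"
    using smooth_on_vector_derivative(2)[OF A(2,1)] unfolding velocity_def .
  show r: "s \<in> J \<Longrightarrow> tmap (I, id) c \<gamma> s r = r *\<^sub>R velocity c \<gamma> s" for r
    unfolding velocity_def using tmap_open_region[OF assms(2), of s c \<gamma>] smooth_on_vector_derivative(4)[OF A(2,1)]
    by (auto simp: J_def)
  then show "s \<in> J \<Longrightarrow> velocity c \<gamma> s = tmap (I, id) c \<gamma> s 1" using r[of 1] by simp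
  show "(\<lambda>s. snd c (\<gamma> s)) ` J \<subseteq> snd c ` fst c" unfolding J_def by auto
qed

lemma velocity_change:
  assumes M: "smooth_atlas M" and I: "open I" and \<gamma>: "smooth_map (open_region I) M \<gamma>"
    and s: "s \<in> I" and c: "c \<in> charts_at M (\<gamma> s)" "d \<in> charts_at M (\<gamma> s)"
  shows "velocity d \<gamma> s = tmap c d id (\<gamma> s) (velocity c \<gamma> s)"
proof -
  have "(I, id) \<in> charts_at (open_region I) s" using s by (simp add: charts_at_open_region)
  from tmap_change_target[OF smooth_atlas_open_region[OF I] M \<gamma> this c, of 1]
  show ?thesis
    using smooth_map_curve(5)[OF M I \<gamma> charts_atD(1)[OF c(1)], of s]
      smooth_map_curve(5)[OF M I \<gamma> charts_atD(1)[OF c(2)], of s] charts_atD(2)[OF c(1)] charts_atD(2)[OF c(2)] s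
    by simp
qed

text \<open>With the coefficients \<open>E\<close>, \<open>F\<close>, \<open>G\<close> of the form,
  the rotation by a right angle is \<open>(- (F v\<^sub>1 + G v\<^sub>2), E v\<^sub>1 + F v\<^sub>2)
  / sqrt (E G - F\<^sup>2)\<close>. In contrast to the description in \<open>rotation\<close>, the
  formula shows smooth dependence on the form.\<close>

definition plane_rotation :: "(real \<times> real \<Rightarrow> real \<times> real \<Rightarrow> real) \<Rightarrow> real \<times> real \<Rightarrow> real \<times> real" where
  "plane_rotation B v = (inverse (sqrt (B (1,0) (1,0) * B (0,1) (0,1) - (B (1,0) (0,1))\<^sup>2))) *\<^sub>R
     (- (B (1,0) (0,1) * fst v + B (0,1) (0,1) * snd v), B (1,0) (1,0) * fst v + B (1,0) (0,1) * snd v)"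

locale plane_inner =
  fixes B :: "real \<times> real \<Rightarrow> real \<times> real \<Rightarrow> real"
  assumes bilin: "bilinear B" and sym: "B v w = B w v" and pos: "v \<noteq> 0 \<Longrightarrow> B v v > 0"
begin

abbreviation "R \<equiv> plane_rotation B"

definition "dt = B (1,0) (1,0) * B (0,1) (0,1) - (B (1,0) (0,1))\<^sup>2"

lemma coords: "B v w = fst v * fst w * B (1,0) (1,0) + (fst v * snd w + snd v * fst w) * B (1,0) (0,1)
    + snd v * snd w * B (0,1) (0,1)"
proof -
  have l: "linear (\<lambda>v. B v w)" "linear (B v)" for v w
    using bilin[unfolded bilinear_def, THEN conjunct2, rule_format] bilin[unfolded bilinear_def, THEN conjunct1, rule_format] .
  show ?thesis
    by (subst linear_plane[OF l(1)], subst (1 2) linear_plane[OF l(2)])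
      (simp add: sym[of "(0,1)" "(1,0)"] algebra_simps)
qed

lemma dt_pos: "dt > 0"
proof -
  let ?E = "B (1,0) (1,0)" and ?F = "B (1,0) (0,1)" and ?G = "B (0,1) (0,1)"
  have E: "?E > 0" by (rule pos) (simp add: zero_prod_def)
  \<comment> \<open>The vector \<open>(-F, E)\<close> is orthogonal to the first basis vector, and
    its square is \<open>E (E G - F\<^sup>2)\<close>.\<close>
  have "B (- ?F, ?E) (- ?F, ?E) > 0" using E by (intro pos) (simp add: zero_prod_def)
  then have "?E * dt > 0" by (subst (asm) coords) (simp add: dt_def power2_eq_square algebra_simps)
  then show ?thesis using E by (simp add: zero_less_mult_iff)
qed

lemma R_coords: "R v = (inverse (sqrt dt)) *\<^sub>R (- (B (1,0) (0,1) * fst v + B (0,1) (0,1) * snd v),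
    B (1,0) (1,0) * fst v + B (1,0) (0,1) * snd v)"
  by (simp add: plane_rotation_def dt_def)

lemma B_R: "B v (R w) = sqrt dt * signed_area w v"
proof -
  have "B v (R w) = inverse (sqrt dt) * (dt * signed_area w v)"
    by (subst coords) (simp add: R_coords dt_def signed_area_def power2_eq_square algebra_simps)
  also have "\<dots> = sqrt dt * signed_area w v"
    using dt_pos by (simp add: field_simps)
  finally show ?thesis .
qed

lemma signed_area_R: "signed_area v (R v) = B v v / sqrt dt"
  by (subst coords) (simp add: R_coords signed_area_def divide_inverse algebra_simps)

lemma B_v_R: "B v (R v) = 0" by (simp add: B_R signed_area_def)

lemma B_R_R: "B (R v) (R v) = B v v"
  using dt_pos by (simp add: B_R signed_area_R)

lemma R_scale: "R (r *\<^sub>R v) = r *\<^sub>R R v"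
  by (simp add: R_coords algebra_simps)

lemma R_zero: "R 0 = 0" using R_scale[of 0] by simp

lemma decompose:
  assumes "v \<noteq> 0"
  shows "a = (B a v / B v v) *\<^sub>R v + (B a (R v) / B v v) *\<^sub>R R v"
proof -
  define z where "z = a - ((B a v / B v v) *\<^sub>R v + (B a (R v) / B v v) *\<^sub>R R v)"
  have p: "B v v > 0" by (rule pos[OF assms])
  note bl = bilinear_ladd[OF bilin] bilinear_lsub[OF bilin] bilinear_lmul[OF bilin]
    bilinear_radd[OF bilin] bilinear_rsub[OF bilin] bilinear_rmul[OF bilin]
  have 1: "B z v = 0" using p by (simp add: z_def bl sym[of "R v" v] B_v_R)
  have 2: "B z (R v) = 0" using p by (simp add: z_def bl B_v_R B_R_R)
  \<comment> \<open>The remainder \<open>z\<close> is orthogonal to \<open>v\<close> and to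
    \<open>R v\<close>. By Cramer's rule \<open>S z\<close> is a combination of these two, so
    \<open>z\<close> is orthogonal to itself.\<close>
  define S where "S = signed_area v (R v)"
  have S: "S \<noteq> 0" using p dt_pos by (simp add: S_def signed_area_R)
  have "S *\<^sub>R z = signed_area z (R v) *\<^sub>R v + signed_area v z *\<^sub>R R v"
    by (simp add: S_def signed_area_def prod_eq_iff algebra_simps)
  then have "B z (S *\<^sub>R z) = B z (signed_area z (R v) *\<^sub>R v + signed_area v z *\<^sub>R R v)" by (rule arg_cong)
  also have "\<dots> = 0" by (simp add: bl 1 2)
  finally have "B z z = 0" using S by (simp add: bl)
  then have "z = 0" using pos[of z] by linarith
  then show ?thesis by (simp add: z_def)
qed

text \<open>Orthogonality puts \<open>w\<close> on the line of \<open>R v\<close>, equality of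
  lengths makes the factor 1 or -1, and the orientation selects 1. This resolves the description in
  \<open>rotation\<close>.\<close>

lemma R_unique:
  assumes "B v w = 0" "B w w = B v v" "signed_area v w \<ge> 0"
  shows "w = R v"
proof (cases "v = 0")
  case True
  then have "B w w = 0" using assms(2) bilinear_lzero[OF bilin] by simp
  then have "w = 0" using pos[of w] by fastforce
  then show ?thesis using True R_zero by simp
next
  case False
  note p = pos[OF False]
  define l where "l = B w (R v) / B v v"
  have w: "w = l *\<^sub>R R v"
    using decompose[OF False, of w] assms(1) sym[of w v] by (simp add: l_def)
  have "B w w = l * l * B v v" by (subst (1 2) w) (simp add: bilinear_lmul[OF bilin] bilinear_rmul[OF bilin] B_R_R)
  then have "l * l = 1" using assms(2) p by simp
  moreover have "l \<ge> 0"
  proof -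
    have "signed_area v w = l * signed_area v (R v)" by (subst w) (simp add: signed_area_def algebra_simps)
    moreover have "signed_area v (R v) > 0" using p dt_pos by (simp add: signed_area_R)
    ultimately show ?thesis using assms(3) by (simp add: zero_le_mult_iff)
  qed
  ultimately have "l = 1" using square_eq_1_iff[of l] by auto
  then show ?thesis using w by simp
qed

lemma B_nonneg: "B v v \<ge> 0"
proof (cases "v = 0")
  case True
  then show ?thesis using bilinear_lzero[OF bilin, of v] by simp
next
  case False
  then show ?thesis using pos[of v] by simp
qed

lemma signed_area_R_nonneg: "signed_area v (R v) \<ge> 0"
  unfolding signed_area_R by (intro divide_nonneg_nonneg B_nonneg) (simp add: less_imp_le[OF dt_pos])

lemma R_the: "(THE w. B v w = 0 \<and> B w w = B v v \<and> signed_area v w \<ge> 0) = R v"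
proof (rule the_equality)
  show "B v (R v) = 0 \<and> B (R v) (R v) = B v v \<and> 0 \<le> signed_area v (R v)"
    by (rule conjI[OF B_v_R conjI[OF B_R_R signed_area_R_nonneg]])
next
  fix w assume w: "B v w = 0 \<and> B w w = B v v \<and> 0 \<le> signed_area v w"
  show "w = R v"
    by (rule R_unique[OF conjunct1[OF w] conjunct1[OF conjunct2[OF w]] conjunct2[OF conjunct2[OF w]]])
qed

end

text \<open>An orientation-preserving isometry carries over the three properties that characterise
  the rotation.\<close>

lemma plane_rotation_transform:
  assumes B: "plane_inner B" and B': "plane_inner B'" and T: "linear T"
    and iso: "\<And>v w. B' (T v) (T w) = B v w" and or: "signed_area (T (1,0)) (T (0,1)) > 0"
  shows "plane_rotation B' (T v) = T (plane_rotation B v)"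
proof (rule plane_inner.R_unique[OF B', symmetric])
  interpret plane_inner B by fact
  show "B' (T v) (T (R v)) = 0" by (simp add: iso B_v_R)
  show "B' (T (R v)) (T (R v)) = B' (T v) (T v)" by (simp add: iso B_R_R)
  show "signed_area (T v) (T (R v)) \<ge> 0"
    by (subst linear_plane_signed_area[OF T]) (use or signed_area_R_nonneg[of v] in simp)
qed

lemma frd_along:
  assumes h: "smooth_on Z h" "open Z" "z \<in> Z" and p: "(p has_vector_derivative e) (at r)" "p r = z"
  shows "((\<lambda>r. h (p r)) has_vector_derivative frd h z e) (at r)"
proof -
  have "((\<lambda>r. h (p r)) has_derivative (\<lambda>t. frd h z (t *\<^sub>R e))) (at r)"
    by (rule has_derivative_compose[OF p(1)[unfolded has_vector_derivative_def]])
      (use smooth_on_has_derivative[OF h] p(2) in simp)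
  then show ?thesis
    unfolding has_vector_derivative_def using smooth_on_linear_frd[OF h] by (simp add: linear_scale)
qed

section \<open>Oriented Riemannian surfaces in charts\<close>

locale surface =
  fixes M :: "('a, real \<times> real) manifold" and g :: "('a, real \<times> real) tensor2"
  assumes surf: "oriented_riemannian_surface M g"
begin

lemma M: "smooth_atlas M"
  using surf smooth_manifold_smooth_atlas unfolding oriented_riemannian_surface_def by blast

lemma pseudo: "pseudo_riemannian_metric M g"
  using surf unfolding oriented_riemannian_surface_def riemannian_metric_def by simp

lemma metric_at:
  assumes c: "c \<in> charts_at M p"
  shows "bilinear (g c p)" "g c p v w = g c p w v" "v \<noteq> 0 \<Longrightarrow> g c p v v > 0"
    and "d \<in> charts_at M p \<Longrightarrow> g d p (tmap c d id p v) (tmap c d id p w) = g c p v w"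
    and "d \<in> charts_at M p \<Longrightarrow> signed_area (tmap c d id p (1, 0)) (tmap c d id p (0, 1)) > 0"
proof -
  note p = charts_at_topspace[OF M c]
  note A = pseudo[unfolded pseudo_riemannian_metric_def, THEN conjunct2, THEN conjunct1, THEN bspec, OF p, THEN bspec, OF c]
  show "bilinear (g c p)" by (rule conjunct1[OF A])
  show "g c p v w = g c p w v" by (rule conjunct1[OF conjunct2[OF A], rule_format])
  show "v \<noteq> 0 \<Longrightarrow> g c p v v > 0"
    by (rule surf[unfolded oriented_riemannian_surface_def, THEN conjunct2, THEN conjunct1,
          unfolded riemannian_metric_def, THEN conjunct2, rule_format, OF p c])
  show "g d p (tmap c d id p v) (tmap c d id p w) = g c p v w" if "d \<in> charts_at M p"
    by (rule conjunct2[OF conjunct2[OF A], rule_format, OF that, symmetric])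
  show "signed_area (tmap c d id p (1, 0)) (tmap c d id p (0, 1)) > 0" if "d \<in> charts_at M p"
    using surf p c that unfolding oriented_riemannian_surface_def by simp
qed

lemma inner: "c \<in> charts_at M p \<Longrightarrow> plane_inner (g c p)"
  using metric_at by unfold_locales

lemma linear_transition: "c \<in> charts_at M p \<Longrightarrow> d \<in> charts_at M p \<Longrightarrow> linear (tmap c d id p)"
  using tmap_linear[OF M M smooth_map_id[OF M]] by simp

lemma rotation_eq: "c \<in> charts_at M p \<Longrightarrow> rotation g c p v = plane_rotation (g c p) v"
  unfolding rotation_def by (rule plane_inner.R_the[OF inner])

lemma rotation_change:
  assumes c: "c \<in> charts_at M p" "d \<in> charts_at M p"
  shows "rotation g d p (tmap c d id p v) = tmap c d id p (rotation g c p v)"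
  unfolding rotation_eq[OF c(1)] rotation_eq[OF c(2)]
  by (rule plane_rotation_transform[OF inner[OF c(1)] inner[OF c(2)] linear_transition[OF c]])
    (simp_all add: metric_at(4,5)[OF c(1) c(2)])

abbreviation "Gc c \<equiv> \<lambda>x. g c (cinv c x)"

lemma field: "c \<in> atlas M \<Longrightarrow> smooth_metric_field (snd c ` fst c) (Gc c)"
proof unfold_locales
  assume c: "c \<in> atlas M"
  show "open (snd c ` fst c)" by (rule chart_range_open[OF M c])
  show "smooth_on (snd c ` fst c) (\<lambda>x. g c (cinv c x) v w)" for v w
    by (rule pseudo[unfolded pseudo_riemannian_metric_def, THEN conjunct1, rule_format, OF c])
  fix x assume x: "x \<in> snd c ` fst c"
  have cx: "c \<in> charts_at M (cinv c x)" using c cinv_domain[OF x] by (rule charts_atI)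
  show "bilinear (g c (cinv c x))" by (rule metric_at(1)[OF cx])
  show "g c (cinv c x) v w = g c (cinv c x) w v" for v w by (rule metric_at(2)[OF cx])
  show "v = 0" if "\<And>w. g c (cinv c x) v w = 0" for v
    using metric_at(3)[OF cx, of v] that[of v] by linarith
qed

abbreviation "Ch c \<equiv> smooth_metric_field.Chr (Gc c)"
abbreviation "dGc c \<equiv> smooth_bilinear_field.dG (Gc c)"

lemma christoffel_eq:
  assumes c: "c \<in> charts_at M p"
  shows "christoffel g c p v w = Ch c (snd c p) v w"
  unfolding christoffel_def smooth_metric_field.Chr_def[OF field[OF charts_atD(1)[OF c]]]
    smooth_bilinear_field.dG_def[OF smooth_metric_field.axioms(1)[OF field[OF charts_atD(1)[OF c]]]] metric_deriv_def
    cinv_chart[OF M charts_atD[OF c]] by (rule refl)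

lemma smooth_rotation_field:
  assumes "c \<in> atlas M" "open Z" "smooth_on Z a" "smooth_on Z X" "a ` Z \<subseteq> snd c ` fst c"
  shows "smooth_on Z (\<lambda>z. plane_rotation (Gc c (a z)) (X z))"
proof -
  interpret smooth_metric_field "snd c ` fst c" "Gc c" by (rule field[OF assms(1)])
  have s: "smooth_on Z (\<lambda>z. Gc c (a z) v w)" for v w
    by (rule smooth_field[OF assms(2,3) smooth_on_const smooth_on_const assms(5)])
  have p: "Gc c (a z) (1,0) (1,0) * Gc c (a z) (0,1) (0,1) - (Gc c (a z) (1,0) (0,1))\<^sup>2 > 0" if "z \<in> Z" for z
  proof -
    have "c \<in> charts_at M (cinv c (a z))" using assms(1,5) that by (auto intro!: charts_atI cinv_domain)
    from plane_inner.dt_pos[OF inner[OF this]] show ?thesis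
      unfolding plane_inner.dt_def[OF inner[OF \<open>c \<in> charts_at M (cinv c (a z))\<close>]] .
  qed
  show ?thesis unfolding plane_rotation_def
  proof (intro smooth_intros assms s p)
    fix z assume "z \<in> Z"
    from p[OF this] show "sqrt (Gc c (a z) (1,0) (1,0) * Gc c (a z) (0,1) (0,1) - (Gc c (a z) (1,0) (0,1))\<^sup>2) \<noteq> 0" by simp
  qed
qed

lemma acceleration_eq:
  assumes "c \<in> charts_at M (\<gamma> s)"
  shows "acceleration g c \<gamma> s = vector_derivative (velocity c \<gamma>) (at s) + Ch c (snd c (\<gamma> s)) (velocity c \<gamma> s) (velocity c \<gamma> s)"
  unfolding acceleration_def christoffel_eq[OF assms] ..

lemma Gc_at: "c \<in> charts_at M p \<Longrightarrow> Gc c (snd c p) = g c p"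
  using cinv_chart[OF M charts_atD] by simp

text \<open>The normal variation \<open>\<gamma> + r v\<close> in a chart: by the first variation identity \<open>g(v, D\<gamma>')\<close> is
  determined by quantities that do not depend on the chart.\<close>

lemma acceleration_change:
  assumes I: "open I" and \<gamma>: "smooth_map (open_region I) M \<gamma>" and s: "s \<in> I"
    and c: "c \<in> charts_at M (\<gamma> s)" "d \<in> charts_at M (\<gamma> s)"
  shows "acceleration g d \<gamma> s = tmap c d id (\<gamma> s) (acceleration g c \<gamma> s)"
proof -
  note cD = charts_atD[OF c(1)] note dD = charts_atD[OF c(2)]
  interpret C: smooth_metric_field "snd c ` fst c" "Gc c" by (rule field[OF cD(1)])
  interpret D: smooth_metric_field "snd d ` fst d" "Gc d" by (rule field[OF dD(1)])
  let ?x = "\<lambda>s. snd c (\<gamma> s)" and ?y = "\<lambda>s. snd d (\<gamma> s)" and ?tr = "local_rep c d id"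
  let ?U = "snd c ` (fst c \<inter> fst d)" and ?T = "tmap c d id (\<gamma> s)"
  note X = smooth_map_curve[OF M I \<gamma> cD(1)] note Y = smooth_map_curve[OF M I \<gamma> dD(1)]
  note tr = transition_smooth[OF M cD(1) dD(1)]
  define J where "J = (I \<inter> \<gamma> -` fst c) \<inter> (I \<inter> \<gamma> -` fst d)"
  have J: "open J" "s \<in> J" unfolding J_def using X(1) Y(1) s cD(2) dD(2) by auto
  have xJ: "smooth_on J ?x" by (rule smooth_on_subset[OF X(2)]) (auto simp: J_def)
  have bil: "bilinear (g d (\<gamma> s))" by (rule metric_at(1)[OF c(2)])
  have key: "g d (\<gamma> s) (?T v) (acceleration g d \<gamma> s) = g c (\<gamma> s) v (acceleration g c \<gamma> s)" for v
  proof -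
    define f where "f z = ?x (snd z) + fst z *\<^sub>R v" for z :: "real \<times> real"
    have sJ: "open (UNIV \<times> J :: (real \<times> real) set)" using J(1) by (intro open_Times) auto
    have f0: "smooth_on (UNIV \<times> J) f" unfolding f_def
      by (intro smooth_intros sJ smooth_on_compose[OF xJ sJ J(1)]) auto
    define Z where "Z = (UNIV \<times> J) \<inter> f -` ?U"
    have Z: "open Z" unfolding Z_def
      by (rule continuous_open_preimage[OF smooth_on_continuous[OF f0] sJ tr(1)])
    have f: "smooth_on Z f" by (rule smooth_on_subset[OF f0]) (auto simp: Z_def)
    have fU: "f ` Z \<subseteq> ?U" by (auto simp: Z_def)
    then have fc: "f ` Z \<subseteq> snd c ` fst c" by blast
    have line: "(0, r) \<in> Z" if "r \<in> J" for r
      using that by (auto simp: Z_def f_def J_def)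
    note z = line[OF J(2)]
    define h where "h z = ?tr (f z)" for z
    have h: "smooth_on Z h" unfolding h_def by (rule smooth_on_compose[OF tr(2) Z tr(1) f fU])
    have hd: "h ` Z \<subseteq> snd d ` fst d"
    proof -
      have "?tr ` ?U \<subseteq> snd d ` fst d" using cinv_chart[OF M cD(1)] by (auto simp: local_rep_def)
      then show ?thesis using fU unfolding h_def by blast
    qed
    \<comment> \<open>\<open>h\<close> is \<open>f\<close> followed by the transition map, and the
      transition map is an isometry between the two coordinate pictures of the metric. Hence all
      pulled-back coefficients of \<open>f\<close> and \<open>h\<close> coincide.\<close>
    have same: "Gc d (h y) (frd h y e) (frd h y e') = Gc c (f y) (frd f y e) (frd f y e')" if y: "y \<in> Z" for y e e'
    proof -
      obtain q where q: "q \<in> fst c" "q \<in> fst d" "f y = snd c q" using fU y by auto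
      have cq: "c \<in> charts_at M q" "d \<in> charts_at M q" using cD dD q by (auto intro: charts_atI)
      have hq: "h y = snd d q" using local_rep_chart[OF M cD(1) q(1), of d id] q by (simp add: h_def)
      have fr: "frd h y e = tmap c d id q (frd f y e)" for e
        unfolding h_def[abs_def] tmap_def q(3)[symmetric]
        by (rule frd_compose[OF f Z tr(2,1) y]) (use fU y in auto)
      show ?thesis
        unfolding fr q(3) hq Gc_at[OF cq(1)] Gc_at[OF cq(2)] by (rule metric_at(4)[OF cq])
    qed
    have d0: "((\<lambda>r. (0, r)) has_vector_derivative (0, 1)) (at r)" for r :: real
      by (auto intro!: derivative_eq_intros simp: has_vector_derivative_def)
    have d1: "((\<lambda>r. (r, s)) has_vector_derivative (1, 0)) (at 0)"
      by (auto intro!: derivative_eq_intros simp: has_vector_derivative_def)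
    have f2: "frd f (0, r) (0, 1) = velocity c \<gamma> r" if "r \<in> J" for r
      using vector_derivative_at[OF frd_along[OF f Z line[OF that] d0 refl]] unfolding f_def velocity_def by simp
    have f1: "frd f (0, s) (1, 0) = v"
    proof -
      have "((\<lambda>r. f (r, s)) has_vector_derivative v) (at 0)" unfolding f_def
        by (auto intro!: derivative_eq_intros simp: has_vector_derivative_def)
      then show ?thesis using vector_derivative_unique_at[OF frd_along[OF f Z z d1 refl]] by simp
    qed
    have hy: "h (0, r) = ?y r" if "r \<in> J" for r
      using local_rep_chart[OF M cD(1), of "\<gamma> r" d id] that by (simp add: h_def f_def J_def)
    have h2: "frd h (0, r) (0, 1) = velocity d \<gamma> r" if "r \<in> J" for r
    proof -
      have "((\<lambda>r. h (0, r)) has_vector_derivative velocity d \<gamma> r) (at r)"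
        by (rule has_vector_derivative_transform_within_open[OF Y(4) J(1) that]) (use that hy in \<open>auto simp: J_def\<close>)
      then show ?thesis using vector_derivative_unique_at[OF frd_along[OF h Z line[OF that] d0 refl]] by simp
    qed
    have h1: "frd h (0, s) (1, 0) = ?T v"
      using frd_compose[OF f Z tr(2,1) z, of "(1, 0)"] fU z f1 unfolding h_def[abs_def] tmap_def
      by (auto simp: f_def)
    have second: "frd (\<lambda>z. frd k z (0, 1)) (0, s) (0, 1) = vector_derivative u (at s)"
      if k: "smooth_on Z k" and ku: "\<And>r. r \<in> J \<Longrightarrow> frd k (0, r) (0, 1) = u r" for k :: "real \<times> real \<Rightarrow> real \<times> real" and u
    proof -
      have "((\<lambda>r. frd k (0, r) (0, 1)) has_vector_derivative frd (\<lambda>z. frd k z (0, 1)) (0, s) (0, 1)) (at s)"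
        by (rule frd_along[OF smooth_on_frd[OF k] Z z d0 refl])
      then have "(u has_vector_derivative frd (\<lambda>z. frd k z (0, 1)) (0, s) (0, 1)) (at s)"
        by (rule has_vector_derivative_transform_within_open[OF _ J]) (rule ku)
      then show ?thesis by (simp add: vector_derivative_at)
    qed
    have e1: "frd (\<lambda>z. Gc d (h z) (frd h z (0, 1)) (frd h z (0, 1))) (0, s) =
        frd (\<lambda>z. Gc c (f z) (frd f z (0, 1)) (frd f z (0, 1))) (0, s)"
      by (rule frd_cong[OF Z z]) (rule same)
    have e2: "frd (\<lambda>z. Gc d (h z) (frd h z (1, 0)) (frd h z (0, 1))) (0, s) =
        frd (\<lambda>z. Gc c (f z) (frd f z (1, 0)) (frd f z (0, 1))) (0, s)"
      by (rule frd_cong[OF Z z]) (rule same)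
    have f0s: "f (0, s) = snd c (\<gamma> s)" by (simp add: f_def)
    note CV = C.first_variation[OF f Z fc z, of "(0, 1)" "(1, 0)"]
    note DV = D.first_variation[OF h Z hd z, of "(0, 1)" "(1, 0)"]
    have "Gc d (h (0, s)) (frd h (0, s) (1, 0)) (frd (\<lambda>z. frd h z (0, 1)) (0, s) (0, 1) + Ch d (h (0, s)) (frd h (0, s) (0, 1)) (frd h (0, s) (0, 1)))
        = Gc c (f (0, s)) (frd f (0, s) (1, 0)) (frd (\<lambda>z. frd f z (0, 1)) (0, s) (0, 1) + Ch c (f (0, s)) (frd f (0, s) (0, 1)) (frd f (0, s) (0, 1)))"
      using CV DV unfolding e1 e2 by linarith
    moreover have sf: "frd (\<lambda>z. frd f z (0, 1)) (0, s) (0, 1) = vector_derivative (velocity c \<gamma>) (at s)"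
      by (rule second[OF f f2])
    moreover have sh: "frd (\<lambda>z. frd h z (0, 1)) (0, s) (0, 1) = vector_derivative (velocity d \<gamma>) (at s)"
      by (rule second[OF h h2])
    ultimately show ?thesis
      unfolding acceleration_eq[of c \<gamma> s, OF c(1)] acceleration_eq[of d \<gamma> s, OF c(2)] hy[OF J(2)] f0s f1 h1 f2[OF J(2)] h2[OF J(2)]
        Gc_at[OF c(1)] Gc_at[OF c(2)] by simp
  qed
  have "g d (\<gamma> s) (acceleration g d \<gamma> s) u = g d (\<gamma> s) (?T (acceleration g c \<gamma> s)) u" for u
  proof -
    \<comment> \<open>\<open>key\<close> tests only vectors of the form \<open>?T v\<close>; the
      transition is invertible, so these are all vectors.\<close>
    let ?v = "tmap d c id (\<gamma> s) u"
    have "?T ?v = u" by (rule tmap_transition_inverse[OF M c(2,1)])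
    then show ?thesis
      using key[of ?v] metric_at(4)[OF c, of ?v "acceleration g c \<gamma> s"] metric_at(2)[OF c(2), of u] by simp
  qed
  then show ?thesis using D.eqI[of "snd d (\<gamma> s)"] dD(2) unfolding Gc_at[OF c(2)] by blast
qed

section \<open>Speed and curvature of a regular curve\<close>

definition sp :: "(real \<Rightarrow> 'a) \<Rightarrow> real \<Rightarrow> real" where
  "sp \<gamma> s = (let c = chart_at M (\<gamma> s) in sqrt (g c (\<gamma> s) (velocity c \<gamma> s) (velocity c \<gamma> s)))"

text \<open>The signed curvature in an arbitrary regular parameter,
  \<open><D \<gamma>', j \<gamma>'> / \<bar>\<gamma>'\<bar>\<^sup>3\<close>. For unit speed it
  agrees with \<open>signed_curvature\<close>.\<close>

definition kv :: "(real \<Rightarrow> 'a) \<Rightarrow> real \<Rightarrow> real" where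
  "kv \<gamma> s = (let c = chart_at M (\<gamma> s) in
     g c (\<gamma> s) (acceleration g c \<gamma> s) (rotation g c (\<gamma> s) (velocity c \<gamma> s)) / sp \<gamma> s ^ 3)"

context
  fixes I \<gamma>
  assumes reg: "regular_curve M I \<gamma>"
begin

lemma curve_open: "open I" and curve_interval: "is_interval I" "I \<noteq> {}"
  and curve_smooth: "smooth_map (open_region I) M \<gamma>"
  using reg unfolding regular_curve_def open_interval_def by auto

lemma curve_in: "s \<in> I \<Longrightarrow> \<gamma> s \<in> topspace (mtop M)"
  using smooth_map_topspace[OF curve_smooth] by simp

lemma curve_chart: "s \<in> I \<Longrightarrow> chart_at M (\<gamma> s) \<in> charts_at M (\<gamma> s)"
  by (rule chart_at_charts_at[OF M curve_in])

lemma velocity_nz: "s \<in> I \<Longrightarrow> c \<in> charts_at M (\<gamma> s) \<Longrightarrow> velocity c \<gamma> s \<noteq> 0"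
  using reg unfolding regular_curve_def by blast

lemma sp_sq:
  assumes s: "s \<in> I" and c: "c \<in> charts_at M (\<gamma> s)"
  shows "g c (\<gamma> s) (velocity c \<gamma> s) (velocity c \<gamma> s) = (sp \<gamma> s)\<^sup>2"
proof -
  let ?d = "chart_at M (\<gamma> s)"
  note d = curve_chart[OF s]
  have "g c (\<gamma> s) (velocity c \<gamma> s) (velocity c \<gamma> s) = g ?d (\<gamma> s) (velocity ?d \<gamma> s) (velocity ?d \<gamma> s)"
    unfolding velocity_change[OF M curve_open curve_smooth s d c] by (rule metric_at(4)[OF d c])
  then show ?thesis
    using metric_at(3)[OF d velocity_nz[OF s d]] by (simp add: sp_def Let_def)
qed

lemma sp_pos: "s \<in> I \<Longrightarrow> sp \<gamma> s > 0"
  unfolding sp_def Let_def using metric_at(3)[OF curve_chart velocity_nz[OF _ curve_chart]] by simp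

lemma kv_eq:
  assumes s: "s \<in> I" and c: "c \<in> charts_at M (\<gamma> s)"
  shows "g c (\<gamma> s) (acceleration g c \<gamma> s) (rotation g c (\<gamma> s) (velocity c \<gamma> s)) = kv \<gamma> s * sp \<gamma> s ^ 3"
proof -
  let ?d = "chart_at M (\<gamma> s)"
  note d = curve_chart[OF s]
  have "g c (\<gamma> s) (acceleration g c \<gamma> s) (rotation g c (\<gamma> s) (velocity c \<gamma> s)) =
    g ?d (\<gamma> s) (acceleration g ?d \<gamma> s) (rotation g ?d (\<gamma> s) (velocity ?d \<gamma> s))"
    unfolding velocity_change[OF M curve_open curve_smooth s d c] acceleration_change[OF curve_open curve_smooth s d c]
      rotation_change[OF d c] by (rule metric_at(4)[OF d c])
  then show ?thesis using sp_pos[OF s] by (simp add: kv_def Let_def)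
qed

lemma acceleration_decompose:
  assumes s: "s \<in> I" and c: "c \<in> charts_at M (\<gamma> s)"
  shows "acceleration g c \<gamma> s =
    (g c (\<gamma> s) (acceleration g c \<gamma> s) (velocity c \<gamma> s) / (sp \<gamma> s)\<^sup>2) *\<^sub>R velocity c \<gamma> s
    + (kv \<gamma> s * sp \<gamma> s) *\<^sub>R rotation g c (\<gamma> s) (velocity c \<gamma> s)"
proof -
  have "kv \<gamma> s * sp \<gamma> s ^ 3 / (sp \<gamma> s)\<^sup>2 = kv \<gamma> s * sp \<gamma> s"
    using sp_pos[OF s] by (simp add: power2_eq_square power3_eq_cube)
  then show ?thesis
    using plane_inner.decompose[OF inner[OF c] velocity_nz[OF s c], of "acceleration g c \<gamma> s"]
    unfolding sp_sq[OF s c] rotation_eq[OF c, symmetric] kv_eq[OF s c] by simp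
qed

lemma smooth_in_chart:
  assumes c: "c \<in> atlas M"
  defines "J \<equiv> I \<inter> \<gamma> -` fst c"
  shows "smooth_on J (sp \<gamma>)" "smooth_on J (kv \<gamma>)"
    "\<And>s. s \<in> J \<Longrightarrow> ((\<lambda>s. (sp \<gamma> s)\<^sup>2) has_real_derivative 2 * g c (\<gamma> s) (acceleration g c \<gamma> s) (velocity c \<gamma> s)) (at s)"
proof -
  interpret smooth_metric_field "snd c ` fst c" "Gc c" by (rule field[OF c])
  note X = smooth_map_curve[OF M curve_open curve_smooth c, folded J_def]
  let ?x = "\<lambda>s. snd c (\<gamma> s)" and ?v = "velocity c \<gamma>"
  let ?R = "\<lambda>s. plane_rotation (Gc c (?x s)) (?v s)"
  have cs: "c \<in> charts_at M (\<gamma> s)" "s \<in> I" if "s \<in> J" for s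
    using that c by (auto simp: J_def intro: charts_atI)
  have R: "smooth_on J ?R" by (rule smooth_rotation_field[OF c X(1,2,3,7)])
  have a: "smooth_on J (\<lambda>s. vector_derivative ?v (at s))" by (rule smooth_on_vector_derivative(1)[OF X(3,1)])
  have sq: "(sp \<gamma> s)\<^sup>2 = Gc c (?x s) (?v s) (?v s)" if "s \<in> J" for s
    unfolding Gc_at[OF cs(1)[OF that]] by (rule sp_sq[OF cs(2,1)[OF that], symmetric])
  have sq_smooth: "smooth_on J (\<lambda>s. Gc c (?x s) (?v s) (?v s))" by (rule smooth_field[OF X(1,2,3,3,7)])
  have "smooth_on J (\<lambda>s. sqrt (Gc c (?x s) (?v s) (?v s)))"
    by (intro smooth_intros X(1) sq_smooth) (use sq sp_pos[OF cs(2)] in \<open>fastforce simp flip: sq\<close>)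
  then show sps: "smooth_on J (sp \<gamma>)"
    by (rule iffD1[OF smooth_on_cong[OF X(1)], rotated]) (use sp_pos[OF cs(2)] in \<open>simp add: less_imp_le flip: sq\<close>)
  have xin: "?x s \<in> snd c ` fst c" if "s \<in> J" for s using X(7) that by auto
  \<comment> \<open>By the Koszul formula, pairing with the acceleration involves only derivatives
    of the metric coefficients. Smoothness of \<open>kv\<close> follows without a solved formula for
    the Christoffel map.\<close>
  have acc: "Gc c (?x s) (acceleration g c \<gamma> s) u =
      Gc c (?x s) (vector_derivative ?v (at s)) u + (dGc c (?x s) (?v s) (?v s) u - dGc c (?x s) u (?v s) (?v s) / 2)"
    if "s \<in> J" for s u
    unfolding acceleration_eq[of c \<gamma> s, OF cs(1)[OF that]] bilinear_ladd[OF bilinear_G[OF xin[OF that]]]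
    using koszul[OF xin[OF that], of "?v s" "?v s" u] by simp
  have "smooth_on J (\<lambda>s. (Gc c (?x s) (vector_derivative ?v (at s)) (?R s) +
      (dGc c (?x s) (?v s) (?v s) (?R s) - dGc c (?x s) (?R s) (?v s) (?v s) / 2)) / sp \<gamma> s ^ 3)"
    by (intro smooth_intros X(1) sps smooth_field[OF X(1,2) a R X(7)] smooth_dG[OF X(1,2) X(3) X(3) R X(7)]
        smooth_dG[OF X(1,2) R X(3) X(3) X(7)]) (use sp_pos[OF cs(2)] in force)+
  then show "smooth_on J (kv \<gamma>)"
  proof (rule iffD1[OF smooth_on_cong[OF X(1)], rotated])
    fix s assume s: "s \<in> J"
    show "(Gc c (?x s) (vector_derivative ?v (at s)) (?R s) +
      (dGc c (?x s) (?v s) (?v s) (?R s) - dGc c (?x s) (?R s) (?v s) (?v s) / 2)) / sp \<gamma> s ^ 3 = kv \<gamma> s"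
      unfolding acc[OF s, symmetric] unfolding Gc_at[OF cs(1)[OF s]] rotation_eq[OF cs(1)[OF s], symmetric]
        kv_eq[OF cs(2,1)[OF s]] using sp_pos[OF cs(2)[OF s]] by simp
  qed
  fix s assume s: "s \<in> J"
  have dv: "(?v has_derivative (\<lambda>t. t *\<^sub>R vector_derivative ?v (at s))) (at s)"
    using smooth_on_vector_derivative(2)[OF X(3,1) s] unfolding has_vector_derivative_def .
  have "((\<lambda>s. Gc c (?x s) (?v s) (?v s)) has_derivative (\<lambda>e. dGc c (?x s) (e *\<^sub>R ?v s) (?v s) (?v s) +
      Gc c (?x s) (e *\<^sub>R vector_derivative ?v (at s)) (?v s) + Gc c (?x s) (?v s) (e *\<^sub>R vector_derivative ?v (at s)))) (at s)"
    by (rule field_has_derivative[OF X(1) s X(7) X(4)[OF s, unfolded has_vector_derivative_def] dv dv])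
  also have "(\<lambda>e. dGc c (?x s) (e *\<^sub>R ?v s) (?v s) (?v s) +
      Gc c (?x s) (e *\<^sub>R vector_derivative ?v (at s)) (?v s) + Gc c (?x s) (?v s) (e *\<^sub>R vector_derivative ?v (at s)))
    = (*) (2 * Gc c (?x s) (acceleration g c \<gamma> s) (?v s))"
    unfolding acc[OF s]
    using linear_scale[OF dG_linear[OF xin[OF s]]] bilinear_lmul[OF bilinear_G[OF xin[OF s]]]
      bilinear_rmul[OF bilinear_G[OF xin[OF s]]] sym_G[OF xin[OF s], of "?v s"]
    by (simp add: fun_eq_iff algebra_simps)
  finally have "((\<lambda>s. Gc c (?x s) (?v s) (?v s)) has_real_derivative 2 * Gc c (?x s) (acceleration g c \<gamma> s) (?v s)) (at s)"
    unfolding has_field_derivative_def .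
  then show "((\<lambda>s. (sp \<gamma> s)\<^sup>2) has_real_derivative 2 * g c (\<gamma> s) (acceleration g c \<gamma> s) (velocity c \<gamma> s)) (at s)"
    unfolding Gc_at[OF cs(1)[OF s]]
    by (rule has_field_derivative_transform_within_open[OF _ X(1) s]) (simp add: sq)
qed

lemma sp_smooth: "smooth_on I (sp \<gamma>)" and kv_smooth: "smooth_on I (kv \<gamma>)"
proof -
  have loc: "\<exists>U. open U \<and> s \<in> U \<and> smooth_on U (sp \<gamma>) \<and> smooth_on U (kv \<gamma>)" if "s \<in> I" for s
  proof -
    note c = curve_chart[OF that]
    show ?thesis
      using smooth_in_chart(1,2)[OF charts_atD(1)[OF c]] that charts_atD(2)[OF c]
        smooth_map_curve(1)[OF M curve_open curve_smooth charts_atD(1)[OF c]]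
      by (intro exI[of _ "I \<inter> \<gamma> -` fst (chart_at M (\<gamma> s))"]) simp
  qed
  show "smooth_on I (sp \<gamma>)" "smooth_on I (kv \<gamma>)"
    by (rule smooth_on_local, use loc in blast)+
qed

end

end

section \<open>Calculus on open intervals\<close>

lemma smooth_on_deriv:
  fixes f :: "real \<Rightarrow> real"
  assumes "smooth_on X f" "open X"
  shows "s \<in> X \<Longrightarrow> (f has_real_derivative deriv f s) (at s)" "smooth_on X (deriv f)"
proof -
  have e: "(f has_real_derivative frd f s 1) (at s)" if "s \<in> X" for s
    using smooth_on_vector_derivative(2,3)[OF assms that] by (simp add: has_real_derivative_iff_has_vector_derivative)
  then show "s \<in> X \<Longrightarrow> (f has_real_derivative deriv f s) (at s)" using DERIV_imp_deriv by metis
  show "smooth_on X (deriv f)"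
    by (rule iffD2[OF smooth_on_cong[OF assms(2)] smooth_on_frd[OF assms(1), of 1]]) (rule DERIV_imp_deriv[OF e])
qed

text \<open>\<open>L\<close> is the signed integral from a base point \<open>s0\<close>. The
  fundamental theorem is available on compact intervals, hence the detour over one that contains
  both \<open>s0\<close> and a neighbourhood of the point in question.\<close>

lemma open_interval_antiderivative:
  fixes a :: "real \<Rightarrow> real"
  assumes I: "open_interval I" and a: "continuous_on I a"
  obtains L where "\<And>s. s \<in> I \<Longrightarrow> (L has_real_derivative a s) (at s)"
proof -
  have "I \<noteq> {}" "open I" and conv: "is_interval I" using I by (auto simp: open_interval_def)
  then obtain s0 where s0: "s0 \<in> I" by auto
  define L where "L s = (if s0 \<le> s then integral {s0..s} a else - integral {s..s0} a)" for s
  have "(L has_real_derivative a s) (at s)" if s: "s \<in> I" for s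
  proof -
    obtain e1 where e1: "e1 > 0" "cball s e1 \<subseteq> I" using \<open>open I\<close> s by (auto simp: open_contains_cball)
    \<comment> \<open>On \<open>{p..q}\<close> the two cases in the definition of \<open>L\<close>
      merge: \<open>L r\<close> is the integral from \<open>p\<close> to \<open>r\<close> minus a
      constant.\<close>
    define p where "p = min (s - e1) s0"
    define q where "q = max (s + e1) s0"
    have "s - e1 \<in> cball s e1" "s + e1 \<in> cball s e1" using e1(1) by (simp_all add: dist_real_def)
    then have e1I: "s - e1 \<in> I" "s + e1 \<in> I" using e1(2) by blast+
    have pq: "p \<in> I" "q \<in> I" "p < s" "s < q" "p \<le> s0" "s0 \<le> q"
      using e1I e1(1) s0 by (simp_all add: p_def q_def min_def max_def)
    have sub: "{p..q} \<subseteq> I" 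
    proof
      fix z assume "z \<in> {p..q}"
      then show "z \<in> I" using conv[unfolded is_interval_1, rule_format, OF pq(1,2), of z] by simp
    qed
    have cont: "continuous_on {p..q} a" by (rule continuous_on_subset[OF a sub])
    have int: "a integrable_on {x..y}" if "p \<le> x" "y \<le> q" for x y
      by (rule integrable_continuous_interval[OF continuous_on_subset[OF cont]]) (use that in auto)
    have L: "L r = integral {p..r} a - integral {p..s0} a" if "r \<in> {p..q}" for r
    proof (cases "s0 \<le> r")
      case True
      have "integral {p..s0} a + integral {s0..r} a = integral {p..r} a"
        by (rule Henstock_Kurzweil_Integration.integral_combine) (use True that pq in \<open>auto intro!: int\<close>)
      then show ?thesis using True by (simp add: L_def)
    next
      case False
      have "integral {p..r} a + integral {r..s0} a = integral {p..s0} a"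
        by (rule Henstock_Kurzweil_Integration.integral_combine) (use False that pq in \<open>auto intro!: int\<close>)
      then show ?thesis using False by (simp add: L_def)
    qed
    have "((\<lambda>r. integral {p..r} a) has_vector_derivative a s) (at s within {p..q})"
      by (rule integral_has_vector_derivative[OF cont]) (use pq in auto)
    then have "((\<lambda>r. integral {p..r} a) has_real_derivative a s) (at s)"
      unfolding has_real_derivative_iff_has_vector_derivative at_within_Icc_at[OF pq(3,4)] .
    then have "((\<lambda>r. integral {p..r} a - integral {p..s0} a) has_real_derivative a s) (at s)"
      using DERIV_diff[OF _ DERIV_const, of "\<lambda>r. integral {p..r} a" "a s" s UNIV "integral {p..s0} a"] by simp
    then show ?thesis
      by (rule has_field_derivative_transform_within_open[where S = "{p<..<q}"]) (use pq L in simp_all)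
  qed
  then show thesis by (rule that)
qed

lemma strict_mono_on_interval:
  fixes L :: "real \<Rightarrow> real"
  assumes "is_interval I" and d: "\<And>s. s \<in> I \<Longrightarrow> (L has_real_derivative a s) (at s)" "\<And>s. s \<in> I \<Longrightarrow> a s > 0"
    and "x \<in> I" "y \<in> I" "x < y"
  shows "L x < L y"
proof (rule DERIV_pos_imp_increasing[OF \<open>x < y\<close>])
  fix z assume "x \<le> z" "z \<le> y"
  then have "z \<in> I" using assms(1,4,5) unfolding is_interval_1 by blast
  then show "\<exists>l. DERIV L z :> l \<and> 0 < l" using d by blast
qed

lemma constant_derivative_on_interval:
  fixes f :: "real \<Rightarrow> real"
  assumes I: "open_interval I" and d: "\<And>s. s \<in> I \<Longrightarrow> (f has_real_derivative l) (at s)"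
  obtains m where "\<And>s. s \<in> I \<Longrightarrow> f s = l * s + m"
proof -
  have "convex I" using I by (simp add: open_interval_def is_interval_convex_1)
  have "\<exists>c. \<forall>s\<in>I. f s - l * s = c"
  proof (rule has_field_derivative_zero_constant[OF \<open>convex I\<close>])
    fix s assume "s \<in> I"
    have "((\<lambda>s. f s - l * s) has_real_derivative l - l * 1) (at s)"
      by (intro DERIV_diff d \<open>s \<in> I\<close> DERIV_cmult DERIV_ident)
    then show "((\<lambda>s. f s - l * s) has_real_derivative 0) (at s within I)"
      by (simp add: has_field_derivative_at_within)
  qed
  then obtain m where "\<forall>s\<in>I. f s - l * s = m" by blast
  then show thesis using that[of m] by (auto simp: algebra_simps)
qed

section \<open>Reparametrisation by arclength\<close>

context surface
begin

context
  fixes I I' \<gamma> \<sigma>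
  assumes reg: "regular_curve M I \<gamma>" and I': "open_interval I'" and \<sigma>: "smooth_on I' \<sigma>" "\<sigma> ` I' \<subseteq> I"
    and pos: "\<And>s. s \<in> I' \<Longrightarrow> deriv \<sigma> s > 0"
begin

lemma open_I': "open I'" using I' by (simp add: open_interval_def)

lemmas \<sigma>_deriv = smooth_on_deriv[OF \<sigma>(1) open_I']

lemma reparam_velocity:
  assumes s: "s \<in> I'" and c: "c \<in> charts_at M (\<gamma> (\<sigma> s))"
  shows "velocity c (\<gamma> \<circ> \<sigma>) s = deriv \<sigma> s *\<^sub>R velocity c \<gamma> (\<sigma> s)"
proof -
  have "\<sigma> s \<in> I \<inter> \<gamma> -` fst c" using s charts_atD(2)[OF c] \<sigma>(2) by auto
  note X = smooth_map_curve(4)[OF M curve_open[OF reg] curve_smooth[OF reg] charts_atD(1)[OF c] this]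
  show ?thesis
    using vector_diff_chain_at[OF \<sigma>_deriv(1)[OF s, unfolded has_real_derivative_iff_has_vector_derivative] X]
    unfolding velocity_def[of c "\<gamma> \<circ> \<sigma>"] by (simp add: o_def vector_derivative_at)
qed

lemma reparam_smooth: "smooth_map (open_region I') M (\<gamma> \<circ> \<sigma>)"
  by (rule smooth_map_compose[OF smooth_atlas_open_region[OF open_I'] smooth_atlas_open_region[OF curve_open[OF reg]] M
        _ curve_smooth[OF reg]])
    (use \<sigma> smooth_map_open_regions[OF open_I' curve_open[OF reg]] in simp)

lemma reparam_regular: "regular_curve M I' (\<gamma> \<circ> \<sigma>)"
  unfolding regular_curve_def
proof (intro conjI ballI I' reparam_smooth)
  fix s c assume s: "s \<in> I'" and c: "c \<in> charts_at M ((\<gamma> \<circ> \<sigma>) s)"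
  have "\<sigma> s \<in> I" using s \<sigma>(2) by auto
  then show "velocity c (\<gamma> \<circ> \<sigma>) s \<noteq> 0"
    using reparam_velocity[OF s] c pos[OF s] velocity_nz[OF reg] by simp
qed

text \<open>The Christoffel term is quadratic in the velocity and so scales like the second
  derivative of the curve, by the square of \<open>deriv \<sigma>\<close>. The second derivative of
  \<open>\<sigma>\<close> adds a tangential term only.\<close>

lemma reparam_acceleration:
  assumes s: "s \<in> I'" and c: "c \<in> charts_at M (\<gamma> (\<sigma> s))"
  shows "acceleration g c (\<gamma> \<circ> \<sigma>) s =
    (deriv \<sigma> s)\<^sup>2 *\<^sub>R acceleration g c \<gamma> (\<sigma> s) + deriv (deriv \<sigma>) s *\<^sub>R velocity c \<gamma> (\<sigma> s)"
proof -
  note cD = charts_atD[OF c]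
  interpret smooth_metric_field "snd c ` fst c" "Gc c" by (rule field[OF cD(1)])
  note X = smooth_map_curve[OF M curve_open[OF reg] curve_smooth[OF reg] cD(1)]
  define J where "J = I' \<inter> (\<gamma> \<circ> \<sigma>) -` fst c"
  have J: "open J" unfolding J_def by (rule smooth_map_curve(1)[OF M open_I' reparam_smooth cD(1)])
  have sJ: "s \<in> J" using s cD(2) by (simp add: J_def)
  have \<sigma>s: "\<sigma> s \<in> I \<inter> \<gamma> -` fst c" using s cD(2) \<sigma>(2) by auto
  have v: "(velocity c \<gamma> has_vector_derivative vector_derivative (velocity c \<gamma>) (at (\<sigma> s))) (at (\<sigma> s))"
    by (rule smooth_on_vector_derivative(2)[OF X(3,1) \<sigma>s])
  have "((\<lambda>r. deriv \<sigma> r *\<^sub>R velocity c \<gamma> (\<sigma> r)) has_vector_derivative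
      deriv \<sigma> s *\<^sub>R (deriv \<sigma> s *\<^sub>R vector_derivative (velocity c \<gamma>) (at (\<sigma> s)))
      + deriv (deriv \<sigma>) s *\<^sub>R velocity c \<gamma> (\<sigma> s)) (at s)"
    using vector_diff_chain_at[OF \<sigma>_deriv(1)[OF s, unfolded has_real_derivative_iff_has_vector_derivative] v]
    by (intro has_vector_derivative_scaleR smooth_on_deriv(1)[OF \<sigma>_deriv(2) open_I' s]) (simp add: o_def)
  then have "(velocity c (\<gamma> \<circ> \<sigma>) has_vector_derivative
      deriv \<sigma> s *\<^sub>R (deriv \<sigma> s *\<^sub>R vector_derivative (velocity c \<gamma>) (at (\<sigma> s)))
      + deriv (deriv \<sigma>) s *\<^sub>R velocity c \<gamma> (\<sigma> s)) (at s)"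
  proof (rule has_vector_derivative_transform_within_open[OF _ J sJ])
    fix r assume "r \<in> J"
    then have "r \<in> I'" "c \<in> charts_at M (\<gamma> (\<sigma> r))" using cD(1) by (auto simp: J_def charts_at_def)
    then show "deriv \<sigma> r *\<^sub>R velocity c \<gamma> (\<sigma> r) = velocity c (\<gamma> \<circ> \<sigma>) r" using reparam_velocity by simp
  qed
  note A = vector_derivative_at[OF this]
  have c': "c \<in> charts_at M ((\<gamma> \<circ> \<sigma>) s)" using c by simp
  have sc: "snd c (\<gamma> (\<sigma> s)) \<in> snd c ` fst c" using cD(2) by auto
  show ?thesis
    unfolding acceleration_eq[of c "\<gamma> \<circ> \<sigma>" s, OF c'] acceleration_eq[of c \<gamma> "\<sigma> s", OF c] A reparam_velocity[OF s c]
      o_apply Chr_scale[OF sc]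
    by (simp add: scaleR_right_distrib power2_eq_square)
qed

text \<open>In the curvature the tangential term of the acceleration pairs to zero with the rotated
  velocity. What remains carries the factor \<open>deriv \<sigma>\<close> three times, which the
  cube of the speed cancels.\<close>

lemma reparam_sp: "s \<in> I' \<Longrightarrow> sp (\<gamma> \<circ> \<sigma>) s = deriv \<sigma> s * sp \<gamma> (\<sigma> s)"
  and reparam_kv: "s \<in> I' \<Longrightarrow> kv (\<gamma> \<circ> \<sigma>) s = kv \<gamma> (\<sigma> s)"
proof -
  assume s: "s \<in> I'"
  then have \<sigma>s: "\<sigma> s \<in> I" using \<sigma>(2) by auto
  let ?c = "chart_at M (\<gamma> (\<sigma> s))"
  note c = curve_chart[OF reg \<sigma>s]
  have c': "?c \<in> charts_at M ((\<gamma> \<circ> \<sigma>) s)" using c by simp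
  let ?d = "deriv \<sigma> s"
  note v = reparam_velocity[OF s c] note a = reparam_acceleration[OF s c]
  note bl = bilinear_ladd[OF metric_at(1)[OF c]] bilinear_lmul[OF metric_at(1)[OF c]]
    bilinear_radd[OF metric_at(1)[OF c]] bilinear_rmul[OF metric_at(1)[OF c]]
  note p = sp_pos[OF reg \<sigma>s] sp_pos[OF reparam_regular s] pos[OF s]
  have "(sp (\<gamma> \<circ> \<sigma>) s)\<^sup>2 = (?d * sp \<gamma> (\<sigma> s))\<^sup>2"
    using sp_sq[where \<gamma> = "\<gamma> \<circ> \<sigma>", OF reparam_regular s c'] sp_sq[OF reg \<sigma>s c]
    by (simp add: v bl power2_eq_square mult_ac)
  then show sp: "sp (\<gamma> \<circ> \<sigma>) s = ?d * sp \<gamma> (\<sigma> s)"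
    using p by (simp add: power2_eq_iff_nonneg)
  interpret plane_inner "g ?c (\<gamma> (\<sigma> s))" by (rule inner[OF c])
  have "kv (\<gamma> \<circ> \<sigma>) s * sp (\<gamma> \<circ> \<sigma>) s ^ 3 = ?d ^ 3 * (kv \<gamma> (\<sigma> s) * sp \<gamma> (\<sigma> s) ^ 3)"
    unfolding kv_eq[where \<gamma> = "\<gamma> \<circ> \<sigma>", OF reparam_regular s c', symmetric] kv_eq[OF reg \<sigma>s c, symmetric]
    unfolding o_apply v a rotation_eq[OF c] R_scale bl B_v_R
    by (simp add: power2_eq_square power3_eq_cube)
  then have "kv (\<gamma> \<circ> \<sigma>) s * (?d * sp \<gamma> (\<sigma> s)) ^ 3 = kv \<gamma> (\<sigma> s) * (?d * sp \<gamma> (\<sigma> s)) ^ 3"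
    unfolding sp by (simp add: power_mult_distrib mult_ac)
  then show "kv (\<gamma> \<circ> \<sigma>) s = kv \<gamma> (\<sigma> s)" using p by simp
qed

end

text \<open>The square of the speed has twice the tangential pairing as its derivative, so constant
  speed leaves only the normal part of the acceleration.\<close>

lemma unit_speed:
  assumes reg: "regular_curve M I \<gamma>" and unit: "\<And>s. s \<in> I \<Longrightarrow> sp \<gamma> s = 1" and s: "s \<in> I" and c: "c \<in> charts_at M (\<gamma> s)"
  shows "acceleration g c \<gamma> s = kv \<gamma> s *\<^sub>R rotation g c (\<gamma> s) (velocity c \<gamma> s)"
proof -
  note cD = charts_atD[OF c]
  let ?J = "I \<inter> \<gamma> -` fst c"
  have J: "open ?J" "s \<in> ?J" using smooth_map_curve(1)[OF M curve_open[OF reg] curve_smooth[OF reg] cD(1)] s cD(2) by auto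
  have "((\<lambda>s. 1) has_real_derivative 2 * g c (\<gamma> s) (acceleration g c \<gamma> s) (velocity c \<gamma> s)) (at s)"
    by (rule has_field_derivative_transform_within_open[OF smooth_in_chart(3)[OF reg cD(1) J(2)] J]) (simp add: unit)
  then have "g c (\<gamma> s) (acceleration g c \<gamma> s) (velocity c \<gamma> s) = 0"
    using DERIV_unique[OF _ DERIV_const] by fastforce
  then show ?thesis using acceleration_decompose[OF reg s c] unit[OF s] by simp
qed

lemma unit_speed_signed_curvature:
  assumes reg: "regular_curve M I \<gamma>" and unit: "\<And>s. s \<in> I \<Longrightarrow> sp \<gamma> s = 1" and s: "s \<in> I"
  shows "signed_curvature M g \<gamma> s = kv \<gamma> s"
proof -
  let ?c = "chart_at M (\<gamma> s)"
  note c = curve_chart[OF reg s]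
  interpret plane_inner "g ?c (\<gamma> s)" by (rule inner[OF c])
  let ?r = "rotation g ?c (\<gamma> s) (velocity ?c \<gamma> s)"
  \<comment> \<open>The rotated velocity is nonzero, so the factor described in
    \<open>signed_curvature\<close> is unique.\<close>
  have "g ?c (\<gamma> s) ?r ?r > 0"
    unfolding rotation_eq[OF c] B_R_R by (rule metric_at(3)[OF c velocity_nz[OF reg s c]])
  then have r: "?r \<noteq> 0" using bilinear_lzero[OF metric_at(1)[OF c], of 0] by (intro notI) simp
  show ?thesis
    unfolding signed_curvature_def Let_def
    by (rule the_equality) (use unit_speed[where \<gamma> = \<gamma> and s = s and c = ?c, OF reg unit s c] r in auto)
qed

lemma arclength_facts:
  assumes reg: "regular_curve M I \<gamma>" and arc: "arclength_reparametrisation M g I \<gamma> I' \<sigma>"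
  shows "open_interval I'" "smooth_on I' \<sigma>" "\<sigma> ` I' = I" "\<And>s. s \<in> I' \<Longrightarrow> deriv \<sigma> s > 0"
    and "regular_curve M I' (\<gamma> \<circ> \<sigma>)" "\<And>s. s \<in> I' \<Longrightarrow> sp (\<gamma> \<circ> \<sigma>) s = 1"
    and "\<And>s. s \<in> I' \<Longrightarrow> kv (\<gamma> \<circ> \<sigma>) s = kv \<gamma> (\<sigma> s)" "\<And>s. s \<in> I' \<Longrightarrow> deriv \<sigma> s * sp \<gamma> (\<sigma> s) = 1"
proof -
  show A: "open_interval I'" "smooth_on I' \<sigma>" "\<sigma> ` I' = I" "\<And>s. s \<in> I' \<Longrightarrow> deriv \<sigma> s > 0"
    using arc unfolding arclength_reparametrisation_def bij_betw_def by auto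
  have B: "\<sigma> ` I' \<subseteq> I" using A(3) by simp
  show reg': "regular_curve M I' (\<gamma> \<circ> \<sigma>)" by (rule reparam_regular[OF reg A(1,2) B A(4)])
  show k: "kv (\<gamma> \<circ> \<sigma>) s = kv \<gamma> (\<sigma> s)" if "s \<in> I'" for s by (rule reparam_kv[OF reg A(1,2) B A(4) that])
  show u: "sp (\<gamma> \<circ> \<sigma>) s = 1" if "s \<in> I'" for s
  proof -
    have c: "chart_at M ((\<gamma> \<circ> \<sigma>) s) \<in> charts_at M ((\<gamma> \<circ> \<sigma>) s)" by (rule curve_chart[OF reg' that])
    have "(sp (\<gamma> \<circ> \<sigma>) s)\<^sup>2 = 1"
      using arc that c sp_sq[where \<gamma> = "\<gamma> \<circ> \<sigma>", OF reg' that c] unfolding arclength_reparametrisation_def by simp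
    then show ?thesis using sp_pos[OF reg' that] by (simp add: power2_eq_1_iff)
  qed
  show "deriv \<sigma> s * sp \<gamma> (\<sigma> s) = 1" if "s \<in> I'" for s
    using u[OF that] reparam_sp[OF reg A(1,2) B A(4) that] by simp
qed

text \<open>\<open>\<sigma>\<close> is the inverse of an antiderivative \<open>L\<close> of the
  speed. Its derivative is \<open>inverse (sp \<gamma> (\<sigma> r))\<close>, an equation to which
  \<open>smooth_on_bootstrap\<close> applies.\<close>

lemma arclength_exists:
  assumes reg: "regular_curve M I \<gamma>"
  obtains I' \<sigma> where "arclength_reparametrisation M g I \<gamma> I' \<sigma>"
proof -
  have I: "open_interval I" using reg by (simp add: regular_curve_def)
  note oI = curve_open[OF reg] note iI = curve_interval(1)[OF reg]
  obtain L where L: "\<And>s. s \<in> I \<Longrightarrow> (L has_real_derivative sp \<gamma> s) (at s)"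
    using open_interval_antiderivative[OF I smooth_on_continuous[OF sp_smooth[OF reg]]] by blast
  have mono: "L x < L y" if "x \<in> I" "y \<in> I" "x < y" for x y
    by (rule strict_mono_on_interval[OF iI L sp_pos[OF reg] that])
  have inj: "inj_on L I"
  proof (rule inj_onI)
    fix x y assume "x \<in> I" "y \<in> I" "L x = L y"
    then show "x = y" using mono[of x y] mono[of y x] by (cases x y rule: linorder_cases) auto
  qed
  have cont: "continuous_on I L"
    by (rule continuous_at_imp_continuous_on) (use L DERIV_isCont in auto)
  define I' where "I' = L ` I"
  define \<sigma> where "\<sigma> = inv_into I L"
  have \<sigma>L: "\<sigma> (L s) = s" if "s \<in> I" for s using inj that by (simp add: \<sigma>_def)
  have \<sigma>in: "\<sigma> r \<in> I" "L (\<sigma> r) = r" if "r \<in> I'" for r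
    using that by (auto simp: \<sigma>_def I'_def f_inv_into_f inv_into_into)
  have oI': "open I'" unfolding I'_def by (rule invariance_of_domain[OF cont oI inj])
  have "connected I'" unfolding I'_def
    by (rule connected_continuous_image[OF cont]) (use iI is_interval_connected_1 in blast)
  then have I': "open_interval I'"
    using oI' curve_interval(2)[OF reg] by (simp add: open_interval_def is_interval_connected_1 I'_def)
  have d: "(\<sigma> has_derivative (\<lambda>v. v * inverse (sp \<gamma> (\<sigma> r)))) (at r)" if r: "r \<in> I'" for r
  proof -
    have "(\<sigma> has_derivative (\<lambda>v. v * inverse (sp \<gamma> (\<sigma> r)))) (at (L (\<sigma> r)))"
    proof (rule has_derivative_inverse_on[OF oI, where f = L and f' = "\<lambda>s. (*) (sp \<gamma> s)" and g' = "\<lambda>s v. v * inverse (sp \<gamma> s)"])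
      show "(L has_derivative (*) (sp \<gamma> x)) (at x)" if "x \<in> I" for x
        using L[OF that] by (simp add: has_field_derivative_def)
      show "\<sigma> (L x) = x" if "x \<in> I" for x by (rule \<sigma>L[OF that])
      show "(*) (sp \<gamma> (\<sigma> r)) \<circ> (\<lambda>v. v * inverse (sp \<gamma> (\<sigma> r))) = id"
        using sp_pos[OF reg \<sigma>in(1)[OF r]] by (auto simp: fun_eq_iff)
      show "\<sigma> r \<in> I" by (rule \<sigma>in(1)[OF r])
    qed
    then show ?thesis using \<sigma>in(2)[OF r] by simp
  qed
  have sub: "\<sigma> ` I' \<subseteq> I" using \<sigma>in by auto
  have smooth: "smooth_on I' \<sigma>"
  proof (rule smooth_on_bootstrap[OF oI' oI sub d])
    show "smooth_on I (\<lambda>x. v * inverse (sp \<gamma> x))" for v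
      by (intro smooth_intros oI sp_smooth[OF reg]) (use sp_pos[OF reg] in force)
  qed
  have der: "deriv \<sigma> r = inverse (sp \<gamma> (\<sigma> r))" if "r \<in> I'" for r
    by (rule DERIV_imp_deriv) (use d[OF that] in \<open>simp add: has_field_derivative_def mult.commute[of _ "inverse _"]\<close>)
  have pos: "deriv \<sigma> r > 0" if "r \<in> I'" for r using der[OF that] sp_pos[OF reg \<sigma>in(1)[OF that]] by simp
  have bij: "bij_betw \<sigma> I' I"
    unfolding bij_betw_def
  proof
    show "inj_on \<sigma> I'" by (rule inj_on_inverseI[where g = L]) (rule \<sigma>in(2))
    have "I \<subseteq> \<sigma> ` I'"
    proof
      fix s assume s: "s \<in> I"
      then have "\<sigma> (L s) \<in> \<sigma> ` I'" by (auto simp: I'_def)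
      then show "s \<in> \<sigma> ` I'" using \<sigma>L[OF s] by simp
    qed
    then show "\<sigma> ` I' = I" using sub by blast
  qed
  have "g c (\<gamma> (\<sigma> s)) (velocity c (\<gamma> \<circ> \<sigma>) s) (velocity c (\<gamma> \<circ> \<sigma>) s) = 1"
    if s: "s \<in> I'" and c: "c \<in> charts_at M (\<gamma> (\<sigma> s))" for s c
  proof -
    have c': "c \<in> charts_at M ((\<gamma> \<circ> \<sigma>) s)" using c by simp
    have "sp (\<gamma> \<circ> \<sigma>) s = 1"
      using reparam_sp[OF reg I' smooth sub pos s] der[OF s] sp_pos[OF reg \<sigma>in(1)[OF s]] by simp
    then show ?thesis
      using sp_sq[where \<gamma> = "\<gamma> \<circ> \<sigma>", OF reparam_regular[OF reg I' smooth sub pos] s c'] by simp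
  qed
  then have "arclength_reparametrisation M g I \<gamma> I' \<sigma>"
    unfolding arclength_reparametrisation_def using I' bij smooth pos by blast
  then show thesis by (rule that)
qed

text \<open>After passing to arclength the acceleration is \<open>kv\<close> times the rotated
  velocity, and \<open>kv\<close> does not change under the reparametrisation.\<close>

lemma geodesic_curve_iff:
  "geodesic_curve M g I \<gamma> \<longleftrightarrow> regular_curve M I \<gamma> \<and> (\<forall>s\<in>I. kv \<gamma> s = 0)"
proof
  assume G: "geodesic_curve M g I \<gamma>"
  then have reg: "regular_curve M I \<gamma>" by (simp add: geodesic_curve_def)
  obtain I' \<sigma> where arc: "arclength_reparametrisation M g I \<gamma> I' \<sigma>" and geo: "affine_geodesic M g I' (\<gamma> \<circ> \<sigma>)"
    using G unfolding geodesic_curve_def by blast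
  note A = arclength_facts[OF reg arc]
  have "kv \<gamma> s = 0" if "s \<in> I" for s
  proof -
    obtain r where r: "r \<in> I'" "s = \<sigma> r" using \<open>s \<in> I\<close> unfolding A(3)[symmetric] by blast
    note c = curve_chart[OF A(5) r(1)]
    have "acceleration g (chart_at M ((\<gamma> \<circ> \<sigma>) r)) (\<gamma> \<circ> \<sigma>) r = 0"
      using geo r(1) c unfolding affine_geodesic_def by blast
    then have "kv (\<gamma> \<circ> \<sigma>) r = 0"
      using bilinear_lzero[OF metric_at(1)[OF c]] by (simp add: kv_def Let_def)
    then show ?thesis using A(7)[OF r(1)] r(2) by simp
  qed
  then show "regular_curve M I \<gamma> \<and> (\<forall>s\<in>I. kv \<gamma> s = 0)" using reg by simp
next
  assume R: "regular_curve M I \<gamma> \<and> (\<forall>s\<in>I. kv \<gamma> s = 0)"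
  then have reg: "regular_curve M I \<gamma>" by simp
  obtain I' \<sigma> where arc: "arclength_reparametrisation M g I \<gamma> I' \<sigma>" by (rule arclength_exists[OF reg])
  note A = arclength_facts[OF reg arc]
  have "acceleration g c (\<gamma> \<circ> \<sigma>) s = 0" if s: "s \<in> I'" and c: "c \<in> charts_at M ((\<gamma> \<circ> \<sigma>) s)" for s c
  proof -
    have "\<sigma> s \<in> I" using A(3) s by auto
    then have "kv (\<gamma> \<circ> \<sigma>) s = 0" using A(7)[OF s] R by simp
    then show ?thesis using unit_speed[where \<gamma> = "\<gamma> \<circ> \<sigma>", OF A(5,6) s c] by simp
  qed
  then have "affine_geodesic M g I' (\<gamma> \<circ> \<sigma>)"
    using A(1) curve_smooth[OF A(5)] unfolding affine_geodesic_def by blast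
  then show "geodesic_curve M g I \<gamma>" using reg arc unfolding geodesic_curve_def by blast
qed

text \<open>Linear growth of the curvature in arclength becomes a differential equation in the given
  parameter, because \<open>deriv \<sigma> s * sp \<gamma> (\<sigma> s) = 1\<close>. This is the
  form that the first variation produces.\<close>

lemma cornu_spiral_iff:
  "cornu_spiral M g I \<gamma> l \<longleftrightarrow>
    regular_curve M I \<gamma> \<and> (\<forall>s\<in>I. (kv \<gamma> has_real_derivative l * sp \<gamma> s) (at s))"
proof
  assume C: "cornu_spiral M g I \<gamma> l"
  then have reg: "regular_curve M I \<gamma>" by (simp add: cornu_spiral_def)
  obtain I' \<sigma> m where arc: "arclength_reparametrisation M g I \<gamma> I' \<sigma>"
    and lin: "\<forall>s\<in>I'. signed_curvature M g (\<gamma> \<circ> \<sigma>) s = l * s + m"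
    using C unfolding cornu_spiral_def by blast
  note A = arclength_facts[OF reg arc]
  have oI': "open I'" using A(1) by (simp add: open_interval_def)
  have k: "kv \<gamma> (\<sigma> s) = l * s + m" if "s \<in> I'" for s
    using lin that A(7)[OF that] unit_speed_signed_curvature[OF A(5,6) that] by simp
  have "(kv \<gamma> has_real_derivative l * sp \<gamma> s) (at s)" if s: "s \<in> I" for s
  proof -
    obtain r where r: "r \<in> I'" "s = \<sigma> r" using s unfolding A(3)[symmetric] by blast
    note d1 = smooth_on_deriv(1)[OF kv_smooth[OF reg] curve_open[OF reg] s]
    have "((\<lambda>r. kv \<gamma> (\<sigma> r)) has_real_derivative deriv (kv \<gamma>) s * deriv \<sigma> r) (at r)"
      using DERIV_chain2[OF d1[unfolded r(2)] smooth_on_deriv(1)[OF A(2) oI' r(1)]] by (simp add: r(2))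
    moreover have "((\<lambda>r. kv \<gamma> (\<sigma> r)) has_real_derivative l) (at r)"
    proof (rule has_field_derivative_transform_within_open[OF _ oI' r(1)])
      show "((\<lambda>r. l * r + m) has_real_derivative l) (at r)" by (auto intro!: derivative_eq_intros)
    qed (simp add: k)
    ultimately have "deriv (kv \<gamma>) s * deriv \<sigma> r = l" by (rule DERIV_unique)
    then have "deriv (kv \<gamma>) s * (deriv \<sigma> r * sp \<gamma> s) = l * sp \<gamma> s" by (simp add: mult.assoc[symmetric])
    then have "deriv (kv \<gamma>) s = l * sp \<gamma> s" using A(8)[OF r(1)] r(2) by simp
    then show ?thesis using d1 by simp
  qed
  then show "regular_curve M I \<gamma> \<and> (\<forall>s\<in>I. (kv \<gamma> has_real_derivative l * sp \<gamma> s) (at s))" using reg by simp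
next
  assume R: "regular_curve M I \<gamma> \<and> (\<forall>s\<in>I. (kv \<gamma> has_real_derivative l * sp \<gamma> s) (at s))"
  then have reg: "regular_curve M I \<gamma>" by simp
  obtain I' \<sigma> where arc: "arclength_reparametrisation M g I \<gamma> I' \<sigma>" by (rule arclength_exists[OF reg])
  note A = arclength_facts[OF reg arc]
  have oI': "open I'" using A(1) by (simp add: open_interval_def)
  have "((\<lambda>r. kv \<gamma> (\<sigma> r)) has_real_derivative l) (at r)" if r: "r \<in> I'" for r
  proof -
    have "\<sigma> r \<in> I" using A(3) r by auto
    then have "(kv \<gamma> has_real_derivative l * sp \<gamma> (\<sigma> r)) (at (\<sigma> r))" using R by simp
    from DERIV_chain2[OF this smooth_on_deriv(1)[OF A(2) oI' r]]
    have "((\<lambda>r. kv \<gamma> (\<sigma> r)) has_real_derivative l * (deriv \<sigma> r * sp \<gamma> (\<sigma> r))) (at r)" by (simp add: mult_ac)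
    then show ?thesis using A(8)[OF r] by simp
  qed
  then obtain m where m: "\<And>r. r \<in> I' \<Longrightarrow> kv \<gamma> (\<sigma> r) = l * r + m"
    using constant_derivative_on_interval[OF A(1)] by metis
  have "signed_curvature M g (\<gamma> \<circ> \<sigma>) s = l * s + m" if "s \<in> I'" for s
    using m[OF that] A(7)[OF that] unit_speed_signed_curvature[OF A(5,6) that] by simp
  then show "cornu_spiral M g I \<gamma> l" using reg arc unfolding cornu_spiral_def by blast
qed

end

section \<open>Products of two surfaces\<close>

text \<open>\<open>pullback\<close> and \<open>product_tensor\<close> evaluate a tensor in the chart
  chosen by \<open>chart_at\<close>. Invariance permits evaluation in whichever chart is at
  hand.\<close>

definition invariant_tensor :: "('a, 'e::euclidean_space) manifold \<Rightarrow> ('a, 'e) tensor2 \<Rightarrow> bool" where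
  "invariant_tensor M B \<longleftrightarrow> (\<forall>p. \<forall>c\<in>charts_at M p. \<forall>d\<in>charts_at M p. \<forall>v w.
     B d p (tmap c d id p v) (tmap c d id p w) = B c p v w)"

lemma invariant_tensorD:
  "invariant_tensor M B \<Longrightarrow> c \<in> charts_at M p \<Longrightarrow> d \<in> charts_at M p \<Longrightarrow>
    B d p (tmap c d id p v) (tmap c d id p w) = B c p v w"
  unfolding invariant_tensor_def by blast

lemma (in surface) invariant_metric: "invariant_tensor M g"
  unfolding invariant_tensor_def by (intro allI ballI metric_at(4))

lemma (in surface) invariant_kaehler: "invariant_tensor M (kaehler_form g)"
  unfolding invariant_tensor_def kaehler_form_def
  by (intro allI ballI) (simp only: rotation_change metric_at(4))

text \<open>First and second derivatives of a curve precomposed with a function \<open>X\<close>.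
  The condition on \<open>r\<close> is made for local representatives of an immersion that splits as
  in \<open>split_immersion\<close>.\<close>

lemma (in surface) curve_derivatives:
  assumes reg: "regular_curve M I \<gamma>" and W: "open W" "z \<in> W" and X: "smooth_on W X" "X ` W \<subseteq> I"
    and c: "c \<in> charts_at M (\<gamma> (X z))" and r: "\<And>y. y \<in> W \<Longrightarrow> \<gamma> (X y) \<in> fst c \<Longrightarrow> r y = snd c (\<gamma> (X y))"
  shows "(r has_derivative (\<lambda>v. frd X z v *\<^sub>R velocity c \<gamma> (X z))) (at z)"
    and "((\<lambda>y. frd r y w) has_derivative (\<lambda>v. (frd X z v * frd X z w) *\<^sub>R vector_derivative (velocity c \<gamma>) (at (X z))
        + frd (\<lambda>y. frd X y w) z v *\<^sub>R velocity c \<gamma> (X z))) (at z)"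
proof -
  note cD = charts_atD[OF c]
  note S = smooth_map_curve[OF M curve_open[OF reg] curve_smooth[OF reg] cD(1)]
  let ?J = "I \<inter> \<gamma> -` fst c"
  define W' where "W' = W \<inter> X -` ?J"
  have W': "open W'" unfolding W'_def
    by (rule continuous_open_preimage[OF smooth_on_continuous[OF X(1)] W(1) S(1)])
  have z: "z \<in> W'" using W(2) X(2) cD(2) by (auto simp: W'_def)
  have d: "(r has_derivative (\<lambda>v. frd X y v *\<^sub>R velocity c \<gamma> (X y))) (at y)" if y: "y \<in> W'" for y
  proof -
    have yW: "y \<in> W" "X y \<in> ?J" using y by (auto simp: W'_def)
    have "((\<lambda>y. snd c (\<gamma> (X y))) has_derivative (\<lambda>v. frd X y v *\<^sub>R velocity c \<gamma> (X y))) (at y)"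
      by (rule has_derivative_compose[OF smooth_on_has_derivative[OF X(1) W(1) yW(1)] S(4)[OF yW(2), unfolded has_vector_derivative_def]])
    then show ?thesis
      by (rule has_derivative_transform_within_open[OF _ W' y]) (simp add: r W'_def)
  qed
  show "(r has_derivative (\<lambda>v. frd X z v *\<^sub>R velocity c \<gamma> (X z))) (at z)" by (rule d[OF z])
  have zJ: "X z \<in> ?J" using z by (simp add: W'_def)
  have v': "(velocity c \<gamma> has_derivative (\<lambda>t. t *\<^sub>R vector_derivative (velocity c \<gamma>) (at (X z)))) (at (X z))"
    using smooth_on_vector_derivative(2)[OF S(3,1) zJ] unfolding has_vector_derivative_def .
  have "((\<lambda>y. frd X y w *\<^sub>R velocity c \<gamma> (X y)) has_derivative
      (\<lambda>v. frd X z w *\<^sub>R (frd X z v *\<^sub>R vector_derivative (velocity c \<gamma>) (at (X z)))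
        + frd (\<lambda>y. frd X y w) z v *\<^sub>R velocity c \<gamma> (X z))) (at z)"
    by (intro has_derivative_scaleR smooth_on_has_derivative[OF smooth_on_frd[OF X(1)] W]
        has_derivative_compose[OF smooth_on_has_derivative[OF X(1) W] v'])
  then have "((\<lambda>y. frd r y w) has_derivative
      (\<lambda>v. frd X z w *\<^sub>R (frd X z v *\<^sub>R vector_derivative (velocity c \<gamma>) (at (X z)))
        + frd (\<lambda>y. frd X y w) z v *\<^sub>R velocity c \<gamma> (X z))) (at z)"
    by (rule has_derivative_transform_within_open[OF _ W' z]) (simp add: frd_eq[OF d])
  then show "((\<lambda>y. frd r y w) has_derivative (\<lambda>v. (frd X z v * frd X z w) *\<^sub>R vector_derivative (velocity c \<gamma>) (at (X z))
        + frd (\<lambda>y. frd X y w) z v *\<^sub>R velocity c \<gamma> (X z))) (at z)"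
    by (simp add: mult.commute)
qed

section \<open>The product metric and the product Kaehler form\<close>

locale two_surfaces = S1: surface M1 g1 + S2: surface M2 g2
  for M1 :: "('a, real \<times> real) manifold" and g1 and M2 :: "('b, real \<times> real) manifold" and g2 +
  fixes \<epsilon> :: real
  assumes \<epsilon>: "\<epsilon> \<in> {1, -1}"
begin

abbreviation "N \<equiv> product_manifold M1 M2"
abbreviation "G \<equiv> product_tensor \<epsilon> M1 g1 M2 g2"
abbreviation "\<Omega> \<equiv> product_tensor \<epsilon> M1 (kaehler_form g1) M2 (kaehler_form g2)"

lemma eps: "\<epsilon> \<noteq> 0" "\<epsilon> * \<epsilon> = 1" "\<bar>\<epsilon>\<bar> = 1" "\<epsilon> * (\<epsilon> * x) = x"
  using \<epsilon> by auto

lemma product_tensor_eq: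
  assumes B: "invariant_tensor M1 B1" "invariant_tensor M2 B2"
    and d: "d1 \<in> charts_at M1 (fst q)" "d2 \<in> charts_at M2 (snd q)"
  shows "product_tensor \<epsilon> M1 B1 M2 B2 (prod_chart d1 d2) q v w =
    B1 d1 (fst q) (fst v) (fst w) + \<epsilon> * B2 d2 (snd q) (snd v) (snd w)"
proof -
  note c1 = chart_at_charts_at[OF S1.M charts_at_topspace[OF S1.M d(1)]]
  note c2 = chart_at_charts_at[OF S2.M charts_at_topspace[OF S2.M d(2)]]
  show ?thesis
    unfolding product_tensor_def pullback_def Let_def tmap_prod_chart_fst[OF S1.M S2.M d c1]
      tmap_prod_chart_snd[OF S1.M S2.M d c2] invariant_tensorD[OF B(1) d(1) c1] invariant_tensorD[OF B(2) d(2) c2] ..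
qed

lemmas G_eq = product_tensor_eq[OF S1.invariant_metric S2.invariant_metric]

lemma chart_at_product:
  assumes "q \<in> topspace (mtop N)"
  obtains e1 e2 where "e1 \<in> charts_at M1 (fst q)" "e2 \<in> charts_at M2 (snd q)" "chart_at N q = prod_chart e1 e2"
proof -
  have "fst q \<in> topspace (mtop M1)" "snd q \<in> topspace (mtop M2)" using assms by (auto simp: mem_Times_iff)
  then obtain c1 c2 where "c1 \<in> charts_at M1 (fst q)" "c2 \<in> charts_at M2 (snd q)"
    using charts_at_ex[OF S1.M] charts_at_ex[OF S2.M] by metis
  then have "prod_chart c1 c2 \<in> charts_at N q" unfolding charts_at_product by blast
  then have "chart_at N q \<in> charts_at N q" unfolding chart_at_def by (rule someI[of "\<lambda>c. c \<in> charts_at N q"])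
  then show thesis unfolding charts_at_product using that by blast
qed

lemma pullback_eq:
  assumes B: "invariant_tensor M1 B1" "invariant_tensor M2 B2"
    and S: "smooth_atlas S" and f: "smooth_map S N \<Phi>" and c: "c \<in> charts_at S p"
    and d: "d1 \<in> charts_at M1 (fst (\<Phi> p))" "d2 \<in> charts_at M2 (snd (\<Phi> p))"
  shows "pullback N (product_tensor \<epsilon> M1 B1 M2 B2) \<Phi> c p v w =
    B1 d1 (fst (\<Phi> p)) (tmap c d1 (fst \<circ> \<Phi>) p v) (tmap c d1 (fst \<circ> \<Phi>) p w)
    + \<epsilon> * B2 d2 (snd (\<Phi> p)) (tmap c d2 (snd \<circ> \<Phi>) p v) (tmap c d2 (snd \<circ> \<Phi>) p w)"
proof -
  have f1: "smooth_map S M1 (fst \<circ> \<Phi>)" and f2: "smooth_map S M2 (snd \<circ> \<Phi>)"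
    using f smooth_map_product[OF S S1.M S2.M] by auto
  have top: "\<Phi> p \<in> topspace (mtop N)" by (rule smooth_map_topspace[OF f charts_at_topspace[OF S c]])
  obtain e1 e2 where e: "e1 \<in> charts_at M1 (fst (\<Phi> p))" "e2 \<in> charts_at M2 (snd (\<Phi> p))"
    and ce: "chart_at N (\<Phi> p) = prod_chart e1 e2"
    by (rule chart_at_product[OF top])
  have de: "d1 \<in> charts_at M1 ((fst \<circ> \<Phi>) p)" "e1 \<in> charts_at M1 ((fst \<circ> \<Phi>) p)"
    "d2 \<in> charts_at M2 ((snd \<circ> \<Phi>) p)" "e2 \<in> charts_at M2 ((snd \<circ> \<Phi>) p)" using d e by simp_all
  have t1: "tmap c e1 (fst \<circ> \<Phi>) p v = tmap d1 e1 id (fst (\<Phi> p)) (tmap c d1 (fst \<circ> \<Phi>) p v)" for v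
    using tmap_change_target[where f = "fst \<circ> \<Phi>", OF S S1.M f1 c de(1,2)] by simp
  have t2: "tmap c e2 (snd \<circ> \<Phi>) p v = tmap d2 e2 id (snd (\<Phi> p)) (tmap c d2 (snd \<circ> \<Phi>) p v)" for v
    using tmap_change_target[where f = "snd \<circ> \<Phi>", OF S S2.M f2 c de(3,4)] by simp
  show ?thesis
    unfolding pullback_def Let_def ce tmap_prod_chart[OF S S1.M S2.M f c e] product_tensor_eq[OF B e] fst_conv snd_conv
      t1 t2 invariant_tensorD[OF B(1) d(1) e(1)] invariant_tensorD[OF B(2) d(2) e(2)] ..
qed

lemmas pullback_G = pullback_eq[OF S1.invariant_metric S2.invariant_metric]
lemmas pullback_\<Omega> = pullback_eq[OF S1.invariant_kaehler S2.invariant_kaehler]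

text \<open>The product metric is block diagonal and each block depends on its own factor only, so
  the Koszul formula falls apart into those of the factors. The constant \<open>\<epsilon>\<close>
  stands on both sides of the second and cancels.\<close>

lemma christoffel_product:
  assumes d: "d1 \<in> charts_at M1 (fst q)" "d2 \<in> charts_at M2 (snd q)"
  shows "christoffel G (prod_chart d1 d2) q v w =
    (christoffel g1 d1 (fst q) (fst v) (fst w), christoffel g2 d2 (snd q) (snd v) (snd w))"
proof -
  note d1 = charts_atD[OF d(1)] note d2 = charts_atD[OF d(2)]
  let ?d = "prod_chart d1 d2" and ?x1 = "snd d1 (fst q)" and ?x2 = "snd d2 (snd q)"
  interpret F1: smooth_metric_field "snd d1 ` fst d1" "S1.Gc d1" by (rule S1.field[OF d1(1)])
  interpret F2: smooth_metric_field "snd d2 ` fst d2" "S2.Gc d2" by (rule S2.field[OF d2(1)])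
  have x: "?x1 \<in> snd d1 ` fst d1" "?x2 \<in> snd d2 ` fst d2" using d1(2) d2(2) by auto
  have md: "metric_deriv G ?d q u v w = F1.dG ?x1 (fst u) (fst v) (fst w) + \<epsilon> * F2.dG ?x2 (snd u) (snd v) (snd w)" for u v w
  proof -
    have A: "open (snd d1 ` fst d1 \<times> snd d2 ` fst d2)" by (rule open_Times[OF F1.open_U F2.open_U])
    have "((\<lambda>y. S1.Gc d1 (fst y) (fst v) (fst w) + \<epsilon> * S2.Gc d2 (snd y) (snd v) (snd w)) has_derivative
      (\<lambda>u. F1.dG ?x1 (fst u) (fst v) (fst w) + \<epsilon> * F2.dG ?x2 (snd u) (snd v) (snd w))) (at (?x1, ?x2))"
    proof (rule has_derivative_add)
      show "((\<lambda>y. S1.Gc d1 (fst y) (fst v) (fst w)) has_derivative (\<lambda>u. F1.dG ?x1 (fst u) (fst v) (fst w))) (at (?x1, ?x2))"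
        by (rule has_derivative_compose[OF has_derivative_fst[OF has_derivative_ident], of "\<lambda>y. S1.Gc d1 y (fst v) (fst w)"])
          (use F1.G_has_derivative[OF x(1)] in simp)
      show "((\<lambda>y. \<epsilon> * S2.Gc d2 (snd y) (snd v) (snd w)) has_derivative (\<lambda>u. \<epsilon> * F2.dG ?x2 (snd u) (snd v) (snd w))) (at (?x1, ?x2))"
        by (rule has_derivative_mult_right,
            rule has_derivative_compose[OF has_derivative_snd[OF has_derivative_ident], of "\<lambda>y. S2.Gc d2 y (snd v) (snd w)"])
          (use F2.G_has_derivative[OF x(2)] in simp)
    qed
    then have "((\<lambda>y. G ?d (cinv ?d y) v w) has_derivative
      (\<lambda>u. F1.dG ?x1 (fst u) (fst v) (fst w) + \<epsilon> * F2.dG ?x2 (snd u) (snd v) (snd w))) (at (?x1, ?x2))"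
    proof (rule has_derivative_transform_within_open[OF _ A])
      show "(?x1, ?x2) \<in> snd d1 ` fst d1 \<times> snd d2 ` fst d2" using x by simp
      fix y assume "y \<in> snd d1 ` fst d1 \<times> snd d2 ` fst d2"
      then obtain y1 y2 where y: "y = (y1, y2)" "y1 \<in> snd d1 ` fst d1" "y2 \<in> snd d2 ` fst d2" by blast
      have ch: "d1 \<in> charts_at M1 (fst (cinv d1 y1, cinv d2 y2))" "d2 \<in> charts_at M2 (snd (cinv d1 y1, cinv d2 y2))"
        using d1(1) d2(1) cinv_domain[OF y(2)] cinv_domain[OF y(3)] by (auto intro: charts_atI)
      show "S1.Gc d1 (fst y) (fst v) (fst w) + \<epsilon> * S2.Gc d2 (snd y) (snd v) (snd w) = G ?d (cinv ?d y) v w"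
        unfolding y(1) cinv_prod_chart[OF S1.M S2.M d1(1) d2(1) y(2,3)] G_eq[OF ch] by simp
    qed
    then show ?thesis unfolding metric_deriv_def by (simp add: frd_eq map_prod_def split_beta)
  qed
  let ?z = "(christoffel g1 d1 (fst q) (fst v) (fst w), christoffel g2 d2 (snd q) (snd v) (snd w))"
  have K1: "2 * g1 d1 (fst q) (fst ?z) u = F1.dG ?x1 (fst v) (fst w) u + F1.dG ?x1 (fst w) (fst v) u - F1.dG ?x1 u (fst v) (fst w)" for u
    unfolding fst_conv S1.christoffel_eq[OF d(1)] S1.Gc_at[OF d(1), symmetric] by (rule F1.koszul[OF x(1)])
  have K2: "2 * g2 d2 (snd q) (snd ?z) u = F2.dG ?x2 (snd v) (snd w) u + F2.dG ?x2 (snd w) (snd v) u - F2.dG ?x2 u (snd v) (snd w)" for u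
    unfolding snd_conv S2.christoffel_eq[OF d(2)] S2.Gc_at[OF d(2), symmetric] by (rule F2.koszul[OF x(2)])
  have iff: "(2 * G ?d q z u = metric_deriv G ?d q v w u + metric_deriv G ?d q w v u - metric_deriv G ?d q u v w) \<longleftrightarrow>
      g1 d1 (fst q) (fst z) (fst u) + \<epsilon> * g2 d2 (snd q) (snd z) (snd u) =
      g1 d1 (fst q) (fst ?z) (fst u) + \<epsilon> * g2 d2 (snd q) (snd ?z) (snd u)" for z u
  proof -
    have "metric_deriv G ?d q v w u + metric_deriv G ?d q w v u - metric_deriv G ?d q u v w =
      (F1.dG ?x1 (fst v) (fst w) (fst u) + F1.dG ?x1 (fst w) (fst v) (fst u) - F1.dG ?x1 (fst u) (fst v) (fst w))
      + \<epsilon> * (F2.dG ?x2 (snd v) (snd w) (snd u) + F2.dG ?x2 (snd w) (snd v) (snd u) - F2.dG ?x2 (snd u) (snd v) (snd w))"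
      unfolding md by (simp add: algebra_simps)
    also have "\<dots> = 2 * (g1 d1 (fst q) (fst ?z) (fst u) + \<epsilon> * g2 d2 (snd q) (snd ?z) (snd u))"
      unfolding K1[symmetric] K2[symmetric] by (simp add: algebra_simps)
    finally have "metric_deriv G ?d q v w u + metric_deriv G ?d q w v u - metric_deriv G ?d q u v w = \<dots>" .
    moreover have "(2 * x = m) \<longleftrightarrow> (x = y)" if "m = 2 * y" for x y m :: real using that by auto
    ultimately show ?thesis unfolding G_eq[OF d] by blast
  qed
  note bl1 = S1.metric_at(1)[OF d(1)] note bl2 = S2.metric_at(1)[OF d(2)]
  show ?thesis
    unfolding christoffel_def[of G] iff
  proof (rule the_equality)
    fix z assume z: "\<forall>u. g1 d1 (fst q) (fst z) (fst u) + \<epsilon> * g2 d2 (snd q) (snd z) (snd u) =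
      g1 d1 (fst q) (fst ?z) (fst u) + \<epsilon> * g2 d2 (snd q) (snd ?z) (snd u)"
    have "fst z = fst ?z"
    proof (rule F1.eqI[OF x(1)])
      fix u show "S1.Gc d1 ?x1 (fst z) u = S1.Gc d1 ?x1 (fst ?z) u"
        unfolding S1.Gc_at[OF d(1)] using z[rule_format, of "(u, 0)"] by (simp add: bilinear_rzero[OF bl2])
    qed
    moreover have "snd z = snd ?z"
    proof (rule F2.eqI[OF x(2)])
      fix u show "S2.Gc d2 ?x2 (snd z) u = S2.Gc d2 ?x2 (snd ?z) u"
        unfolding S2.Gc_at[OF d(2)] using z[rule_format, of "(0, u)"] eps(1) by (simp add: bilinear_rzero[OF bl1])
    qed
    ultimately show "z = ?z" by (rule prod_eqI)
  qed simp
qed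

end

text \<open>Locally \<open>\<Phi> = (\<phi> \<circ> X, \<psi> \<circ> Y)\<close> in a chart \<open>c\<close> around \<open>p\<close>, with independent differentials \<open>dX\<close>, \<open>dY\<close>.\<close>

locale split_immersion = two_surfaces M1 g1 M2 g2 \<epsilon>
  for M1 :: "('a, real \<times> real) manifold" and g1 and M2 :: "('b, real \<times> real) manifold" and g2 and \<epsilon> +
  fixes S :: "('s, real \<times> real) manifold" and \<Phi> :: "'s \<Rightarrow> 'a \<times> 'b" and c p W X Y I \<phi> K \<psi>
  assumes S: "smooth_atlas S" and \<Phi>: "smooth_map S (product_manifold M1 M2) \<Phi>" and c: "c \<in> charts_at S p"
    and reg: "regular_curve M1 I \<phi>" "regular_curve M2 K \<psi>"
    and W: "open W" "snd c p \<in> W" and X: "smooth_on W X" "X ` W \<subseteq> I" and Y: "smooth_on W Y" "Y ` W \<subseteq> K"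
    and split: "z \<in> W \<Longrightarrow> \<Phi> (cinv c z) = (\<phi> (X z), \<psi> (Y z))"
    and indep: "inj (\<lambda>v. (frd X (snd c p) v, frd Y (snd c p) v))"
begin

abbreviation "s0 \<equiv> X (snd c p)"
abbreviation "t0 \<equiv> Y (snd c p)"
abbreviation "dX \<equiv> frd X (snd c p)"
abbreviation "dY \<equiv> frd Y (snd c p)"

lemma \<Phi>p: "\<Phi> p = (\<phi> s0, \<psi> t0)"
  using split[OF W(2)] cinv_chart[OF S charts_atD[OF c]] by simp

lemma s0: "s0 \<in> I" and t0: "t0 \<in> K"
  using X(2) Y(2) W(2) by auto

lemma linX: "linear dX" and linY: "linear dY"
  using smooth_on_linear_frd[OF X(1) W] smooth_on_linear_frd[OF Y(1) W] by auto

text \<open>The basis dual to \<open>dX\<close>, \<open>dY\<close>: the coordinate vectors of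
  \<open>(X, Y)\<close> at \<open>p\<close>, with which the tensors below are tested.\<close>

lemma dual:
  obtains e1 e2 where "dX e1 = 1" "dY e1 = 0" "dX e2 = 0" "dY e2 = 1"
proof -
  have "linear (\<lambda>v. (dX v, dY v))"
    by (rule linearI) (simp_all add: linear_add[OF linX] linear_add[OF linY] linear_scale[OF linX] linear_scale[OF linY])
  then have "surj (\<lambda>v. (dX v, dY v))" using linear_injective_imp_surjective indep by blast
  then obtain e1 e2 where "(1, 0) = (dX e1, dY e1)" "(0, 1) = (dX e2, dY e2)" by (meson surjE)
  then show thesis using that[of e1 e2] by simp
qed

context
  fixes d1 d2
  assumes d: "d1 \<in> charts_at M1 (\<phi> s0)" "d2 \<in> charts_at M2 (\<psi> t0)"
begin

abbreviation "v1 \<equiv> velocity d1 \<phi> s0"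
abbreviation "v2 \<equiv> velocity d2 \<psi> t0"

lemma d': "d1 \<in> charts_at M1 (fst (\<Phi> p))" "d2 \<in> charts_at M2 (snd (\<Phi> p))"
  using d by (simp_all add: \<Phi>p)

lemma comp1: "z \<in> W \<Longrightarrow> local_rep c d1 (fst \<circ> \<Phi>) z = snd d1 (\<phi> (X z))"
  and comp2: "z \<in> W \<Longrightarrow> local_rep c d2 (snd \<circ> \<Phi>) z = snd d2 (\<psi> (Y z))"
  by (simp_all add: local_rep_def split)

lemmas cd1 = S1.curve_derivatives[OF reg(1) W X d(1) comp1]
lemmas cd2 = S2.curve_derivatives[OF reg(2) W Y d(2) comp2]

lemma tmap_split: "tmap c (prod_chart d1 d2) \<Phi> p v = (dX v *\<^sub>R v1, dY v *\<^sub>R v2)"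
  and tmap_fst: "tmap c d1 (fst \<circ> \<Phi>) p v = dX v *\<^sub>R v1"
  and tmap_snd: "tmap c d2 (snd \<circ> \<Phi>) p v = dY v *\<^sub>R v2"
proof -
  show a: "tmap c d1 (fst \<circ> \<Phi>) p v = dX v *\<^sub>R v1" unfolding tmap_def using frd_eq[OF cd1(1)] by simp
  show b: "tmap c d2 (snd \<circ> \<Phi>) p v = dY v *\<^sub>R v2" unfolding tmap_def using frd_eq[OF cd2(1)] by simp
  show "tmap c (prod_chart d1 d2) \<Phi> p v = (dX v *\<^sub>R v1, dY v *\<^sub>R v2)"
    unfolding tmap_prod_chart[OF S S1.M S2.M \<Phi> c d'] a b ..
qed

lemma G_at: "G (prod_chart d1 d2) (\<Phi> p) v w = g1 d1 (\<phi> s0) (fst v) (fst w) + \<epsilon> * g2 d2 (\<psi> t0) (snd v) (snd w)"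
  using G_eq[OF d'] by (simp add: \<Phi>p)

lemma induced:
  "pullback N G \<Phi> c p v w = (S1.sp \<phi> s0)\<^sup>2 * dX v * dX w + \<epsilon> * ((S2.sp \<psi> t0)\<^sup>2 * dY v * dY w)"
  unfolding pullback_G[OF S \<Phi> c d'] tmap_fst tmap_snd
  unfolding \<Phi>p fst_conv snd_conv bilinear_lmul[OF S1.metric_at(1)[OF d(1)]] bilinear_rmul[OF S1.metric_at(1)[OF d(1)]]
    bilinear_lmul[OF S2.metric_at(1)[OF d(2)]] bilinear_rmul[OF S2.metric_at(1)[OF d(2)]]
    S1.sp_sq[OF reg(1) s0 d(1)] S2.sp_sq[OF reg(2) t0 d(2)]
  by simp

text \<open>Each projection of the tangent plane is a line, and an alternating form vanishes on a
  line.\<close>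

lemma induced_\<Omega>: "pullback N \<Omega> \<Phi> c p v w = 0"
proof -
  have 1: "kaehler_form g1 d1 (\<phi> s0) (dX v *\<^sub>R v1) (dX w *\<^sub>R v1) = 0"
  proof -
    interpret plane_inner "g1 d1 (\<phi> s0)" by (rule S1.inner[OF d(1)])
    show ?thesis unfolding kaehler_form_def S1.rotation_eq[OF d(1)] R_scale
      by (simp add: bilinear_lmul[OF bilin] bilinear_rmul[OF bilin] sym[of "R v1"] B_v_R)
  qed
  have 2: "kaehler_form g2 d2 (\<psi> t0) (dY v *\<^sub>R v2) (dY w *\<^sub>R v2) = 0"
  proof -
    interpret plane_inner "g2 d2 (\<psi> t0)" by (rule S2.inner[OF d(2)])
    show ?thesis unfolding kaehler_form_def S2.rotation_eq[OF d(2)] R_scale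
      by (simp add: bilinear_lmul[OF bilin] bilinear_rmul[OF bilin] sym[of "R v2"] B_v_R)
  qed
  show ?thesis
    unfolding pullback_\<Omega>[OF S \<Phi> c d'] tmap_fst tmap_snd
    unfolding \<Phi>p fst_conv snd_conv 1 2 by simp
qed

text \<open>The second derivatives of \<open>X\<close> and \<open>Y\<close> enter only as multiples
  of the velocities. They depend on the coordinates and will disappear into the tangential
  part.\<close>

lemma hessian_split:
  "ambient_hessian G \<Phi> c (prod_chart d1 d2) p v w =
    ((dX v * dX w) *\<^sub>R acceleration g1 d1 \<phi> s0 + frd (\<lambda>z. frd X z w) (snd c p) v *\<^sub>R v1,
     (dY v * dY w) *\<^sub>R acceleration g2 d2 \<psi> t0 + frd (\<lambda>z. frd Y z w) (snd c p) v *\<^sub>R v2)"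
proof -
  let ?r1 = "local_rep c d1 (fst \<circ> \<Phi>)" and ?r2 = "local_rep c d2 (snd \<circ> \<Phi>)"
  note cD = charts_atD[OF c] note d1D = charts_atD[OF d(1)] note d2D = charts_atD[OF d(2)]
  interpret F1: smooth_metric_field "snd d1 ` fst d1" "S1.Gc d1" by (rule S1.field[OF d1D(1)])
  interpret F2: smooth_metric_field "snd d2 ` fst d2" "S2.Gc d2" by (rule S2.field[OF d2D(1)])
  have f12: "smooth_map S M1 (fst \<circ> \<Phi>)" "smooth_map S M2 (snd \<circ> \<Phi>)"
    using \<Phi> smooth_map_product[OF S S1.M S2.M] by auto
  note R1 = smooth_map_local_rep[OF S S1.M f12(1) cD(1) d1D(1)]
  note R2 = smooth_map_local_rep[OF S S2.M f12(2) cD(1) d2D(1)]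
  let ?O = "snd c ` (fst c \<inter> (fst \<circ> \<Phi>) -` fst d1) \<inter> snd c ` (fst c \<inter> (snd \<circ> \<Phi>) -` fst d2)"
  have oO: "open ?O" using R1(1) R2(1) by (rule open_Int)
  have pO: "snd c p \<in> ?O" using cD(2) d1D(2) d2D(2) \<Phi>p by auto
  have pair: "frd (local_rep c (prod_chart d1 d2) \<Phi>) y w = (frd ?r1 y w, frd ?r2 y w)" if "y \<in> ?O" for y
    unfolding local_rep_prod_chart[abs_def]
    by (subst frd_eq[OF has_derivative_Pair[OF smooth_on_has_derivative[OF R1(2,1)] smooth_on_has_derivative[OF R2(2,1)]]])
      (use that in auto)
  have "frd (\<lambda>y. frd (local_rep c (prod_chart d1 d2) \<Phi>) y w) (snd c p) = frd (\<lambda>y. (frd ?r1 y w, frd ?r2 y w)) (snd c p)"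
    by (rule frd_cong[OF oO pO]) (rule pair)
  also have "\<dots> = (\<lambda>v. ((dX v * dX w) *\<^sub>R vector_derivative (velocity d1 \<phi>) (at s0) + frd (\<lambda>y. frd X y w) (snd c p) v *\<^sub>R v1,
      (dY v * dY w) *\<^sub>R vector_derivative (velocity d2 \<psi>) (at t0) + frd (\<lambda>y. frd Y y w) (snd c p) v *\<^sub>R v2))"
    by (rule frd_eq[OF has_derivative_Pair[OF cd1(2) cd2(2)]])
  finally have A: "frd (\<lambda>y. frd (local_rep c (prod_chart d1 d2) \<Phi>) y w) (snd c p) = \<dots>" .
  have x: "snd d1 (\<phi> s0) \<in> snd d1 ` fst d1" "snd d2 (\<psi> t0) \<in> snd d2 ` fst d2" using d1D(2) d2D(2) by auto
  show ?thesis
    unfolding ambient_hessian_def A tmap_split christoffel_product[OF d'] fst_conv snd_conv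
    unfolding \<Phi>p fst_conv snd_conv S1.christoffel_eq[OF d(1)] S2.christoffel_eq[OF d(2)] F1.Chr_scale[OF x(1)] F2.Chr_scale[OF x(2)]
      S1.acceleration_eq[of d1 \<phi> s0, OF d(1)] S2.acceleration_eq[of d2 \<psi> t0, OF d(2)]
    by (simp add: scaleR_right_distrib)
qed

abbreviation "n1 \<equiv> (S1.kv \<phi> s0 * S1.sp \<phi> s0) *\<^sub>R rotation g1 d1 (\<phi> s0) v1"
abbreviation "n2 \<equiv> (S2.kv \<psi> t0 * S2.sp \<psi> t0) *\<^sub>R rotation g2 d2 (\<psi> t0) v2"

text \<open>Each acceleration is a tangential multiple of the velocity plus \<open>n1\<close> or
  \<open>n2\<close>. Two candidates for the normal part differ by a tangent vector, and testing
  orthogonality with the dual basis shows that this vector is zero.\<close>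

lemma second_fundamental_form_split:
  "second_fundamental_form G \<Phi> c (prod_chart d1 d2) p v w = ((dX v * dX w) *\<^sub>R n1, (dY v * dY w) *\<^sub>R n2)"
proof -
  interpret P1: plane_inner "g1 d1 (\<phi> s0)" by (rule S1.inner[OF d(1)])
  interpret P2: plane_inner "g2 d2 (\<psi> t0)" by (rule S2.inner[OF d(2)])
  note bl = bilinear_lmul[OF P1.bilin] bilinear_rmul[OF P1.bilin] bilinear_lmul[OF P2.bilin] bilinear_rmul[OF P2.bilin]
    bilinear_ladd[OF P1.bilin] bilinear_ladd[OF P2.bilin]
    bilinear_rzero[OF P1.bilin] bilinear_rzero[OF P2.bilin] bilinear_lzero[OF P1.bilin] bilinear_lzero[OF P2.bilin]
  obtain e1 e2 where e: "dX e1 = 1" "dY e1 = 0" "dX e2 = 0" "dY e2 = 1" by (rule dual)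
  let ?n = "((dX v * dX w) *\<^sub>R n1, (dY v * dY w) *\<^sub>R n2)"
  have orth: "g1 d1 (\<phi> s0) (rotation g1 d1 (\<phi> s0) v1) v1 = 0" "g2 d2 (\<psi> t0) (rotation g2 d2 (\<psi> t0) v2) v2 = 0"
    unfolding S1.rotation_eq[OF d(1)] S2.rotation_eq[OF d(2)]
    by (simp_all add: P1.sym[of _ v1] P2.sym[of _ v2] P1.B_v_R P2.B_v_R)
  have sq: "g1 d1 (\<phi> s0) v1 v1 > 0" "g2 d2 (\<psi> t0) v2 v2 > 0"
    using P1.pos[OF S1.velocity_nz[OF reg(1) s0 d(1)]] P2.pos[OF S2.velocity_nz[OF reg(2) t0 d(2)]] by auto
  obtain r1 where r1: "acceleration g1 d1 \<phi> s0 = r1 *\<^sub>R v1 + n1"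
    using S1.acceleration_decompose[OF reg(1) s0 d(1)] by blast
  obtain r2 where r2: "acceleration g2 d2 \<psi> t0 = r2 *\<^sub>R v2 + n2"
    using S2.acceleration_decompose[OF reg(2) t0 d(2)] by blast
  have ex: "\<exists>u. ambient_hessian G \<Phi> c (prod_chart d1 d2) p v w = tmap c (prod_chart d1 d2) \<Phi> p u + ?n"
  proof
    \<comment> \<open>The coefficients collect all tangential terms of the two components of the
      ambient Hessian.\<close>
    let ?u = "(dX v * dX w * r1 + frd (\<lambda>z. frd X z w) (snd c p) v) *\<^sub>R e1 +
      (dY v * dY w * r2 + frd (\<lambda>z. frd Y z w) (snd c p) v) *\<^sub>R e2"
    have "dX ?u = dX v * dX w * r1 + frd (\<lambda>z. frd X z w) (snd c p) v"
      "dY ?u = dY v * dY w * r2 + frd (\<lambda>z. frd Y z w) (snd c p) v"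
      by (simp_all add: linear_add[OF linX] linear_scale[OF linX] linear_add[OF linY] linear_scale[OF linY] e)
    then show "ambient_hessian G \<Phi> c (prod_chart d1 d2) p v w = tmap c (prod_chart d1 d2) \<Phi> p ?u + ?n"
      unfolding hessian_split tmap_split r1 r2 by (simp add: algebra_simps)
  qed
  show ?thesis
    unfolding second_fundamental_form_def
  proof (rule the_equality)
    show "(\<forall>u. G (prod_chart d1 d2) (\<Phi> p) ?n (tmap c (prod_chart d1 d2) \<Phi> p u) = 0) \<and>
      (\<exists>u. ambient_hessian G \<Phi> c (prod_chart d1 d2) p v w = tmap c (prod_chart d1 d2) \<Phi> p u + ?n)"
    proof (intro conjI ex allI)
      show "G (prod_chart d1 d2) (\<Phi> p) ?n (tmap c (prod_chart d1 d2) \<Phi> p u) = 0" for u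
        unfolding G_at tmap_split by (simp add: bl orth)
    qed
    fix n assume n: "(\<forall>u. G (prod_chart d1 d2) (\<Phi> p) n (tmap c (prod_chart d1 d2) \<Phi> p u) = 0) \<and>
      (\<exists>u. ambient_hessian G \<Phi> c (prod_chart d1 d2) p v w = tmap c (prod_chart d1 d2) \<Phi> p u + n)"
    obtain u where "ambient_hessian G \<Phi> c (prod_chart d1 d2) p v w = tmap c (prod_chart d1 d2) \<Phi> p u + n"
      using n by blast
    moreover obtain u' where "ambient_hessian G \<Phi> c (prod_chart d1 d2) p v w = tmap c (prod_chart d1 d2) \<Phi> p u' + ?n"
      using ex by blast
    ultimately have "n = ?n + (tmap c (prod_chart d1 d2) \<Phi> p u' - tmap c (prod_chart d1 d2) \<Phi> p u)"
      by (simp add: algebra_simps)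
    then have nn: "n = ?n + ((dX u' - dX u) *\<^sub>R v1, (dY u' - dY u) *\<^sub>R v2)"
      unfolding tmap_split by (simp add: algebra_simps)
    have "g1 d1 (\<phi> s0) (fst n) v1 = 0"
      using conjunct1[OF n, rule_format, of e1] unfolding tmap_split G_at by (simp add: e bl)
    then have "dX u' - dX u = 0" using sq(1) by (simp add: nn bl orth(1))
    moreover have "g2 d2 (\<psi> t0) (snd n) v2 = 0"
      using conjunct1[OF n, rule_format, of e2] unfolding tmap_split G_at by (simp add: e bl eps)
    then have "dY u' - dY u = 0" using sq(2) by (simp add: nn bl orth(2))
    ultimately show "n = ?n" using nn by (simp add: prod_eq_iff)
  qed
qed

lemma mean_curvature_split:
  "mean_curvature N G \<Phi> c (prod_chart d1 d2) p =
    (1/2) *\<^sub>R ((1 / (S1.sp \<phi> s0)\<^sup>2) *\<^sub>R n1, (\<epsilon> / (S2.sp \<psi> t0)\<^sup>2) *\<^sub>R n2)"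
proof -
  obtain e1 e2 where e: "dX e1 = 1" "dY e1 = 0" "dX e2 = 0" "dY e2 = 1" by (rule dual)
  have p: "S1.sp \<phi> s0 > 0" "S2.sp \<psi> t0 > 0" using S1.sp_pos[OF reg(1) s0] S2.sp_pos[OF reg(2) t0] by auto
  have vw: "w = dX w *\<^sub>R e1 + dY w *\<^sub>R e2" for w
    by (rule injD[OF indep]) (simp add: linear_add[OF linX] linear_scale[OF linX] linear_add[OF linY] linear_scale[OF linY] e)
  \<comment> \<open>In the basis \<open>e1\<close>, \<open>e2\<close> the induced metric is
    diagonal. Its inverse has the entries \<open>1/a\<^sup>2\<close> and
    \<open>\<epsilon>/b\<^sup>2\<close>, where \<open>a\<close> and \<open>b\<close> are the speeds;
    the inverse of \<open>\<epsilon>\<close> is \<open>\<epsilon>\<close>.\<close>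
  have sh: "dX (sharp (pullback N G \<Phi>) c p (\<lambda>w. w \<bullet> b)) = (e1 \<bullet> b) / (S1.sp \<phi> s0)\<^sup>2"
    "dY (sharp (pullback N G \<Phi>) c p (\<lambda>w. w \<bullet> b)) = \<epsilon> * (e2 \<bullet> b) / (S2.sp \<psi> t0)\<^sup>2" for b
  proof -
    let ?v = "((e1 \<bullet> b) / (S1.sp \<phi> s0)\<^sup>2) *\<^sub>R e1 + (\<epsilon> * (e2 \<bullet> b) / (S2.sp \<psi> t0)\<^sup>2) *\<^sub>R e2"
    have v: "dX ?v = (e1 \<bullet> b) / (S1.sp \<phi> s0)\<^sup>2" "dY ?v = \<epsilon> * (e2 \<bullet> b) / (S2.sp \<psi> t0)\<^sup>2"
      by (simp_all add: linear_add[OF linX] linear_scale[OF linX] linear_add[OF linY] linear_scale[OF linY] e)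
    have "sharp (pullback N G \<Phi>) c p (\<lambda>w. w \<bullet> b) = ?v"
      unfolding sharp_def
    proof (rule the_equality)
      show "\<forall>w. pullback N G \<Phi> c p ?v w = w \<bullet> b"
      proof
        fix w
        have "w \<bullet> b = dX w * (e1 \<bullet> b) + dY w * (e2 \<bullet> b)" by (subst vw[of w]) (simp add: inner_add_left)
        then show "pullback N G \<Phi> c p ?v w = w \<bullet> b"
          unfolding induced v using p eps by (simp add: mult.commute)
      qed
      fix v' assume v': "\<forall>w. pullback N G \<Phi> c p v' w = w \<bullet> b"
      have "(S1.sp \<phi> s0)\<^sup>2 * dX v' = e1 \<bullet> b" "\<epsilon> * ((S2.sp \<psi> t0)\<^sup>2 * dY v') = e2 \<bullet> b"
        using v'[rule_format, of e1] v'[rule_format, of e2] unfolding induced by (simp_all add: e)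
      moreover have "(S2.sp \<psi> t0)\<^sup>2 * dY v' = \<epsilon> * (\<epsilon> * ((S2.sp \<psi> t0)\<^sup>2 * dY v'))" by (simp only: eps(4))
      ultimately have "dX v' = dX ?v" "dY v' = dY ?v" unfolding v using p by (simp_all add: field_simps)
      then show "v' = ?v" using vw[of v'] vw[of ?v] by simp
    qed
    then show "dX (sharp (pullback N G \<Phi>) c p (\<lambda>w. w \<bullet> b)) = (e1 \<bullet> b) / (S1.sp \<phi> s0)\<^sup>2"
      "dY (sharp (pullback N G \<Phi>) c p (\<lambda>w. w \<bullet> b)) = \<epsilon> * (e2 \<bullet> b) / (S2.sp \<psi> t0)\<^sup>2" using v by simp_all
  qed
  \<comment> \<open>Summing over the basis of the chart reassembles \<open>dX e1\<close> and, below,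
    \<open>dY e2\<close>; this removes the chart coordinates from the trace.\<close>
  have sX: "(\<Sum>b\<in>Basis. dX b * (e1 \<bullet> b)) = 1"
    using linear_basis_expansion[OF linX, of e1] e(1) by (simp add: mult.commute)
  have sY: "(\<Sum>b\<in>Basis. dY b * (e2 \<bullet> b)) = 1"
    using linear_basis_expansion[OF linY, of e2] e(4) by (simp add: mult.commute)
  have "(\<Sum>b\<in>Basis. second_fundamental_form G \<Phi> c (prod_chart d1 d2) p b (sharp (pullback N G \<Phi>) c p (\<lambda>w. w \<bullet> b)))
    = (\<Sum>b\<in>Basis. ((dX b * (e1 \<bullet> b)) *\<^sub>R ((1 / (S1.sp \<phi> s0)\<^sup>2) *\<^sub>R n1), (dY b * (e2 \<bullet> b)) *\<^sub>R ((\<epsilon> / (S2.sp \<psi> t0)\<^sup>2) *\<^sub>R n2)))"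
    unfolding second_fundamental_form_split sh by (simp add: mult_ac)
  also have "\<dots> = ((\<Sum>b\<in>Basis. dX b * (e1 \<bullet> b)) *\<^sub>R ((1 / (S1.sp \<phi> s0)\<^sup>2) *\<^sub>R n1),
      (\<Sum>b\<in>Basis. dY b * (e2 \<bullet> b)) *\<^sub>R ((\<epsilon> / (S2.sp \<psi> t0)\<^sup>2) *\<^sub>R n2))"
    unfolding scaleR_left.sum by (simp add: sum_prod)
  finally show ?thesis unfolding mean_curvature_def sX sY by simp
qed

lemma normal_zero_iff: "n1 = 0 \<longleftrightarrow> S1.kv \<phi> s0 = 0" "n2 = 0 \<longleftrightarrow> S2.kv \<psi> t0 = 0"
proof -
  interpret P1: plane_inner "g1 d1 (\<phi> s0)" by (rule S1.inner[OF d(1)])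
  interpret P2: plane_inner "g2 d2 (\<psi> t0)" by (rule S2.inner[OF d(2)])
  have "P1.R v1 \<noteq> 0"
    using P1.B_R_R[of v1] P1.pos[OF S1.velocity_nz[OF reg(1) s0 d(1)]] bilinear_lzero[OF P1.bilin, of 0] by (intro notI) simp
  then show "n1 = 0 \<longleftrightarrow> S1.kv \<phi> s0 = 0" using S1.sp_pos[OF reg(1) s0] unfolding S1.rotation_eq[OF d(1)] by simp
  have "P2.R v2 \<noteq> 0"
    using P2.B_R_R[of v2] P2.pos[OF S2.velocity_nz[OF reg(2) t0 d(2)]] bilinear_lzero[OF P2.bilin, of 0] by (intro notI) simp
  then show "n2 = 0 \<longleftrightarrow> S2.kv \<psi> t0 = 0" using S2.sp_pos[OF reg(2) t0] unfolding S2.rotation_eq[OF d(2)] by simp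
qed

text \<open>The two summands of the mean curvature lie in different factors of the product and
  cannot cancel.\<close>

lemma mean_curvature_zero_iff:
  "mean_curvature N G \<Phi> c (prod_chart d1 d2) p = 0 \<longleftrightarrow> S1.kv \<phi> s0 = 0 \<and> S2.kv \<psi> t0 = 0"
proof -
  have "mean_curvature N G \<Phi> c (prod_chart d1 d2) p = 0 \<longleftrightarrow> n1 = 0 \<and> n2 = 0"
  proof -
    have "(1/2) *\<^sub>R ((1 / (S1.sp \<phi> s0)\<^sup>2) *\<^sub>R x, (\<epsilon> / (S2.sp \<psi> t0)\<^sup>2) *\<^sub>R y) = 0 \<longleftrightarrow> x = 0 \<and> y = 0"
      for x y :: "real \<times> real"
      using S1.sp_pos[OF reg(1) s0] S2.sp_pos[OF reg(2) t0] eps(1) by (simp add: prod_eq_iff)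
    then show ?thesis unfolding mean_curvature_split by blast
  qed
  then show ?thesis unfolding normal_zero_iff .
qed

lemma second_fundamental_form_zero:
  assumes "S1.kv \<phi> s0 = 0" "S2.kv \<psi> t0 = 0"
  shows "second_fundamental_form G \<Phi> c (prod_chart d1 d2) p v w = 0"
  unfolding second_fundamental_form_split using assms by (simp add: zero_prod_def)

lemma tmap_inj: "inj (tmap c (prod_chart d1 d2) \<Phi> p)"
proof (rule injI)
  fix v w assume "tmap c (prod_chart d1 d2) \<Phi> p v = tmap c (prod_chart d1 d2) \<Phi> p w"
  then have "dX v = dX w" "dY v = dY w"
    unfolding tmap_split using S1.velocity_nz[OF reg(1) s0 d(1)] S2.velocity_nz[OF reg(2) t0 d(2)] by simp_all
  then show "v = w" using injD[OF indep, of v w] by simp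
qed

end

end

lemma frd_bounded_linear: "bounded_linear h \<Longrightarrow> frd h x = h"
  by (rule frd_eq) (rule bounded_linear_imp_has_derivative)

lemmas frd_fst = frd_bounded_linear[OF bounded_linear_fst]
lemmas frd_snd = frd_bounded_linear[OF bounded_linear_snd]

lemma smooth_on_subset_UNIV_fst: "open X \<Longrightarrow> smooth_on X fst" and smooth_on_subset_UNIV_snd: "open X \<Longrightarrow> smooth_on X snd"
  by (auto intro: smooth_on_fst[OF _ smooth_on_id] smooth_on_snd[OF _ smooth_on_id])

text \<open>The metric \<open>A(s) ds\<^sup>2 + B(t) dt\<^sup>2\<close> is flat since its Christoffel symbols are \<open>A'/2A\<close> and \<open>B'/2B\<close>.\<close>

lemma diagonal_metric_flat:
  fixes A B :: "real \<Rightarrow> real"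
  assumes I: "open I" "open K" and A: "smooth_on I A" and B: "smooth_on K B"
    and nz: "\<And>s. s \<in> I \<Longrightarrow> A s \<noteq> 0" "\<And>t. t \<in> K \<Longrightarrow> B t \<noteq> 0"
    and h: "\<And>p v w. p \<in> I \<times> K \<Longrightarrow>
      h (I \<times> K, id) p v w = A (fst p) * (fst v * fst w) + B (snd p) * (snd v * snd w)"
  shows "flat_metric (open_region (I \<times> K)) h"
proof -
  let ?W = "I \<times> K" and ?c = "(I \<times> K, id :: real \<times> real \<Rightarrow> real \<times> real)"
  have W: "open ?W" using I by (rule open_Times)
  have AW: "smooth_on ?W (\<lambda>x. A (fst x))"
    by (rule smooth_on_compose[OF A W I(1) smooth_on_subset_UNIV_fst[OF W]]) auto
  have BW: "smooth_on ?W (\<lambda>x. B (snd x))"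
    by (rule smooth_on_compose[OF B W I(2) smooth_on_subset_UNIV_snd[OF W]]) auto
  let ?A' = "deriv A" and ?B' = "deriv B"
  note dA = smooth_on_deriv[OF A I(1)] and dB = smooth_on_deriv[OF B I(2)]
  have zero: "v = 0" if "p \<in> ?W" "\<And>w. h ?c p v w = 0" for p v
  proof -
    have "A (fst p) * fst v = 0" "B (snd p) * snd v = 0"
      using that(2)[of "(1, 0)"] that(2)[of "(0, 1)"] by (simp_all add: h[OF that(1)])
    then show ?thesis using nz that(1) by (auto simp: mem_Times_iff prod_eq_iff)
  qed
  have pr: "pseudo_riemannian_metric (open_region ?W) h"
    unfolding pseudo_riemannian_metric_def nondegenerate_def
  proof (intro conjI ballI allI)
    fix c v w assume "c \<in> atlas (open_region ?W)"
    then have c: "c = ?c" by simp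
    have "smooth_on ?W (\<lambda>x. A (fst x) * (fst v * fst w) + B (snd x) * (snd v * snd w))"
      by (intro smooth_intros W AW BW)
    then have "smooth_on ?W (\<lambda>x. h ?c (cinv ?c x) v w)"
      by (rule iffD2[OF smooth_on_cong[OF W], rotated]) (simp add: h cinv_id)
    then show "smooth_on (snd c ` fst c) (\<lambda>x. h c (cinv c x) v w)" using c by simp
  next
    fix p c assume "p \<in> topspace (mtop (open_region ?W))" "c \<in> charts_at (open_region ?W) p"
    then have p: "p \<in> ?W" and c: "c = ?c" by (simp_all add: charts_at_open_region)
    show "bilinear (h c p)"
      unfolding bilinear_def c by (auto intro!: linearI simp: h[OF p] algebra_simps)
    show "h c p v w = h c p w v" for v w by (simp add: c h[OF p] mult.commute)
    show "h c p v w = h d p (tmap c d id p v) (tmap c d id p w)" if "d \<in> charts_at (open_region ?W) p" for d v w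
    proof -
      have "d = ?c" using that charts_at_open_region[OF p] by auto
      then show ?thesis
        using tmap_id[OF smooth_atlas_open_region[OF W], of ?c p] charts_at_open_region[OF p] c by simp
    qed
    show "(\<forall>w. h c p v w = 0) \<longrightarrow> v = 0" for v using zero[OF p] c by blast
  qed
  have md: "metric_deriv h ?c p u v w =
      ?A' (fst p) * fst u * (fst v * fst w) + ?B' (snd p) * snd u * (snd v * snd w)" if p: "p \<in> ?W" for p u v w
  proof -
    have "((\<lambda>x. A (fst x) * (fst v * fst w) + B (snd x) * (snd v * snd w)) has_derivative
      (\<lambda>u. ?A' (fst p) * fst u * (fst v * fst w) + ?B' (snd p) * snd u * (snd v * snd w))) (at p)"
      by (intro has_derivative_add has_derivative_mult_left
          has_derivative_compose[OF has_derivative_fst[OF has_derivative_ident] dA(1)[unfolded has_field_derivative_def]]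
          has_derivative_compose[OF has_derivative_snd[OF has_derivative_ident] dB(1)[unfolded has_field_derivative_def]])
        (use p in auto)
    then have "((\<lambda>x. h ?c (cinv ?c x) v w) has_derivative
      (\<lambda>u. ?A' (fst p) * fst u * (fst v * fst w) + ?B' (snd p) * snd u * (snd v * snd w))) (at p)"
      by (rule has_derivative_transform_within_open[OF _ W p]) (simp add: h cinv_id)
    then show ?thesis unfolding metric_deriv_def by (simp add: frd_eq)
  qed
  let ?P = "\<lambda>s. ?A' s / (2 * A s)" and ?Q = "\<lambda>t. ?B' t / (2 * B t)"
  have chr: "christoffel h ?c p v w = (?P (fst p) * (fst v * fst w), ?Q (snd p) * (snd v * snd w))" if p: "p \<in> ?W" for p v w
    unfolding christoffel_def
  proof (rule the_equality)
    have n: "A (fst p) \<noteq> 0" "B (snd p) \<noteq> 0" using nz p by (auto simp: mem_Times_iff)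
    let ?z = "(?P (fst p) * (fst v * fst w), ?Q (snd p) * (snd v * snd w))"
    show z: "\<forall>u. 2 * h ?c p ?z u = metric_deriv h ?c p v w u + metric_deriv h ?c p w v u - metric_deriv h ?c p u v w"
    proof
      fix u
      have "A (fst p) * ?P (fst p) = ?A' (fst p) / 2" "B (snd p) * ?Q (snd p) = ?B' (snd p) / 2" using n by simp_all
      then have "h ?c p ?z u = ?A' (fst p) / 2 * (fst v * fst w * fst u) + ?B' (snd p) / 2 * (snd v * snd w * snd u)"
        unfolding h[OF p] fst_conv snd_conv by (metis (no_types, opaque_lifting) mult.assoc)
      then show "2 * h ?c p ?z u = metric_deriv h ?c p v w u + metric_deriv h ?c p w v u - metric_deriv h ?c p u v w"
        unfolding md[OF p] by (simp add: algebra_simps)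
    qed
    fix z' assume z': "\<forall>u. 2 * h ?c p z' u = metric_deriv h ?c p v w u + metric_deriv h ?c p w v u - metric_deriv h ?c p u v w"
    have "h ?c p (z' - ?z) u = h ?c p z' u - h ?c p ?z u" for u unfolding h[OF p] by (simp add: algebra_simps)
    then have "h ?c p (z' - ?z) u = 0" for u using z z' by (metis diff_self mult_cancel_left zero_neq_numeral)
    then show "z' = ?z" using zero[OF p, of "z' - ?z"] by simp
  qed
  have P: "smooth_on I ?P" by (intro smooth_intros I A dA(2)) (use nz in auto)
  have Q: "smooth_on K ?Q" by (intro smooth_intros I B dB(2)) (use nz in auto)
  note dP = smooth_on_deriv(1)[OF P I(1)] and dQ = smooth_on_deriv(1)[OF Q I(2)]
  have dchr: "frd (\<lambda>x. christoffel h ?c (cinv ?c x) v w) p =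
      (\<lambda>u. (deriv ?P (fst p) * fst u * (fst v * fst w), deriv ?Q (snd p) * snd u * (snd v * snd w)))" if p: "p \<in> ?W" for p v w
  proof -
    have "((\<lambda>x. (?P (fst x) * (fst v * fst w), ?Q (snd x) * (snd v * snd w))) has_derivative
      (\<lambda>u. (deriv ?P (fst p) * fst u * (fst v * fst w), deriv ?Q (snd p) * snd u * (snd v * snd w)))) (at p)"
      by (intro has_derivative_Pair has_derivative_mult_left
          has_derivative_compose[OF has_derivative_fst[OF has_derivative_ident] dP[unfolded has_field_derivative_def]]
          has_derivative_compose[OF has_derivative_snd[OF has_derivative_ident] dQ[unfolded has_field_derivative_def]])
        (use p in auto)
    then show ?thesis
      by (intro frd_eq, elim has_derivative_transform_within_open[OF _ W p]) (simp add: chr cinv_id)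
  qed
  show ?thesis
    unfolding flat_metric_def
  proof (intro conjI pr ballI allI)
    fix p c u v w assume "p \<in> topspace (mtop (open_region ?W))" "c \<in> charts_at (open_region ?W) p"
    then have p: "p \<in> ?W" and c: "c = ?c" by (simp_all add: charts_at_open_region)
    \<comment> \<open>In each component both the derivative of the Christoffel map and its iterate
      are symmetric in \<open>u\<close> and \<open>v\<close>, so the terms cancel in pairs.\<close>
    show "riemann_curvature h c p u v w = 0"
      unfolding riemann_curvature_def c snd_conv id_apply dchr[OF p] chr[OF p] fst_conv
      by (simp add: prod_eq_iff algebra_simps)
  qed
qed

section \<open>Products of two regular curves\<close>

context two_surfaces
begin

context
  fixes I \<phi> K \<psi>
  assumes reg: "regular_curve M1 I \<phi>" "regular_curve M2 K \<psi>"
begin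

abbreviation "cW \<equiv> (I \<times> K, id :: real \<times> real \<Rightarrow> real \<times> real)"

lemma open_IK: "open (I \<times> K)"
  by (rule open_Times[OF S1.curve_open[OF reg(1)] S2.curve_open[OF reg(2)]])

lemma atlas_IK: "smooth_atlas (open_region (I \<times> K))"
  by (rule smooth_atlas_open_region[OF open_IK])

lemma smooth_curve_product: "smooth_map (open_region (I \<times> K)) N (map_prod \<phi> \<psi>)"
  unfolding smooth_map_product[OF atlas_IK S1.M S2.M]
proof
  have "smooth_map (open_region (I \<times> K)) (open_region I) fst"
    unfolding smooth_map_open_regions[OF open_IK S1.curve_open[OF reg(1)]]
    using smooth_on_subset_UNIV_fst[OF open_IK] by auto
  from smooth_map_compose[OF atlas_IK smooth_atlas_open_region[OF S1.curve_open[OF reg(1)]] S1.M this S1.curve_smooth[OF reg(1)]]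
  show "smooth_map (open_region (I \<times> K)) M1 (fst \<circ> map_prod \<phi> \<psi>)" by (simp add: fst_comp_map_prod)
  have "smooth_map (open_region (I \<times> K)) (open_region K) snd"
    unfolding smooth_map_open_regions[OF open_IK S2.curve_open[OF reg(2)]]
    using smooth_on_subset_UNIV_snd[OF open_IK] by auto
  from smooth_map_compose[OF atlas_IK smooth_atlas_open_region[OF S2.curve_open[OF reg(2)]] S2.M this S2.curve_smooth[OF reg(2)]]
  show "smooth_map (open_region (I \<times> K)) M2 (snd \<circ> map_prod \<phi> \<psi>)" by (simp add: snd_comp_map_prod)
qed

text \<open>A product of curves is the split immersion with the two coordinates as \<open>X\<close>
  and \<open>Y\<close>, so the pointwise formulas hold at all its points.\<close>

lemma split_curve_product:
  assumes p: "p \<in> I \<times> K"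
  shows "split_immersion M1 g1 M2 g2 \<epsilon> (open_region (I \<times> K)) (map_prod \<phi> \<psi>) cW p (I \<times> K) fst snd I \<phi> K \<psi>"
proof unfold_locales
  show "inj (\<lambda>v. (frd fst (snd cW p) v, frd snd (snd cW p) v))" unfolding frd_fst frd_snd by simp
  show "map_prod \<phi> \<psi> (cinv cW z) = (\<phi> (fst z), \<psi> (snd z))" if "z \<in> I \<times> K" for z
    using cinv_id[OF that] by (simp add: map_prod_def split_beta)
qed (use p in \<open>auto simp: charts_at_open_region open_IK atlas_IK smooth_curve_product reg
      smooth_on_subset_UNIV_fst smooth_on_subset_UNIV_snd\<close>)

lemma curve_product_charts:
  assumes "p \<in> I \<times> K"
  obtains d1 d2 where "d1 \<in> charts_at M1 (\<phi> (fst p))" "d2 \<in> charts_at M2 (\<psi> (snd p))"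
proof -
  have "fst p \<in> I" "snd p \<in> K" using assms by (auto simp: mem_Times_iff)
  then show thesis using that S1.curve_chart[OF reg(1)] S2.curve_chart[OF reg(2)] by blast
qed

lemma curve_product_metric:
  assumes p: "p \<in> I \<times> K"
  shows "pullback N G (map_prod \<phi> \<psi>) cW p v w =
    (S1.sp \<phi> (fst p))\<^sup>2 * (fst v * fst w) + \<epsilon> * (S2.sp \<psi> (snd p))\<^sup>2 * (snd v * snd w)"
proof -
  interpret split_immersion M1 g1 M2 g2 \<epsilon> "open_region (I \<times> K)" "map_prod \<phi> \<psi>" cW p "I \<times> K" fst snd I \<phi> K \<psi>
    by (rule split_curve_product[OF p])
  obtain d1 d2 where d: "d1 \<in> charts_at M1 (\<phi> (fst p))" "d2 \<in> charts_at M2 (\<psi> (snd p))" by (rule curve_product_charts[OF p])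
  show ?thesis using induced[of d1 d2 v w] d by (simp add: frd_fst frd_snd)
qed

lemma curve_product_flat: "flat_metric (open_region (I \<times> K)) (pullback N G (map_prod \<phi> \<psi>))"
proof (rule diagonal_metric_flat[where A = "\<lambda>s. (S1.sp \<phi> s)\<^sup>2" and B = "\<lambda>t. \<epsilon> * (S2.sp \<psi> t)\<^sup>2"])
  show o: "open I" "open K" by (rule S1.curve_open[OF reg(1)], rule S2.curve_open[OF reg(2)])
  show "smooth_on I (\<lambda>s. (S1.sp \<phi> s)\<^sup>2)" by (intro smooth_intros S1.sp_smooth[OF reg(1)] o)
  show "smooth_on K (\<lambda>t. \<epsilon> * (S2.sp \<psi> t)\<^sup>2)" by (intro smooth_intros S2.sp_smooth[OF reg(2)] o)
  show "(S1.sp \<phi> s)\<^sup>2 \<noteq> 0" if "s \<in> I" for s using S1.sp_pos[OF reg(1) that] by simp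
  show "\<epsilon> * (S2.sp \<psi> t)\<^sup>2 \<noteq> 0" if "t \<in> K" for t using S2.sp_pos[OF reg(2) that] eps(1) by simp
qed (rule curve_product_metric)

lemma curve_product_immersion: "immersion (open_region (I \<times> K)) N (map_prod \<phi> \<psi>)"
  unfolding immersion_def
proof (intro conjI smooth_curve_product ballI)
  fix p c d assume "p \<in> topspace (mtop (open_region (I \<times> K)))" "c \<in> charts_at (open_region (I \<times> K)) p"
    and d: "d \<in> charts_at N (map_prod \<phi> \<psi> p)"
  then have p: "p \<in> I \<times> K" and ceq: "c = cW" by (simp_all add: charts_at_open_region)
  interpret split_immersion M1 g1 M2 g2 \<epsilon> "open_region (I \<times> K)" "map_prod \<phi> \<psi>" cW p "I \<times> K" fst snd I \<phi> K \<psi>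
    by (rule split_curve_product[OF p])
  obtain d1 d2 where d': "d1 \<in> charts_at M1 (fst (map_prod \<phi> \<psi> p))" "d2 \<in> charts_at M2 (snd (map_prod \<phi> \<psi> p))" "d = prod_chart d1 d2"
    using d unfolding charts_at_product by blast
  show "inj (tmap c d (map_prod \<phi> \<psi>) p)"
    unfolding ceq d'(3) by (rule tmap_inj) (use d'(1,2) \<Phi>p in simp_all)
qed

lemma curve_product_nondegenerate: "nondegenerate (open_region (I \<times> K)) (pullback N G (map_prod \<phi> \<psi>))"
  using curve_product_flat unfolding flat_metric_def pseudo_riemannian_metric_def by blast

lemma curve_product_lagrangian: "lagrangian_immersion (open_region (I \<times> K)) N \<Omega> (map_prod \<phi> \<psi>)"
  unfolding lagrangian_immersion_def
proof (intro conjI curve_product_immersion ballI allI)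
  fix p c v w assume "p \<in> topspace (mtop (open_region (I \<times> K)))" "c \<in> charts_at (open_region (I \<times> K)) p"
  then have p: "p \<in> I \<times> K" and ceq: "c = cW" by (simp_all add: charts_at_open_region)
  interpret split_immersion M1 g1 M2 g2 \<epsilon> "open_region (I \<times> K)" "map_prod \<phi> \<psi>" cW p "I \<times> K" fst snd I \<phi> K \<psi>
    by (rule split_curve_product[OF p])
  obtain d1 d2 where d: "d1 \<in> charts_at M1 (\<phi> (fst p))" "d2 \<in> charts_at M2 (\<psi> (snd p))" by (rule curve_product_charts[OF p])
  show "pullback N \<Omega> (map_prod \<phi> \<psi>) c p v w = 0" unfolding ceq by (rule induced_\<Omega>) (use d in simp_all)
qed

lemma curve_product_minimal_iff:
  "minimal_immersion (open_region (I \<times> K)) N G (map_prod \<phi> \<psi>) \<longleftrightarrow> geodesic_curve M1 g1 I \<phi> \<and> geodesic_curve M2 g2 K \<psi>"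
proof -
  have H: "mean_curvature N G (map_prod \<phi> \<psi>) cW (prod_chart d1 d2) p = 0 \<longleftrightarrow> S1.kv \<phi> (fst p) = 0 \<and> S2.kv \<psi> (snd p) = 0"
    if p: "p \<in> I \<times> K" and d: "d1 \<in> charts_at M1 (\<phi> (fst p))" "d2 \<in> charts_at M2 (\<psi> (snd p))" for p d1 d2
  proof -
    interpret split_immersion M1 g1 M2 g2 \<epsilon> "open_region (I \<times> K)" "map_prod \<phi> \<psi>" cW p "I \<times> K" fst snd I \<phi> K \<psi>
      by (rule split_curve_product[OF p])
    show ?thesis using mean_curvature_zero_iff[of d1 d2] d by simp
  qed
  show ?thesis
    unfolding S1.geodesic_curve_iff S2.geodesic_curve_iff
  proof
    assume min: "minimal_immersion (open_region (I \<times> K)) N G (map_prod \<phi> \<psi>)"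
    have kv: "S1.kv \<phi> (fst p) = 0 \<and> S2.kv \<psi> (snd p) = 0" if p: "p \<in> I \<times> K" for p
    proof -
      obtain d1 d2 where d: "d1 \<in> charts_at M1 (\<phi> (fst p))" "d2 \<in> charts_at M2 (\<psi> (snd p))" by (rule curve_product_charts[OF p])
      have "prod_chart d1 d2 \<in> charts_at N (map_prod \<phi> \<psi> p)"
      proof -
        have "d1 \<in> charts_at M1 (fst (map_prod \<phi> \<psi> p))" "d2 \<in> charts_at M2 (snd (map_prod \<phi> \<psi> p))"
          using d by (simp_all add: map_prod_def split_beta)
        then show ?thesis unfolding charts_at_product by blast
      qed
      moreover have "p \<in> topspace (mtop (open_region (I \<times> K)))" "cW \<in> charts_at (open_region (I \<times> K)) p"
        using p by (simp_all add: charts_at_open_region)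
      ultimately have "mean_curvature N G (map_prod \<phi> \<psi>) cW (prod_chart d1 d2) p = 0"
        using min[unfolded minimal_immersion_def, THEN conjunct2, THEN conjunct2] by blast
      then show ?thesis using H[OF p d] by simp
    qed
    \<comment> \<open>Both curvatures are tested at pairs of parameters. A point of the other
      interval completes a single parameter to a pair.\<close>
    obtain s0 t0 where "s0 \<in> I" "t0 \<in> K" using S1.curve_interval(2)[OF reg(1)] S2.curve_interval(2)[OF reg(2)] by auto
    then have "S1.kv \<phi> s = 0" "S2.kv \<psi> t = 0" if "s \<in> I" "t \<in> K" for s t
      using kv[of "(s, t)"] that by auto
    then show "(regular_curve M1 I \<phi> \<and> (\<forall>s\<in>I. S1.kv \<phi> s = 0)) \<and> regular_curve M2 K \<psi> \<and> (\<forall>s\<in>K. S2.kv \<psi> s = 0)"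
      using reg \<open>s0 \<in> I\<close> \<open>t0 \<in> K\<close> by blast
  next
    assume k: "(regular_curve M1 I \<phi> \<and> (\<forall>s\<in>I. S1.kv \<phi> s = 0)) \<and> regular_curve M2 K \<psi> \<and> (\<forall>s\<in>K. S2.kv \<psi> s = 0)"
    show "minimal_immersion (open_region (I \<times> K)) N G (map_prod \<phi> \<psi>)"
      unfolding minimal_immersion_def
    proof (intro conjI curve_product_immersion curve_product_nondegenerate ballI)
      fix p c d assume "p \<in> topspace (mtop (open_region (I \<times> K)))" "c \<in> charts_at (open_region (I \<times> K)) p"
        and d: "d \<in> charts_at N (map_prod \<phi> \<psi> p)"
      then have p: "p \<in> I \<times> K" and ceq: "c = cW" by (simp_all add: charts_at_open_region)
      obtain d1 d2 where d': "d1 \<in> charts_at M1 (fst (map_prod \<phi> \<psi> p))" "d2 \<in> charts_at M2 (snd (map_prod \<phi> \<psi> p))" "d = prod_chart d1 d2"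
        using d unfolding charts_at_product by blast
      have d12: "d1 \<in> charts_at M1 (\<phi> (fst p))" "d2 \<in> charts_at M2 (\<psi> (snd p))" using d' by (cases p; simp)+
      have "fst p \<in> I" "snd p \<in> K" using p by (auto simp: mem_Times_iff)
      then show "mean_curvature N G (map_prod \<phi> \<psi>) c d p = 0"
        unfolding ceq d'(3) H[OF p d12] using k by blast
    qed
  qed
qed

end

end

section \<open>Projected rank one Lagrangian surfaces\<close>

lemma plane_inj_iff:
  fixes A :: "real \<times> real \<Rightarrow> real \<times> real"
  assumes "linear A"
  shows "inj A \<longleftrightarrow> signed_area (A (1, 0)) (A (0, 1)) \<noteq> 0"
proof
  assume "inj A"
  then have s: "surj A" by (rule linear_injective_imp_surjective[OF assms]) simp_all
  obtain u where u: "(1, 0) = A u" using surjD[OF s, of "(1, 0)"] by blast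
  obtain w where w: "(0, 1) = A w" using surjD[OF s, of "(0, 1)"] by blast
  have "signed_area (A u) (A w) = 1" unfolding u[symmetric] w[symmetric] by (simp add: signed_area_def)
  then have "signed_area (A (1, 0)) (A (0, 1)) * signed_area u w = 1"
    unfolding linear_plane_signed_area[OF assms, of u w] .
  then show "signed_area (A (1, 0)) (A (0, 1)) \<noteq> 0" by (intro notI) simp
next
  assume nz: "signed_area (A (1, 0)) (A (0, 1)) \<noteq> 0"
  show "inj A"
  proof (rule injI)
    fix v w assume eq: "A v = A w"
    show "v = w"
      using linear_plane_inverse(2)[OF assms nz, of v, unfolded eq] linear_plane_inverse(2)[OF assms nz, of w]
      by (rule trans[OF sym])
  qed
qed

text \<open>A singular \<open>A\<close> with \<open>l (A w)\<close> nonzero has rank one, and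
  \<open>l\<close> is injective on its image.\<close>

lemma plane_singular_kernel:
  fixes A :: "real \<times> real \<Rightarrow> real \<times> real" and l :: "real \<times> real \<Rightarrow> real"
  assumes A: "linear A" "signed_area (A (1, 0)) (A (0, 1)) = 0" and l: "linear l" "l (A w) \<noteq> 0" "l (A v) = 0"
  shows "A v = 0"
proof -
  have sa: "signed_area (A v) (A w) = 0" using linear_plane_signed_area[OF A(1), of v w] A(2) by simp
  have "signed_area (A v) u = 0" for u
  proof -
    \<comment> \<open>The linear relation between three vectors of the plane; its left-hand side
      vanishes because \<open>A\<close> is singular.\<close>
    have "signed_area (A v) (A w) *\<^sub>R u = signed_area u (A w) *\<^sub>R A v + signed_area (A v) u *\<^sub>R A w"
      by (simp add: signed_area_def prod_eq_iff algebra_simps)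
    then have "l (signed_area u (A w) *\<^sub>R A v + signed_area (A v) u *\<^sub>R A w) = l 0" by (simp add: sa)
    then show ?thesis using l by (simp add: linear_add linear_scale linear_0)
  qed
  from this[of "(1, 0)"] this[of "(0, 1)"] show ?thesis by (simp add: signed_area_def prod_eq_iff)
qed

lemma plane_coordinate:
  fixes x :: "real \<times> real"
  assumes "x \<noteq> 0"
  obtains l :: "real \<times> real \<Rightarrow> real" where "bounded_linear l" "l x \<noteq> 0"
  using assms bounded_linear_fst bounded_linear_snd by (metis prod_eqI zero_prod_def fst_zero snd_zero)

text \<open>The factor is the square root of the Gram determinant. Vanishing of a pulled-back
  Kaehler form thus becomes vanishing of a determinant.\<close>

lemma (in surface) kaehler_signed_area:
  assumes "c \<in> charts_at M p"
  obtains k where "k > 0" "\<And>v w. kaehler_form g c p v w = k * signed_area v w"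
proof -
  interpret plane_inner "g c p" by (rule inner[OF assms])
  have "kaehler_form g c p v w = sqrt dt * signed_area v w" for v w
    unfolding kaehler_form_def rotation_eq[OF assms] sym[of "R v"] B_R ..
  then show thesis using that[of "sqrt dt"] dt_pos by simp
qed

text \<open>\<open>map_rank\<close> is computed in chosen charts. A nonzero determinant in any other
  charts means an injective differential, also in the chosen ones, and hence rank two.\<close>

lemma (in surface) rank_one_singular:
  fixes S :: "('s, real \<times> real) manifold"
  assumes S: "smooth_atlas S" and f: "smooth_map S M f" and c: "c \<in> charts_at S p" and d: "d \<in> charts_at M (f p)"
    and rk: "map_rank S M f p = 1"
  shows "signed_area (tmap c d f p (1, 0)) (tmap c d f p (0, 1)) = (0 :: real)"
proof (rule ccontr)
  let ?A = "tmap c d f p" and ?c = "chart_at S p" and ?d = "chart_at M (f p)"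
  have c': "?c \<in> charts_at S p" by (rule chart_at_charts_at[OF S charts_at_topspace[OF S c]])
  have d': "?d \<in> charts_at M (f p)" by (rule chart_at_charts_at[OF M charts_at_topspace[OF M d]])
  assume "signed_area (?A (1, 0)) (?A (0, 1)) \<noteq> 0"
  then have inj: "inj ?A" using plane_inj_iff[OF tmap_linear[OF S M f c d]] by simp
  have e: "tmap ?c ?d f p v = tmap d ?d id (f p) (?A (tmap ?c c id p v))" for v
    unfolding tmap_change_source[OF S M f c' c d'] tmap_change_target[OF S M f c d d'] ..
  have "inj (tmap ?c ?d f p)"
  proof (rule injI)
    fix v w assume "tmap ?c ?d f p v = tmap ?c ?d f p w"
    then have "tmap ?d d id (f p) (tmap d ?d id (f p) (?A (tmap ?c c id p v))) =
      tmap ?d d id (f p) (tmap d ?d id (f p) (?A (tmap ?c c id p w)))" unfolding e by simp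
    then have "?A (tmap ?c c id p v) = ?A (tmap ?c c id p w)" unfolding tmap_transition_inverse[OF M d d'] .
    then have "tmap ?c c id p v = tmap ?c c id p w" by (rule injD[OF inj])
    then have "tmap c ?c id p (tmap ?c c id p v) = tmap c ?c id p (tmap ?c c id p w)" by simp
    then show "v = w" unfolding tmap_transition_inverse[OF S c' c] .
  qed
  then have "dim (range (tmap ?c ?d f p)) = dim (UNIV :: (real \<times> real) set)"
    by (intro dim_image_eq[OF tmap_linear[OF S M f c' d']]) simp
  then show False using rk unfolding map_rank_def by simp
qed

text \<open>\<open>\<gamma>\<close> parametrises the surface so that \<open>l\<close> of the
  representative of \<open>f\<close> is the first coordinate. In the direction of \<open>t\<close>
  the value under \<open>l\<close> has derivative 0, so by \<open>ker\<close> the map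
  \<open>f\<close> does not change along \<open>t\<close>. In the direction of \<open>s\<close> this
  derivative is 1, so the remaining curve is regular.\<close>

lemma (in surface) factor_curve:
  assumes S: "smooth_atlas S" and f: "smooth_map S M f" and c: "c \<in> atlas S" and d: "d \<in> atlas M"
    and l: "bounded_linear l" and I: "open_interval I" and K: "open_interval K" and \<gamma>: "smooth_on (I \<times> K) \<gamma>"
    and sub: "\<gamma> ` (I \<times> K) \<subseteq> snd c ` (fst c \<inter> f -` fst d)"
    and coord: "\<And>s t. s \<in> I \<Longrightarrow> t \<in> K \<Longrightarrow> l (local_rep c d f (\<gamma> (s, t))) = s"
    and ker: "\<And>x v. x \<in> I \<times> K \<Longrightarrow> l (frd (local_rep c d f) (\<gamma> x) v) = 0 \<Longrightarrow> frd (local_rep c d f) (\<gamma> x) v = 0"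
    and t0: "t0 \<in> K"
  shows "regular_curve M I (\<lambda>s. f (cinv c (\<gamma> (s, t0))))"
    and "s \<in> I \<Longrightarrow> t \<in> K \<Longrightarrow> f (cinv c (\<gamma> (s, t))) = f (cinv c (\<gamma> (s, t0)))"
proof -
  let ?f = "local_rep c d f" and ?\<phi> = "\<lambda>s. f (cinv c (\<gamma> (s, t0)))"
  note F = smooth_map_local_rep[OF S M f c d]
  have o: "open I" "open K" using I K by (auto simp: open_interval_def)
  have oIK: "open (I \<times> K)" by (rule open_Times[OF o])
  have at: "cinv c (\<gamma> x) \<in> fst c" "snd c (cinv c (\<gamma> x)) = \<gamma> x" "f (cinv c (\<gamma> x)) \<in> fst d" if "x \<in> I \<times> K" for x
  proof -
    obtain q where q: "q \<in> fst c" "f q \<in> fst d" "\<gamma> x = snd c q"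
      using subsetD[OF sub imageI[OF \<open>x \<in> I \<times> K\<close>]] by auto
    then show "cinv c (\<gamma> x) \<in> fst c" "snd c (cinv c (\<gamma> x)) = \<gamma> x" "f (cinv c (\<gamma> x)) \<in> fst d"
      using cinv_chart[OF S c q(1)] by simp_all
  qed
  have sd: "snd d (f (cinv c (\<gamma> x))) = ?f (\<gamma> x)" for x by (simp add: local_rep_def)
  have h: "smooth_on (I \<times> K) (\<lambda>x. ?f (\<gamma> x))" by (rule smooth_on_compose[OF F(2) oIK F(1) \<gamma> sub])
  have dh: "frd (\<lambda>x. ?f (\<gamma> x)) x v = frd ?f (\<gamma> x) (frd \<gamma> x v)" if "x \<in> I \<times> K" for x v
    by (rule frd_compose[OF \<gamma> oIK F(2,1) that]) (rule subsetD[OF sub imageI[OF that]])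
  have ldh: "l (frd (\<lambda>x. ?f (\<gamma> x)) x v) = fst v" if x: "x \<in> I \<times> K" for x v
  proof -
    have "((\<lambda>x. l (?f (\<gamma> x))) has_derivative (\<lambda>v. l (frd (\<lambda>x. ?f (\<gamma> x)) x v))) (at x)"
      by (rule bounded_linear.has_derivative[OF l smooth_on_has_derivative[OF h oIK x]])
    then have "(fst has_derivative (\<lambda>v. l (frd (\<lambda>x. ?f (\<gamma> x)) x v))) (at x)"
      by (rule has_derivative_transform_within_open[OF _ oIK x]) (auto simp: coord)
    from fun_cong[OF frd_eq[OF this], of v] show ?thesis unfolding frd_fst by (rule sym)
  qed
  show "f (cinv c (\<gamma> (s, t))) = f (cinv c (\<gamma> (s, t0)))" if s: "s \<in> I" and t: "t \<in> K"
  proof -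
    have "\<exists>k. \<forall>t\<in>K. ?f (\<gamma> (s, t)) = k"
    proof (rule has_derivative_zero_constant)
      show "convex K" using K by (simp add: open_interval_def is_interval_convex_1)
      fix t assume t: "t \<in> K"
      have x: "(s, t) \<in> I \<times> K" using s t by simp
      have "frd (\<lambda>x. ?f (\<gamma> x)) (s, t) (0, 1) = 0"
        using ker[OF x, of "frd \<gamma> (s, t) (0, 1)"] ldh[OF x, of "(0, 1)"] dh[OF x, of "(0, 1)"] by simp
      moreover have "((\<lambda>t. (s, t)) has_vector_derivative (0, 1)) (at t)"
        by (auto intro!: derivative_eq_intros simp: has_vector_derivative_def)
      ultimately have "((\<lambda>t. ?f (\<gamma> (s, t))) has_vector_derivative 0) (at t)"
        using frd_along[OF h oIK x, of "\<lambda>t. (s, t)" "(0, 1)" t] by simp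
      then show "((\<lambda>t. ?f (\<gamma> (s, t))) has_derivative (\<lambda>h. 0)) (at t within K)"
        by (simp add: has_vector_derivative_def has_derivative_at_withinI)
    qed
    then obtain k where "\<forall>t\<in>K. ?f (\<gamma> (s, t)) = k" ..
    then have "?f (\<gamma> (s, t)) = ?f (\<gamma> (s, t0))" using t t0 by simp
    then have "cinv d (snd d (f (cinv c (\<gamma> (s, t))))) = cinv d (snd d (f (cinv c (\<gamma> (s, t0)))))" unfolding sd by simp
    then show ?thesis using at(3)[of "(s, t)"] at(3)[of "(s, t0)"] s t t0 by (simp add: cinv_chart[OF M d])
  qed
  have line: "smooth_on I (\<lambda>s. (s, t0))" by (intro smooth_intros o)
  have hl: "smooth_on I (\<lambda>s. ?f (\<gamma> (s, t0)))"
    by (rule smooth_on_compose[OF h o(1) oIK line]) (use t0 in \<open>simp add: image_subset_iff\<close>)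
  have sm: "smooth_map (open_region I) M ?\<phi>"
  proof (rule smooth_map_open_regionI[OF o(1) M], intro bexI[OF _ d] exI conjI)
    fix s assume "s \<in> I" then show "s \<in> I" .
    show "I \<subseteq> I \<inter> ?\<phi> -` fst d"
    proof
      fix s assume "s \<in> I"
      then show "s \<in> I \<inter> ?\<phi> -` fst d" using at(3)[of "(s, t0)"] t0 by simp
    qed
    show "smooth_on I (\<lambda>s. snd d (?\<phi> s))" unfolding sd by (rule hl)
  qed (rule o)
  show "regular_curve M I ?\<phi>"
    unfolding regular_curve_def
  proof (intro conjI I sm ballI)
    fix s e assume s: "s \<in> I" and e: "e \<in> charts_at M (?\<phi> s)"
    have x: "(s, t0) \<in> I \<times> K" using s t0 by simp
    have dc: "d \<in> charts_at M (?\<phi> s)" using d at(3)[OF x] by (rule charts_atI)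
    have "((\<lambda>s. (s, t0)) has_vector_derivative (1, 0)) (at s)"
      by (auto intro!: derivative_eq_intros simp: has_vector_derivative_def)
    from frd_along[OF h oIK x this refl]
    have "velocity d ?\<phi> s = frd (\<lambda>x. ?f (\<gamma> x)) (s, t0) (1, 0)" unfolding velocity_def sd by (rule vector_derivative_at)
    then have "l (velocity d ?\<phi> s) = 1" using ldh[OF x, of "(1, 0)"] by simp
    then have "velocity d ?\<phi> s \<noteq> 0" using linear_0[OF bounded_linear.linear[OF l]] by (intro notI) simp
    then show "velocity e ?\<phi> s \<noteq> 0"
      unfolding velocity_change[OF M o(1) sm s e dc] using linear_0[OF linear_transition[OF e dc]] by (intro notI) simp
  qed
qed

section \<open>Local splitting of a projected rank one Lagrangian surface\<close>

context two_surfaces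
begin

context
  fixes S :: "('s, real \<times> real) manifold" and \<Phi>
  assumes S: "smooth_atlas S" and L: "lagrangian_immersion S N \<Omega> \<Phi>" and R: "projected_rank_one S M1 M2 \<Phi>"
begin

lemma L_smooth: "smooth_map S N \<Phi>"
  using L unfolding lagrangian_immersion_def immersion_def by blast

lemma L_smooth_fst: "smooth_map S M1 (fst \<circ> \<Phi>)" and L_smooth_snd: "smooth_map S M2 (snd \<circ> \<Phi>)"
  using L_smooth smooth_map_product[OF S S1.M S2.M] by auto

text \<open>The Lagrangian condition reads \<open>k1 det A + \<epsilon> k2 det B = 0\<close> with
  positive \<open>k1\<close> and \<open>k2\<close>. Rank one makes one determinant vanish, hence
  both. Neither differential is zero, since the other would then be injective by the immersion
  property, against its zero determinant.\<close>

lemma lagrangian_differentials: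
  assumes c: "c \<in> charts_at S p" and d: "d1 \<in> charts_at M1 (fst (\<Phi> p))" "d2 \<in> charts_at M2 (snd (\<Phi> p))"
  defines "A \<equiv> tmap c d1 (fst \<circ> \<Phi>) p" and "B \<equiv> tmap c d2 (snd \<circ> \<Phi>) p"
  shows "linear A" "linear B" "signed_area (A (1, 0)) (A (0, 1)) = 0" "signed_area (B (1, 0)) (B (0, 1)) = 0"
    and "A v = 0 \<Longrightarrow> B v = 0 \<Longrightarrow> v = 0" "\<exists>v. A v \<noteq> 0" "\<exists>v. B v \<noteq> 0"
proof -
  have p: "p \<in> topspace (mtop S)" by (rule charts_at_topspace[OF S c])
  have d': "d1 \<in> charts_at M1 ((fst \<circ> \<Phi>) p)" "d2 \<in> charts_at M2 ((snd \<circ> \<Phi>) p)" using d by simp_all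
  show lA: "linear A" and lB: "linear B"
    unfolding A_def B_def by (rule tmap_linear[OF S S1.M L_smooth_fst c d'(1)], rule tmap_linear[OF S S2.M L_smooth_snd c d'(2)])
  have "prod_chart d1 d2 \<in> charts_at N (\<Phi> p)" unfolding charts_at_product using d by blast
  then have "inj (tmap c (prod_chart d1 d2) \<Phi> p)"
    using L p c unfolding lagrangian_immersion_def immersion_def by blast
  then have inj: "inj (\<lambda>v. (A v, B v))"
    unfolding tmap_prod_chart[OF S S1.M S2.M L_smooth c d, abs_def] A_def B_def .
  show ker: "v = 0" if "A v = 0" "B v = 0" for v
    using injD[OF inj, of v 0] that linear_0[OF lA] linear_0[OF lB] by simp
  obtain k1 where k1: "k1 > 0" "\<And>v w. kaehler_form g1 d1 (fst (\<Phi> p)) v w = k1 * signed_area v w"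
    using S1.kaehler_signed_area[OF d(1)] by metis
  obtain k2 where k2: "k2 > 0" "\<And>v w. kaehler_form g2 d2 (snd (\<Phi> p)) v w = k2 * signed_area v w"
    using S2.kaehler_signed_area[OF d(2)] by metis
  have "pullback N \<Omega> \<Phi> c p (1, 0) (0, 1) = 0" using L p c unfolding lagrangian_immersion_def by blast
  then have lag: "k1 * signed_area (A (1, 0)) (A (0, 1)) + \<epsilon> * (k2 * signed_area (B (1, 0)) (B (0, 1))) = 0"
    unfolding pullback_\<Omega>[OF S L_smooth c d] k1(2) k2(2) A_def B_def .
  have "map_rank S M1 (fst \<circ> \<Phi>) p = 1 \<or> map_rank S M2 (snd \<circ> \<Phi>) p = 1"
    using R p unfolding projected_rank_one_def by blast
  then have "signed_area (A (1, 0)) (A (0, 1)) = 0 \<or> signed_area (B (1, 0)) (B (0, 1)) = 0"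
    unfolding A_def B_def using S1.rank_one_singular[OF S L_smooth_fst c d'(1)] S2.rank_one_singular[OF S L_smooth_snd c d'(2)] by blast
  then show det: "signed_area (A (1, 0)) (A (0, 1)) = 0" "signed_area (B (1, 0)) (B (0, 1)) = 0"
    using lag k1(1) k2(1) eps(1) by auto
  show "\<exists>v. A v \<noteq> 0"
  proof (rule ccontr)
    assume "\<nexists>v. A v \<noteq> 0"
    then have "inj B" unfolding linear_injective_0[OF lB] using ker by blast
    then show False using plane_inj_iff[OF lB] det(2) by simp
  qed
  show "\<exists>v. B v \<noteq> 0"
  proof (rule ccontr)
    assume "\<nexists>v. B v \<noteq> 0"
    then have "inj A" unfolding linear_injective_0[OF lA] using ker by blast
    then show False using plane_inj_iff[OF lA] det(1) by simp
  qed
qed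

text \<open>Coordinates \<open>l\<^sub>1 \<circ> \<phi>\<close> and \<open>l\<^sub>2 \<circ> \<psi>\<close> with nonzero differentials are local coordinates of the surface; in
  these \<open>\<phi>\<close> does not depend on the second and \<open>\<psi>\<close> not on the first coordinate.\<close>

lemma local_split:
  assumes c: "c \<in> charts_at S p"
  obtains W X Y I \<phi> K \<psi> \<gamma> where
    "split_immersion M1 g1 M2 g2 \<epsilon> S \<Phi> c p W X Y I \<phi> K \<psi>" "W \<subseteq> snd c ` fst c"
    "smooth_on (I \<times> K) \<gamma>" "\<gamma> ` (I \<times> K) = W" "\<And>z. z \<in> W \<Longrightarrow> \<gamma> (X z, Y z) = z"
    "\<And>x. x \<in> I \<times> K \<Longrightarrow> (X (\<gamma> x), Y (\<gamma> x)) = x"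
proof -
  note cD = charts_atD[OF c]
  have top: "\<Phi> p \<in> topspace (mtop N)" by (rule smooth_map_topspace[OF L_smooth charts_at_topspace[OF S c]])
  obtain d1 d2 where d: "d1 \<in> charts_at M1 (fst (\<Phi> p))" "d2 \<in> charts_at M2 (snd (\<Phi> p))"
    by (rule chart_at_product[OF top]) (rule that; assumption)
  note d1D = charts_atD[OF d(1)] note d2D = charts_atD[OF d(2)]
  let ?f1 = "local_rep c d1 (fst \<circ> \<Phi>)" and ?f2 = "local_rep c d2 (snd \<circ> \<Phi>)"
  note F1 = smooth_map_local_rep[OF S S1.M L_smooth_fst cD(1) d1D(1)]
  note F2 = smooth_map_local_rep[OF S S2.M L_smooth_snd cD(1) d2D(1)]
  let ?z0 = "snd c p"
  define Q where "Q = snd c ` (fst c \<inter> (fst \<circ> \<Phi>) -` fst d1) \<inter> snd c ` (fst c \<inter> (snd \<circ> \<Phi>) -` fst d2)"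
  have oQ: "open Q" unfolding Q_def by (rule open_Int[OF F1(1) F2(1)])
  have z0Q: "?z0 \<in> Q" unfolding Q_def using cD(2) d1D(2) d2D(2) by auto
  have f1: "smooth_on Q ?f1" by (rule smooth_on_subset[OF F1(2)]) (simp add: Q_def)
  have f2: "smooth_on Q ?f2" by (rule smooth_on_subset[OF F2(2)]) (simp add: Q_def)
  have point: "\<exists>q. c \<in> charts_at S q \<and> d1 \<in> charts_at M1 (fst (\<Phi> q)) \<and> d2 \<in> charts_at M2 (snd (\<Phi> q)) \<and> z = snd c q"
    if "z \<in> Q" for z
  proof -
    obtain q where q: "q \<in> fst c" "fst (\<Phi> q) \<in> fst d1" "z = snd c q" using \<open>z \<in> Q\<close> unfolding Q_def by auto
    obtain q' where q': "q' \<in> fst c" "snd (\<Phi> q') \<in> fst d2" "z = snd c q'" using \<open>z \<in> Q\<close> unfolding Q_def by auto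
    have "q = q'" using cinv_chart[OF S cD(1) q(1)] cinv_chart[OF S cD(1) q'(1)] q(3) q'(3) by simp
    then show ?thesis using q q' cD(1) d1D(1) d2D(1) by (intro exI[of _ q]) (simp add: charts_at_def)
  qed
  \<comment> \<open>Neither differential vanishes at \<open>p\<close>, so on each factor one of the
    two chart coordinates, \<open>l1\<close> or \<open>l2\<close>, has nonzero derivative in a
    direction \<open>v1\<close> or \<open>v2\<close>. These become the coordinates \<open>X\<close>
    and \<open>Y\<close>.\<close>
  obtain v1 where v1: "frd ?f1 ?z0 v1 \<noteq> 0" using lagrangian_differentials(6)[OF c d, unfolded tmap_def] ..
  obtain v2 where v2: "frd ?f2 ?z0 v2 \<noteq> 0" using lagrangian_differentials(7)[OF c d, unfolded tmap_def] ..
  obtain l1 :: "real \<times> real \<Rightarrow> real" where l1: "bounded_linear l1" "l1 (frd ?f1 ?z0 v1) \<noteq> 0" by (rule plane_coordinate[OF v1])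
  obtain l2 :: "real \<times> real \<Rightarrow> real" where l2: "bounded_linear l2" "l2 (frd ?f2 ?z0 v2) \<noteq> 0" by (rule plane_coordinate[OF v2])
  note lin = bounded_linear.linear[OF l1(1)] bounded_linear.linear[OF l2(1)]
  define X where "X z = l1 (?f1 z)" for z
  define Y where "Y z = l2 (?f2 z)" for z
  have X: "smooth_on Q X" unfolding X_def[abs_def] by (rule smooth_on_bounded_linear[OF l1(1) oQ f1])
  have Y: "smooth_on Q Y" unfolding Y_def[abs_def] by (rule smooth_on_bounded_linear[OF l2(1) oQ f2])
  have dX: "frd X z v = l1 (frd ?f1 z v)" if "z \<in> Q" for z v
    unfolding X_def[abs_def] by (subst frd_eq[OF bounded_linear.has_derivative[OF l1(1) smooth_on_has_derivative[OF f1 oQ that]]]) simp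
  have dY: "frd Y z v = l2 (frd ?f2 z v)" if "z \<in> Q" for z v
    unfolding Y_def[abs_def] by (subst frd_eq[OF bounded_linear.has_derivative[OF l2(1) smooth_on_has_derivative[OF f2 oQ that]]]) simp
  \<comment> \<open>On \<open>Q'\<close> the derivatives of \<open>X\<close> along \<open>v1\<close>
    and of \<open>Y\<close> along \<open>v2\<close> stay nonzero. There
    \<open>plane_singular_kernel\<close> identifies the kernel of \<open>dX\<close> with that of the
    first differential, and likewise for \<open>dY\<close>.\<close>
  define Q' where "Q' = (Q \<inter> (\<lambda>z. frd X z v1) -` (- {0})) \<inter> (Q \<inter> (\<lambda>z. frd Y z v2) -` (- {0}))"
  have oQ': "open Q'" unfolding Q'_def
    by (intro open_Int continuous_open_preimage[OF smooth_on_continuous[OF smooth_on_frd[OF X]] oQ]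
        continuous_open_preimage[OF smooth_on_continuous[OF smooth_on_frd[OF Y]] oQ]) auto
  have Q'Q: "Q' \<subseteq> Q" by (auto simp: Q'_def)
  have z0Q': "?z0 \<in> Q'" using z0Q l1(2) l2(2) dX dY by (simp add: Q'_def)
  have ker1: "frd ?f1 z v = 0" if z: "z \<in> Q'" and v: "l1 (frd ?f1 z v) = 0" for z v
  proof -
    have zQ: "z \<in> Q" using z Q'Q by blast
    obtain q where q: "c \<in> charts_at S q" "d1 \<in> charts_at M1 (fst (\<Phi> q))" "d2 \<in> charts_at M2 (snd (\<Phi> q))" "z = snd c q"
      using point[OF zQ] by blast
    note D = lagrangian_differentials[OF q(1-3), unfolded tmap_def, folded q(4)]
    have "l1 (frd ?f1 z v1) \<noteq> 0" using z dX[OF zQ] by (simp add: Q'_def)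
    then show ?thesis using plane_singular_kernel[OF D(1,3) lin(1) _ v] by blast
  qed
  have ker2: "frd ?f2 z v = 0" if z: "z \<in> Q'" and v: "l2 (frd ?f2 z v) = 0" for z v
  proof -
    have zQ: "z \<in> Q" using z Q'Q by blast
    obtain q where q: "c \<in> charts_at S q" "d1 \<in> charts_at M1 (fst (\<Phi> q))" "d2 \<in> charts_at M2 (snd (\<Phi> q))" "z = snd c q"
      using point[OF zQ] by blast
    note D = lagrangian_differentials[OF q(1-3), unfolded tmap_def, folded q(4)]
    have "l2 (frd ?f2 z v2) \<noteq> 0" using z dY[OF zQ] by (simp add: Q'_def)
    then show ?thesis using plane_singular_kernel[OF D(2,4) lin(2) _ v] by blast
  qed
  have indep: "inj (\<lambda>v. (frd X ?z0 v, frd Y ?z0 v))"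
  proof (rule injI)
    fix v w assume "(frd X ?z0 v, frd Y ?z0 v) = (frd X ?z0 w, frd Y ?z0 w)"
    then have "frd X ?z0 (v - w) = 0" "frd Y ?z0 (v - w) = 0"
      using linear_diff[OF smooth_on_linear_frd[OF X oQ z0Q]] linear_diff[OF smooth_on_linear_frd[OF Y oQ z0Q]] by simp_all
    then have "frd ?f1 ?z0 (v - w) = 0" "frd ?f2 ?z0 (v - w) = 0"
      using ker1[OF z0Q'] ker2[OF z0Q'] dX[OF z0Q] dY[OF z0Q] by simp_all
    then have "v - w = 0" using lagrangian_differentials(5)[OF c d, of "v - w"] unfolding tmap_def by blast
    then show "v = w" by simp
  qed
  define F where "F z = (X z, Y z)" for z
  have F: "smooth_on Q' F" unfolding F_def[abs_def]
    by (intro smooth_intros oQ' smooth_on_subset[OF X Q'Q] smooth_on_subset[OF Y Q'Q])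
  have dF: "frd F ?z0 = (\<lambda>v. (frd X ?z0 v, frd Y ?z0 v))"
    unfolding F_def[abs_def]
    by (rule frd_eq[OF has_derivative_Pair[OF smooth_on_has_derivative[OF X oQ z0Q] smooth_on_has_derivative[OF Y oQ z0Q]]])
  have nz: "signed_area (frd F ?z0 (1, 0)) (frd F ?z0 (0, 1)) \<noteq> 0"
  proof (rule iffD1[OF plane_inj_iff[OF smooth_on_linear_frd[OF F oQ' z0Q']]])
    show "inj (frd F ?z0)" unfolding dF by (rule indep)
  qed
  obtain U V \<gamma> where U: "open U" "U \<subseteq> Q'" "?z0 \<in> U" and V: "open V" "F ?z0 \<in> V"
    and hom: "homeomorphism U V F \<gamma>" and \<gamma>: "smooth_on V \<gamma>"
    by (rule smooth_local_inverse[OF F oQ' z0Q' nz])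
  \<comment> \<open>The range of the coordinates is shrunk to a product of intervals, so that points
    with the same \<open>s\<close> are joined by a segment along which only \<open>t\<close>
    varies.\<close>
  obtain A B where AB: "open A" "open B" "F ?z0 \<in> A \<times> B" "A \<times> B \<subseteq> V" by (rule open_prod_elim[OF V])
  obtain e1 where e1: "e1 > 0" "ball (X ?z0) e1 \<subseteq> A"
    using AB(3) open_contains_ball[THEN iffD1, OF AB(1), rule_format, of "X ?z0"] by (auto simp: F_def)
  obtain e2 where e2: "e2 > 0" "ball (Y ?z0) e2 \<subseteq> B"
    using AB(3) open_contains_ball[THEN iffD1, OF AB(2), rule_format, of "Y ?z0"] by (auto simp: F_def)
  define I where "I = ball (X ?z0) e1"
  define K where "K = ball (Y ?z0) e2"
  have I: "open_interval I" "X ?z0 \<in> I" and K: "open_interval K" "Y ?z0 \<in> K"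
    using e1(1) e2(1) by (auto simp: I_def K_def open_interval_def is_interval_ball_real)
  have IKV: "I \<times> K \<subseteq> V" unfolding I_def K_def by (rule subset_trans[OF Sigma_mono[OF e1(2) e2(2)] AB(4)])
  have oIK: "open (I \<times> K)" using I(1) K(1) by (intro open_Times) (auto simp: open_interval_def)
  define W where "W = U \<inter> F -` (I \<times> K)"
  have UQ: "U \<subseteq> Q" using U(2) Q'Q by blast
  have oW: "open W" unfolding W_def
    by (rule continuous_open_preimage[OF smooth_on_continuous[OF smooth_on_subset[OF F U(2)]] U(1) oIK])
  have z0W: "?z0 \<in> W" using U(3) I(2) K(2) by (simp add: W_def F_def)
  have gF: "\<gamma> (F z) = z" if "z \<in> U" for z using hom that unfolding homeomorphism_def by blast
  have Fg: "F (\<gamma> x) = x" "\<gamma> x \<in> U" if "x \<in> V" for x using hom that unfolding homeomorphism_def by blast+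
  have gW: "\<gamma> x \<in> W" if "x \<in> I \<times> K" for x
    using Fg[OF subsetD[OF IKV that]] that by (simp add: W_def)
  have \<gamma>IK: "smooth_on (I \<times> K) \<gamma>" by (rule smooth_on_subset[OF \<gamma> IKV])
  have gQ': "\<gamma> x \<in> Q'" if "x \<in> I \<times> K" for x using gW[OF that] U(2) by (auto simp: W_def)
  have gXY: "X (\<gamma> (s, t)) = s" "Y (\<gamma> (s, t)) = t" if "s \<in> I" "t \<in> K" for s t
    using Fg(1)[OF subsetD[OF IKV, of "(s, t)"]] that by (simp_all add: F_def)
  have \<gamma>img: "\<gamma> ` (I \<times> K) = W"
  proof
    show "\<gamma> ` (I \<times> K) \<subseteq> W" using gW by blast
    show "W \<subseteq> \<gamma> ` (I \<times> K)"
    proof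
      fix z assume z: "z \<in> W"
      then have "F z \<in> I \<times> K" "\<gamma> (F z) = z" using gF by (auto simp: W_def)
      then show "z \<in> \<gamma> ` (I \<times> K)" by (metis imageI)
    qed
  qed
  define \<phi> where "\<phi> s = (fst \<circ> \<Phi>) (cinv c (\<gamma> (s, Y ?z0)))" for s
  define \<psi> where "\<psi> t = (snd \<circ> \<Phi>) (cinv c (\<gamma> (X ?z0, t)))" for t
  have sub1: "\<gamma> ` (I \<times> K) \<subseteq> snd c ` (fst c \<inter> (fst \<circ> \<Phi>) -` fst d1)"
  proof (rule image_subsetI)
    fix x assume x: "x \<in> I \<times> K"
    show "\<gamma> x \<in> snd c ` (fst c \<inter> (fst \<circ> \<Phi>) -` fst d1)"
      using subsetD[OF Q'Q gQ'[OF x]] unfolding Q_def by (rule IntD1)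
  qed
  have sub2: "\<gamma> ` (I \<times> K) \<subseteq> snd c ` (fst c \<inter> (snd \<circ> \<Phi>) -` fst d2)"
  proof (rule image_subsetI)
    fix x assume x: "x \<in> I \<times> K"
    show "\<gamma> x \<in> snd c ` (fst c \<inter> (snd \<circ> \<Phi>) -` fst d2)"
      using subsetD[OF Q'Q gQ'[OF x]] unfolding Q_def by (rule IntD2)
  qed
  have fc1: "regular_curve M1 I \<phi>" "\<And>s t. s \<in> I \<Longrightarrow> t \<in> K \<Longrightarrow> (fst \<circ> \<Phi>) (cinv c (\<gamma> (s, t))) = \<phi> s"
    unfolding \<phi>_def[abs_def]
    by (rule S1.factor_curve[OF S L_smooth_fst cD(1) d1D(1) l1(1) I(1) K(1) \<gamma>IK sub1 _ _ K(2)];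
        use gXY ker1[OF gQ'] in \<open>simp add: X_def\<close>)+
  have oKI: "open (K \<times> I)" using I(1) K(1) by (intro open_Times) (auto simp: open_interval_def)
  \<comment> \<open>For the second factor the roles of the coordinates are exchanged;
    \<open>factor_curve\<close> keeps the first coordinate of its parametrisation.\<close>
  define \<gamma>' where "\<gamma>' x = \<gamma> (snd x, fst x)" for x
  have sw: "(snd x, fst x) \<in> I \<times> K" if "x \<in> K \<times> I" for x using that by auto
  have \<gamma>': "smooth_on (K \<times> I) \<gamma>'" unfolding \<gamma>'_def[abs_def]
    by (rule smooth_on_compose[OF \<gamma>IK oKI oIK]) (use sw in \<open>auto intro!: smooth_intros oKI\<close>)
  have sub2': "\<gamma>' ` (K \<times> I) \<subseteq> snd c ` (fst c \<inter> (snd \<circ> \<Phi>) -` fst d2)"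
  proof (rule image_subsetI)
    fix x assume "x \<in> K \<times> I"
    then show "\<gamma>' x \<in> snd c ` (fst c \<inter> (snd \<circ> \<Phi>) -` fst d2)" unfolding \<gamma>'_def by (intro subsetD[OF sub2] imageI sw)
  qed
  have \<psi>': "\<psi> = (\<lambda>t. (snd \<circ> \<Phi>) (cinv c (\<gamma>' (t, X ?z0))))" by (simp add: \<psi>_def[abs_def] \<gamma>'_def)
  have fc2: "regular_curve M2 K \<psi>"
    unfolding \<psi>'
  proof (rule S2.factor_curve(1)[OF S L_smooth_snd cD(1) d2D(1) l2(1) K(1) I(1) \<gamma>' sub2' _ _ I(2)])
    show "l2 (?f2 (\<gamma>' (t, s))) = t" if "t \<in> K" "s \<in> I" for t s using gXY(2)[OF that(2,1)] by (simp add: \<gamma>'_def Y_def)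
    show "frd ?f2 (\<gamma>' x) v = 0" if "x \<in> K \<times> I" "l2 (frd ?f2 (\<gamma>' x) v) = 0" for x v
      using ker2[OF gQ'[OF sw[OF that(1)]]] that(2) by (simp add: \<gamma>'_def)
  qed
  have fc2': "(snd \<circ> \<Phi>) (cinv c (\<gamma> (s, t))) = \<psi> t" if s: "s \<in> I" and t: "t \<in> K" for s t
  proof -
    have "(snd \<circ> \<Phi>) (cinv c (\<gamma>' (t, s))) = (snd \<circ> \<Phi>) (cinv c (\<gamma>' (t, X ?z0)))"
    proof (rule S2.factor_curve(2)[OF S L_smooth_snd cD(1) d2D(1) l2(1) K(1) I(1) \<gamma>' sub2' _ _ I(2) t s])
      show "l2 (?f2 (\<gamma>' (t, s))) = t" if "t \<in> K" "s \<in> I" for t s using gXY(2)[OF that(2,1)] by (simp add: \<gamma>'_def Y_def)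
      show "frd ?f2 (\<gamma>' x) v = 0" if "x \<in> K \<times> I" "l2 (frd ?f2 (\<gamma>' x) v) = 0" for x v
        using ker2[OF gQ'[OF sw[OF that(1)]]] that(2) by (simp add: \<gamma>'_def)
    qed
    then show ?thesis by (simp add: \<gamma>'_def \<psi>_def)
  qed
  have WQ: "W \<subseteq> Q" using UQ by (auto simp: W_def)
  have spl: "\<Phi> (cinv c z) = (\<phi> (X z), \<psi> (Y z))" if z: "z \<in> W" for z
  proof -
    have xy: "X z \<in> I" "Y z \<in> K" using z by (auto simp: W_def F_def)
    have e: "\<gamma> (X z, Y z) = z" using gF[of z] z by (simp add: W_def F_def)
    show ?thesis using fc1(2)[OF xy, unfolded e] fc2'[OF xy, unfolded e] by (simp add: prod_eq_iff)
  qed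
  have "split_immersion M1 g1 M2 g2 \<epsilon> S \<Phi> c p W X Y I \<phi> K \<psi>"
  proof unfold_locales
    show "X ` W \<subseteq> I" "Y ` W \<subseteq> K" by (auto simp: W_def F_def)
  qed (fact S L_smooth c fc1(1) fc2 oW z0W smooth_on_subset[OF X WQ] smooth_on_subset[OF Y WQ] spl indep)+
  moreover have "W \<subseteq> snd c ` fst c" using WQ unfolding Q_def by blast
  moreover have "\<gamma> (X z, Y z) = z" if "z \<in> W" for z using gF[of z] that by (simp add: W_def F_def)
  moreover have "(X (\<gamma> x), Y (\<gamma> x)) = x" if "x \<in> I \<times> K" for x
    using Fg(1)[OF subsetD[OF IKV that]] by (simp add: F_def)
  ultimately show thesis by (rule that[OF _ _ \<gamma>IK \<gamma>img])
qed

text \<open>The parametrisation \<open>\<xi>\<close> is the one found in the chart, carried to the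
  surface. Its inverse is given by \<open>X\<close> and \<open>Y\<close>, and so it is
  smooth.\<close>

lemma local_parametrisation:
  assumes p: "p \<in> topspace (mtop S)"
  shows "\<exists>V I K \<xi> \<phi> \<psi>. openin (mtop S) V \<and> p \<in> V \<and> regular_curve M1 I \<phi> \<and> regular_curve M2 K \<psi> \<and>
    diffeomorphism (open_region (I \<times> K)) (open_submanifold S V) \<xi> \<and>
    (\<forall>s\<in>I. \<forall>t\<in>K. \<Phi> (\<xi> (s, t)) = (\<phi> s, \<psi> t))"
proof -
  note c = chart_at_charts_at[OF S p]
  let ?c = "chart_at S p"
  note cD = charts_atD[OF c]
  obtain W X Y I \<phi> K \<psi> \<gamma> where sp: "split_immersion M1 g1 M2 g2 \<epsilon> S \<Phi> ?c p W X Y I \<phi> K \<psi>" and Wc: "W \<subseteq> snd ?c ` fst ?c"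
    and \<gamma>: "smooth_on (I \<times> K) \<gamma>" "\<gamma> ` (I \<times> K) = W" and gF: "\<And>z. z \<in> W \<Longrightarrow> \<gamma> (X z, Y z) = z"
    and Fg: "\<And>x. x \<in> I \<times> K \<Longrightarrow> (X (\<gamma> x), Y (\<gamma> x)) = x"
    by (rule local_split[OF c]) (rule that; assumption)
  interpret P: split_immersion M1 g1 M2 g2 \<epsilon> S \<Phi> ?c p W X Y I \<phi> K \<psi> by (rule sp)
  have oIK: "open (I \<times> K)" by (rule open_IK[OF P.reg])
  define V where "V = {q\<in>fst ?c. snd ?c q \<in> W}"
  have V: "openin (mtop S) V" "p \<in> V"
    unfolding V_def by (rule chart_preimage_open[OF S cD(1) P.W(1)], simp add: cD(2) P.W(2))
  have Vtop: "V \<subseteq> topspace (mtop S)" using openin_subset[OF V(1)] .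
  define \<xi> where "\<xi> x = cinv ?c (\<gamma> x)" for x
  have \<xi>: "\<xi> x \<in> V" "snd ?c (\<xi> x) = \<gamma> x" if "x \<in> I \<times> K" for x
  proof -
    have "\<gamma> x \<in> W" using \<gamma>(2) that by blast
    moreover from this have "\<gamma> x \<in> snd ?c ` fst ?c" using Wc by blast
    ultimately show "\<xi> x \<in> V" "snd ?c (\<xi> x) = \<gamma> x"
      using chart_cinv[of "\<gamma> x" ?c] cinv_domain[of "\<gamma> x" ?c] by (simp_all add: \<xi>_def V_def)
  qed
  define \<eta> where "\<eta> q = (X (snd ?c q), Y (snd ?c q))" for q
  have \<eta>: "\<eta> q \<in> I \<times> K" "\<xi> (\<eta> q) = q" if "q \<in> V" for q
  proof -
    have q: "q \<in> fst ?c" "snd ?c q \<in> W" using that by (simp_all add: V_def)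
    have "X (snd ?c q) \<in> I" "Y (snd ?c q) \<in> K" using P.X(2) P.Y(2) q(2) by blast+
    then show "\<eta> q \<in> I \<times> K" by (simp add: \<eta>_def)
    show "\<xi> (\<eta> q) = q" unfolding \<xi>_def \<eta>_def gF[OF q(2)] by (rule cinv_chart[OF S cD(1) q(1)])
  qed
  have \<eta>\<xi>: "\<eta> (\<xi> x) = x" if "x \<in> I \<times> K" for x using \<xi>(2)[OF that] Fg[OF that] by (simp add: \<eta>_def)
  have inj: "inj_on \<xi> (I \<times> K)" by (rule inj_on_inverseI[where g = \<eta>]) (rule \<eta>\<xi>)
  have img: "\<xi> ` (I \<times> K) = V"
  proof
    show "\<xi> ` (I \<times> K) \<subseteq> V" by (rule image_subsetI) (rule \<xi>(1))
    show "V \<subseteq> \<xi> ` (I \<times> K)"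
    proof
      fix q assume "q \<in> V"
      from \<eta>[OF this] show "q \<in> \<xi> ` (I \<times> K)" by (intro image_eqI[of _ _ "\<eta> q"]) simp_all
    qed
  qed
  have SV: "smooth_atlas (open_submanifold S V)" by (rule smooth_atlas_open_submanifold[OF S V(1)])
  have top: "topspace (mtop (open_submanifold S V)) = V" using Vtop by (auto simp: mtop_open_submanifold topspace_subtopology)
  let ?d = "(fst ?c \<inter> V, snd ?c)"
  have dat: "?d \<in> atlas (open_submanifold S V)" using cD(1) by (auto simp: atlas_open_submanifold)
  have "smooth_map (open_region (I \<times> K)) (open_submanifold S V) \<xi>"
  proof (rule smooth_map_open_regionI[OF oIK SV], intro bexI[OF _ dat] exI[of _ "I \<times> K"] conjI)
    show "I \<times> K \<subseteq> I \<times> K \<inter> \<xi> -` fst ?d"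
    proof
      fix x assume x: "x \<in> I \<times> K"
      show "x \<in> I \<times> K \<inter> \<xi> -` fst ?d" using x \<xi>(1)[OF x] unfolding V_def by simp
    qed
    show "smooth_on (I \<times> K) (\<lambda>x. snd ?d (\<xi> x))"
      by (rule iffD2[OF smooth_on_cong[OF oIK] \<gamma>(1)]) (simp add: \<xi>(2))
  qed (use oIK in auto)
  moreover have "smooth_map (open_submanifold S V) (open_region (I \<times> K)) (inv_into (topspace (mtop (open_region (I \<times> K)))) \<xi>)"
  proof (rule smooth_mapI[OF SV smooth_atlas_open_region[OF oIK]])
    let ?g = "inv_into (topspace (mtop (open_region (I \<times> K)))) \<xi>"
    have g: "?g q = \<eta> q" if "q \<in> V" for q
      using inv_into_f_eq[OF inj \<eta>(1)[OF that] \<eta>(2)[OF that]] by simp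
    fix q assume "q \<in> topspace (mtop (open_submanifold S V))"
    then have q: "q \<in> V" using top by simp
    have WV: "W = snd ?c ` (fst ?c \<inter> V)"
    proof
      show "W \<subseteq> snd ?c ` (fst ?c \<inter> V)"
      proof
        fix z assume z: "z \<in> W"
        show "z \<in> snd ?c ` (fst ?c \<inter> V)"
          using z cinv_domain[OF subsetD[OF Wc z]] chart_cinv[OF subsetD[OF Wc z]]
          by (intro image_eqI[of _ _ "cinv ?c z"]) (simp_all add: V_def)
      qed
    qed (auto simp: V_def)
    have XY: "smooth_on W (\<lambda>z. (X z, Y z))" by (intro smooth_intros P.W P.X P.Y)
    have rep: "(X z, Y z) = local_rep ?d (I \<times> K, id) ?g z" if z: "z \<in> W" for z
    proof -
      have "cinv ?d z = cinv ?c z" by (rule cinv_restrict[OF S cD(1)]) (use z WV in simp)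
      moreover have "cinv ?c z \<in> V" "snd ?c (cinv ?c z) = z"
        using z cinv_domain[OF subsetD[OF Wc z]] chart_cinv[OF subsetD[OF Wc z]] by (simp_all add: V_def)
      ultimately show ?thesis using g by (simp add: local_rep_def \<eta>_def)
    qed
    have sW: "smooth_on W (local_rep ?d (I \<times> K, id) ?g)"
      by (rule iffD1[OF smooth_on_cong[OF P.W(1)] XY]) (rule rep)
    have "W \<subseteq> snd ?d ` (fst ?d \<inter> ?g -` fst (I \<times> K, id))"
    proof
      fix z assume "z \<in> W"
      then obtain q where q: "q \<in> fst ?c \<inter> V" "z = snd ?c q" unfolding WV by blast
      then have "?g q \<in> I \<times> K" using g \<eta>(1) by simp
      then show "z \<in> snd ?d ` (fst ?d \<inter> ?g -` fst (I \<times> K, id))" using q by (intro image_eqI[of _ _ q]) simp_all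
    qed
    moreover have "?d \<in> charts_at (open_submanifold S V) q" by (rule charts_atI[OF dat]) (use q in \<open>simp add: V_def\<close>)
    moreover have "(I \<times> K, id) \<in> charts_at (open_region (I \<times> K)) (?g q)"
      using g[OF q] \<eta>(1)[OF q] by (simp add: charts_at_open_region)
    moreover have "snd ?d q \<in> W" using q by (simp add: V_def)
    ultimately show "\<exists>c\<in>charts_at (open_submanifold S V) q. \<exists>d\<in>charts_at (open_region (I \<times> K)) (?g q). \<exists>W. open W \<and>
        snd c q \<in> W \<and> W \<subseteq> snd c ` (fst c \<inter> ?g -` fst d) \<and> smooth_on W (local_rep c d ?g)"
      using sW P.W(1) by (intro bexI[of _ ?d] bexI[of _ "(I \<times> K, id)"] exI[of _ W] conjI)
  qed
  ultimately have "diffeomorphism (open_region (I \<times> K)) (open_submanifold S V) \<xi>"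
    unfolding diffeomorphism_def top using inj img by (simp add: bij_betw_def)
  moreover have "\<Phi> (\<xi> (s, t)) = (\<phi> s, \<psi> t)" if "s \<in> I" "t \<in> K" for s t
  proof -
    have x: "(s, t) \<in> I \<times> K" using that by simp
    then have "\<gamma> (s, t) \<in> W" using \<gamma>(2) by blast
    from P.split[OF this] show ?thesis using Fg[OF x] by (simp add: \<xi>_def)
  qed
  ultimately show ?thesis
    using V P.reg by (intro exI[of _ V] exI[of _ I] exI[of _ K] exI[of _ \<xi>] exI[of _ \<phi>] exI[of _ \<psi>]) simp
qed

lemma minimal_totally_geodesic:
  assumes min: "minimal_immersion S N G \<Phi>"
  shows "totally_geodesic S N G \<Phi>"
  unfolding totally_geodesic_def
proof (intro conjI ballI allI)
  show "immersion S N \<Phi>" "nondegenerate S (pullback N G \<Phi>)" using min unfolding minimal_immersion_def by blast+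
  fix p c d v w assume p: "p \<in> topspace (mtop S)" and cp: "c \<in> charts_at S p" and d: "d \<in> charts_at N (\<Phi> p)"
  have H0: "mean_curvature N G \<Phi> c d p = 0" using min p cp d unfolding minimal_immersion_def by blast
  obtain W X Y I \<phi> K \<psi> \<gamma> where sp: "split_immersion M1 g1 M2 g2 \<epsilon> S \<Phi> c p W X Y I \<phi> K \<psi>"
    by (rule local_split[OF cp]) (rule that; assumption)
  interpret P: split_immersion M1 g1 M2 g2 \<epsilon> S \<Phi> c p W X Y I \<phi> K \<psi> by (rule sp)
  obtain d1 d2 where d': "d1 \<in> charts_at M1 (fst (\<Phi> p))" "d2 \<in> charts_at M2 (snd (\<Phi> p))" "d = prod_chart d1 d2"
    using d unfolding charts_at_product by blast
  have d12: "d1 \<in> charts_at M1 (\<phi> P.s0)" "d2 \<in> charts_at M2 (\<psi> P.t0)" using d'(1,2) P.\<Phi>p by simp_all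
  have "S1.kv \<phi> P.s0 = 0" "S2.kv \<psi> P.t0 = 0" using H0 P.mean_curvature_zero_iff[OF d12] unfolding d'(3) by auto
  then show "second_fundamental_form G \<Phi> c d p v w = 0"
    unfolding d'(3) by (rule P.second_fundamental_form_zero[OF d12])
qed

end

end

section \<open>The volume of a region in the plane\<close>

text \<open>The description in \<open>volume_measure\<close> is resolved by the measure with the
  area density. On a compact set its value is then an ordinary integral, which can be differentiated
  under the integral sign.\<close>

lemma volume_measure_open_region:
  fixes h :: "(real \<times> real, real \<times> real) tensor2"
  assumes W: "open W" and cont: "continuous_on W (area_density h (W, id))" and K: "compact K" "K \<subseteq> W"
  shows "measure (volume_measure (open_region W) h) K = integral K (area_density h (W, id))"
    and "area_density h (W, id) integrable_on K"
proof -
  let ?d = "area_density h (W, id)"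
  let ?P = "\<lambda>\<mu>. space \<mu> = topspace (mtop (open_region W)) \<and>
     sets \<mu> = sigma_sets (topspace (mtop (open_region W))) {U. openin (mtop (open_region W)) U} \<and>
     (\<forall>c\<in>atlas (open_region W). \<forall>A\<in>sets \<mu>. A \<subseteq> fst c \<longrightarrow>
        emeasure \<mu> A = (\<integral>\<^sup>+ x\<in>snd c ` A. ennreal (area_density h c (cinv c x)) \<partial>lborel))"
  define \<mu> where "\<mu> = density (restrict_space lborel W) (\<lambda>x. ennreal (?d x))"
  have Wb: "W \<in> sets lborel" using W by simp
  have meas: "(\<lambda>x. ennreal (?d x)) \<in> borel_measurable (restrict_space lborel W)"
  proof -
    have "?d \<in> borel_measurable (restrict_space borel W)" by (rule borel_measurable_continuous_on_restrict[OF cont])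
    then have "?d \<in> borel_measurable (restrict_space lborel W)"
      by (simp cong: measurable_cong_sets add: sets_restrict_space)
    then show ?thesis by measurable
  qed
  have sp: "space \<mu> = W" unfolding \<mu>_def using Wb by simp
  have openW: "openin (top_of_set W) U \<longleftrightarrow> open U \<and> U \<subseteq> W" for U by (rule openin_open_eq[OF W])
  have sets: "sets \<mu> = sigma_sets W {U. openin (top_of_set W) U}"
  proof -
    have "sets \<mu> = (\<inter>) W ` sigma_sets UNIV {S. open S}"
      by (simp add: \<mu>_def sets_restrict_space borel_def)
    also have "\<dots> = sigma_sets W ((\<inter>) W ` {S. open S})"
      by (rule sigma_sets_Int) (use W in auto)
    also have "(\<inter>) W ` {S. open S} = {U. openin (top_of_set W) U}"
    proof
      show "(\<inter>) W ` {S. open S} \<subseteq> {U. openin (top_of_set W) U}" using W by (auto simp: openW)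
      show "{U. openin (top_of_set W) U} \<subseteq> (\<inter>) W ` {S. open S}"
      proof
        fix U assume "U \<in> {U. openin (top_of_set W) U}"
        then have "open U" "U = W \<inter> U" by (auto simp: openW)
        then show "U \<in> (\<inter>) W ` {S. open S}" by (intro image_eqI[of _ _ U]) simp_all
      qed
    qed
    finally show ?thesis .
  qed
  have em: "emeasure \<mu> A = (\<integral>\<^sup>+ x\<in>A. ennreal (?d (cinv (W, id) x)) \<partial>lborel)" if A: "A \<in> sets \<mu>" for A
  proof -
    have AW: "A \<subseteq> W" using sets.sets_into_space[OF A] sp by simp
    have "A \<in> sets (restrict_space lborel W)" using A by (simp add: \<mu>_def)
    then have "emeasure \<mu> A = (\<integral>\<^sup>+ x. ennreal (?d x) * indicator A x \<partial>restrict_space lborel W)"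
      unfolding \<mu>_def by (rule emeasure_density[OF meas])
    also have "\<dots> = (\<integral>\<^sup>+ x. (ennreal (?d x) * indicator A x) * indicator W x \<partial>lborel)"
      by (rule nn_integral_restrict_space) (use Wb in simp)
    also have "\<dots> = (\<integral>\<^sup>+ x. ennreal (?d (cinv (W, id) x)) * indicator A x \<partial>lborel)"
      by (rule nn_integral_cong) (use AW in \<open>auto simp: indicator_def cinv_id\<close>)
    finally show ?thesis .
  qed
  have "?P \<mu>" using sp sets em by simp
  \<comment> \<open>The only chart of the region covers all of \<open>W\<close>, so the defining
    formula prescribes the measure of every measurable set.\<close>
  moreover have "\<nu> = \<mu>" if \<nu>: "?P \<nu>" for \<nu>
  proof (rule measure_eqI)
    show "sets \<nu> = sets \<mu>" using \<nu> sets by simp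
    fix A assume A: "A \<in> sets \<nu>"
    have AW: "A \<subseteq> W" using sets.sets_into_space[OF A] \<nu> by simp
    have "emeasure \<nu> A = (\<integral>\<^sup>+ x\<in>A. ennreal (?d (cinv (W, id) x)) \<partial>lborel)"
      using conjunct2[OF conjunct2[OF \<nu>], rule_format, of "(W, id)" A] A AW by simp
    then show "emeasure \<nu> A = emeasure \<mu> A" using em A \<nu> sets by simp
  qed
  ultimately have vm: "volume_measure (open_region W) h = \<mu>"
    unfolding volume_measure_def by (rule the_equality)
  have contK: "continuous_on K ?d" by (rule continuous_on_subset[OF cont K(2)])
  have int: "set_integrable lborel K ?d"
    unfolding set_integrable_def by (rule borel_integrable_compact[OF K(1) contK])
  show "?d integrable_on K" by (rule set_borel_integral_eq_integral(1)[OF int])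
  have Ks: "K \<in> sets \<mu>"
  proof -
    have "K \<in> sets borel" using K(1) by (simp add: compact_imp_closed)
    moreover have "K = W \<inter> K" using K(2) by blast
    ultimately show ?thesis unfolding \<mu>_def by (auto simp: sets_restrict_space)
  qed
  have "emeasure \<mu> K = (\<integral>\<^sup>+ x. ennreal (indicator K x *\<^sub>R ?d x) \<partial>lborel)"
    unfolding em[OF Ks] by (rule nn_integral_cong) (use K(2) in \<open>auto simp: indicator_def cinv_id\<close>)
  also have "\<dots> = ennreal (\<integral>x. indicator K x *\<^sub>R ?d x \<partial>lborel)"
    by (rule nn_integral_eq_integral) (use int in \<open>auto simp: set_integrable_def area_density_def indicator_def\<close>)
  also have "\<dots> = ennreal (integral K ?d)"
    using set_borel_integral_eq_integral(2)[OF int] by (simp add: set_lebesgue_integral_def)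
  finally have e: "emeasure \<mu> K = ennreal (integral K ?d)" .
  have "integral K ?d \<ge> 0"
    by (rule Henstock_Kurzweil_Integration.integral_nonneg[OF set_borel_integral_eq_integral(1)[OF int]]) (simp add: area_density_def)
  then show "measure (volume_measure (open_region W) h) K = integral K ?d"
    unfolding vm measure_def e by simp
qed

section \<open>Variations of a curve\<close>

context surface
begin

lemma pullback_chart:
  assumes S: "smooth_atlas S" and f: "smooth_map S M f" and c: "c \<in> charts_at S p" and d: "d \<in> charts_at M (f p)"
  shows "pullback M g f c p v w = g d (f p) (tmap c d f p v) (tmap c d f p w)"
proof -
  have d': "chart_at M (f p) \<in> charts_at M (f p)" by (rule chart_at_charts_at[OF M charts_at_topspace[OF M d]])
  show ?thesis
    unfolding pullback_def Let_def tmap_change_target[OF S M f c d d'] by (rule metric_at(4)[OF d d'])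
qed

context
  fixes Z :: "'z::euclidean_space set" and F
  assumes Z: "open Z" and F: "smooth_map (open_region Z) M F"
begin

lemma pullback_local:
  assumes d: "d \<in> atlas M"
  defines "J \<equiv> Z \<inter> F -` fst d"
  shows "open J" "smooth_on J (\<lambda>z. snd d (F z))" "(\<lambda>z. snd d (F z)) ` J \<subseteq> snd d ` fst d"
    "\<And>z v w. z \<in> J \<Longrightarrow> pullback M g F (Z, id) z v w = Gc d (snd d (F z)) (frd (\<lambda>z. snd d (F z)) z v) (frd (\<lambda>z. snd d (F z)) z w)"
proof -
  note A = smooth_map_open_region[OF Z M F d, folded J_def]
  show "open J" "smooth_on J (\<lambda>z. snd d (F z))" by (fact A)+
  show "(\<lambda>z. snd d (F z)) ` J \<subseteq> snd d ` fst d" unfolding J_def by auto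
  fix z v w assume z: "z \<in> J"
  have zZ: "z \<in> Z" and dz: "d \<in> charts_at M (F z)" using z d by (auto simp: J_def charts_at_def)
  have c: "(Z, id) \<in> charts_at (open_region Z) z" using zZ by (simp add: charts_at_open_region)
  show "pullback M g F (Z, id) z v w = Gc d (snd d (F z)) (frd (\<lambda>z. snd d (F z)) z v) (frd (\<lambda>z. snd d (F z)) z w)"
    unfolding pullback_chart[OF smooth_atlas_open_region[OF Z] F c dz] Gc_at[OF dz] tmap_open_region[OF Z zZ] ..
qed

lemma pullback_smooth: "smooth_on Z (\<lambda>z. pullback M g F (Z, id) z v w)"
proof (rule smooth_on_local)
  fix z assume z: "z \<in> Z"
  let ?d = "chart_at M (F z)"
  have top: "F z \<in> topspace (mtop M)" using smooth_map_topspace[OF F] z by simp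
  note dz = chart_at_charts_at[OF M top] note d = charts_atD[OF dz]
  note L = pullback_local[OF d(1)]
  interpret smooth_metric_field "snd ?d ` fst ?d" "Gc ?d" by (rule field[OF d(1)])
  let ?J = "Z \<inter> F -` fst ?d"
  have "smooth_on ?J (\<lambda>z. Gc ?d (snd ?d (F z)) (frd (\<lambda>z. snd ?d (F z)) z v) (frd (\<lambda>z. snd ?d (F z)) z w))"
    by (rule smooth_field[OF L(1,2) smooth_on_frd[OF L(2)] smooth_on_frd[OF L(2)] L(3)])
  then have "smooth_on ?J (\<lambda>z. pullback M g F (Z, id) z v w)"
    by (rule iffD1[OF smooth_on_cong[OF L(1)], rotated]) (simp add: L(4))
  then show "\<exists>U. open U \<and> z \<in> U \<and> smooth_on U (\<lambda>z. pullback M g F (Z, id) z v w)"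
    using L(1) z d(2) by (intro exI[of _ ?J]) simp
qed

text \<open>The square of \<open>dF(v)\<close> vanishes to second order where \<open>dF(v)\<close>
  vanishes. This disposes of the factor that does not move in the coordinate direction under
  consideration.\<close>

lemma pullback_derivative_degenerate:
  assumes z: "z \<in> Z" and d: "d \<in> charts_at M (F z)" and zero: "frd (\<lambda>z. snd d (F z)) z v = 0"
  shows "frd (\<lambda>z. pullback M g F (Z, id) z v v) z e = 0"
proof -
  note dD = charts_atD[OF d] note L = pullback_local[OF dD(1)]
  interpret smooth_metric_field "snd d ` fst d" "Gc d" by (rule field[OF dD(1)])
  let ?J = "Z \<inter> F -` fst d" and ?f = "\<lambda>z. snd d (F z)"
  have zJ: "z \<in> ?J" using z dD(2) by simp
  have fz: "?f z \<in> snd d ` fst d" using dD(2) by simp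
  have "frd (\<lambda>z. pullback M g F (Z, id) z v v) z = frd (\<lambda>z. Gc d (?f z) (frd ?f z v) (frd ?f z v)) z"
    by (rule frd_cong[OF L(1) zJ]) (rule L(4))
  also have "\<dots> = (\<lambda>e. dG (?f z) (frd ?f z e) (frd ?f z v) (frd ?f z v) + Gc d (?f z) (frd (\<lambda>z. frd ?f z v) z e) (frd ?f z v)
      + Gc d (?f z) (frd ?f z v) (frd (\<lambda>z. frd ?f z v) z e))"
    by (rule frd_eq[OF field_has_derivative[OF L(1) zJ L(3) smooth_on_has_derivative[OF L(2,1) zJ]
            smooth_on_has_derivative[OF smooth_on_frd[OF L(2)] L(1) zJ] smooth_on_has_derivative[OF smooth_on_frd[OF L(2)] L(1) zJ]]])
  finally show ?thesis
    unfolding zero by (simp add: bilinear_lzero[OF bilinear_G[OF fz]] bilinear_rzero[OF bilinear_G[OF fz]] bilinear_rzero[OF dG_bilinear[OF fz]])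
qed

text \<open>\<open>first_variation\<close> with the variation in direction \<open>e1\<close> and the
  curve in direction \<open>e2\<close>. The mixed term drops out and the pairing of the variation
  field with the acceleration remains, which is expressed by \<open>kv\<close> and the cube of the
  speed.\<close>

lemma normal_variation_derivative:
  assumes reg: "regular_curve M I \<gamma>" and J: "open J" "s \<in> J" "J \<subseteq> I"
    and line: "\<And>r. r \<in> J \<Longrightarrow> line r \<in> Z" "\<And>r. r \<in> J \<Longrightarrow> F (line r) = \<gamma> r" "\<And>r. r \<in> J \<Longrightarrow> (line has_vector_derivative e2) (at r)"
    and d: "d \<in> charts_at M (\<gamma> s)"
    and normal: "\<And>r. r \<in> J \<Longrightarrow> \<gamma> r \<in> fst d \<Longrightarrow>
      frd (\<lambda>z. snd d (F z)) (line r) e1 = \<beta> r *\<^sub>R rotation g d (\<gamma> r) (velocity d \<gamma> r)"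
  shows "frd (\<lambda>z. pullback M g F (Z, id) z e2 e2) (line s) e1 = - 2 * \<beta> s * kv \<gamma> s * sp \<gamma> s ^ 3"
proof -
  note dD = charts_atD[OF d] note L = pullback_local[OF dD(1)]
  note X = smooth_map_curve[OF M curve_open[OF reg] curve_smooth[OF reg] dD(1)]
  interpret smooth_metric_field "snd d ` fst d" "Gc d" by (rule field[OF dD(1)])
  let ?Z = "Z \<inter> F -` fst d" and ?f = "\<lambda>z. snd d (F z)"
  define J' where "J' = J \<inter> (I \<inter> \<gamma> -` fst d)"
  have J': "open J'" "s \<in> J'" unfolding J'_def using J X(1) dD(2) by auto
  have r: "r \<in> J" "r \<in> I" "\<gamma> r \<in> fst d" "line r \<in> ?Z" "d \<in> charts_at M (\<gamma> r)" if "r \<in> J'" for r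
    using that line dD(1) J(3) by (auto simp: J'_def charts_at_def)
  have f2: "frd ?f (line r) e2 = velocity d \<gamma> r" if "r \<in> J'" for r
  proof -
    have "((\<lambda>r. ?f (line r)) has_vector_derivative frd ?f (line r) e2) (at r)"
      by (rule frd_along[OF L(2,1) r(4)[OF that] line(3)[OF r(1)[OF that]] refl])
    then have "((\<lambda>r. snd d (\<gamma> r)) has_vector_derivative frd ?f (line r) e2) (at r)"
      by (rule has_vector_derivative_transform_within_open[OF _ J'(1) that]) (simp add: line(2) r(1))
    then show ?thesis unfolding velocity_def by (rule vector_derivative_at[symmetric])
  qed
  note zs = r(4)[OF J'(2)]
  have second: "frd (\<lambda>z. frd ?f z e2) (line s) e2 = vector_derivative (velocity d \<gamma>) (at s)"
  proof -
    have "((\<lambda>r. frd ?f (line r) e2) has_vector_derivative frd (\<lambda>z. frd ?f z e2) (line s) e2) (at s)"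
      by (rule frd_along[OF smooth_on_frd[OF L(2)] L(1) zs line(3)[OF J(2)] refl])
    then have "(velocity d \<gamma> has_vector_derivative frd (\<lambda>z. frd ?f z e2) (line s) e2) (at s)"
      by (rule has_vector_derivative_transform_within_open[OF _ J']) (rule f2)
    then show ?thesis by (rule vector_derivative_at[symmetric])
  qed
  have Q: "smooth_on ?Z (\<lambda>z. Gc d (?f z) (frd ?f z e1) (frd ?f z e2))"
    by (rule smooth_field[OF L(1,2) smooth_on_frd[OF L(2)] smooth_on_frd[OF L(2)] L(3)])
  \<comment> \<open>The variation field is normal along the whole curve and not only at
    \<open>s\<close>, so the derivative of the mixed coefficient along the curve is zero as
    well.\<close>
  have Q0: "frd (\<lambda>z. Gc d (?f z) (frd ?f z e1) (frd ?f z e2)) (line s) e2 = 0"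
  proof -
    have "((\<lambda>r. Gc d (?f (line r)) (frd ?f (line r) e1) (frd ?f (line r) e2)) has_vector_derivative
      frd (\<lambda>z. Gc d (?f z) (frd ?f z e1) (frd ?f z e2)) (line s) e2) (at s)"
      by (rule frd_along[OF Q L(1) zs line(3)[OF J(2)] refl])
    moreover have "Gc d (?f (line r)) (frd ?f (line r) e1) (frd ?f (line r) e2) = 0" if rJ: "r \<in> J'" for r
    proof -
      note rr = r[OF rJ]
      interpret P: plane_inner "g d (\<gamma> r)" by (rule inner[OF rr(5)])
      show ?thesis
        unfolding normal[OF rr(1,3)] f2[OF rJ] line(2)[OF rr(1)] Gc_at[OF rr(5)] rotation_eq[OF rr(5)]
        by (simp add: bilinear_lmul[OF P.bilin] P.sym[of "P.R _"] P.B_v_R)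
    qed
    ultimately have "((\<lambda>r. 0) has_vector_derivative frd (\<lambda>z. Gc d (?f z) (frd ?f z e1) (frd ?f z e2)) (line s) e2) (at s)"
      using has_vector_derivative_transform_within_open[OF _ J', where g = "\<lambda>r. 0 :: real"] by simp
    then show ?thesis using vector_derivative_unique_at[OF _ has_vector_derivative_const] by blast
  qed
  have "frd (\<lambda>z. pullback M g F (Z, id) z e2 e2) (line s) = frd (\<lambda>z. Gc d (?f z) (frd ?f z e2) (frd ?f z e2)) (line s)"
    by (rule frd_cong[OF L(1) zs]) (rule L(4))
  then have "frd (\<lambda>z. pullback M g F (Z, id) z e2 e2) (line s) e1 =
      - 2 * Gc d (?f (line s)) (frd ?f (line s) e1) (frd (\<lambda>z. frd ?f z e2) (line s) e2 + Chr (?f (line s)) (frd ?f (line s) e2) (frd ?f (line s) e2))"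
    using first_variation[OF L(2,1,3) zs, of e2 e1] Q0 by simp
  also have "\<dots> = - 2 * g d (\<gamma> s) (\<beta> s *\<^sub>R rotation g d (\<gamma> s) (velocity d \<gamma> s)) (acceleration g d \<gamma> s)"
    unfolding second f2[OF J'(2)] normal[OF J(2) dD(2)] line(2)[OF J(2)] Gc_at[OF d] acceleration_eq[of d \<gamma> s, OF d] ..
  also have "\<dots> = - 2 * (\<beta> s * g d (\<gamma> s) (acceleration g d \<gamma> s) (rotation g d (\<gamma> s) (velocity d \<gamma> s)))"
    by (simp add: bilinear_lmul[OF metric_at(1)[OF d]] metric_at(2)[OF d, of "rotation g d (\<gamma> s) (velocity d \<gamma> s)"])
  also have "\<dots> = - 2 * \<beta> s * kv \<gamma> s * sp \<gamma> s ^ 3" unfolding kv_eq[OF reg r(2)[OF J'(2)] d] by simp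
  finally show ?thesis .
qed

end

end

section \<open>Hamiltonian vector fields along a product of curves\<close>

context two_surfaces
begin

abbreviation "JJ \<equiv> product_rotation M1 g1 M2 g2"

text \<open>Transition maps commute with the rotations and are invertible, so the condition in the
  chosen charts is equivalent to that in \<open>d1\<close> and \<open>d2\<close>.\<close>

lemma product_rotation_eq:
  assumes d: "d1 \<in> charts_at M1 (fst q)" "d2 \<in> charts_at M2 (snd q)"
  shows "JJ (prod_chart d1 d2) q v = (rotation g1 d1 (fst q) (fst v), rotation g2 d2 (snd q) (snd v))"
proof -
  note c1 = chart_at_charts_at[OF S1.M charts_at_topspace[OF S1.M d(1)]]
  note c2 = chart_at_charts_at[OF S2.M charts_at_topspace[OF S2.M d(2)]]
  show ?thesis
    unfolding product_rotation_def Let_def tmap_prod_chart_fst[OF S1.M S2.M d c1] tmap_prod_chart_snd[OF S1.M S2.M d c2]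
      S1.rotation_change[OF d(1) c1] S2.rotation_change[OF d(2) c2]
  proof (rule the_equality)
    fix w assume w: "tmap d1 (chart_at M1 (fst q)) id (fst q) (fst w) = tmap d1 (chart_at M1 (fst q)) id (fst q) (rotation g1 d1 (fst q) (fst v)) \<and>
      tmap d2 (chart_at M2 (snd q)) id (snd q) (snd w) = tmap d2 (chart_at M2 (snd q)) id (snd q) (rotation g2 d2 (snd q) (snd v))"
    have "fst w = rotation g1 d1 (fst q) (fst v)"
      using arg_cong[OF conjunct1[OF w], of "tmap (chart_at M1 (fst q)) d1 id (fst q)"]
      unfolding tmap_transition_inverse[OF S1.M d(1) c1] .
    moreover have "snd w = rotation g2 d2 (snd q) (snd v)"
      using arg_cong[OF conjunct2[OF w], of "tmap (chart_at M2 (snd q)) d2 id (snd q)"]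
      unfolding tmap_transition_inverse[OF S2.M d(2) c2] .
    ultimately show "w = (rotation g1 d1 (fst q) (fst v), rotation g2 d2 (snd q) (snd v))" by (simp add: prod_eq_iff)
  qed simp
qed

lemma pullback_sum:
  assumes S: "smooth_atlas S" and f: "smooth_map S N \<Phi>" and c: "c \<in> charts_at S p"
  shows "pullback N G \<Phi> c p v w = pullback M1 g1 (fst \<circ> \<Phi>) c p v w + \<epsilon> * pullback M2 g2 (snd \<circ> \<Phi>) c p v w"
proof -
  have f12: "smooth_map S M1 (fst \<circ> \<Phi>)" "smooth_map S M2 (snd \<circ> \<Phi>)" using f smooth_map_product[OF S S1.M S2.M] by auto
  have top: "\<Phi> p \<in> topspace (mtop N)" by (rule smooth_map_topspace[OF f charts_at_topspace[OF S c]])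
  obtain d1 d2 where d: "d1 \<in> charts_at M1 (fst (\<Phi> p))" "d2 \<in> charts_at M2 (snd (\<Phi> p))"
    by (rule chart_at_product[OF top]) (rule that; assumption)
  have d': "d1 \<in> charts_at M1 ((fst \<circ> \<Phi>) p)" "d2 \<in> charts_at M2 ((snd \<circ> \<Phi>) p)" using d by simp_all
  show ?thesis
    unfolding pullback_G[OF S f c d] S1.pullback_chart[OF S f12(1) c d'(1)] S2.pullback_chart[OF S f12(2) c d'(2)] by simp
qed

context
  fixes I \<phi> K \<psi>
  assumes reg: "regular_curve M1 I \<phi>" "regular_curve M2 K \<psi>"
begin

text \<open>The metric is diagonal, and division by \<open>\<epsilon>\<close> is multiplication by
  \<open>\<epsilon>\<close>.\<close>

lemma curve_product_gradient:
  assumes u: "smooth_on (I \<times> K) u" and x: "x \<in> I \<times> K"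
  shows "gradient (pullback N G (map_prod \<phi> \<psi>)) u (cW I K) x =
    (frd u x (1, 0) / (S1.sp \<phi> (fst x))\<^sup>2, \<epsilon> * frd u x (0, 1) / (S2.sp \<psi> (snd x))\<^sup>2)"
proof -
  have p: "S1.sp \<phi> (fst x) > 0" "S2.sp \<psi> (snd x) > 0"
    using S1.sp_pos[OF reg(1)] S2.sp_pos[OF reg(2)] x by (auto simp: mem_Times_iff)
  note oIK = open_IK[OF reg]
  have lin: "linear (frd u x)" by (rule smooth_on_linear_frd[OF u oIK x])
  have e: "frd (\<lambda>y. u (cinv (cW I K) y)) (snd (cW I K) x) = frd u x"
    using frd_cong[OF oIK x, of "\<lambda>y. u (cinv (cW I K) y)" u] by (simp add: cinv_id)
  let ?v = "(frd u x (1, 0) / (S1.sp \<phi> (fst x))\<^sup>2, \<epsilon> * frd u x (0, 1) / (S2.sp \<psi> (snd x))\<^sup>2)"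
  show ?thesis
    unfolding gradient_def sharp_def e curve_product_metric[OF reg x]
  proof (rule the_equality)
    show "\<forall>w. (S1.sp \<phi> (fst x))\<^sup>2 * (fst ?v * fst w) + \<epsilon> * (S2.sp \<psi> (snd x))\<^sup>2 * (snd ?v * snd w) = frd u x w"
    proof
      fix w :: "real \<times> real"
      have 1: "(S1.sp \<phi> (fst x))\<^sup>2 * (fst ?v * fst w) = frd u x (1, 0) * fst w" using p by simp
      have "\<epsilon> * (S2.sp \<psi> (snd x))\<^sup>2 * (snd ?v * snd w) = \<epsilon> * (\<epsilon> * (frd u x (0, 1) * snd w))" using p by simp
      then have 2: "\<epsilon> * (S2.sp \<psi> (snd x))\<^sup>2 * (snd ?v * snd w) = frd u x (0, 1) * snd w" unfolding eps(4) .
      show "(S1.sp \<phi> (fst x))\<^sup>2 * (fst ?v * fst w) + \<epsilon> * (S2.sp \<psi> (snd x))\<^sup>2 * (snd ?v * snd w) = frd u x w"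
        unfolding 1 2 using linear_plane[OF lin, of w] by (simp add: mult.commute)
    qed
    fix v assume v: "\<forall>w. (S1.sp \<phi> (fst x))\<^sup>2 * (fst v * fst w) + \<epsilon> * (S2.sp \<psi> (snd x))\<^sup>2 * (snd v * snd w) = frd u x w"
    have 1: "(S1.sp \<phi> (fst x))\<^sup>2 * fst v = frd u x (1, 0)" using v[rule_format, of "(1, 0)"] by simp
    have "\<epsilon> * ((S2.sp \<psi> (snd x))\<^sup>2 * snd v) = frd u x (0, 1)" using v[rule_format, of "(0, 1)"] by (simp add: mult.assoc)
    then have "\<epsilon> * (\<epsilon> * ((S2.sp \<psi> (snd x))\<^sup>2 * snd v)) = \<epsilon> * frd u x (0, 1)" by simp
    then have 2: "(S2.sp \<psi> (snd x))\<^sup>2 * snd v = \<epsilon> * frd u x (0, 1)" unfolding eps(4) .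
    show "v = ?v" using p by (simp add: prod_eq_iff field_simps flip: 1 2)
  qed
qed

lemma hamiltonian_field:
  assumes u: "smooth_on (I \<times> K) u" and x: "x \<in> I \<times> K"
    and d: "d1 \<in> charts_at M1 (\<phi> (fst x))" "d2 \<in> charts_at M2 (\<psi> (snd x))"
  shows "JJ (prod_chart d1 d2) (map_prod \<phi> \<psi> x)
      (tmap (cW I K) (prod_chart d1 d2) (map_prod \<phi> \<psi>) x (gradient (pullback N G (map_prod \<phi> \<psi>)) u (cW I K) x)) =
    ((frd u x (1, 0) / (S1.sp \<phi> (fst x))\<^sup>2) *\<^sub>R rotation g1 d1 (\<phi> (fst x)) (velocity d1 \<phi> (fst x)),
     (\<epsilon> * frd u x (0, 1) / (S2.sp \<psi> (snd x))\<^sup>2) *\<^sub>R rotation g2 d2 (\<psi> (snd x)) (velocity d2 \<psi> (snd x)))"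
proof -
  interpret P: split_immersion M1 g1 M2 g2 \<epsilon> "open_region (I \<times> K)" "map_prod \<phi> \<psi>" "cW I K" x "I \<times> K" fst snd I \<phi> K \<psi>
    by (rule split_curve_product[OF reg x])
  have d': "d1 \<in> charts_at M1 (\<phi> P.s0)" "d2 \<in> charts_at M2 (\<psi> P.t0)" using d by simp_all
  have dq: "d1 \<in> charts_at M1 (fst (map_prod \<phi> \<psi> x))" "d2 \<in> charts_at M2 (snd (map_prod \<phi> \<psi> x))"
    using d by (simp_all add: map_prod_def split_beta)
  show ?thesis
    unfolding curve_product_gradient[OF u x] P.tmap_split[OF d'] product_rotation_eq[OF dq]
    unfolding frd_fst frd_snd map_prod_def split_beta fst_conv snd_conv id_apply
      S1.rotation_eq[OF d(1)] S2.rotation_eq[OF d(2)] plane_inner.R_scale[OF S1.inner[OF d(1)]] plane_inner.R_scale[OF S2.inner[OF d(2)]] ..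
qed

end

end

section \<open>First variation of the area\<close>

lemma pullback_cong:
  assumes S: "smooth_atlas S" and c: "c \<in> charts_at S p" and U: "openin (mtop S) U" "p \<in> U" and eq: "\<And>q. q \<in> U \<Longrightarrow> f q = h q"
  shows "pullback N B f c p = pullback N B h c p"
  by (intro ext) (simp add: pullback_def Let_def eq[OF U(2)] tmap_cong[OF S c U eq])

lemma (in surface) pullback_compose:
  assumes Z: "open Z" and F: "smooth_map (open_region Z) M F" and Q: "open Q" and i: "smooth_on Q i" "i ` Q \<subseteq> Z" and x: "x \<in> Q"
  shows "pullback M g (F \<circ> i) (Q, id) x v w = pullback M g F (Z, id) (i x) (frd i x v) (frd i x w)"
proof -
  note SQ = smooth_atlas_open_region[OF Q] note SZ = smooth_atlas_open_region[OF Z]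
  have im: "smooth_map (open_region Q) (open_region Z) i" using smooth_map_open_regions[OF Q Z] i by blast
  have Fi: "smooth_map (open_region Q) M (F \<circ> i)" by (rule smooth_map_compose[OF SQ SZ M im F])
  have ix: "i x \<in> Z" using i(2) x by blast
  have cQ: "(Q, id) \<in> charts_at (open_region Q) x" and cZ: "(Z, id) \<in> charts_at (open_region Z) (i x)"
    using x ix by (simp_all add: charts_at_open_region)
  have top: "F (i x) \<in> topspace (mtop M)" using smooth_map_topspace[OF F] ix by simp
  note d = chart_at_charts_at[OF M top]
  have d': "chart_at M (F (i x)) \<in> charts_at M ((F \<circ> i) x)" using d by simp
  have t: "tmap (Q, id) (chart_at M (F (i x))) (F \<circ> i) x v = tmap (Z, id) (chart_at M (F (i x))) F (i x) (frd i x v)" for v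
    using tmap_compose[OF SQ SZ M im F cQ cZ d, of v] tmap_open_region[OF Q x, of "(Z, id)" i] by simp
  show ?thesis
    unfolding pullback_chart[OF SQ Fi cQ d'] pullback_chart[OF SZ F cZ d] t by simp
qed

section \<open>Integration over boxes\<close>

lemma compact_in_open_interval:
  assumes I: "open_interval I" and A: "compact A" "A \<subseteq> I"
  obtains s1 s2 where "s1 \<in> I" "s2 \<in> I" "s1 < s2" "A \<subseteq> {s1<..<s2}"
proof -
  obtain s0 where s0: "s0 \<in> I" using I by (auto simp: open_interval_def)
  have oI: "open I" using I by (simp add: open_interval_def)
  \<comment> \<open>The inserted point guarantees a minimum and a maximum even if \<open>A\<close>
    is empty.\<close>
  have B: "compact (insert s0 A)" "insert s0 A \<noteq> {}" using A(1) by auto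
  obtain m where m: "m \<in> insert s0 A" "\<And>t. t \<in> insert s0 A \<Longrightarrow> m \<le> t" using compact_attains_inf[OF B] by blast
  obtain n where n: "n \<in> insert s0 A" "\<And>t. t \<in> insert s0 A \<Longrightarrow> t \<le> n" using compact_attains_sup[OF B] by blast
  have "m \<in> I" "n \<in> I" using m n s0 A(2) by blast+
  obtain e where e: "e > 0" "cball m e \<subseteq> I" using open_contains_cball[THEN iffD1, OF oI, rule_format, OF \<open>m \<in> I\<close>] by blast
  obtain e' where e': "e' > 0" "cball n e' \<subseteq> I" using open_contains_cball[THEN iffD1, OF oI, rule_format, OF \<open>n \<in> I\<close>] by blast
  have in1: "m - e \<in> I" by (rule subsetD[OF e(2)]) (use e(1) in \<open>simp add: dist_real_def\<close>)
  have in2: "n + e' \<in> I" by (rule subsetD[OF e'(2)]) (use e'(1) in \<open>simp add: dist_real_def\<close>)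
  have "m \<le> n" by (rule m(2)[OF n(1)])
  moreover have "A \<subseteq> {m - e<..<n + e'}"
  proof
    fix t assume "t \<in> A"
    then show "t \<in> {m - e<..<n + e'}" using m(2)[of t] n(2)[of t] e(1) e'(1) by simp
  qed
  ultimately show thesis using that[OF in1 in2] e(1) e'(1) by simp
qed

lemma box_subset:
  assumes "open_interval I" "open_interval K" "s1 \<in> I" "s2 \<in> I" "t1 \<in> K" "t2 \<in> K"
  shows "cbox (s1, t1) (s2, t2) \<subseteq> I \<times> K"
proof
  fix x assume "x \<in> cbox (s1, t1) (s2, t2)"
  then have x: "s1 \<le> fst x" "fst x \<le> s2" "t1 \<le> snd x" "snd x \<le> t2" by (auto simp: cbox_Pair_eq)
  have "fst x \<in> I" using assms(1)[unfolded open_interval_def is_interval_1] assms(3,4) x(1,2) by blast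
  moreover have "snd x \<in> K" using assms(2)[unfolded open_interval_def is_interval_1] assms(5,6) x(3,4) by blast
  ultimately show "x \<in> I \<times> K" by (simp add: mem_Times_iff)
qed

lemma integral_box_first_derivative:
  fixes w :: "real \<times> real \<Rightarrow> real"
  assumes w: "smooth_on Q w" "open Q" and B: "cbox (s1, t1) (s2, t2) \<subseteq> Q" and s: "s1 \<le> s2"
    and zero: "\<And>t. t \<in> {t1..t2} \<Longrightarrow> w (s1, t) = 0 \<and> w (s2, t) = 0"
  shows "integral (cbox (s1, t1) (s2, t2)) (\<lambda>x. frd w x (1, 0)) = 0"
proof -
  have cont: "continuous_on (cbox (s1, t1) (s2, t2)) (\<lambda>x. frd w x (1, 0))"
    by (rule continuous_on_subset[OF smooth_on_continuous[OF smooth_on_frd[OF w(1)]] B])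
  have cont': "continuous_on (cbox (s1, t1) (s2, t2)) (\<lambda>(s, t). frd w (s, t) (1, 0))"
    using cont by (simp add: split_beta)
  have "integral (cbox (s1, t1) (s2, t2)) (\<lambda>x. frd w x (1, 0)) =
    integral (cbox s1 s2) (\<lambda>s. integral (cbox t1 t2) (\<lambda>t. frd w (s, t) (1, 0)))"
    by (rule integral_prod_continuous[OF cont])
  \<comment> \<open>The order of integration is exchanged so that the inner integral runs along the
    direction of the derivative, where the fundamental theorem leaves boundary values only.\<close>
  also have "\<dots> = integral (cbox t1 t2) (\<lambda>t. integral (cbox s1 s2) (\<lambda>s. frd w (s, t) (1, 0)))"
    by (rule integral_swap_continuous[OF cont'])
  also have "\<dots> = integral (cbox t1 t2) (\<lambda>t. 0)"
  proof (rule integral_cong)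
    fix t assume t: "t \<in> cbox t1 t2"
    have "((\<lambda>s. frd w (s, t) (1, 0)) has_integral (w (s2, t) - w (s1, t))) {s1..s2}"
    proof (rule fundamental_theorem_of_calculus[OF s])
      fix r assume r: "r \<in> {s1..s2}"
      have "(r, t) \<in> Q" by (rule subsetD[OF B]) (use r t in \<open>simp add: cbox_Pair_eq\<close>)
      moreover have "((\<lambda>s. (s, t)) has_vector_derivative (1, 0)) (at r)"
        by (auto intro!: derivative_eq_intros simp: has_vector_derivative_def)
      ultimately show "((\<lambda>s. w (s, t)) has_vector_derivative frd w (r, t) (1, 0)) (at r within {s1..s2})"
        using frd_along[OF w, of "(r, t)" "\<lambda>s. (s, t)" "(1, 0)" r] has_vector_derivative_at_within by blast
    qed
    then show "integral (cbox s1 s2) (\<lambda>s. frd w (s, t) (1, 0)) = 0"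
      using zero[of t] t by (simp add: integral_unique)
  qed
  finally show ?thesis by simp
qed

lemma integral_box_second_derivative:
  fixes w :: "real \<times> real \<Rightarrow> real"
  assumes w: "smooth_on Q w" "open Q" and B: "cbox (s1, t1) (s2, t2) \<subseteq> Q" and t: "t1 \<le> t2"
    and zero: "\<And>s. s \<in> {s1..s2} \<Longrightarrow> w (s, t1) = 0 \<and> w (s, t2) = 0"
  shows "integral (cbox (s1, t1) (s2, t2)) (\<lambda>x. frd w x (0, 1)) = 0"
proof -
  have cont: "continuous_on (cbox (s1, t1) (s2, t2)) (\<lambda>x. frd w x (0, 1))"
    by (rule continuous_on_subset[OF smooth_on_continuous[OF smooth_on_frd[OF w(1)]] B])
  have "integral (cbox (s1, t1) (s2, t2)) (\<lambda>x. frd w x (0, 1)) =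
    integral (cbox s1 s2) (\<lambda>s. integral (cbox t1 t2) (\<lambda>t. frd w (s, t) (0, 1)))"
    by (rule integral_prod_continuous[OF cont])
  also have "\<dots> = integral (cbox s1 s2) (\<lambda>s. 0)"
  proof (rule integral_cong)
    fix s assume s: "s \<in> cbox s1 s2"
    have "((\<lambda>t. frd w (s, t) (0, 1)) has_integral (w (s, t2) - w (s, t1))) {t1..t2}"
    proof (rule fundamental_theorem_of_calculus[OF t])
      fix r assume r: "r \<in> {t1..t2}"
      have "(s, r) \<in> Q" by (rule subsetD[OF B]) (use r s in \<open>simp add: cbox_Pair_eq\<close>)
      moreover have "((\<lambda>t. (s, t)) has_vector_derivative (0, 1)) (at r)"
        by (auto intro!: derivative_eq_intros simp: has_vector_derivative_def)
      ultimately show "((\<lambda>t. w (s, t)) has_vector_derivative frd w (s, r) (0, 1)) (at r within {t1..t2})"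
        using frd_along[OF w, of "(s, r)" "\<lambda>t. (s, t)" "(0, 1)" r] has_vector_derivative_at_within by blast
    qed
    then show "integral (cbox t1 t2) (\<lambda>t. frd w (s, t) (0, 1)) = 0"
      using zero[of s] s by (simp add: integral_unique)
  qed
  finally show ?thesis by simp
qed

lemma frd_mult:
  fixes f h :: "'e::euclidean_space \<Rightarrow> real"
  assumes "smooth_on X f" "smooth_on X h" "open X" "x \<in> X"
  shows "frd (\<lambda>x. f x * h x) x v = f x * frd h x v + frd f x v * h x"
  by (subst frd_eq[OF has_derivative_mult[OF smooth_on_has_derivative[OF assms(1,3,4)] smooth_on_has_derivative[OF assms(2,3,4)]]]) simp

lemma frd_diff:
  fixes f h :: "'e::euclidean_space \<Rightarrow> real"
  assumes "smooth_on X f" "smooth_on X h" "open X" "x \<in> X"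
  shows "frd (\<lambda>x. f x - h x) x v = frd f x v - frd h x v"
  by (subst frd_eq[OF has_derivative_diff[OF smooth_on_has_derivative[OF assms(1,3,4)] smooth_on_has_derivative[OF assms(2,3,4)]]]) simp

lemma frd_add:
  fixes f h :: "'e::euclidean_space \<Rightarrow> real"
  assumes "smooth_on X f" "smooth_on X h" "open X" "x \<in> X"
  shows "frd (\<lambda>x. f x + h x) x v = frd f x v + frd h x v"
  by (subst frd_eq[OF has_derivative_add[OF smooth_on_has_derivative[OF assms(1,3,4)] smooth_on_has_derivative[OF assms(2,3,4)]]]) simp

lemma frd_cmult:
  fixes f :: "'e::euclidean_space \<Rightarrow> real"
  assumes "smooth_on X f" "open X" "x \<in> X"
  shows "frd (\<lambda>x. k * f x) x v = k * frd f x v"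
  by (subst frd_eq[OF has_derivative_mult_right[OF smooth_on_has_derivative[OF assms]]]) simp

lemma frd_first_coordinate:
  fixes k :: "real \<Rightarrow> real" and x v :: "real \<times> real"
  assumes k: "smooth_on I k" "open I" and s: "fst x \<in> I"
  shows "frd (\<lambda>x. k (fst x)) x v = deriv k (fst x) * fst v"
  by (subst frd_eq[OF has_derivative_compose[OF has_derivative_fst[OF has_derivative_ident] smooth_on_deriv(1)[OF k s, unfolded has_field_derivative_def]]]) simp

lemma frd_second_coordinate:
  fixes k :: "real \<Rightarrow> real" and x v :: "real \<times> real"
  assumes k: "smooth_on I k" "open I" and s: "snd x \<in> I"
  shows "frd (\<lambda>x. k (snd x)) x v = deriv k (snd x) * snd v"
  by (subst frd_eq[OF has_derivative_compose[OF has_derivative_snd[OF has_derivative_ident] smooth_on_deriv(1)[OF k s, unfolded has_field_derivative_def]]]) simp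

text \<open>The two integrands differ by the derivative of \<open>u k1 b\<close> in the first
  direction and \<open>\<epsilon>\<close> times that of \<open>u k2 a\<close> in the second. Both
  integrate to zero, since \<open>u\<close> vanishes on the boundary; \<open>b\<close> is constant
  in the first direction and \<open>a\<close> in the second.\<close>

lemma integral_by_parts_box:
  fixes u :: "real \<times> real \<Rightarrow> real" and k1 k2 a b :: "real \<Rightarrow> real"
  assumes I: "open I" "open K" and u: "smooth_on (I \<times> K) u" and k: "smooth_on I k1" "smooth_on K k2"
    and ab: "smooth_on I a" "smooth_on K b" and B: "cbox (s1, t1) (s2, t2) \<subseteq> I \<times> K" and st: "s1 \<le> s2" "t1 \<le> t2"
    and zero: "\<And>x. x \<in> cbox (s1, t1) (s2, t2) \<Longrightarrow> fst x = s1 \<or> fst x = s2 \<or> snd x = t1 \<or> snd x = t2 \<Longrightarrow> u x = 0"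
  shows "integral (cbox (s1, t1) (s2, t2))
      (\<lambda>x. - (frd u x (1, 0) * k1 (fst x) * b (snd x) + \<epsilon> * (frd u x (0, 1) * k2 (snd x) * a (fst x)))) =
    integral (cbox (s1, t1) (s2, t2))
      (\<lambda>x. u x * (deriv k1 (fst x) * b (snd x) + \<epsilon> * (deriv k2 (snd x) * a (fst x))))"
proof -
  let ?B = "cbox (s1, t1) (s2, t2)"
  have o: "open (I \<times> K)" by (rule open_Times[OF I])
  have f: "smooth_on (I \<times> K) (\<lambda>x. q (fst x))" if "smooth_on I q" for q :: "real \<Rightarrow> real"
    by (rule smooth_on_compose[OF that o I(1) smooth_on_subset_UNIV_fst[OF o]]) auto
  have g: "smooth_on (I \<times> K) (\<lambda>x. q (snd x))" if "smooth_on K q" for q :: "real \<Rightarrow> real"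
    by (rule smooth_on_compose[OF that o I(2) smooth_on_subset_UNIV_snd[OF o]]) auto
  define w1 where "w1 x = u x * (k1 (fst x) * b (snd x))" for x
  define w2 where "w2 x = u x * (k2 (snd x) * a (fst x))" for x
  have p1: "smooth_on (I \<times> K) (\<lambda>x. k1 (fst x) * b (snd x))" and p2: "smooth_on (I \<times> K) (\<lambda>x. k2 (snd x) * a (fst x))"
    by (intro smooth_intros o f g k ab)+
  have w: "smooth_on (I \<times> K) w1" "smooth_on (I \<times> K) w2"
    unfolding w1_def[abs_def] w2_def[abs_def] by (intro smooth_intros o u p1 p2)+
  have d1: "frd w1 x (1, 0) = u x * (deriv k1 (fst x) * b (snd x)) + frd u x (1, 0) * (k1 (fst x) * b (snd x))"
    if x: "x \<in> I \<times> K" for x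
    unfolding w1_def[abs_def] frd_mult[OF u p1 o x] frd_mult[OF f[OF k(1)] g[OF ab(2)] o x]
    using frd_first_coordinate[OF k(1) I(1), of x] frd_second_coordinate[OF ab(2) I(2), of x] x by (simp add: mem_Times_iff)
  have d2: "frd w2 x (0, 1) = u x * (deriv k2 (snd x) * a (fst x)) + frd u x (0, 1) * (k2 (snd x) * a (fst x))"
    if x: "x \<in> I \<times> K" for x
    unfolding w2_def[abs_def] frd_mult[OF u p2 o x] frd_mult[OF g[OF k(2)] f[OF ab(1)] o x]
    using frd_first_coordinate[OF ab(1) I(1), of x] frd_second_coordinate[OF k(2) I(2), of x] x by (simp add: mem_Times_iff)
  have i1: "integral ?B (\<lambda>x. frd w1 x (1, 0)) = 0"
    by (rule integral_box_first_derivative[OF w(1) o B st(1)]) (use zero st in \<open>simp add: w1_def cbox_Pair_eq\<close>)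
  have i2: "integral ?B (\<lambda>x. frd w2 x (0, 1)) = 0"
    by (rule integral_box_second_derivative[OF w(2) o B st(2)]) (use zero st in \<open>simp add: w2_def cbox_Pair_eq\<close>)
  have int: "q integrable_on ?B" if "smooth_on (I \<times> K) q" for q :: "real \<times> real \<Rightarrow> real"
    by (rule integrable_continuous[OF continuous_on_subset[OF smooth_on_continuous[OF that] B]])
  let ?r = "\<lambda>x. u x * (deriv k1 (fst x) * b (snd x) + \<epsilon> * (deriv k2 (snd x) * a (fst x)))"
  have r: "smooth_on (I \<times> K) ?r"
    by (intro smooth_intros o u f g k ab smooth_on_deriv(2)[OF k(1) I(1)] smooth_on_deriv(2)[OF k(2) I(2)])
  have "integral ?B (\<lambda>x. - (frd u x (1, 0) * k1 (fst x) * b (snd x) + \<epsilon> * (frd u x (0, 1) * k2 (snd x) * a (fst x)))) =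
    integral ?B (\<lambda>x. ?r x - (frd w1 x (1, 0) + \<epsilon> * frd w2 x (0, 1)))"
    by (rule integral_cong) (use subsetD[OF B] in \<open>simp add: d1 d2 algebra_simps\<close>)
  also have "\<dots> = integral ?B ?r - (integral ?B (\<lambda>x. frd w1 x (1, 0)) + \<epsilon> * integral ?B (\<lambda>x. frd w2 x (0, 1)))"
  proof -
    note i = int[OF r] int[OF smooth_on_frd[OF w(1), of "(1, 0)"]]
    have c: "(\<lambda>x. \<epsilon> * frd w2 x (0, 1)) integrable_on ?B"
      by (rule int) (intro smooth_intros o smooth_on_frd w)
    show ?thesis
      unfolding Henstock_Kurzweil_Integration.integral_diff[OF i(1) Henstock_Kurzweil_Integration.integrable_add[OF i(2) c]]
        Henstock_Kurzweil_Integration.integral_add[OF i(2) c] by simp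
  qed
  finally show ?thesis by (simp add: i1 i2)
qed

section \<open>The area along a Hamiltonian variation\<close>

locale hamiltonian_variation = two_surfaces M1 g1 M2 g2 \<epsilon>
  for M1 :: "('a, real \<times> real) manifold" and g1 and M2 :: "('b, real \<times> real) manifold" and g2 and \<epsilon> +
  fixes I \<phi> K \<psi> and u :: "real \<times> real \<Rightarrow> real" and \<delta> C F
  assumes reg: "regular_curve M1 I \<phi>" "regular_curve M2 K \<psi>" and u: "smooth_on (I \<times> K) u"
    and var: "variation (open_region (I \<times> K)) (product_manifold M1 M2) (map_prod \<phi> \<psi>) \<delta> C F"
    and vel: "p \<in> I \<times> K \<Longrightarrow> d \<in> charts_at (product_manifold M1 M2) (map_prod \<phi> \<psi> p) \<Longrightarrow>
      vector_derivative (\<lambda>\<tau>. snd d (F (\<tau>, p))) (at 0) =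
      product_rotation M1 g1 M2 g2 d (map_prod \<phi> \<psi> p) (tmap (I \<times> K, id) d (map_prod \<phi> \<psi>) p
        (gradient (pullback (product_manifold M1 M2) (product_tensor \<epsilon> M1 g1 M2 g2) (map_prod \<phi> \<psi>)) u (I \<times> K, id) p))"
begin

abbreviation "Q \<equiv> I \<times> K"
abbreviation "Z \<equiv> {-\<delta><..<\<delta>} \<times> Q"
abbreviation "\<kappa>1 \<equiv> S1.kv \<phi>"
abbreviation "\<kappa>2 \<equiv> S2.kv \<psi>"
abbreviation "a \<equiv> S1.sp \<phi>"
abbreviation "b \<equiv> S2.sp \<psi>"

lemma oQ: "open Q" by (rule open_IK[OF reg])

lemma oZ: "open Z" by (intro open_Times oQ) simp

lemma \<delta>: "\<delta> > 0" and C: "compact C" "C \<subseteq> Q" and F: "smooth_map (open_region Z) N F"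
  and F0: "p \<in> Q \<Longrightarrow> F (0, p) = map_prod \<phi> \<psi> p"
  and Fout: "\<tau> \<in> {-\<delta><..<\<delta>} \<Longrightarrow> p \<in> Q - C \<Longrightarrow> F (\<tau>, p) = map_prod \<phi> \<psi> p"
  using var unfolding variation_def product_open_region open_region_simps
  by (auto simp: compactin_subtopology compactin_euclidean_iff)

lemma FM: "smooth_map (open_region Z) M1 (fst \<circ> F)" "smooth_map (open_region Z) M2 (snd \<circ> F)"
  using F smooth_map_product[OF smooth_atlas_open_region[OF oZ] S1.M S2.M] by auto

lemma zero_Z: "x \<in> Q \<Longrightarrow> (0, x) \<in> Z" using \<delta> by simp

lemma coords: "x \<in> Q \<Longrightarrow> fst x \<in> I" "x \<in> Q \<Longrightarrow> snd x \<in> K" by auto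

text \<open>The prescribed velocity is read in product charts and split into the factors, where it
  is normal to each curve as \<open>normal_variation_derivative\<close> demands.\<close>

lemma velocities:
  assumes x: "x \<in> Q" and d: "d1 \<in> charts_at M1 (\<phi> (fst x))" "d2 \<in> charts_at M2 (\<psi> (snd x))"
  shows "frd (\<lambda>z. snd d1 ((fst \<circ> F) z)) (0, x) (1, 0) = (frd u x (1, 0) / (a (fst x))\<^sup>2) *\<^sub>R rotation g1 d1 (\<phi> (fst x)) (velocity d1 \<phi> (fst x))"
    and "frd (\<lambda>z. snd d2 ((snd \<circ> F) z)) (0, x) (1, 0) = (\<epsilon> * frd u x (0, 1) / (b (snd x))\<^sup>2) *\<^sub>R rotation g2 d2 (\<psi> (snd x)) (velocity d2 \<psi> (snd x))"
proof -
  note L1 = S1.pullback_local[OF oZ FM(1) charts_atD(1)[OF d(1)]]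
  note L2 = S2.pullback_local[OF oZ FM(2) charts_atD(1)[OF d(2)]]
  have z1: "(0, x) \<in> Z \<inter> (fst \<circ> F) -` fst d1" "(0, x) \<in> Z \<inter> (snd \<circ> F) -` fst d2"
    using zero_Z[OF x] F0[OF x] charts_atD(2)[OF d(1)] charts_atD(2)[OF d(2)] by (simp_all add: map_prod_def split_beta)
  have line: "((\<lambda>\<tau>. (\<tau>, x)) has_vector_derivative (1, 0)) (at 0)"
    by (auto intro!: derivative_eq_intros simp: has_vector_derivative_def zero_prod_def)
  have "((\<lambda>\<tau>. (snd d1 ((fst \<circ> F) (\<tau>, x)), snd d2 ((snd \<circ> F) (\<tau>, x)))) has_vector_derivative
    (frd (\<lambda>z. snd d1 ((fst \<circ> F) z)) (0, x) (1, 0), frd (\<lambda>z. snd d2 ((snd \<circ> F) z)) (0, x) (1, 0))) (at 0)"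
    by (intro has_vector_derivative_Pair frd_along[OF L1(2,1) z1(1) line refl] frd_along[OF L2(2,1) z1(2) line refl])
  then have "vector_derivative (\<lambda>\<tau>. snd (prod_chart d1 d2) (F (\<tau>, x))) (at 0) =
    (frd (\<lambda>z. snd d1 ((fst \<circ> F) z)) (0, x) (1, 0), frd (\<lambda>z. snd d2 ((snd \<circ> F) z)) (0, x) (1, 0))"
    by (intro vector_derivative_at) (simp add: map_prod_def split_beta)
  moreover have "prod_chart d1 d2 \<in> charts_at N (map_prod \<phi> \<psi> x)"
  proof -
    have "d1 \<in> charts_at M1 (fst (map_prod \<phi> \<psi> x))" "d2 \<in> charts_at M2 (snd (map_prod \<phi> \<psi> x))"
      using d by (simp_all add: map_prod_def split_beta)
    then show ?thesis unfolding charts_at_product by blast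
  qed
  ultimately have "(frd (\<lambda>z. snd d1 ((fst \<circ> F) z)) (0, x) (1, 0), frd (\<lambda>z. snd d2 ((snd \<circ> F) z)) (0, x) (1, 0)) =
    ((frd u x (1, 0) / (a (fst x))\<^sup>2) *\<^sub>R rotation g1 d1 (\<phi> (fst x)) (velocity d1 \<phi> (fst x)),
     (\<epsilon> * frd u x (0, 1) / (b (snd x))\<^sup>2) *\<^sub>R rotation g2 d2 (\<psi> (snd x)) (velocity d2 \<psi> (snd x)))"
    using vel[OF x] hamiltonian_field[OF reg u x d] by metis
  then show "frd (\<lambda>z. snd d1 ((fst \<circ> F) z)) (0, x) (1, 0) = (frd u x (1, 0) / (a (fst x))\<^sup>2) *\<^sub>R rotation g1 d1 (\<phi> (fst x)) (velocity d1 \<phi> (fst x))"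
    "frd (\<lambda>z. snd d2 ((snd \<circ> F) z)) (0, x) (1, 0) = (\<epsilon> * frd u x (0, 1) / (b (snd x))\<^sup>2) *\<^sub>R rotation g2 d2 (\<psi> (snd x)) (velocity d2 \<psi> (snd x))"
    by simp_all
qed

text \<open>The contributions of the factors to the induced metric of the surface at time
  \<open>\<tau>\<close>, as functions of time and point together. The zero in \<open>(0, v)\<close>
  excludes the time direction.\<close>

definition "P1 v w z = pullback M1 g1 (fst \<circ> F) (Z, id) z (0, v) (0, w)"
definition "P2 v w z = pullback M2 g2 (snd \<circ> F) (Z, id) z (0, v) (0, w)"
definition "hh v w z = P1 v w z + \<epsilon> * P2 v w z"

lemma P_smooth: "smooth_on Z (P1 v w)" "smooth_on Z (P2 v w)"
  unfolding P1_def[abs_def] P2_def[abs_def] by (rule S1.pullback_smooth[OF oZ FM(1)], rule S2.pullback_smooth[OF oZ FM(2)])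

lemma hh_smooth: "smooth_on Z (hh v w)"
  unfolding hh_def[abs_def] by (intro smooth_intros oZ P_smooth)

lemma frd_hh: "z \<in> Z \<Longrightarrow> frd (hh v w) z e = frd (P1 v w) z e + \<epsilon> * frd (P2 v w) z e"
proof -
  assume z: "z \<in> Z"
  have s: "smooth_on Z (\<lambda>z. \<epsilon> * P2 v w z)" by (intro smooth_intros oZ P_smooth)
  show ?thesis unfolding hh_def[abs_def] frd_add[OF P_smooth(1) s oZ z] frd_cmult[OF P_smooth(2) oZ z] ..
qed

lemma slice:
  assumes \<tau>: "\<tau> \<in> {-\<delta><..<\<delta>}" and x: "x \<in> Q"
  shows "pullback N G (\<lambda>p. F (\<tau>, p)) (Q, id) x v w = hh v w (\<tau>, x)"
proof -
  have i: "smooth_on Q (Pair \<tau>)" by (intro smooth_intros oQ)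
  have iZ: "Pair \<tau> ` Q \<subseteq> Z" using \<tau> by auto
  have im: "smooth_map (open_region Q) (open_region Z) (Pair \<tau>)" using smooth_map_open_regions[OF oQ oZ] i iZ by blast
  have fi: "frd (Pair \<tau>) x v = (0, v)" for v
  proof -
    have "((\<lambda>p. (\<tau>, p)) has_derivative (\<lambda>v. (0, v))) (at x)" by (auto intro!: derivative_eq_intros)
    from frd_eq[OF this] show ?thesis by simp
  qed
  have fm: "smooth_map (open_region Q) N (\<lambda>p. F (\<tau>, p))"
    unfolding smooth_map_product[OF smooth_atlas_open_region[OF oQ] S1.M S2.M]
    using smooth_map_compose[OF smooth_atlas_open_region[OF oQ] smooth_atlas_open_region[OF oZ] S1.M im FM(1)]
      smooth_map_compose[OF smooth_atlas_open_region[OF oQ] smooth_atlas_open_region[OF oZ] S2.M im FM(2)]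
    by (simp add: o_def)
  have c: "(Q, id) \<in> charts_at (open_region Q) x" using x by (simp add: charts_at_open_region)
  have o: "fst \<circ> (\<lambda>p. F (\<tau>, p)) = (fst \<circ> F) \<circ> Pair \<tau>" "snd \<circ> (\<lambda>p. F (\<tau>, p)) = (snd \<circ> F) \<circ> Pair \<tau>" by (auto simp: fun_eq_iff)
  show ?thesis
    unfolding pullback_sum[OF smooth_atlas_open_region[OF oQ] fm c] o S1.pullback_compose[OF oZ FM(1) oQ i iZ x]
      S2.pullback_compose[OF oZ FM(2) oQ i iZ x] fi hh_def P1_def P2_def ..
qed

text \<open>A pullback involves derivatives, so agreement of the maps is required on an open set
  around the point.\<close>

lemma slice_out:
  assumes U: "open U" "U \<subseteq> Q" "x \<in> U" and eq: "\<And>q. q \<in> U \<Longrightarrow> F (\<tau>, q) = map_prod \<phi> \<psi> q"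
  shows "pullback N G (\<lambda>p. F (\<tau>, p)) (Q, id) x = pullback N G (map_prod \<phi> \<psi>) (Q, id) x"
  by (rule pullback_cong[OF smooth_atlas_open_region[OF oQ], where U = U])
    (use U eq in \<open>auto simp: charts_at_open_region openin_open_eq[OF oQ]\<close>)

lemma hh_0:
  assumes x: "x \<in> Q"
  shows "hh v w (0, x) = (a (fst x))\<^sup>2 * (fst v * fst w) + \<epsilon> * (b (snd x))\<^sup>2 * (snd v * snd w)"
proof -
  have "hh v w (0, x) = pullback N G (\<lambda>p. F (0, p)) (Q, id) x v w" by (rule slice[symmetric]) (use \<delta> x in auto)
  also have "\<dots> = pullback N G (map_prod \<phi> \<psi>) (Q, id) x v w"
    using slice_out[OF oQ subset_refl x, of 0] F0 by simp
  finally show ?thesis unfolding curve_product_metric[OF reg x] .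
qed

lemma line1: "((\<lambda>r. (0 :: real, (r, t :: real))) has_vector_derivative (0, (1, 0))) (at r)"
  by (auto intro!: derivative_eq_intros simp: has_vector_derivative_def)

lemma line2: "((\<lambda>r. (0 :: real, (s :: real, r))) has_vector_derivative (0, (0, 1))) (at r)"
  by (auto intro!: derivative_eq_intros simp: has_vector_derivative_def)

lemma charts_x:
  assumes "x \<in> Q"
  obtains d1 d2 where "d1 \<in> charts_at M1 (\<phi> (fst x))" "d2 \<in> charts_at M2 (\<psi> (snd x))"
  by (rule curve_product_charts[OF reg assms]) (rule that; assumption)

text \<open>The first factor contributes by the normal variation of \<open>\<phi>\<close> along the
  line of constant \<open>t\<close>. The second contributes nothing, since \<open>\<psi>\<close>
  does not depend on \<open>s\<close> at time 0.\<close>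

lemma hh_11:
  assumes x: "x \<in> Q"
  shows "frd (hh (1, 0) (1, 0)) (0, x) (1, 0) = - 2 * frd u x (1, 0) * \<kappa>1 (fst x) * a (fst x)"
proof -
  obtain d1 d2 where d: "d1 \<in> charts_at M1 (\<phi> (fst x))" "d2 \<in> charts_at M2 (\<psi> (snd x))" by (rule charts_x[OF x])
  note I = S1.curve_open[OF reg(1)]
  have xs: "fst x \<in> I" "snd x \<in> K" using x by auto
  have "frd (P1 (1, 0) (1, 0)) (0, (fst x, snd x)) (1, 0) =
      - 2 * (frd u (fst x, snd x) (1, 0) / (a (fst x))\<^sup>2) * \<kappa>1 (fst x) * a (fst x) ^ 3"
    unfolding P1_def[abs_def]
  proof (rule S1.normal_variation_derivative[OF oZ FM(1) reg(1) I xs(1) subset_refl _ _ _ d(1),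
        where line = "\<lambda>r. (0, (r, snd x))" and \<beta> = "\<lambda>r. frd u (r, snd x) (1, 0) / (a r)\<^sup>2"])
    fix r assume r: "r \<in> I"
    have q: "(r, snd x) \<in> Q" using r xs(2) by simp
    show "(0, (r, snd x)) \<in> Z" by (rule zero_Z[OF q])
    show "(fst \<circ> F) (0, (r, snd x)) = \<phi> r" using F0[OF q] by simp
    show "((\<lambda>r. (0 :: real, (r, snd x))) has_vector_derivative (0, (1, 0))) (at r)" by (rule line1)
    assume "\<phi> r \<in> fst d1"
    then have d1: "d1 \<in> charts_at M1 (\<phi> (fst (r, snd x)))" using charts_atD(1)[OF d(1)] by (simp add: charts_at_def)
    have d2: "d2 \<in> charts_at M2 (\<psi> (snd (r, snd x)))" using d(2) by simp
    show "frd (\<lambda>z. snd d1 ((fst \<circ> F) z)) (0, (r, snd x)) (1, 0) =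
      (frd u (r, snd x) (1, 0) / (a r)\<^sup>2) *\<^sub>R rotation g1 d1 (\<phi> r) (velocity d1 \<phi> r)"
      using velocities(1)[OF q d1 d2] by simp
  qed
  then have 1: "frd (P1 (1, 0) (1, 0)) (0, x) (1, 0) = - 2 * frd u x (1, 0) * \<kappa>1 (fst x) * a (fst x)"
    using S1.sp_pos[OF reg(1) xs(1)] by (simp add: power2_eq_square power3_eq_cube)
  have 2: "frd (P2 (1, 0) (1, 0)) (0, x) (1, 0) = 0"
    unfolding P2_def[abs_def]
  proof (rule S2.pullback_derivative_degenerate[OF oZ FM(2) zero_Z[OF x]])
    show dx: "d2 \<in> charts_at M2 ((snd \<circ> F) (0, x))" using d(2) F0[OF x] by (simp add: map_prod_def split_beta)
    note L = S2.pullback_local[OF oZ FM(2) charts_atD(1)[OF d(2)]]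
    have zx: "(0, x) \<in> Z \<inter> (snd \<circ> F) -` fst d2" using zero_Z[OF x] charts_atD(2)[OF dx] by simp
    have "((\<lambda>r. snd d2 ((snd \<circ> F) (0, (r, snd x)))) has_vector_derivative
        frd (\<lambda>z. snd d2 ((snd \<circ> F) z)) (0, x) (0, (1, 0))) (at (fst x))"
      by (rule frd_along[OF L(2,1) zx line1]) simp
    then have "((\<lambda>r. snd d2 (\<psi> (snd x))) has_vector_derivative
        frd (\<lambda>z. snd d2 ((snd \<circ> F) z)) (0, x) (0, (1, 0))) (at (fst x))"
      by (rule has_vector_derivative_transform_within_open[OF _ I xs(1)]) (use F0 xs(2) in simp)
    then show "frd (\<lambda>z. snd d2 ((snd \<circ> F) z)) (0, x) (0, (1, 0)) = 0"
      by (rule vector_derivative_unique_at) (rule has_vector_derivative_const)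
  qed
  show ?thesis unfolding frd_hh[OF zero_Z[OF x]] 1 2 by simp
qed

text \<open>As in \<open>hh_11\<close> with the factors exchanged. The \<open>\<epsilon>\<close> of
  the gradient meets the \<open>\<epsilon>\<close> of the metric, and their product is 1.\<close>

lemma hh_22:
  assumes x: "x \<in> Q"
  shows "frd (hh (0, 1) (0, 1)) (0, x) (1, 0) = - 2 * frd u x (0, 1) * \<kappa>2 (snd x) * b (snd x)"
proof -
  obtain d1 d2 where d: "d1 \<in> charts_at M1 (\<phi> (fst x))" "d2 \<in> charts_at M2 (\<psi> (snd x))" by (rule charts_x[OF x])
  note K = S2.curve_open[OF reg(2)]
  have xs: "fst x \<in> I" "snd x \<in> K" using x by auto
  have "frd (P2 (0, 1) (0, 1)) (0, (fst x, snd x)) (1, 0) =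
      - 2 * (\<epsilon> * frd u (fst x, snd x) (0, 1) / (b (snd x))\<^sup>2) * \<kappa>2 (snd x) * b (snd x) ^ 3"
    unfolding P2_def[abs_def]
  proof (rule S2.normal_variation_derivative[OF oZ FM(2) reg(2) K xs(2) subset_refl _ _ _ d(2),
        where line = "\<lambda>r. (0, (fst x, r))" and \<beta> = "\<lambda>r. \<epsilon> * frd u (fst x, r) (0, 1) / (b r)\<^sup>2"])
    fix r assume r: "r \<in> K"
    have q: "(fst x, r) \<in> Q" using r xs(1) by simp
    show "(0, (fst x, r)) \<in> Z" by (rule zero_Z[OF q])
    show "(snd \<circ> F) (0, (fst x, r)) = \<psi> r" using F0[OF q] by simp
    show "((\<lambda>r. (0 :: real, (fst x, r))) has_vector_derivative (0, (0, 1))) (at r)" by (rule line2)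
    assume "\<psi> r \<in> fst d2"
    then have d2: "d2 \<in> charts_at M2 (\<psi> (snd (fst x, r)))" using charts_atD(1)[OF d(2)] by (simp add: charts_at_def)
    have d1: "d1 \<in> charts_at M1 (\<phi> (fst (fst x, r)))" using d(1) by simp
    show "frd (\<lambda>z. snd d2 ((snd \<circ> F) z)) (0, (fst x, r)) (1, 0) =
      (\<epsilon> * frd u (fst x, r) (0, 1) / (b r)\<^sup>2) *\<^sub>R rotation g2 d2 (\<psi> r) (velocity d2 \<psi> r)"
      using velocities(2)[OF q d1 d2] by simp
  qed
  then have 2: "frd (P2 (0, 1) (0, 1)) (0, x) (1, 0) = \<epsilon> * (- 2 * frd u x (0, 1) * \<kappa>2 (snd x) * b (snd x))"
    using S2.sp_pos[OF reg(2) xs(2)] by (simp add: power2_eq_square power3_eq_cube)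
  have 1: "frd (P1 (0, 1) (0, 1)) (0, x) (1, 0) = 0"
    unfolding P1_def[abs_def]
  proof (rule S1.pullback_derivative_degenerate[OF oZ FM(1) zero_Z[OF x]])
    show dx: "d1 \<in> charts_at M1 ((fst \<circ> F) (0, x))" using d(1) F0[OF x] by (simp add: map_prod_def split_beta)
    note L = S1.pullback_local[OF oZ FM(1) charts_atD(1)[OF d(1)]]
    have zx: "(0, x) \<in> Z \<inter> (fst \<circ> F) -` fst d1" using zero_Z[OF x] charts_atD(2)[OF dx] by simp
    have "((\<lambda>r. snd d1 ((fst \<circ> F) (0, (fst x, r)))) has_vector_derivative
        frd (\<lambda>z. snd d1 ((fst \<circ> F) z)) (0, x) (0, (0, 1))) (at (snd x))"
      by (rule frd_along[OF L(2,1) zx line2]) simp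
    then have "((\<lambda>r. snd d1 (\<phi> (fst x))) has_vector_derivative
        frd (\<lambda>z. snd d1 ((fst \<circ> F) z)) (0, x) (0, (0, 1))) (at (snd x))"
      by (rule has_vector_derivative_transform_within_open[OF _ K xs(2)]) (use F0 xs(1) in simp)
    then show "frd (\<lambda>z. snd d1 ((fst \<circ> F) z)) (0, x) (0, (0, 1)) = 0"
      by (rule vector_derivative_unique_at) (rule has_vector_derivative_const)
  qed
  show ?thesis unfolding frd_hh[OF zero_Z[OF x]] 1 2 eps(4) by simp
qed

text \<open>The factor \<open>\<epsilon>\<close> makes the determinant of the induced metric
  positive at time 0 for both signs, so its square root is differentiable there; the absolute value
  in \<open>area_density\<close> is unaffected.\<close>

definition "E z = \<epsilon> * (hh (1, 0) (1, 0) z * hh (0, 1) (0, 1) z - hh (1, 0) (0, 1) z * hh (0, 1) (1, 0) z)"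

lemma E_smooth: "smooth_on Z E"
  unfolding E_def[abs_def] by (intro smooth_intros oZ hh_smooth)

lemma E_0: "x \<in> Q \<Longrightarrow> E (0, x) = (a (fst x) * b (snd x))\<^sup>2"
  unfolding E_def by (simp add: hh_0 power_mult_distrib eps)

text \<open>The off-diagonal coefficients vanish at time 0, hence the derivative of their product
  vanishes and only the diagonal derivatives contribute.\<close>

lemma E_deriv:
  assumes x: "x \<in> Q"
  shows "frd E (0, x) (1, 0) = - 2 * (a (fst x) * b (snd x)) *
    (frd u x (1, 0) * \<kappa>1 (fst x) * b (snd x) + \<epsilon> * (frd u x (0, 1) * \<kappa>2 (snd x) * a (fst x)))"
proof -
  note z = zero_Z[OF x]
  have p: "smooth_on Z (\<lambda>z. hh (1, 0) (1, 0) z * hh (0, 1) (0, 1) z)" "smooth_on Z (\<lambda>z. hh (1, 0) (0, 1) z * hh (0, 1) (1, 0) z)"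
    by (intro smooth_intros oZ hh_smooth)+
  have d: "smooth_on Z (\<lambda>z. hh (1, 0) (1, 0) z * hh (0, 1) (0, 1) z - hh (1, 0) (0, 1) z * hh (0, 1) (1, 0) z)"
    by (intro smooth_intros oZ p)
  have "frd E (0, x) (1, 0) = \<epsilon> * ((a (fst x))\<^sup>2 * (- 2 * frd u x (0, 1) * \<kappa>2 (snd x) * b (snd x))
      + (- 2 * frd u x (1, 0) * \<kappa>1 (fst x) * a (fst x)) * (\<epsilon> * (b (snd x))\<^sup>2))"
    unfolding E_def[abs_def] frd_cmult[OF d oZ z] frd_diff[OF p oZ z] frd_mult[OF hh_smooth hh_smooth oZ z]
    by (simp add: hh_0[OF x] hh_11[OF x] hh_22[OF x])
  also have "\<dots> = - 2 * (a (fst x) * b (snd x)) *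
    (\<epsilon> * (\<epsilon> * (frd u x (1, 0) * \<kappa>1 (fst x) * b (snd x))) + \<epsilon> * (frd u x (0, 1) * \<kappa>2 (snd x) * a (fst x)))"
    by (simp add: power2_eq_square algebra_simps)
  finally show ?thesis unfolding eps(4) .
qed

abbreviation "dens \<tau> \<equiv> area_density (pullback N G (\<lambda>p. F (\<tau>, p))) (Q, id)"

lemma dens_E: "\<tau> \<in> {-\<delta><..<\<delta>} \<Longrightarrow> x \<in> Q \<Longrightarrow> dens \<tau> x = sqrt \<bar>E (\<tau>, x)\<bar>"
  unfolding area_density_def by (simp add: slice E_def abs_mult eps)

lemma dens_out:
  assumes \<tau>: "\<tau> \<in> {-\<delta><..<\<delta>}" and x: "x \<in> Q - C"
  shows "dens \<tau> x = dens 0 x"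
proof -
  have o: "open (Q - C)" using oQ compact_imp_closed[OF C(1)] by (rule open_Diff)
  have "pullback N G (\<lambda>p. F (\<tau>, p)) (Q, id) x = pullback N G (\<lambda>p. F (0, p)) (Q, id) x"
    using slice_out[OF o Diff_subset x, of \<tau>] slice_out[OF o Diff_subset x, of 0] Fout[OF \<tau>] F0 by simp
  then show ?thesis unfolding area_density_def by simp
qed

text \<open>\<open>C\<close> is an arbitrary compact set, so the integral is taken over a box around
  it. Outside \<open>C\<close> the density does not depend on time and contributes a constant.
  Inside, the Leibniz rule applies to the square root of \<open>E\<close>.\<close>

lemma area_derivative:
  assumes st: "s1 \<in> I" "s2 \<in> I" "t1 \<in> K" "t2 \<in> K" and CB: "C \<subseteq> cbox (s1, t1) (s2, t2)"
  shows "((\<lambda>\<tau>. measure (volume_measure (open_region Q) (pullback N G (\<lambda>p. F (\<tau>, p)))) C) has_real_derivative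
    integral (cbox (s1, t1) (s2, t2)) (\<lambda>x. - (frd u x (1, 0) * \<kappa>1 (fst x) * b (snd x)
      + \<epsilon> * (frd u x (0, 1) * \<kappa>2 (snd x) * a (fst x))))) (at 0)"
proof -
  let ?B = "cbox (s1, t1) (s2, t2)" and ?T = "{-\<delta><..<\<delta>}"
  have I: "open_interval I" "open_interval K" using reg by (auto simp: regular_curve_def)
  have BQ: "?B \<subseteq> Q" by (rule box_subset[OF I st])
  have cont: "continuous_on Q (dens \<tau>)" if \<tau>: "\<tau> \<in> ?T" for \<tau>
  proof -
    have "continuous_on Q (\<lambda>x. sqrt \<bar>E (\<tau>, x)\<bar>)"
      by (intro continuous_intros continuous_on_compose2[OF smooth_on_continuous[OF E_smooth]]) (use \<tau> in auto)
    then show ?thesis by (rule continuous_on_eq) (simp add: dens_E[OF \<tau>])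
  qed
  have intB: "dens \<tau> integrable_on ?B" if "\<tau> \<in> ?T" for \<tau>
    by (rule integrable_continuous[OF continuous_on_subset[OF cont[OF that] BQ]])
  \<comment> \<open>The time-independent share of the box outside \<open>C\<close>; it disappears on
    differentiation.\<close>
  define c0 where "c0 = integral ?B (\<lambda>x. if x \<in> C then 0 else dens 0 x)"
  have T0: "0 \<in> ?T" using \<delta> by simp
  have area: "measure (volume_measure (open_region Q) (pullback N G (\<lambda>p. F (\<tau>, p)))) C = integral ?B (dens \<tau>) - c0"
    if \<tau>: "\<tau> \<in> ?T" for \<tau>
  proof -
    note V = volume_measure_open_region[OF oQ cont[OF \<tau>] C]
    have int1: "(\<lambda>x. if x \<in> C then dens \<tau> x else 0) integrable_on ?B"
      using V(2) CB by (simp add: integrable_restrict_Int inf.absorb1)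
    have i1: "integral ?B (\<lambda>x. if x \<in> C then dens \<tau> x else 0) = integral C (dens \<tau>)"
      using CB by (simp add: Henstock_Kurzweil_Integration.integral_restrict_Int inf.absorb1)
    have "integral ?B (dens \<tau>) - integral C (dens \<tau>) = integral ?B (\<lambda>x. dens \<tau> x - (if x \<in> C then dens \<tau> x else 0))"
      unfolding i1[symmetric] by (rule Henstock_Kurzweil_Integration.integral_diff[OF intB[OF \<tau>] int1, symmetric])
    also have "\<dots> = c0" unfolding c0_def
    proof (rule integral_cong)
      fix x assume x: "x \<in> ?B"
      show "dens \<tau> x - (if x \<in> C then dens \<tau> x else 0) = (if x \<in> C then 0 else dens 0 x)"
      proof (cases "x \<in> C")
        case False
        then have "x \<in> Q - C" using subsetD[OF BQ x] by blast
        from dens_out[OF \<tau> this] show ?thesis using False by simp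
      qed simp
    qed
    finally show ?thesis unfolding V(1) by simp
  qed
  \<comment> \<open>\<open>E\<close> is positive on the compact box at time 0. By the tube lemma it
    stays positive on the whole box for a common short time, where its square root is
    smooth.\<close>
  define Z' where "Z' = Z \<inter> E -` {0<..}"
  have Z': "open Z'" unfolding Z'_def by (rule continuous_open_preimage[OF smooth_on_continuous[OF E_smooth] oZ]) simp
  have ab: "a (fst x) > 0" "b (snd x) > 0" if "x \<in> Q" for x
    using S1.sp_pos[OF reg(1) coords(1)[OF that]] S2.sp_pos[OF reg(2) coords(2)[OF that]] .
  have "{0} \<times> ?B \<subseteq> Z'"
  proof
    fix z :: "real \<times> real \<times> real" assume "z \<in> {0} \<times> ?B"
    then obtain x where x: "z = (0, x)" "x \<in> Q" using BQ by blast
    have "E (0, x) > 0" unfolding E_0[OF x(2)] using ab[OF x(2)] by simp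
    then show "z \<in> Z'" using zero_Z[OF x(2)] x(1) by (simp add: Z'_def)
  qed
  from Elementary_Topology.tube_lemma[OF compact_cbox Z' this]
  obtain X0 where X0: "0 \<in> X0" "open X0" "X0 \<times> ?B \<subseteq> Z'" by blast
  obtain \<eta> where \<eta>: "\<eta> > 0" "ball 0 \<eta> \<subseteq> X0" using open_contains_ball[THEN iffD1, OF X0(2), rule_format, OF X0(1)] by blast
  define T' where "T' = ball (0::real) \<eta> \<inter> ?T"
  have T': "open T'" "0 \<in> T'" "convex T'" unfolding T'_def using \<eta>(1) \<delta> by (auto intro!: convex_Int)
  have inZ': "(\<tau>, x) \<in> Z'" if "\<tau> \<in> T'" "x \<in> ?B" for \<tau> x
    using X0(3) \<eta>(2) that unfolding T'_def by blast
  define f where "f z = sqrt (E z)" for z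
  have f: "smooth_on Z' f" unfolding f_def[abs_def]
    by (intro smooth_intros Z' smooth_on_subset[OF E_smooth]) (auto simp: Z'_def)
  have fd: "((\<lambda>\<tau>. f (\<tau>, x)) has_real_derivative frd f (\<tau>, x) (1, 0)) (at \<tau>)" if "\<tau> \<in> T'" "x \<in> ?B" for \<tau> x
  proof -
    have "((\<lambda>\<tau>. (\<tau>, x)) has_vector_derivative (1, 0)) (at \<tau>)"
      by (auto intro!: derivative_eq_intros simp: has_vector_derivative_def zero_prod_def)
    from frd_along[OF f Z' inZ'[OF that] this refl] show ?thesis
      by (simp add: has_real_derivative_iff_has_vector_derivative)
  qed
  have df: "f (\<tau>, x) = dens \<tau> x" if "\<tau> \<in> T'" "x \<in> ?B" for \<tau> x
  proof -
    have "E (\<tau>, x) > 0" using inZ'[OF that] by (simp add: Z'_def)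
    then show ?thesis using dens_E[of \<tau> x] that(1) subsetD[OF BQ that(2)] by (simp add: f_def T'_def)
  qed
  have f0: "frd f (0, x) (1, 0) = - (frd u x (1, 0) * \<kappa>1 (fst x) * b (snd x) + \<epsilon> * (frd u x (0, 1) * \<kappa>2 (snd x) * a (fst x)))"
    if x: "x \<in> ?B" for x
  proof -
    note xQ = subsetD[OF BQ x]
    have ab0: "a (fst x) * b (snd x) > 0" using ab[OF xQ] by simp
    have "((\<lambda>\<tau>. (\<tau>, x)) has_vector_derivative (1, 0)) (at 0)"
      by (auto intro!: derivative_eq_intros simp: has_vector_derivative_def zero_prod_def)
    from frd_along[OF E_smooth oZ zero_Z[OF xQ] this refl]
    have dE: "((\<lambda>\<tau>. E (\<tau>, x)) has_real_derivative frd E (0, x) (1, 0)) (at 0)"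
      by (simp add: has_real_derivative_iff_has_vector_derivative)
    have Epos: "E (0, x) > 0" unfolding E_0[OF xQ] using ab[OF xQ] by simp
    have "((\<lambda>\<tau>. sqrt (E (\<tau>, x))) has_real_derivative (inverse (sqrt (E (0, x))) / 2) * frd E (0, x) (1, 0)) (at 0)"
      by (rule DERIV_chain2[OF DERIV_real_sqrt[OF Epos] dE])
    then have "frd f (0, x) (1, 0) = (inverse (sqrt (E (0, x))) / 2) * frd E (0, x) (1, 0)"
      using DERIV_unique[OF fd[OF T'(2) x]] unfolding f_def by blast
    also have "sqrt (E (0, x)) = a (fst x) * b (snd x)" unfolding E_0[OF xQ] using ab0 by simp
    finally have *: "frd f (0, x) (1, 0) = inverse (a (fst x) * b (snd x)) / 2 * frd E (0, x) (1, 0)" .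
    have "inverse y / 2 * (- 2 * y * z) = - z" if "y > 0" for y z :: real using that by simp
    from this[OF ab0] show ?thesis unfolding * E_deriv[OF xQ] .
  qed
  have leib: "((\<lambda>\<tau>. integral ?B (\<lambda>x. f (\<tau>, x))) has_real_derivative integral ?B (\<lambda>x. frd f (0, x) (1, 0))) (at 0 within T')"
  proof (rule leibniz_rule_field_derivative[where f = "\<lambda>\<tau> x. f (\<tau>, x)" and fx = "\<lambda>\<tau> x. frd f (\<tau>, x) (1, 0)"])
    show "((\<lambda>\<tau>. f (\<tau>, x)) has_real_derivative frd f (\<tau>, x) (1, 0)) (at \<tau> within T')" if "\<tau> \<in> T'" "x \<in> ?B" for \<tau> x
      using fd[OF that] by (rule has_field_derivative_at_within)
    show "(\<lambda>x. f (\<tau>, x)) integrable_on ?B" if "\<tau> \<in> T'" for \<tau>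
      using intB[of \<tau>] integrable_cong[of ?B "dens \<tau>" "\<lambda>x. f (\<tau>, x)"] df[OF that] that by (simp add: T'_def)
    have "continuous_on (T' \<times> ?B) (\<lambda>z. frd f z (1, 0))"
      by (rule continuous_on_subset[OF smooth_on_continuous[OF smooth_on_frd[OF f]]]) (use inZ' in auto)
    then show "continuous_on (T' \<times> ?B) (\<lambda>(\<tau>, x). frd f (\<tau>, x) (1, 0))" by (simp add: split_beta)
  qed (use T' in auto)
  then have "((\<lambda>\<tau>. integral ?B (\<lambda>x. f (\<tau>, x)) - c0) has_real_derivative integral ?B (\<lambda>x. frd f (0, x) (1, 0)) - 0) (at 0)"
    unfolding at_within_open[OF T'(2,1)] by (intro DERIV_diff DERIV_const)
  then have "((\<lambda>\<tau>. measure (volume_measure (open_region Q) (pullback N G (\<lambda>p. F (\<tau>, p)))) C) has_real_derivative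
      integral ?B (\<lambda>x. frd f (0, x) (1, 0)) - 0) (at 0)"
  proof (rule has_field_derivative_transform_within_open[OF _ T'(1,2)])
    fix \<tau> assume \<tau>: "\<tau> \<in> T'"
    have "integral ?B (\<lambda>x. f (\<tau>, x)) = integral ?B (dens \<tau>)" by (rule integral_cong) (rule df[OF \<tau>])
    then show "integral ?B (\<lambda>x. f (\<tau>, x)) - c0 = measure (volume_measure (open_region Q) (pullback N G (\<lambda>p. F (\<tau>, p)))) C"
      using area[of \<tau>] \<tau> by (simp add: T'_def)
  qed
  moreover have "integral ?B (\<lambda>x. frd f (0, x) (1, 0)) =
    integral ?B (\<lambda>x. - (frd u x (1, 0) * \<kappa>1 (fst x) * b (snd x) + \<epsilon> * (frd u x (0, 1) * \<kappa>2 (snd x) * a (fst x))))"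
    by (rule integral_cong) (rule f0)
  ultimately show ?thesis by simp
qed

lemma area_derivative_by_parts:
  assumes st: "s1 \<in> I" "s2 \<in> I" "t1 \<in> K" "t2 \<in> K" "s1 \<le> s2" "t1 \<le> t2" and CB: "C \<subseteq> cbox (s1, t1) (s2, t2)"
    and zero: "\<And>x. x \<in> cbox (s1, t1) (s2, t2) \<Longrightarrow> fst x = s1 \<or> fst x = s2 \<or> snd x = t1 \<or> snd x = t2 \<Longrightarrow> u x = 0"
  shows "((\<lambda>\<tau>. measure (volume_measure (open_region Q) (pullback N G (\<lambda>p. F (\<tau>, p)))) C) has_real_derivative
    integral (cbox (s1, t1) (s2, t2)) (\<lambda>x. u x * (deriv \<kappa>1 (fst x) * b (snd x) + \<epsilon> * (deriv \<kappa>2 (snd x) * a (fst x))))) (at 0)"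
proof -
  have I: "open_interval I" "open_interval K" using reg by (auto simp: regular_curve_def)
  show ?thesis
  proof (rule DERIV_cong[OF area_derivative[OF st(1-4) CB]])
    show "integral (cbox (s1, t1) (s2, t2))
        (\<lambda>x. - (frd u x (1, 0) * \<kappa>1 (fst x) * b (snd x) + \<epsilon> * (frd u x (0, 1) * \<kappa>2 (snd x) * a (fst x)))) =
      integral (cbox (s1, t1) (s2, t2))
        (\<lambda>x. u x * (deriv \<kappa>1 (fst x) * b (snd x) + \<epsilon> * (deriv \<kappa>2 (snd x) * a (fst x))))"
      by (rule integral_by_parts_box[OF S1.curve_open[OF reg(1)] S2.curve_open[OF reg(2)] u S1.kv_smooth[OF reg(1)] S2.kv_smooth[OF reg(2)]
          S1.sp_smooth[OF reg(1)] S2.sp_smooth[OF reg(2)] box_subset[OF I st(1-4)] st(5,6) zero])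
  qed
qed

end

section \<open>Hamiltonian minimality\<close>

lemma smooth_map_euclidean:
  assumes "open W"
  shows "smooth_map (open_region W) euclidean_manifold f \<longleftrightarrow> smooth_on W f"
  using smooth_map_open_regions[OF assms open_UNIV, of f] unfolding euclidean_manifold_open_region[symmetric] by simp

text \<open>Points of \<open>B\<close> are moved along straight lines in the chart \<open>d\<close>
  with velocity \<open>V\<close>; all others stay fixed, as \<open>V\<close> vanishes there. At time
  0 the velocity in another chart \<open>e\<close> is the transformed vector.\<close>

lemma (in surface) displacement:
  fixes Q :: "'c::euclidean_space set"
  assumes Q: "open Q" and f: "smooth_map (open_region Q) M f" and d: "d \<in> atlas M"
    and B: "compact B" "B \<subseteq> Q \<inter> f -` fst d" and V: "smooth_on (Q \<inter> f -` fst d) V" and V0: "\<forall>x\<in>Q - B. V x = 0"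
  obtains \<delta> F where "\<delta> > 0" "smooth_map (open_region ({-\<delta><..<\<delta>} \<times> Q)) M F" "\<And>x. x \<in> Q \<Longrightarrow> F (0, x) = f x"
    "\<And>\<tau> x. x \<in> Q - B \<Longrightarrow> F (\<tau>, x) = f x"
    "\<And>x e. x \<in> Q \<Longrightarrow> f x \<in> fst d \<Longrightarrow> e \<in> charts_at M (f x) \<Longrightarrow>
      ((\<lambda>\<tau>. snd e (F (\<tau>, x))) has_vector_derivative tmap d e id (f x) (V x)) (at 0)"
proof -
  let ?R = "snd d ` fst d"
  define W where "W = Q \<inter> f -` fst d"
  note L = pullback_local(1-3)[OF Q f d, folded W_def]
  define P where "P z = snd d (f (snd z)) + fst z *\<^sub>R V (snd z)" for z :: "real \<times> 'c"
  have oUW: "open (UNIV \<times> W)" by (intro open_Times open_UNIV L(1))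
  have q: "smooth_on X (\<lambda>z. q (snd z))" if X: "open X" "X \<subseteq> UNIV \<times> Y" and q: "open Y" "smooth_on Y q"
    for X :: "(real \<times> 'c) set" and Y and q :: "'c \<Rightarrow> real \<times> real"
    by (rule smooth_on_compose[OF q(2) X(1) q(1) smooth_on_subset_UNIV_snd[OF X(1)]]) (use X(2) in auto)
  have P: "smooth_on (UNIV \<times> W) P" unfolding P_def[abs_def]
    by (intro smooth_intros oUW smooth_on_subset_UNIV_fst q[OF oUW subset_refl L(1)] L(2) V[folded W_def])
  define T where "T = (UNIV \<times> W) \<inter> P -` ?R"
  have T: "open T" unfolding T_def
    by (rule continuous_open_preimage[OF smooth_on_continuous[OF P] oUW chart_range_open[OF M d]])
  have T0: "(\<tau>, x) \<in> T" if "x \<in> W" "\<tau> = 0 \<or> V x = 0" for \<tau> x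
    using that L(3) by (auto simp: T_def P_def)
  have "{0} \<times> B \<subseteq> T" using T0 B(2) by (auto simp: W_def)
  \<comment> \<open>By compactness of \<open>B\<close> the lines from all its points remain in the
    range of the chart for a common time \<open>\<delta>\<close>.\<close>
  from Elementary_Topology.tube_lemma[OF B(1) T this]
  obtain X0 where X0: "0 \<in> X0" "open X0" "X0 \<times> B \<subseteq> T" by blast
  obtain \<delta> where \<delta>: "\<delta> > 0" "ball 0 \<delta> \<subseteq> X0" using open_contains_ball[THEN iffD1, OF X0(2), rule_format, OF X0(1)] by blast
  have inT: "(\<tau>, x) \<in> T" if "\<tau> \<in> {-\<delta><..<\<delta>}" "x \<in> B" for \<tau> x
  proof -
    have "\<tau> \<in> ball 0 \<delta>" using that(1) by (auto simp: dist_real_def)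
    then show ?thesis using \<delta>(2) X0(3) that(2) by blast
  qed
  \<comment> \<open>Off \<open>B\<close> both branches give \<open>f\<close>, because
    \<open>V\<close> is zero there. Smoothness is therefore checked in the chart \<open>d\<close> at
    points of \<open>B\<close>, and as that of \<open>f\<close> at points of the open complement of
    \<open>B\<close>.\<close>
  define F where "F z = (if snd z \<in> W then cinv d (P z) else f (snd z))" for z
  have FP: "F (\<tau>, x) = f x" if "x \<in> Q" "\<tau> = 0 \<or> V x = 0" for \<tau> x
    using that cinv_chart[OF M d, of "f x"] by (auto simp: F_def P_def W_def)
  have FT: "F z \<in> fst d" "snd d (F z) = P z" if "z \<in> T" for z
    using that cinv_domain[of "P z" d] chart_cinv[of "P z" d] by (auto simp: F_def T_def)
  let ?Z = "{-\<delta><..<\<delta>} \<times> Q"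
  have oZ: "open ?Z" by (intro open_Times Q) simp
  have F: "smooth_map (open_region ?Z) M F"
  proof (rule smooth_map_open_regionI[OF oZ M])
    fix z assume z: "z \<in> ?Z"
    show "\<exists>d\<in>atlas M. \<exists>U. open U \<and> z \<in> U \<and> U \<subseteq> ?Z \<inter> F -` fst d \<and> smooth_on U (\<lambda>x. snd d (F x))"
    proof (cases "snd z \<in> B")
      case True
      have o: "open (?Z \<inter> T)" by (intro open_Int oZ T)
      have "smooth_on (?Z \<inter> T) (\<lambda>x. snd d (F x))"
        by (rule iffD2[OF smooth_on_cong[OF o] smooth_on_subset[OF P]]) (use FT(2) in \<open>auto simp: T_def\<close>)
      moreover have "z \<in> T" using inT[OF _ True, of "fst z"] z by (auto simp: mem_Times_iff)
      ultimately show ?thesis using o z d FT(1) by (intro bexI[of _ d] exI[of _ "?Z \<inter> T"]) auto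
    next
      case False
      let ?e = "chart_at M (f (snd z))"
      have "f (snd z) \<in> topspace (mtop M)" using smooth_map_topspace[OF f] z by auto
      note e = charts_atD[OF chart_at_charts_at[OF M this]]
      let ?Y = "(Q \<inter> f -` fst ?e) - B" and ?U = "{-\<delta><..<\<delta>} \<times> ((Q \<inter> f -` fst ?e) - B)"
      note Le = pullback_local(1,2)[OF Q f e(1)]
      have Y: "open ?Y" by (rule open_Diff[OF Le(1) compact_imp_closed[OF B(1)]])
      have o: "open ?U" by (intro open_Times Y) simp
      have eq: "F x = f (snd x)" if "x \<in> ?U" for x using FP[of "snd x" "fst x"] V0[rule_format, of "snd x"] that by auto
      have "smooth_on ?U (\<lambda>x. snd ?e (f (snd x)))"
        by (rule q[OF o _ Y smooth_on_subset[OF Le(2)]]) auto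
      then have "smooth_on ?U (\<lambda>x. snd ?e (F x))" by (rule iffD1[OF smooth_on_cong[OF o], rotated]) (simp add: eq)
      moreover have "?U \<subseteq> ?Z \<inter> F -` fst ?e" using eq by auto
      moreover have "z \<in> ?U" using z False e(2) by (auto simp: mem_Times_iff)
      ultimately show ?thesis using o e(1) by blast
    qed
  qed
  have D: "((\<lambda>\<tau>. snd e (F (\<tau>, x))) has_vector_derivative tmap d e id (f x) (V x)) (at 0)"
    if x: "x \<in> Q" "f x \<in> fst d" and e: "e \<in> charts_at M (f x)" for x e
  proof -
    have dx: "d \<in> charts_at M (f x)" by (rule charts_atI[OF d x(2)])
    have e': "e \<in> charts_at M (id (f x))" using e by simp
    have "((\<lambda>\<tau>. P (\<tau>, x)) has_vector_derivative V x) (at 0)"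
      unfolding P_def by (auto intro!: derivative_eq_intros simp: has_vector_derivative_def)
    moreover have "(local_rep d e id has_derivative tmap d e id (f x)) (at (P (0, x)))"
      using tmap_has_derivative[OF M M smooth_map_id[OF M] dx e'] unfolding P_def fst_conv snd_conv scale_zero_left add_0_right .
    ultimately have "((\<lambda>\<tau>. local_rep d e id (P (\<tau>, x))) has_vector_derivative tmap d e id (f x) (V x)) (at 0)"
      unfolding has_vector_derivative_def
      by (rule has_derivative_compose[THEN has_derivative_eq_rhs])
        (use linear_scale[OF linear_transition[OF dx e]] in \<open>auto simp: fun_eq_iff\<close>)
    moreover have "local_rep d e id (P (\<tau>, x)) = snd e (F (\<tau>, x))" for \<tau>
      using x by (simp add: local_rep_def F_def W_def)
    ultimately show ?thesis by simp
  qed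
  show thesis by (rule that[OF \<delta>(1) F _ _ D]) (use FP V0 in auto)
qed

text \<open>\<open>displacement\<close> with the multiple \<open>\<beta>\<close> of the rotated
  velocity, written in the chart \<open>d\<close> by the explicit formula
  \<open>plane_rotation\<close> so that it is smooth. In the other charts it has the same form by
  the transformation rules for rotation and velocity.\<close>

lemma (in surface) normal_displacement:
  assumes reg: "regular_curve M I \<gamma>" and Q: "open Q" and pr: "smooth_on Q pr" "pr ` Q \<subseteq> I" and d: "d \<in> atlas M"
    and B: "compact B" "B \<subseteq> Q" "\<forall>x\<in>B. \<gamma> (pr x) \<in> fst d" and \<beta>: "smooth_on Q \<beta>" "\<forall>x\<in>Q - B. \<beta> x = 0"
  obtains \<delta> F where "\<delta> > 0" "smooth_map (open_region ({-\<delta><..<\<delta>} \<times> Q)) M F" "\<And>x. x \<in> Q \<Longrightarrow> F (0, x) = \<gamma> (pr x)"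
    "\<And>\<tau> x. x \<in> Q - B \<Longrightarrow> F (\<tau>, x) = \<gamma> (pr x)"
    "\<And>x e. x \<in> Q \<Longrightarrow> e \<in> charts_at M (\<gamma> (pr x)) \<Longrightarrow>
      ((\<lambda>\<tau>. snd e (F (\<tau>, x))) has_vector_derivative \<beta> x *\<^sub>R rotation g e (\<gamma> (pr x)) (velocity e \<gamma> (pr x))) (at 0)"
proof -
  note I = curve_open[OF reg] note sm = curve_smooth[OF reg]
  let ?f = "\<lambda>x. \<gamma> (pr x)"
  have "smooth_map (open_region Q) (open_region I) pr" using smooth_map_open_regions[OF Q I] pr by blast
  from smooth_map_compose[OF smooth_atlas_open_region[OF Q] smooth_atlas_open_region[OF I] M this sm]
  have f: "smooth_map (open_region Q) M ?f" by (simp add: o_def)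
  note L = pullback_local(1-3)[OF Q f d]
  note X = smooth_map_curve[OF M I sm d]
  let ?W = "Q \<inter> ?f -` fst d"
  define V where "V x = \<beta> x *\<^sub>R plane_rotation (Gc d (snd d (?f x))) (velocity d \<gamma> (pr x))" for x
  have v: "smooth_on ?W (\<lambda>x. velocity d \<gamma> (pr x))"
    by (rule smooth_on_compose[OF X(3) L(1) X(1) smooth_on_subset[OF pr(1)]]) (use pr(2) in auto)
  have V: "smooth_on ?W V" unfolding V_def[abs_def]
    by (intro smooth_intros L(1) smooth_on_subset[OF \<beta>(1)] smooth_rotation_field[OF d L(1,2) v L(3)]) simp
  have Vd: "V x = \<beta> x *\<^sub>R rotation g d (?f x) (velocity d \<gamma> (pr x))" if "x \<in> ?W" for x
  proof -
    have "d \<in> charts_at M (?f x)" using that d by (intro charts_atI) auto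
    then show ?thesis unfolding V_def by (simp add: rotation_eq Gc_at)
  qed
  have BW: "B \<subseteq> ?W" using B by auto
  have V0: "\<forall>x\<in>Q - B. V x = 0" unfolding V_def using \<beta>(2) by simp
  obtain \<delta> F where F: "\<delta> > 0" "smooth_map (open_region ({-\<delta><..<\<delta>} \<times> Q)) M F" "\<And>x. x \<in> Q \<Longrightarrow> F (0, x) = ?f x"
    "\<And>\<tau> x. x \<in> Q - B \<Longrightarrow> F (\<tau>, x) = ?f x"
    "\<And>x e. x \<in> Q \<Longrightarrow> ?f x \<in> fst d \<Longrightarrow> e \<in> charts_at M (?f x) \<Longrightarrow>
      ((\<lambda>\<tau>. snd e (F (\<tau>, x))) has_vector_derivative tmap d e id (?f x) (V x)) (at 0)"
    by (rule displacement[OF Q f d B(1) BW V V0]) (rule that; assumption)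
  have "((\<lambda>\<tau>. snd e (F (\<tau>, x))) has_vector_derivative \<beta> x *\<^sub>R rotation g e (?f x) (velocity e \<gamma> (pr x))) (at 0)"
    if x: "x \<in> Q" and e: "e \<in> charts_at M (?f x)" for x e
  proof (cases "?f x \<in> fst d")
    case True
    have dx: "d \<in> charts_at M (?f x)" by (rule charts_atI[OF d True])
    have s: "pr x \<in> I" using pr(2) x by blast
    have xW: "x \<in> ?W" using x True by simp
    have "tmap d e id (?f x) (V x) = \<beta> x *\<^sub>R rotation g e (?f x) (velocity e \<gamma> (pr x))"
      unfolding Vd[OF xW] linear_scale[OF linear_transition[OF dx e]] rotation_change[OF dx e, symmetric]
        velocity_change[OF M I sm s dx e] ..
    then show ?thesis using F(5)[OF x True e] by simp
  next
    case False
    \<comment> \<open>A point mapped outside the chart \<open>d\<close> lies off \<open>B\<close>,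
      where both the motion and \<open>\<beta>\<close> vanish.\<close>
    then have xB: "x \<in> Q - B" using B(3) x by blast
    show ?thesis unfolding bspec[OF \<beta>(2) xB] F(4)[OF xB] by simp
  qed
  show thesis by (rule that[OF F(1-4)], assumption+) fact
qed

section \<open>The Euler-Lagrange equation and Cornu spirals\<close>

context two_surfaces
begin

context
  fixes I \<phi> K \<psi>
  assumes reg: "regular_curve M1 I \<phi>" "regular_curve M2 K \<psi>"
begin

text \<open>\<open>\<beta>1\<close> and \<open>\<beta>2\<close> are the coefficients of the rotated
  gradient on the two curves. The factors are displaced independently and the two motions are paired
  on their common time interval.\<close>

lemma hamiltonian_variation_exists:
  assumes u: "smooth_on (I \<times> K) u" and B: "compact B" "B \<subseteq> I \<times> K" and u0: "\<forall>x\<in>I \<times> K - B. u x = 0"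
    and d: "d1 \<in> atlas M1" "d2 \<in> atlas M2" "\<forall>x\<in>B. \<phi> (fst x) \<in> fst d1" "\<forall>x\<in>B. \<psi> (snd x) \<in> fst d2"
  obtains \<delta> F where "hamiltonian_variation M1 g1 M2 g2 \<epsilon> I \<phi> K \<psi> u \<delta> B F"
proof -
  let ?Q = "I \<times> K"
  note oQ = open_IK[OF reg]
  note I = S1.curve_open[OF reg(1)] note K = S2.curve_open[OF reg(2)]
  have oD: "open (?Q - B)" by (rule open_Diff[OF oQ compact_imp_closed[OF B(1)]])
  \<comment> \<open>\<open>u\<close> vanishes on the open complement of \<open>B\<close>, and with
    it the derivatives that determine the displacement.\<close>
  have du0: "frd u x v = 0" if x: "x \<in> ?Q - B" for x v
    using frd_cong[OF oD x, of u "\<lambda>x. 0"] u0 frd_eq[OF has_derivative_const, of 0 x] by simp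
  define \<beta>1 where "\<beta>1 x = frd u x (1, 0) / (S1.sp \<phi> (fst x))\<^sup>2" for x
  define \<beta>2 where "\<beta>2 x = \<epsilon> * frd u x (0, 1) / (S2.sp \<psi> (snd x))\<^sup>2" for x
  have a: "smooth_on ?Q (\<lambda>x. S1.sp \<phi> (fst x))"
    by (rule smooth_on_compose[OF S1.sp_smooth[OF reg(1)] oQ I smooth_on_subset_UNIV_fst[OF oQ]]) auto
  have b: "smooth_on ?Q (\<lambda>x. S2.sp \<psi> (snd x))"
    by (rule smooth_on_compose[OF S2.sp_smooth[OF reg(2)] oQ K smooth_on_subset_UNIV_snd[OF oQ]]) auto
  have p: "S1.sp \<phi> (fst x) > 0" "S2.sp \<psi> (snd x) > 0" if "x \<in> ?Q" for x
    using S1.sp_pos[OF reg(1)] S2.sp_pos[OF reg(2)] that by (auto simp: mem_Times_iff)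
  have \<beta>1: "smooth_on ?Q \<beta>1" unfolding \<beta>1_def[abs_def]
    by (intro smooth_intros oQ a smooth_on_frd[OF u]) (use p(1) in force)
  have \<beta>2: "smooth_on ?Q \<beta>2" unfolding \<beta>2_def[abs_def]
    by (intro smooth_intros oQ b smooth_on_frd[OF u]) (use p(2) in force)
  have \<beta>0: "\<forall>x\<in>?Q - B. \<beta>1 x = 0" "\<forall>x\<in>?Q - B. \<beta>2 x = 0" unfolding \<beta>1_def \<beta>2_def using du0 by simp_all
  have im: "fst ` ?Q \<subseteq> I" "snd ` ?Q \<subseteq> K" by auto
  obtain \<delta>1 F1 where F1: "\<delta>1 > 0" "smooth_map (open_region ({-\<delta>1<..<\<delta>1} \<times> ?Q)) M1 F1" "\<And>x. x \<in> ?Q \<Longrightarrow> F1 (0, x) = \<phi> (fst x)"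
    "\<And>\<tau> x. x \<in> ?Q - B \<Longrightarrow> F1 (\<tau>, x) = \<phi> (fst x)"
    "\<And>x e. x \<in> ?Q \<Longrightarrow> e \<in> charts_at M1 (\<phi> (fst x)) \<Longrightarrow>
      ((\<lambda>\<tau>. snd e (F1 (\<tau>, x))) has_vector_derivative \<beta>1 x *\<^sub>R rotation g1 e (\<phi> (fst x)) (velocity e \<phi> (fst x))) (at 0)"
    by (rule S1.normal_displacement[OF reg(1) oQ smooth_on_subset_UNIV_fst[OF oQ] im(1) d(1) B d(3) \<beta>1 \<beta>0(1)])
      (rule that; assumption)
  obtain \<delta>2 F2 where F2: "\<delta>2 > 0" "smooth_map (open_region ({-\<delta>2<..<\<delta>2} \<times> ?Q)) M2 F2" "\<And>x. x \<in> ?Q \<Longrightarrow> F2 (0, x) = \<psi> (snd x)"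
    "\<And>\<tau> x. x \<in> ?Q - B \<Longrightarrow> F2 (\<tau>, x) = \<psi> (snd x)"
    "\<And>x e. x \<in> ?Q \<Longrightarrow> e \<in> charts_at M2 (\<psi> (snd x)) \<Longrightarrow>
      ((\<lambda>\<tau>. snd e (F2 (\<tau>, x))) has_vector_derivative \<beta>2 x *\<^sub>R rotation g2 e (\<psi> (snd x)) (velocity e \<psi> (snd x))) (at 0)"
    by (rule S2.normal_displacement[OF reg(2) oQ smooth_on_subset_UNIV_snd[OF oQ] im(2) d(2) B d(4) \<beta>2 \<beta>0(2)])
      (rule that; assumption)
  define \<delta> where "\<delta> = min \<delta>1 \<delta>2"
  define F where "F z = (F1 z, F2 z)" for z
  let ?Z = "{-\<delta><..<\<delta>} \<times> ?Q"
  have oZ: "open ?Z" "open ({-\<delta>1<..<\<delta>1} \<times> ?Q)" "open ({-\<delta>2<..<\<delta>2} \<times> ?Q)" by (intro open_Times oQ; simp)+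
  have inc: "smooth_map (open_region ?Z) (open_region ({-\<delta>1<..<\<delta>1} \<times> ?Q)) id" "smooth_map (open_region ?Z) (open_region ({-\<delta>2<..<\<delta>2} \<times> ?Q)) id"
    unfolding smooth_map_open_regions[OF oZ(1,2)] smooth_map_open_regions[OF oZ(1,3)] id_def
    by (auto simp: \<delta>_def intro!: smooth_on_id oZ(1)[unfolded \<delta>_def])
  have "smooth_map (open_region ?Z) M1 (fst \<circ> F)"
    using smooth_map_compose[OF smooth_atlas_open_region[OF oZ(1)] smooth_atlas_open_region[OF oZ(2)] S1.M inc(1) F1(2)]
    by (simp add: F_def o_def id_def)
  moreover have "smooth_map (open_region ?Z) M2 (snd \<circ> F)"
    using smooth_map_compose[OF smooth_atlas_open_region[OF oZ(1)] smooth_atlas_open_region[OF oZ(3)] S2.M inc(2) F2(2)]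
    by (simp add: F_def o_def id_def)
  ultimately have F: "smooth_map (open_region ?Z) N F"
    using smooth_map_product[OF smooth_atlas_open_region[OF oZ(1)] S1.M S2.M] by blast
  have var: "variation (open_region ?Q) N (map_prod \<phi> \<psi>) \<delta> B F"
    unfolding variation_def product_open_region open_region_simps topspace_euclidean_subtopology
  proof (intro conjI ballI F)
    show "0 < \<delta>" using F1(1) F2(1) by (simp add: \<delta>_def)
    show "compactin (top_of_set ?Q) B" using B by (simp add: compactin_subtopology)
    show "F (0, x) = map_prod \<phi> \<psi> x" if "x \<in> ?Q" for x
      using F1(3)[OF that] F2(3)[OF that] by (simp add: F_def map_prod_def split_beta)
    show "F (\<tau>, x) = map_prod \<phi> \<psi> x" if "x \<in> ?Q - B" for \<tau> x
      using F1(4)[OF that] F2(4)[OF that] by (simp add: F_def map_prod_def split_beta)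
  qed
  have vel: "vector_derivative (\<lambda>\<tau>. snd e (F (\<tau>, x))) (at 0) =
      JJ e (map_prod \<phi> \<psi> x) (tmap (?Q, id) e (map_prod \<phi> \<psi>) x (gradient (pullback N G (map_prod \<phi> \<psi>)) u (?Q, id) x))"
    if x: "x \<in> ?Q" and e: "e \<in> charts_at N (map_prod \<phi> \<psi> x)" for x e
  proof -
    obtain e1 e2 where "e1 \<in> charts_at M1 (fst (map_prod \<phi> \<psi> x))" "e2 \<in> charts_at M2 (snd (map_prod \<phi> \<psi> x))" and ee: "e = prod_chart e1 e2"
      using e unfolding charts_at_product by blast
    then have e': "e1 \<in> charts_at M1 (\<phi> (fst x))" "e2 \<in> charts_at M2 (\<psi> (snd x))" by (simp_all add: map_prod_def split_beta)
    have eq: "snd e (F (\<tau>, x)) = (snd e1 (F1 (\<tau>, x)), snd e2 (F2 (\<tau>, x)))" for \<tau> by (simp add: ee F_def)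
    show ?thesis
      unfolding eq vector_derivative_at[OF has_vector_derivative_Pair[OF F1(5)[OF x e'(1)] F2(5)[OF x e'(2)]]]
      unfolding ee hamiltonian_field[OF reg u x e'] \<beta>1_def \<beta>2_def ..
  qed
  have "hamiltonian_variation M1 g1 M2 g2 \<epsilon> I \<phi> K \<psi> u \<delta> B F"
    by (intro hamiltonian_variation.intro two_surfaces_axioms hamiltonian_variation_axioms.intro reg u var vel)
  then show thesis by (rule that)
qed

text \<open>The factor of \<open>u\<close> in the first variation of the area; its vanishing is the
  Euler-Lagrange equation.\<close>

abbreviation "defect x \<equiv> deriv (S1.kv \<phi>) (fst x) * S2.sp \<psi> (snd x) + \<epsilon> * (deriv (S2.kv \<psi>) (snd x) * S1.sp \<phi> (fst x))"

lemma defect_smooth: "smooth_on (I \<times> K) defect"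
proof -
  note oQ = open_IK[OF reg]
  note I = S1.curve_open[OF reg(1)] note K = S2.curve_open[OF reg(2)]
  have f: "smooth_on (I \<times> K) (\<lambda>x. q (fst x))" if "smooth_on I q" for q :: "real \<Rightarrow> real"
    by (rule smooth_on_compose[OF that oQ I smooth_on_subset_UNIV_fst[OF oQ]]) auto
  have g: "smooth_on (I \<times> K) (\<lambda>x. q (snd x))" if "smooth_on K q" for q :: "real \<Rightarrow> real"
    by (rule smooth_on_compose[OF that oQ K smooth_on_subset_UNIV_snd[OF oQ]]) auto
  show ?thesis
    by (intro smooth_intros oQ f g S1.sp_smooth[OF reg(1)] S2.sp_smooth[OF reg(2)]
        smooth_on_deriv(2)[OF S1.kv_smooth[OF reg(1)] I] smooth_on_deriv(2)[OF S2.kv_smooth[OF reg(2)] K])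
qed

lemma hamiltonian_minimalI:
  assumes defect0: "\<And>x. x \<in> I \<times> K \<Longrightarrow> defect x = 0"
  shows "hamiltonian_minimal (open_region (I \<times> K)) N G JJ \<Omega> (map_prod \<phi> \<psi>)"
  unfolding hamiltonian_minimal_def
proof (intro conjI allI impI curve_product_lagrangian[OF reg] curve_product_nondegenerate[OF reg])
  fix u \<delta> C F
  let ?S = "open_region (I \<times> K)"
  assume H: "smooth_map ?S euclidean_manifold u \<and> (\<exists>L. compactin (mtop ?S) L \<and> (\<forall>p\<in>topspace (mtop ?S) - L. u p = 0)) \<and>
    variation ?S N (map_prod \<phi> \<psi>) \<delta> C F \<and>
    (\<forall>p\<in>topspace (mtop ?S). \<forall>c\<in>charts_at ?S p. \<forall>d\<in>charts_at N (map_prod \<phi> \<psi> p).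
      vector_derivative (\<lambda>\<tau>. snd d (F (\<tau>, p))) (at 0) =
      JJ d (map_prod \<phi> \<psi> p) (tmap c d (map_prod \<phi> \<psi>) p (gradient (pullback N G (map_prod \<phi> \<psi>)) u c p)))"
  note var = H[THEN conjunct2, THEN conjunct2, THEN conjunct1]
  have u: "smooth_on (I \<times> K) u" by (rule iffD1[OF smooth_map_euclidean[OF open_IK[OF reg]] H[THEN conjunct1]])
  obtain L where "compactin (mtop ?S) L" and L3: "\<forall>p\<in>topspace (mtop ?S) - L. u p = 0"
    using H[THEN conjunct2, THEN conjunct1] by (elim conjE exE) (rule that; assumption)
  then have L: "compact L" "L \<subseteq> I \<times> K" "\<And>x. x \<in> I \<times> K - L \<Longrightarrow> u x = 0"
    by (simp_all add: compactin_subtopology)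
  have vel: "vector_derivative (\<lambda>\<tau>. snd d (F (\<tau>, p))) (at 0) =
      JJ d (map_prod \<phi> \<psi> p) (tmap (I \<times> K, id) d (map_prod \<phi> \<psi>) p (gradient (pullback N G (map_prod \<phi> \<psi>)) u (I \<times> K, id) p))"
    if p: "p \<in> I \<times> K" and d: "d \<in> charts_at N (map_prod \<phi> \<psi> p)" for p d
  proof -
    have "p \<in> topspace (mtop ?S)" "(I \<times> K, id) \<in> charts_at ?S p" using p by (simp_all add: charts_at_open_region)
    from H[THEN conjunct2, THEN conjunct2, THEN conjunct2, rule_format, OF this d] show ?thesis .
  qed
  have hv: "hamiltonian_variation M1 g1 M2 g2 \<epsilon> I \<phi> K \<psi> u \<delta> C F"
    by (intro hamiltonian_variation.intro two_surfaces_axioms hamiltonian_variation_axioms.intro reg u var vel)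
  have "compactin (mtop ?S) C" by (rule var[unfolded variation_def, THEN conjunct2, THEN conjunct1])
  then have C: "compact C" "C \<subseteq> I \<times> K" by (simp_all add: compactin_subtopology)
  have oi: "open_interval I" "open_interval K" using reg by (auto simp: regular_curve_def)
  \<comment> \<open>The box has to contain the support of \<open>u\<close> besides the moving set
    \<open>C\<close>: a variation that is constant off \<open>C\<close> controls only the
    derivatives of \<open>u\<close> there, whereas the integration by parts needs \<open>u\<close>
    to vanish on the boundary.\<close>
  have c: "compact (C \<union> L)" "C \<union> L \<subseteq> I \<times> K" using C L by auto
  have "compact (fst ` (C \<union> L))" "fst ` (C \<union> L) \<subseteq> I" "compact (snd ` (C \<union> L))" "snd ` (C \<union> L) \<subseteq> K"
    using c by (auto intro!: compact_continuous_image continuous_intros)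
  note A = this
  obtain s1 s2 where s: "s1 \<in> I" "s2 \<in> I" "s1 < s2" "fst ` (C \<union> L) \<subseteq> {s1<..<s2}"
    by (rule compact_in_open_interval[OF oi(1) A(1,2)])
  obtain t1 t2 where t: "t1 \<in> K" "t2 \<in> K" "t1 < t2" "snd ` (C \<union> L) \<subseteq> {t1<..<t2}"
    by (rule compact_in_open_interval[OF oi(2) A(3,4)])
  have inner: "s1 < fst x \<and> fst x < s2 \<and> t1 < snd x \<and> snd x < t2" if "x \<in> C \<union> L" for x
    using subsetD[OF s(4) imageI[OF that]] subsetD[OF t(4) imageI[OF that]] by simp
  have BQ: "cbox (s1, t1) (s2, t2) \<subseteq> I \<times> K" by (rule box_subset[OF oi s(1,2) t(1,2)])
  have CB: "C \<subseteq> cbox (s1, t1) (s2, t2)"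
  proof
    fix x assume "x \<in> C"
    then have "s1 < fst x \<and> fst x < s2 \<and> t1 < snd x \<and> snd x < t2" using inner by simp
    then show "x \<in> cbox (s1, t1) (s2, t2)" by (cases x) (simp add: cbox_Pair_eq)
  qed
  have zero: "u x = 0" if "x \<in> cbox (s1, t1) (s2, t2)" "fst x = s1 \<or> fst x = s2 \<or> snd x = t1 \<or> snd x = t2" for x
    using L(3)[of x] inner[of x] that subsetD[OF BQ that(1)] by auto
  have "integral (cbox (s1, t1) (s2, t2)) (\<lambda>x. u x * defect x) = integral (cbox (s1, t1) (s2, t2)) (\<lambda>x. 0)"
    by (rule integral_cong) (simp only: defect0[OF subsetD[OF BQ]] mult_zero_right)
  then show "((\<lambda>\<tau>. measure (volume_measure ?S (pullback N G (\<lambda>p. F (\<tau>, p)))) C) has_real_derivative 0) (at 0)"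
    by (intro DERIV_cong[OF hamiltonian_variation.area_derivative_by_parts[OF hv s(1,2) t(1,2) less_imp_le[OF s(3)] less_imp_le[OF t(3)] CB]])
      (rule zero, assumption+, simp)
qed

text \<open>The fundamental lemma of the calculus of variations: where \<open>defect\<close> is
  nonzero, a bump function concentrated on a region of constant sign gives a Hamiltonian variation
  with nonzero derivative of the area.\<close>

lemma hamiltonian_minimalD:
  assumes H: "hamiltonian_minimal (open_region (I \<times> K)) N G JJ \<Omega> (map_prod \<phi> \<psi>)" and x0: "x0 \<in> I \<times> K"
  shows "defect x0 = 0"
proof (rule ccontr)
  assume defect0: "defect x0 \<noteq> 0"
  let ?S = "open_region (I \<times> K)"
  note oQ = open_IK[OF reg]
  obtain d1 d2 where d: "d1 \<in> charts_at M1 (\<phi> (fst x0))" "d2 \<in> charts_at M2 (\<psi> (snd x0))"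
    by (rule curve_product_charts[OF reg x0]) (rule that; assumption)
  note X1 = smooth_map_curve(1)[OF S1.M S1.curve_open[OF reg(1)] S1.curve_smooth[OF reg(1)] charts_atD(1)[OF d(1)]]
  note X2 = smooth_map_curve(1)[OF S2.M S2.curve_open[OF reg(2)] S2.curve_smooth[OF reg(2)] charts_atD(1)[OF d(2)]]
  \<comment> \<open>On \<open>U\<close> the function \<open>defect\<close> keeps its sign at
    \<open>x0\<close>, and each curve stays in one chart, as the construction of the variation
    requires.\<close>
  define U where "U = ((I \<inter> \<phi> -` fst d1) \<times> (K \<inter> \<psi> -` fst d2)) \<inter> ((I \<times> K) \<inter> (\<lambda>x. defect x0 * defect x) -` {0<..})"
  have "open ((I \<times> K) \<inter> (\<lambda>x. defect x0 * defect x) -` {0<..})"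
    by (rule continuous_open_preimage[OF _ oQ open_greaterThan]) (intro continuous_intros smooth_on_continuous[OF defect_smooth])
  then have U: "open U" unfolding U_def by (rule open_Int[OF open_Times[OF X1 X2]])
  have "defect x0 * defect x0 > 0" using defect0 by (metis not_real_square_gt_zero)
  then have "x0 \<in> U" using x0 charts_atD(2)[OF d(1)] charts_atD(2)[OF d(2)] by (simp add: U_def mem_Times_iff)
  then obtain A1 A2 where A: "open A1" "open A2" "x0 \<in> A1 \<times> A2" "A1 \<times> A2 \<subseteq> U" using open_prod_elim[OF U] by blast
  define s0 t0 where "s0 = fst x0" and "t0 = snd x0"
  have st: "s0 \<in> A1" "t0 \<in> A2" using A(3) by (simp_all add: s0_def t0_def mem_Times_iff)
  obtain r1 where r1: "r1 > 0" "cball s0 r1 \<subseteq> A1" using open_contains_cball[THEN iffD1, OF A(1), rule_format, OF st(1)] by blast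
  obtain r2 where r2: "r2 > 0" "cball t0 r2 \<subseteq> A2" using open_contains_cball[THEN iffD1, OF A(2), rule_format, OF st(2)] by blast
  define B where "B = cbox (s0 - r1, t0 - r2) (s0 + r1, t0 + r2)"
  have Bx: "x \<in> B \<longleftrightarrow> \<bar>fst x - s0\<bar> \<le> r1 \<and> \<bar>snd x - t0\<bar> \<le> r2" for x
    unfolding B_def by (cases x) (auto simp: cbox_Pair_eq)
  have BU: "B \<subseteq> U"
  proof
    fix x assume "x \<in> B"
    then have "fst x \<in> cball s0 r1" "snd x \<in> cball t0 r2" by (auto simp: Bx dist_real_def)
    then have "x \<in> A1 \<times> A2" using r1(2) r2(2) by (auto simp: mem_Times_iff)
    then show "x \<in> U" using A(4) by blast
  qed
  then have BQ: "B \<subseteq> I \<times> K" by (auto simp: U_def)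
  \<comment> \<open>Positive exactly inside the box \<open>B\<close> and zero on its boundary, so
    there are no boundary terms.\<close>
  define u where "u x = bump s0 r1 (fst x) * bump t0 r2 (snd x)" for x
  have u: "smooth_on UNIV u" unfolding u_def[abs_def]
    by (intro smooth_intros open_UNIV smooth_on_compose[OF smooth_bump open_UNIV open_UNIV] smooth_on_subset_UNIV_fst smooth_on_subset_UNIV_snd) auto
  have u': "smooth_on (I \<times> K) u" by (rule smooth_on_subset[OF u]) simp
  have u0: "u x = 0" if "\<bar>fst x - s0\<bar> \<ge> r1 \<or> \<bar>snd x - t0\<bar> \<ge> r2" for x
    using that bump_eq_0[OF r1(1)] bump_eq_0[OF r2(1)] by (auto simp: u_def)
  have u0': "\<forall>x\<in>I \<times> K - B. u x = 0" by (intro ballI u0) (auto simp: Bx)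
  have cB: "compact B" unfolding B_def by (rule compact_cbox)
  obtain \<delta> F where hv: "hamiltonian_variation M1 g1 M2 g2 \<epsilon> I \<phi> K \<psi> u \<delta> B F"
  proof (rule hamiltonian_variation_exists[OF u' cB BQ u0' charts_atD(1)[OF d(1)] charts_atD(1)[OF d(2)]])
    show "\<forall>x\<in>B. \<phi> (fst x) \<in> fst d1" "\<forall>x\<in>B. \<psi> (snd x) \<in> fst d2" using BU by (auto simp: U_def)
  qed
  interpret hamiltonian_variation M1 g1 M2 g2 \<epsilon> I \<phi> K \<psi> u \<delta> B F by (rule hv)
  have "((\<lambda>\<tau>. measure (volume_measure ?S (pullback N G (\<lambda>p. F (\<tau>, p)))) B) has_real_derivative 0) (at 0)"
  proof (rule H[unfolded hamiltonian_minimal_def, THEN conjunct2, THEN conjunct2, rule_format], intro conjI ballI)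
    show "smooth_map ?S euclidean_manifold u" by (rule iffD2[OF smooth_map_euclidean[OF oQ] u'])
    show "\<exists>L. compactin (mtop ?S) L \<and> (\<forall>p\<in>topspace (mtop ?S) - L. u p = 0)"
      using cB BQ u0' by (intro exI[of _ B]) (auto simp: compactin_subtopology)
    fix p c e assume p: "p \<in> topspace (mtop ?S)" and ce: "c \<in> charts_at ?S p" and e: "e \<in> charts_at N (map_prod \<phi> \<psi> p)"
    have pQ: "p \<in> I \<times> K" and ceq: "c = (I \<times> K, id)" using p ce by (simp_all add: charts_at_open_region)
    show "vector_derivative (\<lambda>\<tau>. snd e (F (\<tau>, p))) (at 0) =
        JJ e (map_prod \<phi> \<psi> p) (tmap c e (map_prod \<phi> \<psi>) p (gradient (pullback N G (map_prod \<phi> \<psi>)) u c p))"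
      unfolding ceq by (rule vel[OF pQ e])
  qed (rule var)
  moreover have "((\<lambda>\<tau>. measure (volume_measure ?S (pullback N G (\<lambda>p. F (\<tau>, p)))) B) has_real_derivative
      integral (cbox (s0 - r1, t0 - r2) (s0 + r1, t0 + r2)) (\<lambda>x. u x * defect x)) (at 0)"
  proof (rule area_derivative_by_parts)
    have "(s0 - r1, t0 - r2) \<in> B" "(s0 + r1, t0 + r2) \<in> B" using r1 r2 by (auto simp: Bx)
    then show "s0 - r1 \<in> I" "s0 + r1 \<in> I" "t0 - r2 \<in> K" "t0 + r2 \<in> K" using BQ by auto
    show "u x = 0" if "fst x = s0 - r1 \<or> fst x = s0 + r1 \<or> snd x = t0 - r2 \<or> snd x = t0 + r2" for x
      using that r1 r2 by (intro u0) auto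
  qed (use r1 r2 in \<open>auto simp: B_def\<close>)
  ultimately have int0: "integral B (\<lambda>x. u x * defect x) = 0" unfolding B_def by (rule DERIV_unique[symmetric])
  \<comment> \<open>Multiplication by the constant \<open>defect x0\<close> makes the integrand
    nonnegative. A continuous nonnegative function with integral zero vanishes on the box, but this
    one is positive at \<open>x0\<close>.\<close>
  define f where "f x = u x * (defect x0 * defect x)" for x
  have cont: "continuous_on B f" unfolding f_def
    by (intro continuous_intros continuous_on_subset[OF smooth_on_continuous[OF u']] continuous_on_subset[OF smooth_on_continuous[OF defect_smooth]] BQ)
  have nonneg: "f x \<ge> 0" if "x \<in> B" for x
  proof -
    have "defect x0 * defect x > 0" using subsetD[OF BU that] by (simp add: U_def)
    then show ?thesis unfolding f_def u_def by (intro mult_nonneg_nonneg bump_nonneg less_imp_le)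
  qed
  have "integral B f = integral B (\<lambda>x. defect x0 * (u x * defect x))" by (rule integral_cong) (simp add: f_def)
  also have "\<dots> = 0" using int0 by simp
  finally have "integral B f = 0" .
  moreover have "f integrable_on B" unfolding B_def by (rule integrable_continuous[OF cont[unfolded B_def]])
  ultimately have "(f has_integral 0) B" using integrable_integral by fastforce
  moreover have "(s0, t0) \<in> box (s0 - r1, t0 - r2) (s0 + r1, t0 + r2)" using r1(1) r2(1) by (auto simp: mem_box Basis_prod_def)
  then have "box (s0 - r1, t0 - r2) (s0 + r1, t0 + r2) \<noteq> {}" by blast
  moreover have "x0 \<in> B" using r1(1) r2(1) by (simp add: Bx s0_def t0_def)
  moreover have "f x \<ge> 0" if "x \<in> box (s0 - r1, t0 - r2) (s0 + r1, t0 + r2)" for x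
    by (rule nonneg) (use that box_subset_cbox in \<open>auto simp: B_def\<close>)
  ultimately have "f x0 = 0"
    unfolding B_def by (intro has_integral_0_cbox_imp_0[OF cont[unfolded B_def]])
  moreover have "u x0 > 0" using r1 r2 by (simp add: u_def s0_def t0_def bump_pos_iff)
  ultimately show False using defect0 by (simp add: f_def)
qed

lemma defect_eq_0_iff:
  "(\<forall>x\<in>I \<times> K. defect x = 0) \<longleftrightarrow>
    (\<exists>l1 l2. cornu_spiral M1 g1 I \<phi> l1 \<and> cornu_spiral M2 g2 K \<psi> l2 \<and> l1 = - \<epsilon> * l2)"
proof
  assume defect0: "\<forall>x\<in>I \<times> K. defect x = 0"
  obtain s0 t0 where st: "s0 \<in> I" "t0 \<in> K" using S1.curve_interval(2)[OF reg(1)] S2.curve_interval(2)[OF reg(2)] by blast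
  \<comment> \<open>Fixing \<open>t0\<close> in the equation determines the first curvature with
    parameter \<open>l1\<close>. Fixing \<open>s0\<close> then shows that the ratio found at
    \<open>t0\<close> is the same for all \<open>t\<close>.\<close>
  define l2 where "l2 = deriv (S2.kv \<psi>) t0 / S2.sp \<psi> t0"
  define l1 where "l1 = - \<epsilon> * l2"
  have defect: "deriv (S1.kv \<phi>) s * S2.sp \<psi> t + \<epsilon> * (deriv (S2.kv \<psi>) t * S1.sp \<phi> s) = 0" if "s \<in> I" "t \<in> K" for s t
    using defect0[rule_format, of "(s, t)"] that by simp
  have 1: "deriv (S1.kv \<phi>) s = l1 * S1.sp \<phi> s" if "s \<in> I" for s
    using defect[OF that st(2)] S2.sp_pos[OF reg(2) st(2)] by (simp add: l1_def l2_def field_simps)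
  have 2: "deriv (S2.kv \<psi>) t = l2 * S2.sp \<psi> t" if "t \<in> K" for t
  proof -
    have "S1.sp \<phi> s0 * (\<epsilon> * (deriv (S2.kv \<psi>) t - l2 * S2.sp \<psi> t)) = 0"
      using defect[OF st(1) that] by (simp add: 1[OF st(1)] l1_def algebra_simps)
    then show ?thesis using S1.sp_pos[OF reg(1) st(1)] eps(1) by simp
  qed
  have "cornu_spiral M1 g1 I \<phi> l1"
    unfolding S1.cornu_spiral_iff using reg(1) smooth_on_deriv(1)[OF S1.kv_smooth[OF reg(1)] S1.curve_open[OF reg(1)]] 1 by simp
  moreover have "cornu_spiral M2 g2 K \<psi> l2"
    unfolding S2.cornu_spiral_iff using reg(2) smooth_on_deriv(1)[OF S2.kv_smooth[OF reg(2)] S2.curve_open[OF reg(2)]] 2 by simp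
  ultimately show "\<exists>l1 l2. cornu_spiral M1 g1 I \<phi> l1 \<and> cornu_spiral M2 g2 K \<psi> l2 \<and> l1 = - \<epsilon> * l2"
    using l1_def by blast
next
  assume "\<exists>l1 l2. cornu_spiral M1 g1 I \<phi> l1 \<and> cornu_spiral M2 g2 K \<psi> l2 \<and> l1 = - \<epsilon> * l2"
  then obtain l1 l2 where c: "cornu_spiral M1 g1 I \<phi> l1" "cornu_spiral M2 g2 K \<psi> l2" and l: "l1 = - \<epsilon> * l2" by blast
  show "\<forall>x\<in>I \<times> K. defect x = 0"
  proof
    fix x assume "x \<in> I \<times> K"
    then have "fst x \<in> I" "snd x \<in> K" by auto
    then have "deriv (S1.kv \<phi>) (fst x) = l1 * S1.sp \<phi> (fst x)" "deriv (S2.kv \<psi>) (snd x) = l2 * S2.sp \<psi> (snd x)"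
      using c unfolding S1.cornu_spiral_iff S2.cornu_spiral_iff by (auto intro: DERIV_imp_deriv)
    then show "defect x = 0" by (simp add: l)
  qed
qed

lemma hamiltonian_minimal_iff:
  "hamiltonian_minimal (open_region (I \<times> K)) N G JJ \<Omega> (map_prod \<phi> \<psi>) \<longleftrightarrow>
    (\<exists>l1 l2. cornu_spiral M1 g1 I \<phi> l1 \<and> cornu_spiral M2 g2 K \<psi> l2 \<and> l1 = - \<epsilon> * l2)"
  unfolding defect_eq_0_iff[symmetric]
  by (rule iffI, rule ballI, rule hamiltonian_minimalD, assumption+, rule hamiltonian_minimalI, rule bspec)

end

end

theorem theorem2:
  fixes M1 :: "('a, real \<times> real) manifold" and g1 :: "('a, real \<times> real) tensor2"
    and M2 :: "('b, real \<times> real) manifold" and g2 :: "('b, real \<times> real) tensor2"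
    and \<epsilon> :: real
  assumes "oriented_riemannian_surface M1 g1" and "oriented_riemannian_surface M2 g2"
    and "connected_space (mtop M1)" and "connected_space (mtop M2)"
    and "geodesically_complete M1 g1" and "geodesically_complete M2 g2"
    and "\<epsilon> \<in> {1, -1}"
  shows
    "(\<forall>(S :: ('s, real \<times> real) manifold) \<Phi>.
        smooth_manifold S \<and>
        lagrangian_immersion S (product_manifold M1 M2)
          (product_tensor \<epsilon> M1 (kaehler_form g1) M2 (kaehler_form g2)) \<Phi> \<and>
        projected_rank_one S M1 M2 \<Phi> \<longrightarrow>
        (\<forall>p\<in>topspace (mtop S). \<exists>V I K \<xi> \<phi> \<psi>.
           openin (mtop S) V \<and> p \<in> V \<and>
           regular_curve M1 I \<phi> \<and> regular_curve M2 K \<psi> \<and>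
           diffeomorphism (open_region (I \<times> K)) (open_submanifold S V) \<xi> \<and>
           (\<forall>s\<in>I. \<forall>t\<in>K. \<Phi> (\<xi> (s, t)) = (\<phi> s, \<psi> t))) \<and>
        (minimal_immersion S (product_manifold M1 M2) (product_tensor \<epsilon> M1 g1 M2 g2) \<Phi> \<longrightarrow>
           totally_geodesic S (product_manifold M1 M2) (product_tensor \<epsilon> M1 g1 M2 g2) \<Phi>)) \<and>
     (\<forall>I K \<phi> \<psi>.
        regular_curve M1 I \<phi> \<and> regular_curve M2 K \<psi> \<longrightarrow>
        flat_metric (open_region (I \<times> K))
          (pullback (product_manifold M1 M2) (product_tensor \<epsilon> M1 g1 M2 g2) (map_prod \<phi> \<psi>)) \<and>
        (hamiltonian_minimal (open_region (I \<times> K)) (product_manifold M1 M2)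
           (product_tensor \<epsilon> M1 g1 M2 g2) (product_rotation M1 g1 M2 g2)
           (product_tensor \<epsilon> M1 (kaehler_form g1) M2 (kaehler_form g2)) (map_prod \<phi> \<psi>) \<longleftrightarrow>
         (\<exists>l1 l2. cornu_spiral M1 g1 I \<phi> l1 \<and> cornu_spiral M2 g2 K \<psi> l2 \<and>
            l1 = - \<epsilon> * l2)) \<and>
        (minimal_immersion (open_region (I \<times> K)) (product_manifold M1 M2)
           (product_tensor \<epsilon> M1 g1 M2 g2) (map_prod \<phi> \<psi>) \<and>
         lagrangian_immersion (open_region (I \<times> K)) (product_manifold M1 M2)
           (product_tensor \<epsilon> M1 (kaehler_form g1) M2 (kaehler_form g2)) (map_prod \<phi> \<psi>) \<longleftrightarrow>
         geodesic_curve M1 g1 I \<phi> \<and> geodesic_curve M2 g2 K \<psi>))"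
proof -
  interpret two_surfaces M1 g1 M2 g2 \<epsilon>
    by unfold_locales (rule assms)+
  show ?thesis
  proof (rule conjI)
    show "\<forall>(S :: ('s, real \<times> real) manifold) \<Phi>.
        smooth_manifold S \<and> lagrangian_immersion S N \<Omega> \<Phi> \<and> projected_rank_one S M1 M2 \<Phi> \<longrightarrow>
        (\<forall>p\<in>topspace (mtop S). \<exists>V I K \<xi> \<phi> \<psi>.
           openin (mtop S) V \<and> p \<in> V \<and>
           regular_curve M1 I \<phi> \<and> regular_curve M2 K \<psi> \<and>
           diffeomorphism (open_region (I \<times> K)) (open_submanifold S V) \<xi> \<and>
           (\<forall>s\<in>I. \<forall>t\<in>K. \<Phi> (\<xi> (s, t)) = (\<phi> s, \<psi> t))) \<and>
        (minimal_immersion S N G \<Phi> \<longrightarrow> totally_geodesic S N G \<Phi>)"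
    proof (intro allI impI, elim conjE, intro conjI ballI impI)
      fix S :: "('s, real \<times> real) manifold" and \<Phi>
      assume "smooth_manifold S" and L: "lagrangian_immersion S N \<Omega> \<Phi>" and R: "projected_rank_one S M1 M2 \<Phi>"
      then have S: "smooth_atlas S" by (intro smooth_manifold_smooth_atlas)
      show "\<exists>V I K \<xi> \<phi> \<psi>. openin (mtop S) V \<and> p \<in> V \<and> regular_curve M1 I \<phi> \<and> regular_curve M2 K \<psi> \<and>
          diffeomorphism (open_region (I \<times> K)) (open_submanifold S V) \<xi> \<and> (\<forall>s\<in>I. \<forall>t\<in>K. \<Phi> (\<xi> (s, t)) = (\<phi> s, \<psi> t))"
        if "p \<in> topspace (mtop S)" for p
        by (rule local_parametrisation[OF S L R that])
      show "totally_geodesic S N G \<Phi>" if "minimal_immersion S N G \<Phi>"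
        by (rule minimal_totally_geodesic[OF S L R that])
    qed
    show "\<forall>I K \<phi> \<psi>. regular_curve M1 I \<phi> \<and> regular_curve M2 K \<psi> \<longrightarrow>
        flat_metric (open_region (I \<times> K)) (pullback N G (map_prod \<phi> \<psi>)) \<and>
        (hamiltonian_minimal (open_region (I \<times> K)) N G JJ \<Omega> (map_prod \<phi> \<psi>) \<longleftrightarrow>
         (\<exists>l1 l2. cornu_spiral M1 g1 I \<phi> l1 \<and> cornu_spiral M2 g2 K \<psi> l2 \<and> l1 = - \<epsilon> * l2)) \<and>
        (minimal_immersion (open_region (I \<times> K)) N G (map_prod \<phi> \<psi>) \<and>
         lagrangian_immersion (open_region (I \<times> K)) N \<Omega> (map_prod \<phi> \<psi>) \<longleftrightarrow>
         geodesic_curve M1 g1 I \<phi> \<and> geodesic_curve M2 g2 K \<psi>)"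
    proof (intro allI impI, elim conjE)
      fix I K \<phi> \<psi> assume reg: "regular_curve M1 I \<phi>" "regular_curve M2 K \<psi>"
      note L = curve_product_lagrangian[OF reg]
      show "flat_metric (open_region (I \<times> K)) (pullback N G (map_prod \<phi> \<psi>)) \<and>
        (hamiltonian_minimal (open_region (I \<times> K)) N G JJ \<Omega> (map_prod \<phi> \<psi>) \<longleftrightarrow>
         (\<exists>l1 l2. cornu_spiral M1 g1 I \<phi> l1 \<and> cornu_spiral M2 g2 K \<psi> l2 \<and> l1 = - \<epsilon> * l2)) \<and>
        (minimal_immersion (open_region (I \<times> K)) N G (map_prod \<phi> \<psi>) \<and>
         lagrangian_immersion (open_region (I \<times> K)) N \<Omega> (map_prod \<phi> \<psi>) \<longleftrightarrow>
         geodesic_curve M1 g1 I \<phi> \<and> geodesic_curve M2 g2 K \<psi>)"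
        unfolding curve_product_minimal_iff[OF reg, symmetric]
        by (intro conjI curve_product_flat[OF reg] hamiltonian_minimal_iff[OF reg] iffI L) (erule conjunct1, assumption)
    qed
  qed
qed

end
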